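(* Let $d>1$ be an integer and let $0<p<\infty$, $0<q<\infty$, $0\le s<1/p$. a) The tensor-product Haar system $\tilde H^d$ is an unconditional Schauder basis in $B_{p,q,1}^s(I^d)$ if and only if $1<p<\infty$. For $p=1$, there is a blockwise ordering of $\tilde H^d$ with which it is still a Schauder basis in $B_{1,q,1}^s(I^d)$, but only a conditional one (i.e. not unconditional). b) If $0<p<1$, then the family of $L_2$-orthogonal projectors $$\Lambda_{\tilde h}:\ f\mapsto \Lambda_{\tilde h}f:=\|\tilde h\|_{L_2}^{-2}\Big(\int_{I^d}f\,\tilde h\,dx\Big)\tilde h,\qquad \tilde h\in\tilde H^d,$$ onto the one-dimensional subspaces spanned by the tensor-product Haar functions $\tilde h\in\tilde H^d$ is not uniformly bounded in $B_{p,q,1}^s(I^d)$: there is no constant $C<\infty$ such that $\|\Lambda_{\tilde h}f\|_{B_{p,q,1}^s}\le C\|f\|_{B_{p,q,1}^s}$ for all $\tilde h\in\tilde H^d$ and all dyadic step functions $f\in S^d$. As a consequence, $\tilde H^d$ is not a Schauder basis in $B_{p,q,1}^s(I^d)$ for $0<p<1$, independently of the ordering within $\tilde H^d$.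
   Context: Notation: $I=[0,1]$, $I^d\subset\mathbb{R}^d$ is the unit cube with Lebesgue measure, functions are real-valued and identified when equal a.e., $L_p=L_p(I^d)$ with the usual (quasi-)norm. Besov spaces: for $y\in\mathbb{R}^d$ let $I^d_y=\{z\in I^d: z+y\in I^d\}$ and $\Delta_y f(x)=f(x+y)-f(x)$ for $x\in I^d_y$. The first-order $L_p$ modulus of smoothness is $\omega(t,f)_p=\sup_{0<|y|\le t}\|\Delta_y f\|_{L_p(I^d_y)}$, $t>0$. For $0<p,q<\infty$ and $s\ge 0$, the space $B_{p,q,1}^s(I^d)$ is the set of all $f\in L_p(I^d)$ with finite quasi-norm $$\|f\|_{B_{p,q,1}^s}=\Big(\|f\|_{L_p}^q+\int_0^1 \big(t^{-s}\omega(t,f)_p\big)^q\,\frac{dt}{t}\Big)^{1/q}.$$ It is a quasi-Banach space. Tensor-product Haar system: for $k\ge 0$ and $i=1,\dots,2^k$ let $\Delta_{k,i}=[(i-1)2^{-k},i2^{-k})$. The univariate Haar system is $H=\{h_m\}_{m\in\mathbb{N}}$ with $h_1=\chi_I$ and $h_{2^{k-1}+i}=\chi_{\Delta_{k,2i-1}}-\chi_{\Delta_{k,2i}}$ for $k\ge1$, $i=1,\dots,2^{k-1}$. Then $\tilde H^d=H\otimes\cdots\otimes H$ ($d$ factors), i.e. $\tilde H^d=\{h_{m_1}\otimes\cdots\otimes h_{m_d}: m_1,\dots,m_d\in\mathbb{N}\}$. Let $S_k^d$ be the space of functions on $I^d$ that are constant on each dyadic cube $\Delta_{k,i_1}\times\cdots\times\Delta_{k,i_d}$,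 $i_1,\dots,i_d\in\{1,\dots,2^k\}$, and let $S^d=\bigcup_{k\ge0}S_k^d$ (the dyadic step functions), a dense subspace of $B_{p,q,1}^s(I^d)$ for the parameters considered. The blocks are $\tilde H_0^d=\{\chi_{I^d}\}$ and $\tilde H_k^d=\{\tilde h\in\tilde H^d:\tilde h\in S_k^d,\ \tilde h\notin S_{k-1}^d\}$ for $k\ge1$. A blockwise ordering of $\tilde H^d$ is an enumeration in which all elements of $\tilde H_k^d$ precede all elements of $\tilde H_{k+1}^d$, for every $k\ge0$. Schauder bases: a sequence $(f_m)_{m\in\mathbb{N}}$ in a quasi-Banach space $X$ is a Schauder basis in $X$ if every $f\in X$ has a unique representation $f=\sum_{m=1}^\infty c_mf_m$ converging in $X$. It is an unconditional Schauder basis if every rearrangement of it is a Schauder basis in $X$. *)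

theory Defs
  imports "HOL-Analysis.Analysis" "HOL-Library.Discrete_Functions"
begin

text \<open>
  Functions on the unit cube are represented by functions on the whole space of which only the
  values on the cube matter. Almost-everywhere equality is not divided out: the quasi-norms below
  depend only on the a.e.-class of a function on the cube.
\<close>

definition unit_cube :: "(real ^ 'n) set" where
  "unit_cube = cbox 0 1"

definition Lp_space :: "real \<Rightarrow> (real ^ 'n) set \<Rightarrow> (real ^ 'n \<Rightarrow> real) set" where
  "Lp_space p A = {f. f \<in> borel_measurable (lebesgue_on A) \<and>
                      integrable (lebesgue_on A) (\<lambda>x. \<bar>f x\<bar> powr p)}"

definition Lp_norm :: "real \<Rightarrow> (real ^ 'n) set \<Rightarrow> (real ^ 'n \<Rightarrow> real) \<Rightarrow> real" where
  "Lp_norm p A f = (integral\<^sup>L (lebesgue_on A) (\<lambda>x. \<bar>f x\<bar> powr p)) powr (1 / p)"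


definition shifted_cube :: "real ^ 'n \<Rightarrow> (real ^ 'n) set" where
  "shifted_cube y = {z \<in> unit_cube. z + y \<in> unit_cube}"

definition difference :: "real ^ 'n \<Rightarrow> (real ^ 'n \<Rightarrow> real) \<Rightarrow> real ^ 'n \<Rightarrow> real" where
  "difference y f x = f (x + y) - f x"

text \<open>
  For an \<open>L\<^sub>p\<close> function on the cube the supremum is that of a nonempty bounded set, since the
  quasi-norm of a difference is at most a constant (depending on \<open>p\<close>) times that of the function.
\<close>

definition modulus :: "real \<Rightarrow> real \<Rightarrow> (real ^ 'n \<Rightarrow> real) \<Rightarrow> real" where
  "modulus p t f = (SUP y \<in> {y. 0 < norm y \<and> norm y \<le> t}. Lp_norm p (shifted_cube y) (difference y f))"

definition besov_integral :: "real \<Rightarrow> real \<Rightarrow> real \<Rightarrow> (real ^ 'n \<Rightarrow> real) \<Rightarrow> ennreal" where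
  "besov_integral p q s f =
     (\<integral>\<^sup>+ t \<in> {0<..<1}. ennreal ((t powr (- s) * modulus p t f) powr q / t) \<partial>lborel)"

definition besov_space :: "real \<Rightarrow> real \<Rightarrow> real \<Rightarrow> (real ^ 'n \<Rightarrow> real) set" where
  "besov_space p q s = {f \<in> Lp_space p unit_cube. besov_integral p q s f < \<infinity>}"

text \<open>Only meaningful on \<^term>\<open>besov_space p q s\<close>, where the integral is finite.\<close>

definition besov_norm :: "real \<Rightarrow> real \<Rightarrow> real \<Rightarrow> (real ^ 'n \<Rightarrow> real) \<Rightarrow> real" where
  "besov_norm p q s f =
     (Lp_norm p unit_cube f powr q + enn2real (besov_integral p q s f)) powr (1 / q)"


definition dyadic_interval :: "nat \<Rightarrow> nat \<Rightarrow> real set" where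
  "dyadic_interval k i = {(real i - 1) / 2 ^ k ..< real i / 2 ^ k}"

text \<open>
  The index \<open>m \<ge> 2\<close> is written as \<open>2 ^ (k - 1) + i\<close> with \<open>k \<ge> 1\<close> and \<open>1 \<le> i \<le> 2 ^ (k - 1)\<close>; then
  \<open>k - 1\<close> is the integer part of the binary logarithm of \<open>m - 1\<close> (see \<open>haar_dyadic\<close> below).
  The index \<open>0\<close> is not used.
\<close>

definition haar :: "nat \<Rightarrow> real \<Rightarrow> real" where
  "haar m =
     (if m \<le> 1 then indicator {0..1}
      else let k = Suc (floor_log (m - 1)); i = m - 2 ^ (k - 1)
           in (\<lambda>x. indicator (dyadic_interval k (2 * i - 1)) x - indicator (dyadic_interval k (2 * i)) x))"

lemma haar_1: "haar 1 = indicator {0..1}"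
  by (simp add: haar_def)

lemma haar_dyadic:
  assumes "k \<ge> 1" "1 \<le> i" "i \<le> 2 ^ (k - 1)"
  shows "haar (2 ^ (k - 1) + i) x =
    indicator (dyadic_interval k (2 * i - 1)) x - indicator (dyadic_interval k (2 * i)) x"
proof -
  have "floor_log (2 ^ (k - 1) + i - 1) = k - 1"
    by (rule floor_log_eqI) (use assms in auto)
  moreover have "\<not> 2 ^ (k - 1) + i \<le> 1"
    using assms one_le_power[of "2::nat" "k - 1"] by linarith
  ultimately show ?thesis
    using assms by (simp add: haar_def)
qed

definition tensor_haar :: "('n \<Rightarrow> nat) \<Rightarrow> real ^ 'n \<Rightarrow> real" where
  "tensor_haar m x = (\<Prod>j\<in>UNIV. haar (m j) (x $ j))"

definition haar_system :: "(real ^ 'n \<Rightarrow> real) set" where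
  "haar_system = tensor_haar ` {m. \<forall>j. 1 \<le> m j}"

definition dyadic_cube :: "nat \<Rightarrow> ('n \<Rightarrow> nat) \<Rightarrow> (real ^ 'n) set" where
  "dyadic_cube k i = {x. \<forall>j. x $ j \<in> dyadic_interval k (i j)}"

text \<open>
  The dyadic cubes cover the unit cube up to the null set of points with a coordinate \<open>1\<close>, where the
  values are unconstrained.
\<close>

definition step_functions_level :: "nat \<Rightarrow> (real ^ 'n \<Rightarrow> real) set" where
  "step_functions_level k = {f. \<forall>i. (\<forall>j. i j \<in> {1..2 ^ k}) \<longrightarrow> f constant_on dyadic_cube k i}"

definition step_functions :: "(real ^ 'n \<Rightarrow> real) set" where
  "step_functions = (\<Union>k. step_functions_level k)"

definition haar_block :: "nat \<Rightarrow> (real ^ 'n \<Rightarrow> real) set" where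
  "haar_block k =
     (if k = 0 then {indicator unit_cube}
      else {h \<in> haar_system. h \<in> step_functions_level k \<and> h \<notin> step_functions_level (k - 1)})"

text \<open>Sequences are indexed from \<open>0\<close>.\<close>

definition enumeration_of :: "'a set \<Rightarrow> (nat \<Rightarrow> 'a) \<Rightarrow> bool" where
  "enumeration_of A e \<longleftrightarrow> bij_betw e UNIV A"

definition blockwise_ordering :: "(nat \<Rightarrow> real ^ 'n \<Rightarrow> real) \<Rightarrow> bool" where
  "blockwise_ordering e \<longleftrightarrow> enumeration_of haar_system e \<and>
     (\<forall>k a b. e a \<in> haar_block k \<longrightarrow> e b \<in> haar_block (Suc k) \<longrightarrow> a < b)"

definition haar_projector :: "(real ^ 'n \<Rightarrow> real) \<Rightarrow> (real ^ 'n \<Rightarrow> real) \<Rightarrow> real ^ 'n \<Rightarrow> real" where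
  "haar_projector h f =
     (\<lambda>x. inverse ((Lp_norm 2 unit_cube h)\<^sup>2) * integral\<^sup>L (lebesgue_on unit_cube) (\<lambda>y. f y * h y) * h x)"


text \<open>
  Schauder bases of a space \<open>X\<close> of functions with quasi-norm \<open>N\<close>. Functions at distance zero need
  not be equal, but the coefficients are required to be unique.
\<close>

definition schauder_basis ::
    "('a \<Rightarrow> real) set \<Rightarrow> (('a \<Rightarrow> real) \<Rightarrow> real) \<Rightarrow> (nat \<Rightarrow> 'a \<Rightarrow> real) \<Rightarrow> bool" where
  "schauder_basis X N f \<longleftrightarrow> range f \<subseteq> X \<and>
     (\<forall>g\<in>X. \<exists>!c :: nat \<Rightarrow> real. (\<lambda>M. N (\<lambda>x. g x - (\<Sum>m<M. c m * f m x))) \<longlonglongrightarrow> 0)"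

definition unconditional_schauder_basis ::
    "('a \<Rightarrow> real) set \<Rightarrow> (('a \<Rightarrow> real) \<Rightarrow> real) \<Rightarrow> (nat \<Rightarrow> 'a \<Rightarrow> real) \<Rightarrow> bool" where
  "unconditional_schauder_basis X N f \<longleftrightarrow>
     (\<forall>\<pi>. bij (\<pi> :: nat \<Rightarrow> nat) \<longrightarrow> schauder_basis X N (f \<circ> \<pi>))"

end

theory Submission
  imports Defs
begin

text \<open>
  For \<open>p \<ge> 1\<close> averages over dyadic cubes satisfy a direct and an inverse estimate, so the Besov quasi-norm
  is equivalent to a weighted sum of the \<open>L\<^sub>p\<close> errors of these averages. Partial sums of Haar expansions
  commute with the averages, and the basis property reduces to a uniform \<open>L\<^sub>p\<close> bound for the partial
  sums. For \<open>p > 1\<close> it holds for all finite index sets, by square function inequalities in each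
  coordinate and duality. For \<open>p = 1\<close> it holds for lexicographic initial segments of the blocks, but
  fails for the projection onto every second frequency applied to a Haar function in one coordinate times
  an approximate point mass in another. For \<open>p < 1\<close> already the projection of the indicator function of
  a small corner cube onto a Haar function depending on a single coordinate is too large, as \<open>d > 1\<close>.
  Completeness and Baire's argument show that the partial sum operators of any Schauder basis are
  uniformly bounded, which turns these examples into the negative statements.
\<close>

section \<open>Inequalities for real powers\<close>

text \<open>The restriction s < 1/p comes from step functions: a shift by y changes them only near
  cell faces, so the p-th power of the modulus decays like |y|, and the weights 2^(k s p) must stay
  below 2^k. Averages are useful because they are themselves Haar partial sums and commute with all
  others; an operator bound in L_p therefore passes to every approximation error and so to the Besov
  quasi-norm. In place of a triangle inequality, estimates are written for p-th or q-th powers, and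
  long sums are paid for by geometric weights. The rectangular supports decide the negative part.
  Every block of positive level contains functions h(x_1) g(x_2) with h of the highest frequency and
  g arbitrary up to that frequency. On one block the Besov quasi-norm is comparable to a fixed
  multiple of the L_p quasi-norm, so for p = 1 the conditionality of the univariate Haar system in
  L_1 survives, although the functions of one univariate block have disjoint supports. For p < 1 the
  projection spreads the mass of a small cube over a long slab, and L_p with p < 1 penalises
  spreading.\<close>

lemma powr_add_le:
  fixes a b p :: real
  assumes "0 \<le> a" "0 \<le> b" "0 < p"
  shows "(a + b) powr p \<le> 2 powr p * (a powr p + b powr p)"
proof -
  have "(a + b) powr p \<le> (2 * max a b) powr p"
    using assms by (intro powr_mono2) auto
  also have "\<dots> = 2 powr p * max a b powr p"
    by (simp add: powr_mult)
  also have "\<dots> \<le> 2 powr p * (a powr p + b powr p)"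
    by (intro mult_left_mono) (simp_all add: max_def)
  finally show ?thesis .
qed

text \<open>Stands in for the triangle inequality and for convexity at once, for every exponent
  \<theta> > 0. With T the weighted sum, each term satisfies a l \<le> T^(1/\<theta>) \<nu>^l where
  \<nu>^\<theta> = 1/\<mu>, and the geometric series in \<nu> converges. The ratio \<mu> may be as
  close to 1 as desired.\<close>

lemma powr_suminf_le_weighted:
  fixes \<theta> \<mu> :: real
  assumes "0 < \<theta>" "1 < \<mu>"
  shows "\<exists>C>0. \<forall>a :: nat => real. (\<forall>l. 0 \<le> a l) --> summable (\<lambda>l. \<mu> ^ l * a l powr \<theta>) -->
       summable a \<and> suminf a powr \<theta> \<le> C * (\<Sum>l. \<mu> ^ l * a l powr \<theta>)"
proof -
  define \<nu> where "\<nu> = (1 / \<mu>) powr (1 / \<theta>)"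
  have \<nu>: "0 < \<nu>" "\<nu> < 1"
    unfolding \<nu>_def using assms powr01_less_one[of "1 / \<mu>" "1 / \<theta>"] by simp_all
  have \<nu>l: "\<nu> ^ l = (1 / \<mu> ^ l) powr (1 / \<theta>)" for l
    using assms by (simp add: \<nu>_def powr_realpow[symmetric] powr_powr powr_divide mult.commute)
  define C where "C = (1 / (1 - \<nu>)) powr \<theta>"
  have "0 < C" using \<nu> by (simp add: C_def)
  moreover have "summable a \<and> suminf a powr \<theta> \<le> C * (\<Sum>l. \<mu> ^ l * a l powr \<theta>)"
    if a: "\<And>l. 0 \<le> a l" and s: "summable (\<lambda>l. \<mu> ^ l * a l powr \<theta>)" for a :: "nat => real"
  proof -
    define T where "T = (\<Sum>l. \<mu> ^ l * a l powr \<theta>)"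
    have T0: "0 \<le> T" unfolding T_def using s assms by (intro suminf_nonneg) auto
    have al: "a l \<le> T powr (1 / \<theta>) * \<nu> ^ l" for l
    proof -
      have "\<mu> ^ l * a l powr \<theta> \<le> T"
        unfolding T_def using s sum_le_suminf[of "\<lambda>l. \<mu> ^ l * a l powr \<theta>" "{l}"] assms by auto
      then have "a l powr \<theta> \<le> T * (1 / \<mu> ^ l)"
        using assms by (simp add: field_simps)
      then have "(a l powr \<theta>) powr (1 / \<theta>) \<le> (T * (1 / \<mu> ^ l)) powr (1 / \<theta>)"
        using assms by (intro powr_mono2) auto
      then show ?thesis
        using assms a by (simp add: powr_powr powr_divide \<nu>l)
    qed
    have sg: "summable (\<lambda>l. T powr (1 / \<theta>) * \<nu> ^ l)"
      using \<nu> by (intro summable_mult summable_geometric) auto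
    have sa: "summable a"
      by (rule summable_comparison_test'[OF sg, of 0]) (use a al in auto)
    have "suminf a \<le> (\<Sum>l. T powr (1 / \<theta>) * \<nu> ^ l)"
      by (rule suminf_le[OF al sa sg])
    also have "\<dots> = T powr (1 / \<theta>) * (1 / (1 - \<nu>))"
      using \<nu> by (simp add: suminf_mult suminf_geometric summable_geometric)
    finally have "suminf a powr \<theta> \<le> (T powr (1 / \<theta>) * (1 / (1 - \<nu>))) powr \<theta>"
      using assms a sa by (intro powr_mono2 suminf_nonneg) auto
    also have "\<dots> = C * T"
      using assms T0 by (simp add: powr_mult powr_divide powr_powr C_def)
    finally show ?thesis using sa by (simp add: T_def)
  qed
  ultimately show ?thesis by blast
qed

lemma powr_sum_le_weighted:
  fixes \<theta> \<mu> :: real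
  assumes "0 < \<theta>" "1 < \<mu>"
  shows "\<exists>C>0. \<forall>(a :: nat => real) n. (\<forall>l<n. 0 \<le> a l) -->
       (\<Sum>l<n. a l) powr \<theta> \<le> C * (\<Sum>l<n. \<mu> ^ l * a l powr \<theta>)"
proof -
  obtain C where C: "0 < C" "\<forall>a :: nat => real. (\<forall>l. 0 \<le> a l) --> summable (\<lambda>l. \<mu> ^ l * a l powr \<theta>) -->
       summable a \<and> suminf a powr \<theta> \<le> C * (\<Sum>l. \<mu> ^ l * a l powr \<theta>)"
    using powr_suminf_le_weighted[OF assms] by blast
  have "(\<Sum>l<n. a l) powr \<theta> \<le> C * (\<Sum>l<n. \<mu> ^ l * a l powr \<theta>)"
    if a: "\<And>l. l < n ==> 0 \<le> a l" for a :: "nat => real" and n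
  proof -
    define b where "b l = (if l < n then a l else 0)" for l
    have 1: "suminf b = (\<Sum>l<n. a l)"
      by (subst suminf_finite[of "{..<n}"]) (auto simp: b_def)
    have 2: "(\<Sum>l. \<mu> ^ l * b l powr \<theta>) = (\<Sum>l<n. \<mu> ^ l * a l powr \<theta>)"
      by (subst suminf_finite[of "{..<n}"]) (auto simp: b_def)
    have 3: "summable (\<lambda>l. \<mu> ^ l * b l powr \<theta>)"
      by (rule summable_finite[of "{..<n}"]) (auto simp: b_def)
    have "0 \<le> b l" for l using a by (simp add: b_def)
    from C(2)[rule_format, OF this 3] show ?thesis by (simp add: 1 2)
  qed
  with C(1) show ?thesis by blast
qed

lemma powr_mult_powr_le:
  fixes \<alpha> \<beta> \<delta> :: real
  assumes "0 < \<delta>" "0 \<le> \<alpha>" "0 < \<beta>"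
  shows "\<exists>\<kappa>>0. \<forall>a\<ge>0. \<forall>b\<ge>0. a powr \<alpha> * b powr \<beta> \<le> \<delta> * a powr (\<alpha> + \<beta>) + \<kappa> * b powr (\<alpha> + \<beta>)"
proof -
  define \<eta> where "\<eta> = \<delta> powr (1 / \<beta>)"
  have \<eta>: "0 < \<eta>" "\<eta> powr \<beta> = \<delta>" using assms by (auto simp: \<eta>_def powr_powr)
  define \<kappa> where "\<kappa> = (1 / \<eta>) powr \<alpha>"
  have "0 < \<kappa>" using \<eta> by (simp add: \<kappa>_def)
  moreover have "a powr \<alpha> * b powr \<beta> \<le> \<delta> * a powr (\<alpha> + \<beta>) + \<kappa> * b powr (\<alpha> + \<beta>)"
    if ab: "0 \<le> a" "0 \<le> b" for a b :: real
  proof (cases "b \<le> \<eta> * a")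
    case True
    have "a powr \<alpha> * b powr \<beta> \<le> a powr \<alpha> * (\<eta> * a) powr \<beta>"
      using ab assms True by (intro mult_left_mono powr_mono2) auto
    also have "\<dots> = \<delta> * a powr (\<alpha> + \<beta>)"
      using \<eta> by (simp add: powr_mult powr_add mult_ac)
    finally show ?thesis using \<open>0 < \<kappa>\<close> by (simp add: add_increasing2)
  next
    case False
    then have "a \<le> (1 / \<eta>) * b" using \<eta> by (simp add: field_simps)
    then have "a powr \<alpha> * b powr \<beta> \<le> ((1 / \<eta>) * b) powr \<alpha> * b powr \<beta>"
      using ab assms by (intro mult_right_mono powr_mono2) auto
    also have "\<dots> = \<kappa> * b powr (\<alpha> + \<beta>)"
      unfolding powr_mult \<kappa>_def powr_add by (simp add: mult_ac)
    finally show ?thesis using assms by (simp add: add_increasing)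
  qed
  ultimately show ?thesis by blast
qed

text \<open>Convexity of the power function: the tangent at a lies below the graph. For positive
  arguments it is Young's inequality with the exponents 1 - 1/g and 1/g.\<close>

lemma powr_tangent:
  fixes a b g :: real
  assumes "0 \<le> a" "0 \<le> b" "1 \<le> g"
  shows "a powr g - b powr g \<le> g * a powr (g - 1) * (a - b)"
proof (cases "a = 0 \<or> b = 0")
  case True
  then show ?thesis
  proof
    assume "b = 0"
    have "a powr g \<le> g * (a powr (g - 1) * a)"
      using assms by (cases "a = 0") (auto simp: powr_diff)
    then show ?thesis using \<open>b = 0\<close> by (simp add: mult.assoc)
  qed auto
next
  case False
  then have ab: "0 < a" "0 < b" using assms by auto
  have "(a powr g) powr (1 - 1 / g) * (b powr g) powr (1 / g) \<le> (1 - 1 / g) * a powr g + (1 / g) * b powr g"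
    using ab assms by (intro Youngs_inequality_0) auto
  moreover have "g * (1 - 1 / g) = g - 1" using assms by (simp add: field_simps)
  ultimately have "a powr (g - 1) * b \<le> (1 - 1 / g) * a powr g + (1 / g) * b powr g"
    using ab assms by (simp add: powr_powr)
  then have "g * (a powr (g - 1) * b) \<le> g * ((1 - 1 / g) * a powr g + (1 / g) * b powr g)"
    using assms by (intro mult_left_mono) auto
  also have "\<dots> = (g - 1) * a powr g + b powr g" using assms by (simp add: field_simps)
  finally have 1: "g * (a powr (g - 1) * b) \<le> (g - 1) * a powr g + b powr g" .
  have "a powr (g - 1) * a = a powr g" using ab by (simp add: powr_diff)
  moreover have "g * a powr (g - 1) * (a - b) = g * (a powr (g - 1) * a) - g * (a powr (g - 1) * b)"
    by (simp add: algebra_simps)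
  ultimately have "g * a powr (g - 1) * (a - b) = g * a powr g - g * (a powr (g - 1) * b)" by simp
  with 1 show ?thesis by (simp add: left_diff_distrib)
qed

text \<open>For 1 < g < 2 the second derivative of the power function is unbounded near 0, so
  Taylor's formula does not help for v close to 1. Adding the tangent inequalities at 1 + v and 1 -
  v leaves g v times a difference of (g-1)-th powers, and that difference is O(v).\<close>

lemma powr_symmetric_second_difference:
  fixes g :: real
  assumes "1 \<le> g"
  shows "\<exists>c>0. \<forall>v. \<bar>v\<bar> \<le> 1 --> (1 + v) powr g + (1 - v) powr g \<le> 2 + c * v\<^sup>2"
proof -
  define \<beta> where "\<beta> = g - 1"
  define c0 where "c0 = 2 + 2 * \<beta> * 2 powr (\<beta> - 1)"
  have \<beta>: "0 \<le> \<beta>" using assms by (simp add: \<beta>_def)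
  have c0: "0 < c0" using \<beta> by (simp add: c0_def add_pos_nonneg)
  have diff: "(1 + v) powr \<beta> - (1 - v) powr \<beta> \<le> c0 * v" if v: "0 \<le> v" "v \<le> 1" for v
  proof (cases "\<beta> < 1")
    case True
    \<comment> \<open>For exponents below 1 both powers are compared with first powers: the one with
      base above 1 increases, the one with base below 1 decreases.\<close>
    have "(1 + v) powr \<beta> \<le> (1 + v) powr 1" using v True by (intro powr_mono) auto
    moreover have "(1 - v) powr 1 \<le> (1 - v) powr \<beta>" using v True by (intro powr_mono') auto
    ultimately have "(1 + v) powr \<beta> - (1 - v) powr \<beta> \<le> 2 * v" using v by simp
    also have "\<dots> \<le> c0 * v" using v \<beta> by (intro mult_right_mono) (auto simp: c0_def)
    finally show ?thesis .
  next
    case False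
    have "(1 + v) powr \<beta> - (1 - v) powr \<beta> \<le> \<beta> * (1 + v) powr (\<beta> - 1) * ((1 + v) - (1 - v))"
      using v False by (intro powr_tangent) auto
    also have "\<dots> \<le> \<beta> * 2 powr (\<beta> - 1) * ((1 + v) - (1 - v))"
      using v False by (intro mult_right_mono mult_left_mono powr_mono2) auto
    also have "\<dots> = (2 * \<beta> * 2 powr (\<beta> - 1)) * v" by simp
    also have "\<dots> \<le> c0 * v" using v by (intro mult_right_mono) (auto simp: c0_def)
    finally show ?thesis .
  qed
  have main: "(1 + v) powr g + (1 - v) powr g \<le> 2 + (g * c0) * v\<^sup>2" if v: "0 \<le> v" "v \<le> 1" for v
  proof -
    have 1: "(1 + v) powr g - 1 powr g \<le> g * (1 + v) powr (g - 1) * ((1 + v) - 1)"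
      using v assms by (intro powr_tangent) auto
    have 2: "(1 - v) powr g - 1 powr g \<le> g * (1 - v) powr (g - 1) * ((1 - v) - 1)"
      using v assms by (intro powr_tangent) auto
    have 3: "g * v * ((1 + v) powr \<beta> - (1 - v) powr \<beta>) \<le> g * v * (c0 * v)"
      using v assms diff[OF v] by (intro mult_left_mono) auto
    show ?thesis using 1 2 3 by (simp add: \<beta>_def algebra_simps power2_eq_square)
  qed
  have "(1 + v) powr g + (1 - v) powr g \<le> 2 + (g * c0) * v\<^sup>2" if v: "\<bar>v\<bar> \<le> 1" for v
    using main[of "\<bar>v\<bar>"] v by (cases "0 \<le> v") auto
  moreover have "0 < g * c0" using c0 assms by simp
  ultimately show ?thesis by blast
qed

section \<open>Haar functions of one variable on a dyadic grid\<close>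

text \<open>For m \<le> 2^K the function \<open>haar m\<close> is constant on the grid intervals of
  length 2^(-K), so its value at the left endpoint suffices. Haar estimates up to level K thereby
  become finite sums over a grid.\<close>

definition hh :: "nat => nat => nat => real" where
  "hh K m t = haar m (real t / 2 ^ K)"

text \<open>The reciprocal of the measure of the support of \<open>haar m\<close>, that is, of the
  square of its L_2 norm.\<close>

definition haar_weight :: "nat => real" where
  "haar_weight m = (if m \<le> 1 then 1 else 2 ^ floor_log (m - 1))"

lemma haar_index_cases:
  assumes "1 \<le> (m::nat)"
  obtains "m = 1" | l r where "m = Suc (2 ^ l + r)" "r < 2 ^ l" "l = floor_log (m - 1)"
proof (cases "m = 1")
  case False
  define l where "l = floor_log (m - 1)"
  have "2 ^ l \<le> m - 1" "m - 1 < 2 * 2 ^ l"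
    using floor_log_exp2_le[of "m - 1"] floor_log_exp2_gt[of "m - 1"] False assms by (auto simp: l_def)
  then have "m = Suc (2 ^ l + (m - 1 - 2 ^ l))" "m - 1 - 2 ^ l < 2 ^ l" by auto
  then show ?thesis using that(2) l_def by blast
qed (use that in auto)

lemma haar_cell:
  assumes "1 \<le> m" "m \<le> 2 ^ K" "t < 2 ^ K" "real t / 2 ^ K \<le> x" "x < (real t + 1) / 2 ^ K"
  shows "haar m x = hh K m t"
  using \<open>1 \<le> m\<close>
proof (cases rule: haar_index_cases)
  case 1
  have "real (Suc t) \<le> real (2 ^ K)" using assms(3) by (subst of_nat_le_iff) auto
  then have "real t + 1 \<le> 2 ^ K" by simp
  then have "(real t + 1) / 2 ^ K \<le> 1" by (simp only: divide_le_eq_1_pos zero_less_power zero_less_numeral)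
  then have "x \<le> 1" using assms(5) by linarith
  moreover have "real t / 2 ^ K \<le> 1" using assms(3) by simp
  moreover have "0 \<le> x" using assms(4) order_trans[of 0 "real t / 2 ^ K" x] by simp
  ultimately show ?thesis using 1 assms by (auto simp: hh_def haar_def indicator_def)
next
  case (2 l r)
  have lK: "l < K"
  proof (rule ccontr)
    assume "\<not> l < K"
    then have "(2::nat) ^ K \<le> 2 ^ l" by (intro power_increasing) auto
    with 2(1) assms show False by linarith
  qed
  \<comment> \<open>The breakpoints of \<open>haar m\<close> are multiples of 2^(-(l+1)), hence of
    2^(-K) because l < K, so no breakpoint lies in the interior of a grid interval.\<close>
  have eq: "real c / 2 ^ Suc l \<le> x \<longleftrightarrow> real c / 2 ^ Suc l \<le> real t / 2 ^ K" for c
  proof -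
    have e: "real c / 2 ^ Suc l = real (c * 2 ^ (K - Suc l)) / 2 ^ K"
    proof -
      have "(2::real) ^ K = 2 ^ Suc l * 2 ^ (K - Suc l)" by (subst power_add[symmetric]) (use lK in simp)
      then show ?thesis by simp
    qed
    show ?thesis unfolding e
    proof
      assume "real (c * 2 ^ (K - Suc l)) / 2 ^ K \<le> x"
      then have "real (c * 2 ^ (K - Suc l)) / 2 ^ K < (real t + 1) / 2 ^ K" using assms(5) by linarith
      then have "real (c * 2 ^ (K - Suc l)) < real t + 1" by (simp add: divide_less_cancel)
      then have "c * 2 ^ (K - Suc l) \<le> t" by linarith
      then have "real (c * 2 ^ (K - Suc l)) \<le> real t" by linarith
      then show "real (c * 2 ^ (K - Suc l)) / 2 ^ K \<le> real t / 2 ^ K" by (simp add: divide_right_mono)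
    qed (use assms(4) in linarith)
  qed
  have mem: "x \<in> dyadic_interval (Suc l) j \<longleftrightarrow> real t / 2 ^ K \<in> dyadic_interval (Suc l) j" if "1 \<le> j" for j
    using eq[of j] eq[of "j - 1"] that
    by (simp only: dyadic_interval_def atLeastLessThan_iff not_le[symmetric] of_nat_diff) simp
  have h: "haar m z = indicator (dyadic_interval (Suc l) (2 * Suc r - 1)) z
      - indicator (dyadic_interval (Suc l) (2 * Suc r)) z" for z
    using haar_dyadic[of "Suc l" "Suc r" z] 2(1,2) by simp
  show ?thesis unfolding hh_def h using mem[of "2 * Suc r - 1"] mem[of "2 * Suc r"]
    by (simp add: indicator_def)
qed

lemma hh_1: "t < 2 ^ K ==> hh K 1 t = 1"
  by (simp add: hh_def haar_def indicator_def)

text \<open>With \<open>hh_Suc_fine\<close> this is the whole recursion for the grid: an old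
  function repeats its value on both halves of an interval, and each new one lives on the two halves
  of a single interval. Orthogonality, kernels and the Bellman argument follow from it by induction
  on K.\<close>

lemma hh_Suc_coarse:
  assumes "1 \<le> m" "m \<le> 2 ^ K" "t < 2 ^ Suc K"
  shows "hh (Suc K) m t = hh K m (t div 2)"
  unfolding hh_def[of "Suc K"]
proof (rule haar_cell)
  show "t div 2 < 2 ^ K" using assms by simp
  have "2 * (t div 2) \<le> t" "t < 2 * (t div 2) + 2" by auto
  then have "2 * real (t div 2) \<le> real t" "real t < 2 * real (t div 2) + 2" by linarith+
  then show "real (t div 2) / 2 ^ K \<le> real t / 2 ^ Suc K"
    "real t / 2 ^ Suc K < (real (t div 2) + 1) / 2 ^ K"
    by (simp_all add: field_simps)
qed (use assms in auto)

lemma hh_Suc_fine: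
  assumes "r < 2 ^ K"
  shows "hh (Suc K) (Suc (2 ^ K + r)) t = (if t div 2 = r then if even t then 1 else - 1 else 0)"
proof -
  have h: "hh (Suc K) (Suc (2 ^ K + r)) t = indicator (dyadic_interval (Suc K) (Suc (2 * r))) (real t / 2 ^ Suc K)
      - indicator (dyadic_interval (Suc K) (Suc (Suc (2 * r)))) (real t / 2 ^ Suc K)"
    using haar_dyadic[of "Suc K" "Suc r" "real t / 2 ^ Suc K"] assms by (simp add: hh_def)
  have mem: "real t / 2 ^ Suc K \<in> dyadic_interval (Suc K) (Suc j) \<longleftrightarrow> t = j" for j
  proof -
    have "real t / 2 ^ Suc K \<in> dyadic_interval (Suc K) (Suc j) \<longleftrightarrow> real j \<le> real t \<and> real t < real j + 1"
      unfolding dyadic_interval_def atLeastLessThan_iff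
      by (subst divide_le_cancel, subst divide_less_cancel) (simp add: add.commute)
    also have "\<dots> \<longleftrightarrow> t = j" by linarith
    finally show ?thesis .
  qed
  show ?thesis unfolding h indicator_def mem by auto
qed

lemma haar_weight_1: "haar_weight 1 = 1"
  by (simp add: haar_weight_def)

lemma haar_weight_fine: "r < 2 ^ K ==> haar_weight (Suc (2 ^ K + r)) = 2 ^ K"
proof -
  assume "r < 2 ^ K"
  then have "floor_log (Suc (2 ^ K + r) - 1) = K"
    by (intro floor_log_eqI) auto
  then show ?thesis by (simp add: haar_weight_def)
qed

lemma haar_weight_pos: "0 < haar_weight m"
  by (simp add: haar_weight_def)

lemma haar_index_split: "{1..2 ^ Suc K} = {1..2 ^ K} \<union> (\<lambda>r. Suc (2 ^ K + r)) ` {..<2 ^ K}"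
proof -
  have "(\<lambda>r. Suc (2 ^ K + r)) ` {..<2 ^ K} = {Suc (2 ^ K)..2 ^ Suc K}"
    using image_add_atLeastLessThan[of "Suc (2 ^ K)" 0 "2 ^ K"]
    by (simp add: atLeast0LessThan add.commute[of _ "Suc (2 ^ K)"] atLeastLessThanSuc_atLeastAtMost mult_2)
  then show ?thesis by (simp only:) (auto simp: set_eq_iff)
qed

lemma sum_haar_index_Suc:
  "(\<Sum>m\<in>{1..2 ^ Suc K}. \<phi> m) = (\<Sum>m\<in>{1..2 ^ K}. \<phi> m) + (\<Sum>r<2 ^ K. \<phi> (Suc (2 ^ K + r)) :: real)"
proof -
  have "(\<Sum>m\<in>{1..2 ^ Suc K}. \<phi> m) = (\<Sum>m\<in>{1..2 ^ K}. \<phi> m) + (\<Sum>m\<in>(\<lambda>r. Suc (2 ^ K + r)) ` {..<2 ^ K}. \<phi> m)"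
    unfolding haar_index_split by (rule sum.union_disjoint) auto
  also have "(\<Sum>m\<in>(\<lambda>r. Suc (2 ^ K + r)) ` {..<2 ^ K}. \<phi> m) = (\<Sum>r<2 ^ K. \<phi> (Suc (2 ^ K + r)))"
    by (subst sum.reindex) (auto simp: inj_on_def)
  finally show ?thesis .
qed

lemma sum_grid_Suc:
  "(\<Sum>t<2 ^ Suc K. \<phi> t) = (\<Sum>t<2 ^ K. \<phi> (2 * t) + \<phi> (Suc (2 * t)) :: real)"
proof -
  have "(\<Sum>t<2 * n. \<phi> t) = (\<Sum>t<n. \<phi> (2 * t) + \<phi> (Suc (2 * t)))" for n
    by (induction n) (auto simp: algebra_simps)
  then show ?thesis by simp
qed

lemma hh_expansion_Suc:
  assumes "t < 2 ^ K"
  shows "(\<Sum>m\<in>{1..2 ^ Suc K}. a m * hh (Suc K) m (2 * t)) = (\<Sum>m\<in>{1..2 ^ K}. a m * hh K m t) + a (Suc (2 ^ K + t))"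
    and "(\<Sum>m\<in>{1..2 ^ Suc K}. a m * hh (Suc K) m (Suc (2 * t))) = (\<Sum>m\<in>{1..2 ^ K}. a m * hh K m t) - a (Suc (2 ^ K + t))"
proof -
  have c: "(\<Sum>m\<in>{1..2 ^ K}. a m * hh (Suc K) m t') = (\<Sum>m\<in>{1..2 ^ K}. a m * hh K m t)"
    if "t' = 2 * t \<or> t' = Suc (2 * t)" for t'
    using that assms by (intro sum.cong refl) (auto simp: hh_Suc_coarse)
  show "(\<Sum>m\<in>{1..2 ^ Suc K}. a m * hh (Suc K) m (2 * t)) = (\<Sum>m\<in>{1..2 ^ K}. a m * hh K m t) + a (Suc (2 ^ K + t))"
    unfolding sum_haar_index_Suc c[OF disjI1[OF refl]] using assms
    by (simp add: hh_Suc_fine if_distrib sum.delta cong: if_cong)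
  show "(\<Sum>m\<in>{1..2 ^ Suc K}. a m * hh (Suc K) m (Suc (2 * t))) = (\<Sum>m\<in>{1..2 ^ K}. a m * hh K m t) - a (Suc (2 ^ K + t))"
    unfolding sum_haar_index_Suc c[OF disjI2[OF refl]] using assms
    by (simp add: hh_Suc_fine if_distrib sum.delta cong: if_cong)
qed

lemma haar_values: "haar m x = 0 \<or> \<bar>haar m x\<bar> = 1"
  by (auto simp: haar_def Let_def indicator_def)

lemma abs_hh_le_1: "\<bar>hh K m t\<bar> \<le> 1"
  using haar_values[of m "real t / 2 ^ K"] by (auto simp: hh_def)

lemma hh_square: "hh K m t * hh K m t = \<bar>hh K m t\<bar>"
  using haar_values[of m "real t / 2 ^ K"] by (auto simp: hh_def abs_if split: if_splits)

lemma hh_orthogonal: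
  "u \<in> {1..2 ^ K} ==> v \<in> {1..2 ^ K} ==>
    (\<Sum>t<2 ^ K. hh K u t * hh K v t) = (if u = v then 2 ^ K / haar_weight u else 0)"
proof (induction K arbitrary: u v)
  case 0
  then show ?case using hh_1[of 0 0] by (simp add: haar_weight_def)
next
  case (Suc K)
  have coarse: "hh (Suc K) m (2 * t) = hh K m t" "hh (Suc K) m (Suc (2 * t)) = hh K m t"
    if "m \<in> {1..2 ^ K}" "t < 2 ^ K" for m t
    using that by (simp_all add: hh_Suc_coarse)
  have fine: "hh (Suc K) (Suc (2 ^ K + r)) (2 * t) = (if t = r then 1 else 0)"
    "hh (Suc K) (Suc (2 ^ K + r)) (Suc (2 * t)) = (if t = r then - 1 else 0)" if "r < 2 ^ K" for r t
    using that by (simp_all add: hh_Suc_fine)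
  consider (cc) "u \<in> {1..2 ^ K}" "v \<in> {1..2 ^ K}"
    | (cf) r where "u \<in> {1..2 ^ K}" "v = Suc (2 ^ K + r)" "r < 2 ^ K"
    | (fc) r where "v \<in> {1..2 ^ K}" "u = Suc (2 ^ K + r)" "r < 2 ^ K"
    | (ff) r r' where "u = Suc (2 ^ K + r)" "r < 2 ^ K" "v = Suc (2 ^ K + r')" "r' < 2 ^ K"
    using Suc.prems unfolding haar_index_split by auto
  then show ?case
  proof cases
    case cc
    have "(\<Sum>t<2 ^ Suc K. hh (Suc K) u t * hh (Suc K) v t) = 2 * (\<Sum>t<2 ^ K. hh K u t * hh K v t)"
      unfolding sum_grid_Suc sum_distrib_left using cc by (intro sum.cong) (auto simp: coarse)
    then show ?thesis using Suc.IH[OF cc] by simp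
  next
    case cf
    have "(\<Sum>t<2 ^ Suc K. hh (Suc K) u t * hh (Suc K) v t) = 0"
      unfolding sum_grid_Suc using cf by (intro sum.neutral) (auto simp: coarse fine)
    then show ?thesis using cf by auto
  next
    case fc
    have "(\<Sum>t<2 ^ Suc K. hh (Suc K) u t * hh (Suc K) v t) = 0"
      unfolding sum_grid_Suc using fc by (intro sum.neutral) (auto simp: coarse fine)
    then show ?thesis using fc by auto
  next
    case ff
    have "(\<Sum>t<2 ^ Suc K. hh (Suc K) u t * hh (Suc K) v t) = (\<Sum>t<2 ^ K. if t = r then (if r = r' then 2 else 0) else 0)"
      unfolding sum_grid_Suc using ff by (intro sum.cong) (auto simp: fine)
    also have "\<dots> = (if r = r' then 2 else 0)" using ff by simp
    finally show ?thesis using ff by (simp add: haar_weight_fine)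
  qed
qed

lemma sum_hh:
  assumes "m \<in> {1..2 ^ K}"
  shows "(\<Sum>t<2 ^ K. hh K m t) = (if m = 1 then 2 ^ K else 0)"
proof -
  have "(\<Sum>t<2 ^ K. hh K m t) = (\<Sum>t<2 ^ K. hh K m t * hh K 1 t)"
    by (intro sum.cong refl) (use hh_1 in auto)
  then show ?thesis using hh_orthogonal[of m K 1] assms by (simp add: haar_weight_def)
qed

lemma haar_kernel_Suc:
  assumes "t < 2 ^ Suc K" "u < 2 ^ Suc K" "M \<le> 2 ^ K"
  shows "(\<Sum>m\<in>{1..M}. haar_weight m * hh (Suc K) m t * hh (Suc K) m u) =
         (\<Sum>m\<in>{1..M}. haar_weight m * hh K m (t div 2) * hh K m (u div 2))"
  using assms by (intro sum.cong refl) (auto simp: hh_Suc_coarse)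

text \<open>From K to K + 1 the new functions contribute 2^K or -2^K when t and u have the same
  parent interval: this doubles the diagonal and cancels the inherited value for siblings.\<close>

lemma haar_kernel:
  "t < 2 ^ K ==> u < 2 ^ K ==>
    (\<Sum>m\<in>{1..2 ^ K}. haar_weight m * hh K m t * hh K m u) = (if t = u then 2 ^ K else 0)"
proof (induction K arbitrary: t u)
  case 0
  then show ?case using hh_1[of 0 0] by (simp add: haar_weight_def)
next
  case (Suc K)
  have fine: "(\<Sum>r<2 ^ K. haar_weight (Suc (2 ^ K + r)) * hh (Suc K) (Suc (2 ^ K + r)) t * hh (Suc K) (Suc (2 ^ K + r)) u)
     = (\<Sum>r<2 ^ K. if r = t div 2 then (if t div 2 = u div 2 then 2 ^ K * (if even t = even u then 1 else - 1) else 0) else 0)"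
    by (intro sum.cong refl) (auto simp: hh_Suc_fine haar_weight_fine)
  have t2: "t div 2 < 2 ^ K" "u div 2 < 2 ^ K" using Suc.prems by auto
  have tu: "t = u \<longleftrightarrow> t div 2 = u div 2 \<and> even t = even u"
    by (metis dvd_mult_div_cancel odd_two_times_div_two_succ)
  have "(\<Sum>m\<in>{1..2 ^ Suc K}. haar_weight m * hh (Suc K) m t * hh (Suc K) m u)
     = (if t div 2 = u div 2 then 2 ^ K else 0)
       + (if t div 2 = u div 2 then 2 ^ K * (if even t = even u then 1 else - 1) else 0)"
    unfolding sum_haar_index_Suc haar_kernel_Suc[OF Suc.prems order_refl] Suc.IH[OF t2] fine
    using t2 by simp
  then show ?case unfolding tu by (auto split: if_splits)
qed

text \<open>The partial sum over the first M univariate Haar functions averages over a partition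
  into dyadic intervals of at most two consecutive lengths, so its kernel cannot be negative. In the
  induction, the incomplete new level adds 2^K or -2^K only where the old kernel equals 2^K.\<close>

lemma haar_partial_kernel_nonneg:
  "t < 2 ^ K ==> u < 2 ^ K ==> M \<le> 2 ^ K ==>
    0 \<le> (\<Sum>m\<in>{1..M}. haar_weight m * hh K m t * hh K m u)"
proof (induction K arbitrary: t u M)
  case 0
  then have "M = 0 \<or> M = 1" by auto
  then show ?case using 0 hh_1[of 0 0] by (auto simp: haar_weight_def)
next
  case (Suc K)
  have t2: "t div 2 < 2 ^ K" "u div 2 < 2 ^ K" using Suc.prems by auto
  show ?case
  proof (cases "M \<le> 2 ^ K")
    case True
    then show ?thesis using haar_kernel_Suc[OF Suc.prems(1,2) True] Suc.IH[OF t2 True] by simp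
  next
    case False
    let ?\<phi> = "\<lambda>m. haar_weight m * hh (Suc K) m t * hh (Suc K) m u"
    define n where "n = M - 2 ^ K"
    have M: "M = 2 ^ K + n" "n \<le> 2 ^ K" using False Suc.prems by (auto simp: n_def)
    have "{1..M} = {1..2 ^ K} \<union> {Suc (2 ^ K)..M}" using False by auto
    then have "sum ?\<phi> {1..M} = sum ?\<phi> {1..2 ^ K} + sum ?\<phi> {Suc (2 ^ K)..M}"
      by (simp add: sum.union_disjoint)
    also have "sum ?\<phi> {Suc (2 ^ K)..M} = (\<Sum>r<n. ?\<phi> (Suc (2 ^ K + r)))"
      unfolding M by (rule sum.reindex_bij_witness[of _ "\<lambda>r. Suc (2 ^ K + r)" "\<lambda>m. m - Suc (2 ^ K)"]) auto
    also have "\<dots> = (\<Sum>r<n. if r = t div 2 then (if t div 2 = u div 2 then 2 ^ K * (if even t = even u then 1 else - 1) else 0) else 0)"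
      using M by (intro sum.cong refl) (auto simp: hh_Suc_fine haar_weight_fine)
    finally show ?thesis
      unfolding haar_kernel_Suc[OF Suc.prems(1,2) order_refl] haar_kernel[OF t2] by simp
  qed
qed

text \<open>Nonnegativity removes the absolute values, and summing over t leaves only the constant
  function.\<close>

lemma haar_partial_kernel_L1:
  assumes "u < 2 ^ K" "M \<le> 2 ^ K"
  shows "(\<Sum>t<2 ^ K. \<bar>\<Sum>m\<in>{1..M}. haar_weight m * hh K m t * hh K m u\<bar>) \<le> 2 ^ K"
proof -
  have "(\<Sum>t<2 ^ K. \<bar>\<Sum>m\<in>{1..M}. haar_weight m * hh K m t * hh K m u\<bar>)
      = (\<Sum>t<2 ^ K. \<Sum>m\<in>{1..M}. haar_weight m * hh K m t * hh K m u)"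
    using assms by (intro sum.cong refl abs_of_nonneg haar_partial_kernel_nonneg) auto
  also have "\<dots> = (\<Sum>m\<in>{1..M}. haar_weight m * hh K m u * (\<Sum>t<2 ^ K. hh K m t))"
    by (subst sum.swap) (simp add: sum_distrib_left mult_ac)
  also have "\<dots> = (\<Sum>m\<in>{1..M}. if m = 1 then 2 ^ K else 0)"
    using assms hh_1[of u K] by (intro sum.cong refl) (auto simp: sum_hh haar_weight_def)
  also have "\<dots> \<le> 2 ^ K" by simp
  finally show ?thesis .
qed

text \<open>Since |h| \<le> 1 and the square of h equals |h|, the sum is at most the weighted
  squared norm of h.\<close>

lemma haar_single_kernel_L1:
  assumes "m \<in> {1..2 ^ K}"
  shows "(\<Sum>t<2 ^ K. \<bar>haar_weight m * hh K m t * hh K m u\<bar>) \<le> 2 ^ K"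
proof -
  have "(\<Sum>t<2 ^ K. \<bar>haar_weight m * hh K m t * hh K m u\<bar>) \<le> (\<Sum>t<2 ^ K. haar_weight m * (hh K m t * hh K m t))"
  proof (rule sum_mono)
    fix t
    have "haar_weight m * \<bar>hh K m t\<bar> * \<bar>hh K m u\<bar> \<le> haar_weight m * \<bar>hh K m t\<bar> * 1"
      using abs_hh_le_1 haar_weight_pos[of m] by (intro mult_left_mono) auto
    then show "\<bar>haar_weight m * hh K m t * hh K m u\<bar> \<le> haar_weight m * (hh K m t * hh K m t)"
      using haar_weight_pos[of m] by (simp add: abs_mult hh_square)
  qed
  also have "\<dots> = 2 ^ K"
    using hh_orthogonal[OF assms assms] haar_weight_pos[of m] by (simp flip: sum_distrib_left)
  finally show ?thesis .
qed

section \<open>The vector-valued square function inequality\<close>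

lemma hh_square_expansion_Suc:
  assumes "t < 2 ^ K" "t' = 2 * t \<or> t' = Suc (2 * t)"
  shows "(\<Sum>m\<in>{1..2 ^ Suc K}. (a m * hh (Suc K) m t')\<^sup>2) = (\<Sum>m\<in>{1..2 ^ K}. (a m * hh K m t)\<^sup>2) + (a (Suc (2 ^ K + t)))\<^sup>2"
proof -
  have c: "(\<Sum>m\<in>{1..2 ^ K}. (a m * hh (Suc K) m t')\<^sup>2) = (\<Sum>m\<in>{1..2 ^ K}. (a m * hh K m t)\<^sup>2)"
    using assms by (intro sum.cong refl) (auto simp: hh_Suc_coarse)
  have "(\<Sum>r<2 ^ K. (a (Suc (2 ^ K + r)) * hh (Suc K) (Suc (2 ^ K + r)) t')\<^sup>2)
     = (\<Sum>r<2 ^ K. if r = t then (a (Suc (2 ^ K + t)))\<^sup>2 else 0)"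
    using assms by (intro sum.cong refl) (auto simp: hh_Suc_fine)
  then show ?thesis unfolding sum_haar_index_Suc c using assms by simp
qed

text \<open>
  Bellman function argument: passing from one dyadic level to the next replaces the squared length
  \<^term>\<open>X\<close> of a vector by \<^term>\<open>X + H + u\<close> or \<^term>\<open>X + H - u\<close>, where \<^term>\<open>H\<close> is the squared
  length of the increment and \<^term>\<open>u\<close> is twice the inner product.
\<close>

lemma haar_bellman:
  fixes U :: "real => real => real" and a :: "'l => nat => real"
  assumes step: "\<And>X Y H u. 0 \<le> X ==> 0 \<le> Y ==> 0 \<le> H ==> u\<^sup>2 \<le> 4 * X * H ==>
      U (X + H + u) (Y + H) + U (X + H - u) (Y + H) \<le> 2 * U X Y"
    and init: "\<And>X. 0 \<le> X ==> U X X \<le> 0"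
  shows "(\<Sum>t<2 ^ K. U (\<Sum>l\<in>L. (\<Sum>m\<in>{1..2 ^ K}. a l m * hh K m t)\<^sup>2)
      (\<Sum>l\<in>L. \<Sum>m\<in>{1..2 ^ K}. (a l m * hh K m t)\<^sup>2)) \<le> 0"
proof (induction K)
  case 0
  have "0 \<le> (\<Sum>l\<in>L. (a l (Suc 0))\<^sup>2)" by (intro sum_nonneg) auto
  then show ?case using hh_1[of 0 0] init by simp
next
  case (Suc K)
  let ?F = "\<lambda>K l t. \<Sum>m\<in>{1..2 ^ K}. a l m * hh K m t"
  let ?X = "\<lambda>K t. \<Sum>l\<in>L. (?F K l t)\<^sup>2"
  let ?Y = "\<lambda>K t. \<Sum>l\<in>L. \<Sum>m\<in>{1..2 ^ K}. (a l m * hh K m t)\<^sup>2"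
  have "(\<Sum>t<2 ^ Suc K. U (?X (Suc K) t) (?Y (Suc K) t)) \<le> (\<Sum>t<2 ^ K. 2 * U (?X K t) (?Y K t))"
    unfolding sum_grid_Suc
  proof (rule sum_mono)
    fix t :: nat
    assume "t \<in> {..<2 ^ K}"
    then have t: "t < 2 ^ K" by simp
    define h where "h l = a l (Suc (2 ^ K + t))" for l
    define H where "H = (\<Sum>l\<in>L. (h l)\<^sup>2)"
    define u where "u = 2 * (\<Sum>l\<in>L. ?F K l t * h l)"
    have X1: "?X (Suc K) (2 * t) = ?X K t + H + u"
      unfolding hh_expansion_Suc(1)[OF t] h_def[symmetric] H_def u_def
      by (simp add: power2_sum sum.distrib sum_distrib_left algebra_simps)
    have X2: "?X (Suc K) (Suc (2 * t)) = ?X K t + H - u"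
      unfolding hh_expansion_Suc(2)[OF t] h_def[symmetric] H_def u_def
      by (simp add: power2_diff sum.distrib sum_subtractf sum_distrib_left algebra_simps)
    have Y1: "?Y (Suc K) (2 * t) = ?Y K t + H" "?Y (Suc K) (Suc (2 * t)) = ?Y K t + H"
      unfolding hh_square_expansion_Suc[OF t disjI1[OF refl]] hh_square_expansion_Suc[OF t disjI2[OF refl]]
        h_def[symmetric] H_def by (simp_all add: sum.distrib)
    \<comment> \<open>Cauchy-Schwarz in the vector index l is the source of the constraint on u in
      the assumption on \<open>U\<close>.\<close>
    have "(\<Sum>l\<in>L. ?F K l t * h l)\<^sup>2 \<le> ?X K t * H"
      unfolding H_def by (rule Cauchy_Schwarz_ineq_sum)
    then have "u\<^sup>2 \<le> 4 * ?X K t * H" by (simp add: u_def power_mult_distrib)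
    then show "U (?X (Suc K) (2 * t)) (?Y (Suc K) (2 * t)) + U (?X (Suc K) (Suc (2 * t))) (?Y (Suc K) (Suc (2 * t)))
        \<le> 2 * U (?X K t) (?Y K t)"
      unfolding X1 X2 Y1 by (intro step) (auto simp: H_def intro!: sum_nonneg)
  qed
  then show ?case using Suc by (simp flip: sum_distrib_left)
qed

text \<open>X and Y are squares, so \<gamma> \<ge> 1 stands for the exponents p = 2\<gamma> \<ge> 2.
  The Bellman function \<open>U\<close> is affine in X, so the increments u and -u cancel, and the
  tangent inequality for Y^\<gamma> bounds its growth by what the mixed term loses. The mixed term
  left at the end is split by Young's inequality. The index set \<open>L\<close> makes it possible
  to treat several coordinates one after the other.\<close>

lemma square_function_le:
  fixes \<gamma> :: real
  assumes "1 \<le> \<gamma>"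
  shows "\<exists>C>0. \<forall>K (L :: 'l set) a.
    (\<Sum>t<2 ^ K. (\<Sum>l\<in>L. \<Sum>m\<in>{1..2 ^ K}. (a l m * hh K m t)\<^sup>2) powr \<gamma>)
    \<le> C * (\<Sum>t<2 ^ K. (\<Sum>l\<in>L. (\<Sum>m\<in>{1..2 ^ K}. a l m * hh K m t)\<^sup>2) powr \<gamma>)"
proof -
  have d: "0 < 1 / (2 * \<gamma>)" and g: "0 \<le> \<gamma> - 1" using assms by auto
  \<comment> \<open>1/(2\<gamma>) is half the factor of Y^\<gamma> in \<open>U\<close>, so the
    corresponding term can be moved to the left-hand side at the end.\<close>
  obtain \<kappa> where \<kappa>: "\<kappa> > 0" and young: "\<forall>a\<ge>0. \<forall>b\<ge>0. a powr (\<gamma> - 1) * b powr 1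
     \<le> 1 / (2 * \<gamma>) * a powr (\<gamma> - 1 + 1) + \<kappa> * b powr (\<gamma> - 1 + 1)"
    using powr_mult_powr_le[OF d g zero_less_one] by blast
  define U where "U X Y = 1 / \<gamma> * Y powr \<gamma> - Y powr (\<gamma> - 1) * X" for X Y
  have step: "U (X + H + u) (Y + H) + U (X + H - u) (Y + H) \<le> 2 * U X Y"
    if "0 \<le> X" "0 \<le> Y" "0 \<le> H" for X Y H u
  proof -
    have "(Y + H) powr \<gamma> - Y powr \<gamma> \<le> \<gamma> * (Y + H) powr (\<gamma> - 1) * (Y + H - Y)"
      using that assms by (intro powr_tangent) auto
    then have "1 / \<gamma> * ((Y + H) powr \<gamma> - Y powr \<gamma>) \<le> (Y + H) powr (\<gamma> - 1) * H"
      using assms by (simp add: field_simps)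
    moreover have "Y powr (\<gamma> - 1) * X \<le> (Y + H) powr (\<gamma> - 1) * X"
      using that g by (intro mult_right_mono powr_mono2) auto
    ultimately show ?thesis unfolding U_def by (simp add: algebra_simps)
  qed
  have init: "U X X \<le> 0" if "0 \<le> X" for X
  proof -
    have "X powr (\<gamma> - 1) * X = X powr \<gamma>" using that by (cases "X = 0") (auto simp: powr_diff)
    moreover have "1 / \<gamma> * X powr \<gamma> \<le> 1 * X powr \<gamma>" using assms by (intro mult_right_mono) auto
    ultimately show ?thesis by (simp add: U_def)
  qed
  have "(\<Sum>t<2 ^ K. (\<Sum>l\<in>L. \<Sum>m\<in>{1..2 ^ K}. (a l m * hh K m t)\<^sup>2) powr \<gamma>)
    \<le> (2 * \<gamma> * \<kappa>) * (\<Sum>t<2 ^ K. (\<Sum>l\<in>L. (\<Sum>m\<in>{1..2 ^ K}. a l m * hh K m t)\<^sup>2) powr \<gamma>)"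
    for K and L :: "'l set" and a
  proof -
    let ?X = "\<lambda>t. \<Sum>l\<in>L. (\<Sum>m\<in>{1..2 ^ K}. a l m * hh K m t)\<^sup>2"
    let ?Y = "\<lambda>t. \<Sum>l\<in>L. \<Sum>m\<in>{1..2 ^ K}. (a l m * hh K m t)\<^sup>2"
    have X0: "0 \<le> ?X t" and Y0: "0 \<le> ?Y t" for t by (auto intro!: sum_nonneg)
    have "(\<Sum>t<2 ^ K. U (?X t) (?Y t)) \<le> 0"
      by (rule haar_bellman) (use step init in auto)
    then have "1 / \<gamma> * (\<Sum>t<2 ^ K. ?Y t powr \<gamma>) \<le> (\<Sum>t<2 ^ K. ?Y t powr (\<gamma> - 1) * ?X t)"
      by (simp add: U_def sum_subtractf sum_distrib_left)
    also have "\<dots> \<le> (\<Sum>t<2 ^ K. 1 / (2 * \<gamma>) * ?Y t powr \<gamma> + \<kappa> * ?X t powr \<gamma>)"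
    proof (rule sum_mono)
      fix t
      show "?Y t powr (\<gamma> - 1) * ?X t \<le> 1 / (2 * \<gamma>) * ?Y t powr \<gamma> + \<kappa> * ?X t powr \<gamma>"
        using young[rule_format, OF Y0 X0, of t t] X0[of t] by (simp add: powr_one)
    qed
    also have "\<dots> = 1 / (2 * \<gamma>) * (\<Sum>t<2 ^ K. ?Y t powr \<gamma>) + \<kappa> * (\<Sum>t<2 ^ K. ?X t powr \<gamma>)"
      by (simp add: sum.distrib sum_distrib_left)
    finally show ?thesis using assms by (simp add: field_simps)
  qed
  moreover have "0 < 2 * \<gamma> * \<kappa>" using \<kappa> assms by simp
  ultimately show ?thesis by blast
qed

text \<open>In this direction \<open>U\<close> is not affine in X, so the increment u matters and is
  controlled by u^2 \<le> 4XH. Using R = X + Y in place of X gives |u| \<le> M with M = R + 2H, so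
  both arguments M + u and M - u are nonnegative; the negative term with the factor C Y pays for the
  second-order growth.\<close>

lemma le_square_function:
  fixes \<gamma> :: real
  assumes "1 \<le> \<gamma>"
  shows "\<exists>C>0. \<forall>K (L :: 'l set) a.
    (\<Sum>t<2 ^ K. (\<Sum>l\<in>L. (\<Sum>m\<in>{1..2 ^ K}. a l m * hh K m t)\<^sup>2) powr \<gamma>)
    \<le> C * (\<Sum>t<2 ^ K. (\<Sum>l\<in>L. \<Sum>m\<in>{1..2 ^ K}. (a l m * hh K m t)\<^sup>2) powr \<gamma>)"
proof -
  define \<beta> where "\<beta> = \<gamma> - 1"
  have \<beta>: "0 \<le> \<beta>" using assms by (simp add: \<beta>_def)
  obtain c where c: "c > 0" "\<forall>v. \<bar>v\<bar> \<le> 1 --> (1 + v) powr \<gamma> + (1 - v) powr \<gamma> \<le> 2 + c * v\<^sup>2"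
    using powr_symmetric_second_difference[OF assms] by blast
  \<comment> \<open>4\<gamma> comes from the tangent inequality for R^\<gamma> along the increment
    2H, counted twice, and 4c from the second difference with u^2/M \<le> 4H.\<close>
  define C where "C = 4 * \<gamma> + 4 * c"
  have C: "2 \<le> C" using c assms by (simp add: C_def)
  define U where "U X Y = (X + Y) powr \<gamma> - C * Y * (X + Y) powr \<beta>" for X Y
  have U': "U X Y = (X + Y) powr \<gamma> - C * ((X + Y) powr \<beta> * Y)" for X Y
    by (simp add: U_def mult_ac)
  have powr_\<gamma>: "z powr \<gamma> = z powr \<beta> * z" if "0 \<le> z" for z :: real
    using that by (cases "z = 0") (auto simp: powr_diff \<beta>_def)
  have step: "U (X + H + u) (Y + H) + U (X + H - u) (Y + H) \<le> 2 * U X Y"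
    if XYH: "0 \<le> X" "0 \<le> Y" "0 \<le> H" and u: "u\<^sup>2 \<le> 4 * X * H" for X Y H u
  proof -
    define R where "R = X + Y"
    define M where "M = R + 2 * H"
    have R: "0 \<le> R" "X \<le> R" using XYH by (auto simp: R_def)
    have M: "0 \<le> M" "R \<le> M" using R XYH by (auto simp: M_def)
    have XH: "X * H \<le> R * H" using R XYH by (intro mult_right_mono) auto
    have "4 * X * H \<le> M\<^sup>2"
    proof -
      have "4 * (X * H) \<le> 4 * (R * H)" using XH by simp
      also have "\<dots> \<le> M\<^sup>2" using R XYH by (simp add: M_def power2_sum power_mult_distrib)
      finally show ?thesis by simp
    qed
    then have uM: "\<bar>u\<bar> \<le> M" using u M by (metis abs_le_square_iff abs_of_nonneg order_trans)
    have 1: "(M + u) powr \<gamma> + (M - u) powr \<gamma> \<le> 2 * R powr \<gamma> + C * H * M powr \<beta>"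
    proof (cases "M = 0")
      case False
      then have M0: "0 < M" using M by simp
      define v where "v = u / M"
      have v: "\<bar>v\<bar> \<le> 1" using uM M0 by (simp add: v_def)
      have uv: "M + u = M * (1 + v)" "M - u = M * (1 - v)" using M0 by (simp_all add: v_def field_simps)
      have "(M + u) powr \<gamma> + (M - u) powr \<gamma> = M powr \<gamma> * ((1 + v) powr \<gamma> + (1 - v) powr \<gamma>)"
        unfolding uv powr_mult by (simp add: algebra_simps)
      also have "\<dots> \<le> M powr \<gamma> * (2 + c * v\<^sup>2)" using c v by (intro mult_left_mono) auto
      also have "M powr \<gamma> * (2 + c * v\<^sup>2) = 2 * M powr \<gamma> + c * (M powr \<beta> * (u\<^sup>2 / M))"
        using M0 by (simp add: powr_\<gamma> v_def power2_eq_square field_simps)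
      also have "u\<^sup>2 / M \<le> 4 * H"
      proof -
        have "u\<^sup>2 \<le> 4 * (X * H)" using u by simp
        also have "\<dots> \<le> 4 * (M * H)" using XYH R M by (intro mult_left_mono mult_right_mono) auto
        finally show ?thesis using M0 by (simp add: field_simps)
      qed
      also have "M powr \<gamma> \<le> R powr \<gamma> + \<gamma> * M powr \<beta> * (2 * H)"
        using powr_tangent[of M R \<gamma>] M R assms by (simp add: \<beta>_def M_def)
      finally show ?thesis using c M0 by (simp add: C_def algebra_simps mult_left_mono)
    qed (use uM XYH R M C in \<open>auto simp: M_def\<close>)
    \<comment> \<open>The product (M + u)(M - u) is at least R^2 since u^2 \<le> 4RH; the
      arithmetic-geometric mean inequality for the (\<beta>/2)-th powers then gives the bound. It
      handles the old part Y of Y + H.\<close>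
    have 2: "2 * R powr \<beta> \<le> (M + u) powr \<beta> + (M - u) powr \<beta>"
    proof -
      have "(M + u) * (M - u) = R * R + 4 * (R * H) + 4 * (H * H) - u\<^sup>2"
        by (simp add: M_def algebra_simps power2_eq_square)
      moreover have "0 \<le> H * H" using XYH by simp
      moreover have "u\<^sup>2 \<le> 4 * (X * H)" using u by simp
      ultimately have "R * R \<le> (M + u) * (M - u)"
        using XH by linarith
      then have "(R * R) powr (\<beta> / 2) \<le> ((M + u) * (M - u)) powr (\<beta> / 2)"
        using R \<beta> by (intro powr_mono2) auto
      then have "R powr \<beta> \<le> (M + u) powr (\<beta> / 2) * (M - u) powr (\<beta> / 2)"
        by (simp add: powr_mult flip: powr_add)
      moreover have "2 * ((M + u) powr (\<beta> / 2) * (M - u) powr (\<beta> / 2)) \<le> ((M + u) powr (\<beta> / 2))\<^sup>2 + ((M - u) powr (\<beta> / 2))\<^sup>2"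
        using sum_squares_bound[of "(M + u) powr (\<beta> / 2)" "(M - u) powr (\<beta> / 2)"] by simp
      ultimately show ?thesis by (simp add: power2_eq_square flip: powr_add)
    qed
    \<comment> \<open>One of the two arguments is at least M. This handles the new part H of Y + H,
      which has to pay for the growth found in the first inequality.\<close>
    have 3: "M powr \<beta> \<le> (M + u) powr \<beta> + (M - u) powr \<beta>"
    proof (cases "0 \<le> u")
      case True
      then have "M powr \<beta> \<le> (M + u) powr \<beta>" using M \<beta> by (intro powr_mono2) auto
      then show ?thesis by (simp add: add_increasing2)
    next
      case False
      then have "M powr \<beta> \<le> (M - u) powr \<beta>" using M \<beta> by (intro powr_mono2) auto
      then show ?thesis by (simp add: add_increasing)
    qed
    have "C * Y * (2 * R powr \<beta>) \<le> C * Y * ((M + u) powr \<beta> + (M - u) powr \<beta>)"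
      using 2 C XYH by (intro mult_left_mono) auto
    moreover have "C * H * M powr \<beta> \<le> C * H * ((M + u) powr \<beta> + (M - u) powr \<beta>)"
      using 3 C XYH by (intro mult_left_mono) auto
    moreover have e: "X + H + u + (Y + H) = M + u" "X + H - u + (Y + H) = M - u"
      by (simp_all add: M_def R_def)
    ultimately show ?thesis using 1 unfolding U_def e R_def[symmetric] by (simp add: algebra_simps)
  qed
  have init: "U X X \<le> 0" if "0 \<le> X" for X
  proof -
    have "U X X = (2 * X) powr \<beta> * (2 * X - C * X)"
      using that powr_\<gamma>[of "2 * X"] by (simp add: U_def algebra_simps)
    also have "\<dots> \<le> 0" using C that by (intro mult_nonneg_nonpos) (auto intro!: mult_right_mono)
    finally show ?thesis .
  qed
  have d: "0 < 1 / (2 * C)" using C by simp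
  obtain \<kappa> where \<kappa>: "\<kappa> > 0" and young: "\<forall>a\<ge>0. \<forall>b\<ge>0. a powr \<beta> * b powr 1
     \<le> 1 / (2 * C) * a powr (\<beta> + 1) + \<kappa> * b powr (\<beta> + 1)"
    using powr_mult_powr_le[OF d \<beta> zero_less_one] by blast
  have cancel: "C * (1 / (2 * C) * x + \<kappa> * y) = 1 / 2 * x + C * \<kappa> * y" for x y
    using C by (simp add: field_simps)
  have "(\<Sum>t<2 ^ K. (\<Sum>l\<in>L. (\<Sum>m\<in>{1..2 ^ K}. a l m * hh K m t)\<^sup>2) powr \<gamma>)
    \<le> (2 * C * \<kappa>) * (\<Sum>t<2 ^ K. (\<Sum>l\<in>L. \<Sum>m\<in>{1..2 ^ K}. (a l m * hh K m t)\<^sup>2) powr \<gamma>)"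
    for K and L :: "'l set" and a
  proof -
    let ?X = "\<lambda>t. \<Sum>l\<in>L. (\<Sum>m\<in>{1..2 ^ K}. a l m * hh K m t)\<^sup>2"
    let ?Y = "\<lambda>t. \<Sum>l\<in>L. \<Sum>m\<in>{1..2 ^ K}. (a l m * hh K m t)\<^sup>2"
    let ?R = "\<lambda>t. ?X t + ?Y t"
    have X0: "0 \<le> ?X t" and Y0: "0 \<le> ?Y t" for t by (auto intro!: sum_nonneg)
    have R0: "0 \<le> ?R t" for t using X0[of t] Y0[of t] by simp
    have "(\<Sum>t<2 ^ K. U (?X t) (?Y t)) \<le> 0"
      by (rule haar_bellman) (use step init in auto)
    moreover have "(\<Sum>t<2 ^ K. U (?X t) (?Y t)) = (\<Sum>t<2 ^ K. ?R t powr \<gamma>) - C * (\<Sum>t<2 ^ K. ?R t powr \<beta> * ?Y t)"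
      by (simp only: U' sum_subtractf sum_distrib_left[symmetric])
    ultimately have "(\<Sum>t<2 ^ K. ?R t powr \<gamma>) \<le> C * (\<Sum>t<2 ^ K. ?R t powr \<beta> * ?Y t)"
      by linarith
    also have "\<dots> \<le> C * (\<Sum>t<2 ^ K. 1 / (2 * C) * ?R t powr \<gamma> + \<kappa> * ?Y t powr \<gamma>)"
    proof (intro mult_left_mono sum_mono)
      fix t
      show "?R t powr \<beta> * ?Y t \<le> 1 / (2 * C) * ?R t powr \<gamma> + \<kappa> * ?Y t powr \<gamma>"
        using young[rule_format, OF R0 Y0, of t t] Y0[of t] by (simp add: powr_one \<beta>_def)
    qed (use C in auto)
    also have "\<dots> = 1 / 2 * (\<Sum>t<2 ^ K. ?R t powr \<gamma>) + C * \<kappa> * (\<Sum>t<2 ^ K. ?Y t powr \<gamma>)"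
      unfolding sum.distrib sum_distrib_left[symmetric] cancel ..
    finally have "(\<Sum>t<2 ^ K. ?R t powr \<gamma>) \<le> 2 * C * \<kappa> * (\<Sum>t<2 ^ K. ?Y t powr \<gamma>)" by simp
    moreover have "(\<Sum>t<2 ^ K. ?X t powr \<gamma>) \<le> (\<Sum>t<2 ^ K. ?R t powr \<gamma>)"
      using X0 Y0 assms by (intro sum_mono powr_mono2) auto
    ultimately show ?thesis by linarith
  qed
  moreover have "0 < 2 * C * \<kappa>" using \<kappa> C by simp
  ultimately show ?thesis by blast
qed

section \<open>The tensor Haar system on a dyadic grid\<close>

definition grid :: "nat => ('n::finite => nat) set" where
  "grid K = PiE UNIV (\<lambda>_. {..<2 ^ K})"

definition haar_box :: "nat => ('n::finite => nat) set" where
  "haar_box K = PiE UNIV (\<lambda>_. {1..2 ^ K})"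

definition th :: "nat => ('n::finite => nat) => ('n => nat) => real" where
  "th K m i = (\<Prod>j\<in>UNIV. hh K (m j) (i j))"

definition tensor_weight :: "('n::finite => nat) => real" where
  "tensor_weight m = (\<Prod>j\<in>UNIV. haar_weight (m j))"

text \<open>Orthogonal projection onto the span of \<open>th K m\<close> for m in A with respect to
  the averaged inner product on the grid; \<open>tensor_weight m\<close> is the inverse squared norm
  of \<open>th K m\<close> there.\<close>

definition grid_proj :: "nat => ('n::finite => nat) set => (('n => nat) => real) => ('n => nat) => real" where
  "grid_proj K A F i =
     (\<Sum>m\<in>A. tensor_weight m * ((\<Sum>i'\<in>grid K. th K m i' * F i') / 2 ^ (K * CARD('n))) * th K m i)"

lemma mem_grid: "i \<in> grid K \<longleftrightarrow> (\<forall>j. i j < 2 ^ K)"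
  by (auto simp: grid_def PiE_iff)

lemma mem_haar_box: "m \<in> haar_box K \<longleftrightarrow> (\<forall>j. 1 \<le> m j \<and> m j \<le> 2 ^ K)"
  by (auto simp: haar_box_def PiE_iff)

lemma finite_grid [simp]: "finite (grid K)"
  unfolding grid_def by (intro finite_PiE) auto

lemma finite_haar_box [simp]: "finite (haar_box K)"
  unfolding haar_box_def by (intro finite_PiE) auto

lemma tensor_weight_pos: "0 < tensor_weight m"
  unfolding tensor_weight_def by (intro prod_pos) (simp add: haar_weight_pos)

lemma th_orthogonal:
  fixes m m' :: "'n::finite => nat"
  assumes "m \<in> haar_box K" "m' \<in> haar_box K"
  shows "(\<Sum>i\<in>grid K. th K m i * th K m' i) = (if m = m' then 2 ^ (K * CARD('n)) / tensor_weight m else 0)"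
proof -
  have "(\<Sum>i\<in>grid K. th K m i * th K m' i) = (\<Prod>j\<in>UNIV. \<Sum>t<2 ^ K. hh K (m j) t * hh K (m' j) t)"
    unfolding th_def grid_def by (subst prod_sum_PiE) (auto simp: prod.distrib)
  also have "\<dots> = (\<Prod>j\<in>UNIV. if m j = m' j then 2 ^ K / haar_weight (m j) else 0)"
    using assms by (intro prod.cong refl hh_orthogonal) (auto simp: mem_haar_box)
  also have "\<dots> = (if m = m' then 2 ^ (K * CARD('n)) / tensor_weight m else 0)"
    by (auto simp: fun_eq_iff prod_dividef tensor_weight_def power_mult)
  finally show ?thesis .
qed

lemma th_kernel:
  fixes i i' :: "'n::finite => nat"
  assumes "i \<in> grid K" "i' \<in> grid K"
  shows "(\<Sum>m\<in>haar_box K. tensor_weight m * th K m i * th K m i') = (if i = i' then 2 ^ (K * CARD('n)) else 0)"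
proof -
  have "(\<Sum>m\<in>haar_box K. tensor_weight m * th K m i * th K m i')
      = (\<Prod>j\<in>UNIV. \<Sum>u\<in>{1..2 ^ K}. haar_weight u * hh K u (i j) * hh K u (i' j))"
    unfolding th_def haar_box_def tensor_weight_def by (subst prod_sum_PiE) (auto simp: prod.distrib)
  also have "\<dots> = (\<Prod>j\<in>UNIV. if i j = i' j then 2 ^ K else 0)"
    using assms by (intro prod.cong refl haar_kernel) (auto simp: mem_grid)
  also have "\<dots> = (if i = i' then 2 ^ (K * CARD('n)) else 0)"
    by (auto simp: fun_eq_iff power_mult)
  finally show ?thesis .
qed

lemma grid_proj_kernel:
  fixes F :: "('n::finite => nat) => real"
  shows "grid_proj K A F i =
    (\<Sum>i'\<in>grid K. (\<Sum>m\<in>A. tensor_weight m * th K m i * th K m i') * F i') / 2 ^ (K * CARD('n))"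
proof -
  have "grid_proj K A F i = (\<Sum>m\<in>A. \<Sum>i'\<in>grid K. tensor_weight m * th K m i * th K m i' * F i' / 2 ^ (K * CARD('n)))"
    unfolding grid_proj_def by (simp add: sum_distrib_left sum_distrib_right sum_divide_distrib mult_ac)
  also have "\<dots> = (\<Sum>i'\<in>grid K. \<Sum>m\<in>A. tensor_weight m * th K m i * th K m i' * F i' / 2 ^ (K * CARD('n)))"
    by (rule sum.swap)
  finally show ?thesis by (simp add: sum_distrib_right sum_divide_distrib)
qed

lemma grid_proj_box:
  fixes F :: "('n::finite => nat) => real"
  assumes "i \<in> grid K"
  shows "grid_proj K (haar_box K) F i = F i"
proof -
  have "grid_proj K (haar_box K) F i = (\<Sum>i'\<in>grid K. (if i = i' then 2 ^ (K * CARD('n)) else 0) * F i') / 2 ^ (K * CARD('n))"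
    unfolding grid_proj_kernel using assms
    by (intro arg_cong2[of _ _ _ _ "(/)"] sum.cong refl arg_cong2[of _ _ _ _ "(*)"] th_kernel) auto
  also have "\<dots> = F i" using assms by (simp add: if_distrib[of "\<lambda>x. x * _"] cong: if_cong)
  finally show ?thesis .
qed

lemma grid_proj_self_adjoint:
  fixes F V :: "('n::finite => nat) => real"
  shows "(\<Sum>i\<in>grid K. grid_proj K A F i * V i) = (\<Sum>i\<in>grid K. F i * grid_proj K A V i)"
proof -
  have "(\<Sum>i\<in>grid K. grid_proj K A F i * V i)
      = (\<Sum>i\<in>grid K. \<Sum>i'\<in>grid K. (\<Sum>m\<in>A. tensor_weight m * th K m i * th K m i') * F i' * V i / 2 ^ (K * CARD('n)))"
    unfolding grid_proj_kernel by (simp add: sum_divide_distrib sum_distrib_right)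
  also have "\<dots> = (\<Sum>i'\<in>grid K. \<Sum>i\<in>grid K. (\<Sum>m\<in>A. tensor_weight m * th K m i * th K m i') * F i' * V i / 2 ^ (K * CARD('n)))"
    by (rule sum.swap)
  also have "\<dots> = (\<Sum>i\<in>grid K. F i * grid_proj K A V i)"
    unfolding grid_proj_kernel by (simp add: sum_divide_distrib sum_distrib_left sum_distrib_right mult_ac)
  finally show ?thesis .
qed

lemma sum_grid_fibres:
  fixes \<phi> :: "('n::finite => nat) => real"
  shows "(\<Sum>i\<in>grid K. \<Sum>t<2 ^ K. \<phi> (i(j := t))) = 2 ^ K * (\<Sum>i\<in>grid K. \<phi> i)"
proof -
  have "(\<Sum>i\<in>grid K. \<Sum>t<2 ^ K. \<phi> (i(j := t))) = (\<Sum>(i, t)\<in>grid K \<times> {..<(2 :: nat) ^ K}. \<phi> (i(j := t)))"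
    by (simp add: sum.cartesian_product)
  \<comment> \<open>The bijection is the involution that exchanges the j-th entry of i with
    t.\<close>
  also have "\<dots> = (\<Sum>(i, t)\<in>grid K \<times> {..<(2 :: nat) ^ K}. \<phi> i)"
    by (rule sum.reindex_bij_witness[of _ "\<lambda>(i, t). (i(j := t), i j)" "\<lambda>(i, t). (i(j := t), i j)"])
       (auto simp: mem_grid)
  also have "\<dots> = 2 ^ K * (\<Sum>i\<in>grid K. \<phi> i)"
    by (simp flip: sum.cartesian_product add: sum_distrib_left)
  finally show ?thesis .
qed

text \<open>
  The square function in the coordinates \<^term>\<open>J\<close>: for \<^term>\<open>J = {}\<close> it is the square of the
  function itself, for \<^term>\<open>J = UNIV\<close> the sum of the squares of all terms of its Haar expansion.
\<close>

definition partial_square :: "nat => (('n::finite => nat) => real) => 'n set => ('n => nat) => real" where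
  "partial_square K c J i =
     (\<Sum>\<mu>\<in>PiE J (\<lambda>_. {1..2 ^ K}). (\<Sum>m\<in>{m \<in> haar_box K. restrict m J = \<mu>}. c m * th K m i)\<^sup>2)"

lemma partial_square_empty: "partial_square K c {} i = (\<Sum>m\<in>haar_box K. c m * th K m i)\<^sup>2"
  by (simp add: partial_square_def restrict_def)

lemma partial_square_UNIV: "partial_square K c UNIV i = (\<Sum>m\<in>haar_box K. (c m * th K m i)\<^sup>2)"
proof -
  have "{m \<in> haar_box K. restrict m UNIV = \<mu>} = {\<mu>}" if "\<mu> \<in> haar_box K" for \<mu> :: "'a => nat"
    using that by (auto simp: restrict_def)
  then show ?thesis unfolding partial_square_def haar_box_def[symmetric] by simp
qed

text \<open>On a line in direction j every inner sum is a univariate Haar expansion with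
  coefficients \<open>a i \<mu> u\<close>, one for each \<mu>; adding j to J replaces its square by
  the sum of the squares of its terms. This is the setting of the vector-valued inequalities, with
  the \<mu> as vector index.\<close>

lemma partial_square_fibre:
  fixes c :: "('n::finite => nat) => real" and K :: nat
  assumes "j \<notin> J"
  defines "a \<equiv> \<lambda>i \<mu> u. \<Sum>m\<in>{m \<in> haar_box K. restrict m J = \<mu> \<and> m j = u}. c m * (\<Prod>j'\<in>-{j}. hh K (m j') (i j'))"
  shows "partial_square K c J (i(j := t)) = (\<Sum>\<mu>\<in>PiE J (\<lambda>_. {1..2 ^ K}). (\<Sum>u\<in>{1..2 ^ K}. a i \<mu> u * hh K u t)\<^sup>2)"
    and "partial_square K c (insert j J) (i(j := t)) =
      (\<Sum>\<mu>\<in>PiE J (\<lambda>_. {1..2 ^ K}). \<Sum>u\<in>{1..2 ^ K}. (a i \<mu> u * hh K u t)\<^sup>2)"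
proof -
  have th: "th K m (i(j := t)) = (\<Prod>j'\<in>-{j}. hh K (m j') (i j')) * hh K (m j) t" for m
  proof -
    have "th K m (i(j := t)) = hh K (m j) t * (\<Prod>j'\<in>-{j}. hh K (m j') ((i(j := t)) j'))"
      unfolding th_def by (subst prod.remove[of _ j]) (auto simp: Compl_eq_Diff_UNIV)
    also have "(\<Prod>j'\<in>-{j}. hh K (m j') ((i(j := t)) j')) = (\<Prod>j'\<in>-{j}. hh K (m j') (i j'))"
      by (intro prod.cong) auto
    finally show ?thesis by (simp only: mult.commute)
  qed
  have au: "a i \<mu> u * hh K u t = (\<Sum>m\<in>{m \<in> haar_box K. restrict m J = \<mu> \<and> m j = u}. c m * th K m (i(j := t)))" for \<mu> u
    unfolding a_def sum_distrib_right th by (intro sum.cong) auto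
  show "partial_square K c J (i(j := t)) = (\<Sum>\<mu>\<in>PiE J (\<lambda>_. {1..2 ^ K}). (\<Sum>u\<in>{1..2 ^ K}. a i \<mu> u * hh K u t)\<^sup>2)"
    unfolding partial_square_def
  proof (intro sum.cong refl arg_cong2[of _ _ _ _ "power"])
    fix \<mu> :: "'n => nat"
    let ?S = "{m \<in> haar_box K. restrict m J = \<mu>}"
    have "(\<Sum>m\<in>?S. c m * th K m (i(j := t))) = (\<Sum>u\<in>{1..2 ^ K}. \<Sum>m\<in>{m \<in> ?S. m j = u}. c m * th K m (i(j := t)))"
    proof (rule sum.group[symmetric])
      show "finite ?S" by simp
    qed (auto simp: mem_haar_box)
    then show "(\<Sum>m\<in>?S. c m * th K m (i(j := t))) = (\<Sum>u\<in>{1..2 ^ K}. a i \<mu> u * hh K u t)"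
      unfolding au by (simp add: conj_assoc)
  qed
  have inj: "inj_on (\<lambda>(u, \<mu>). \<mu>(j := u)) ({1..2 ^ K} \<times> PiE J (\<lambda>_. {1..2 ^ K}))"
    by (rule inj_combinator) (rule assms(1))
  have "partial_square K c (insert j J) (i(j := t)) = (\<Sum>(u, \<mu>)\<in>{1..2 ^ K} \<times> PiE J (\<lambda>_. {1..2 ^ K}).
     (\<Sum>m\<in>{m \<in> haar_box K. restrict m (insert j J) = \<mu>(j := u)}. c m * th K m (i(j := t)))\<^sup>2)"
    unfolding partial_square_def PiE_insert_eq by (subst sum.reindex[OF inj]) (simp add: case_prod_unfold)
  also have "\<dots> = (\<Sum>(u, \<mu>)\<in>{1..2 ^ K} \<times> PiE J (\<lambda>_. {1..2 ^ K}). (a i \<mu> u * hh K u t)\<^sup>2)"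
  proof (intro sum.cong refl, clarify)
    fix u :: nat and \<mu> :: "'n => nat"
    assume \<mu>: "\<mu> \<in> PiE J (\<lambda>_. {1..2 ^ K})"
    have "restrict m (insert j J) = \<mu>(j := u) \<longleftrightarrow> restrict m J = \<mu> \<and> m j = u" for m
      using assms(1) \<mu> by (auto simp: fun_eq_iff restrict_def PiE_iff extensional_def; metis)
    then show "(\<Sum>m\<in>{m \<in> haar_box K. restrict m (insert j J) = \<mu>(j := u)}. c m * th K m (i(j := t)))\<^sup>2
        = (a i \<mu> u * hh K u t)\<^sup>2"
      unfolding au by simp
  qed
  also have "\<dots> = (\<Sum>\<mu>\<in>PiE J (\<lambda>_. {1..2 ^ K}). \<Sum>u\<in>{1..2 ^ K}. (a i \<mu> u * hh K u t)\<^sup>2)"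
    by (subst sum.cartesian_product[symmetric], rule sum.swap)
  finally show "partial_square K c (insert j J) (i(j := t)) =
      (\<Sum>\<mu>\<in>PiE J (\<lambda>_. {1..2 ^ K}). \<Sum>u\<in>{1..2 ^ K}. (a i \<mu> u * hh K u t)\<^sup>2)" .
qed

text \<open>One coordinate is treated at a time: on lines in direction j the two univariate
  inequalities compare J with \<open>insert j J\<close>, and summation over all lines gives the
  comparison on the grid. The constants multiply, so the final one depends on the number of
  coordinates but not on K.\<close>

lemma partial_square_equivalence:
  fixes J :: "'n::finite set" and g :: real
  assumes "1 \<le> g"
  shows "\<exists>C>0. \<forall>K c. (\<Sum>i\<in>grid K. partial_square K c J i powr g) \<le> C * (\<Sum>i\<in>grid K. partial_square K c {} i powr g)
    \<and> (\<Sum>i\<in>grid K. partial_square K c {} i powr g) \<le> C * (\<Sum>i\<in>grid K. partial_square K c J i powr g)"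
proof -
  obtain C1 where C1: "C1 > 0" "\<forall>K (L :: ('n => nat) set) a.
    (\<Sum>t<2 ^ K. (\<Sum>l\<in>L. \<Sum>m\<in>{1..2 ^ K}. (a l m * hh K m t)\<^sup>2) powr g)
    \<le> C1 * (\<Sum>t<2 ^ K. (\<Sum>l\<in>L. (\<Sum>m\<in>{1..2 ^ K}. a l m * hh K m t)\<^sup>2) powr g)"
    using square_function_le[OF assms, where 'l = "'n => nat"] by blast
  obtain C2 where C2: "C2 > 0" "\<forall>K (L :: ('n => nat) set) a.
    (\<Sum>t<2 ^ K. (\<Sum>l\<in>L. (\<Sum>m\<in>{1..2 ^ K}. a l m * hh K m t)\<^sup>2) powr g)
    \<le> C2 * (\<Sum>t<2 ^ K. (\<Sum>l\<in>L. \<Sum>m\<in>{1..2 ^ K}. (a l m * hh K m t)\<^sup>2) powr g)"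
    using le_square_function[OF assms, where 'l = "'n => nat"] by blast
  \<comment> \<open>An inequality on every line in direction j implies the one on the grid, as each
    grid point is counted 2^K times on both sides.\<close>
  have fib: "(\<Sum>i\<in>grid K. \<phi> i) \<le> C * (\<Sum>i\<in>grid K. \<psi> i)"
    if "\<And>i :: 'n => nat. (\<Sum>t<2 ^ K. \<phi> (i(j := t))) \<le> C * (\<Sum>t<2 ^ K. \<psi> (i(j := t)))" for K C j and \<phi> \<psi> :: "('n => nat) => real"
  proof -
    have "2 ^ K * (\<Sum>i\<in>grid K. \<phi> i) \<le> (\<Sum>i\<in>grid K. C * (\<Sum>t<2 ^ K. \<psi> (i(j := t))))"
      unfolding sum_grid_fibres[where j = j, symmetric] by (intro sum_mono that)
    also have "\<dots> = 2 ^ K * (C * (\<Sum>i\<in>grid K. \<psi> i))"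
      unfolding sum_distrib_left[symmetric] sum_grid_fibres by simp
    finally show ?thesis by simp
  qed
  have "finite J" by simp
  then show ?thesis
  proof (induction J rule: finite_induct)
    case empty
    show ?case by (rule exI[of _ 1]) simp
  next
    case (insert j J)
    then obtain C where C: "C > 0" "\<forall>K c. (\<Sum>i\<in>grid K. partial_square K c J i powr g) \<le> C * (\<Sum>i\<in>grid K. partial_square K c {} i powr g)
    \<and> (\<Sum>i\<in>grid K. partial_square K c {} i powr g) \<le> C * (\<Sum>i\<in>grid K. partial_square K c J i powr g)" by blast
    define D where "D = max (C1 * C) (C * C2)"
    have D: "0 < D" "C1 * C \<le> D" "C * C2 \<le> D" using C C1 by (auto simp: D_def less_max_iff_disj)
    have pos: "0 \<le> (\<Sum>i\<in>grid K. partial_square K c J i powr g)" for K c J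
      by (intro sum_nonneg) auto
    have "(\<Sum>i\<in>grid K. partial_square K c (insert j J) i powr g) \<le> D * (\<Sum>i\<in>grid K. partial_square K c {} i powr g)
    \<and> (\<Sum>i\<in>grid K. partial_square K c {} i powr g) \<le> D * (\<Sum>i\<in>grid K. partial_square K c (insert j J) i powr g)" for K c
    proof
      have "(\<Sum>i\<in>grid K. partial_square K c (insert j J) i powr g) \<le> C1 * (\<Sum>i\<in>grid K. partial_square K c J i powr g)"
        by (rule fib[where j = j]) (unfold partial_square_fibre[OF insert.hyps(2)], rule C1(2)[rule_format])
      also have "\<dots> \<le> C1 * (C * (\<Sum>i\<in>grid K. partial_square K c {} i powr g))"
        using C C1 by (intro mult_left_mono) auto
      also have "\<dots> \<le> D * (\<Sum>i\<in>grid K. partial_square K c {} i powr g)"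
        unfolding mult.assoc[symmetric] using D pos by (intro mult_right_mono) auto
      finally show "(\<Sum>i\<in>grid K. partial_square K c (insert j J) i powr g) \<le> D * (\<Sum>i\<in>grid K. partial_square K c {} i powr g)" .
      have "(\<Sum>i\<in>grid K. partial_square K c J i powr g) \<le> C2 * (\<Sum>i\<in>grid K. partial_square K c (insert j J) i powr g)"
        by (rule fib[where j = j]) (unfold partial_square_fibre[OF insert.hyps(2)], rule C2(2)[rule_format])
      then have "C * (\<Sum>i\<in>grid K. partial_square K c J i powr g) \<le> C * (C2 * (\<Sum>i\<in>grid K. partial_square K c (insert j J) i powr g))"
        using C by (intro mult_left_mono) auto
      also have "\<dots> \<le> D * (\<Sum>i\<in>grid K. partial_square K c (insert j J) i powr g)"
        unfolding mult.assoc[symmetric] using D pos by (intro mult_right_mono) auto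
      finally show "(\<Sum>i\<in>grid K. partial_square K c {} i powr g) \<le> D * (\<Sum>i\<in>grid K. partial_square K c (insert j J) i powr g)"
        using C by (meson order_trans)
    qed
    then show ?case using D by blast
  qed
qed

lemma square_powr: "(x\<^sup>2) powr g = \<bar>x\<bar> powr (2 * g)" for x :: real
proof -
  have "x\<^sup>2 = \<bar>x\<bar> powr 2" by simp
  then show ?thesis by (simp only: powr_powr)
qed

text \<open>Restriction to A deletes terms of the full square function, which is monotone in the set
  of its terms. The equivalence is used twice, from the projection to its square function and from
  the full square function back to F, so the constant is independent of A and K.\<close>

lemma grid_proj_bounded_ge2:
  assumes "2 \<le> p"
  shows "\<exists>C>0. \<forall>K (A :: ('n::finite => nat) set) F. A \<subseteq> haar_box K -->
    (\<Sum>i\<in>grid K. \<bar>grid_proj K A F i\<bar> powr p) \<le> C * (\<Sum>i\<in>grid K. \<bar>F i\<bar> powr p)"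
proof -
  define g where "g = p / 2"
  have g: "1 \<le> g" "2 * g = p" using assms by (auto simp: g_def)
  obtain C where C: "C > 0" "\<forall>K c. (\<Sum>i\<in>grid K. partial_square K c (UNIV :: 'n set) i powr g) \<le> C * (\<Sum>i\<in>grid K. partial_square K c {} i powr g)
    \<and> (\<Sum>i\<in>grid K. partial_square K c {} i powr g) \<le> C * (\<Sum>i\<in>grid K. partial_square K c (UNIV :: 'n set) i powr g)"
    using partial_square_equivalence[OF g(1), of "UNIV :: 'n set"] by blast
  have "(\<Sum>i\<in>grid K. \<bar>grid_proj K A F i\<bar> powr p) \<le> (C * C) * (\<Sum>i\<in>grid K. \<bar>F i\<bar> powr p)"
    if A: "A \<subseteq> haar_box K" for K and A :: "('n => nat) set" and F
  proof -
    define c where "c m = tensor_weight m * ((\<Sum>i'\<in>grid K. th K m i' * F i') / 2 ^ (K * CARD('n)))" for m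
    define c' where "c' m = (if m \<in> A then c m else 0)" for m
    have "(\<Sum>i\<in>grid K. \<bar>grid_proj K A F i\<bar> powr p) = (\<Sum>i\<in>grid K. partial_square K c' {} i powr g)"
    proof (intro sum.cong refl)
      fix i
      have "(\<Sum>m\<in>haar_box K. c' m * th K m i) = (\<Sum>m\<in>haar_box K. if m \<in> A then c m * th K m i else 0)"
        by (intro sum.cong) (auto simp: c'_def)
      also have "\<dots> = (\<Sum>m\<in>haar_box K \<inter> A. c m * th K m i)" by (simp add: sum.inter_restrict)
      also have "haar_box K \<inter> A = A" using A by auto
      finally have "(\<Sum>m\<in>haar_box K. c' m * th K m i) = grid_proj K A F i"
        by (simp add: grid_proj_def c_def)
      then show "\<bar>grid_proj K A F i\<bar> powr p = partial_square K c' {} i powr g"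
        by (simp add: partial_square_empty square_powr g)
    qed
    also have "\<dots> \<le> C * (\<Sum>i\<in>grid K. partial_square K c' UNIV i powr g)" using C by blast
    also have "\<dots> \<le> C * (\<Sum>i\<in>grid K. partial_square K c UNIV i powr g)"
    proof (intro mult_left_mono sum_mono powr_mono2)
      fix i
      show "partial_square K c' UNIV i \<le> partial_square K c UNIV i" unfolding partial_square_UNIV
        by (intro sum_mono) (auto simp: c'_def)
    qed (use g C in \<open>auto simp: partial_square_UNIV intro!: sum_nonneg\<close>)
    also have "\<dots> \<le> C * (C * (\<Sum>i\<in>grid K. partial_square K c {} i powr g))"
      using C by (intro mult_left_mono) auto
    also have "(\<Sum>i\<in>grid K. partial_square K c {} i powr g) = (\<Sum>i\<in>grid K. \<bar>F i\<bar> powr p)"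
    proof (intro sum.cong refl)
      fix i :: "'n => nat"
      assume "i \<in> grid K"
      then have "(\<Sum>m\<in>haar_box K. c m * th K m i) = F i"
        using grid_proj_box[of i K F] by (simp add: grid_proj_def c_def)
      then show "partial_square K c {} i powr g = \<bar>F i\<bar> powr p"
        by (simp add: partial_square_empty square_powr g)
    qed
    finally show ?thesis by (simp add: mult.assoc)
  qed
  moreover have "0 < C * C" using C by simp
  ultimately show ?thesis by blast
qed

text \<open>For \<^term>\<open>p < 2\<close> the bound follows by duality from the one for the conjugate exponent.\<close>

theorem grid_proj_bounded:
  assumes "1 < p"
  shows "\<exists>C>0. \<forall>K (A :: ('n::finite => nat) set) F. A \<subseteq> haar_box K -->
    (\<Sum>i\<in>grid K. \<bar>grid_proj K A F i\<bar> powr p) \<le> C * (\<Sum>i\<in>grid K. \<bar>F i\<bar> powr p)"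
proof (cases "2 \<le> p")
  case False
  define p' where "p' = p / (p - 1)"
  have p': "2 \<le> p'" "(p - 1) * p' = p" using assms False by (auto simp: p'_def field_simps)
  obtain C where C: "C > 0" "\<forall>K (A :: ('n::finite => nat) set) F. A \<subseteq> haar_box K -->
    (\<Sum>i\<in>grid K. \<bar>grid_proj K A F i\<bar> powr p') \<le> C * (\<Sum>i\<in>grid K. \<bar>F i\<bar> powr p')"
    using grid_proj_bounded_ge2[OF p'(1)] by blast
  have d: "0 < 1 / (2 * C)" "0 \<le> p - 1" using C assms by auto
  \<comment> \<open>The factor 1/(2C) compensates the constant C of the conjugate exponent, so that
    half of the left-hand side is absorbed.\<close>
  obtain \<kappa> where \<kappa>: "\<kappa> > 0" and young: "\<forall>a\<ge>0. \<forall>b\<ge>0. a powr (p - 1) * b powr 1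
     \<le> 1 / (2 * C) * a powr (p - 1 + 1) + \<kappa> * b powr (p - 1 + 1)"
    using powr_mult_powr_le[OF d zero_less_one] by blast
  have "(\<Sum>i\<in>grid K. \<bar>grid_proj K A F i\<bar> powr p) \<le> (2 * \<kappa>) * (\<Sum>i\<in>grid K. \<bar>F i\<bar> powr p)"
    if A: "A \<subseteq> haar_box K" for K and A :: "('n => nat) set" and F
  proof -
    let ?G = "grid_proj K A F"
    \<comment> \<open>The norming function of the projected function G: the product G V is |G|^p,
      and |V|^p' is again |G|^p because (p - 1) p' = p.\<close>
    define V where "V i = sgn (?G i) * \<bar>?G i\<bar> powr (p - 1)" for i
    have GV: "?G i * V i = \<bar>?G i\<bar> powr p" for i
    proof -
      have "?G i * V i = (?G i * sgn (?G i)) * \<bar>?G i\<bar> powr (p - 1)" by (simp add: V_def)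
      also have "?G i * sgn (?G i) = \<bar>?G i\<bar>" by (simp add: abs_sgn)
      finally show ?thesis using powr_mult_base[of "\<bar>?G i\<bar>" "p - 1"] by simp
    qed
    have Vp: "\<bar>V i\<bar> powr p' = \<bar>?G i\<bar> powr p" for i
      by (cases "?G i = 0") (auto simp: V_def abs_mult powr_mult powr_powr p' abs_sgn_eq)
    have "(\<Sum>i\<in>grid K. \<bar>?G i\<bar> powr p) = (\<Sum>i\<in>grid K. F i * grid_proj K A V i)"
      unfolding GV[symmetric] by (rule grid_proj_self_adjoint)
    also have "\<dots> \<le> (\<Sum>i\<in>grid K. 1 / (2 * C) * \<bar>grid_proj K A V i\<bar> powr p' + \<kappa> * \<bar>F i\<bar> powr p)"
    proof (rule sum_mono)
      fix i
      \<comment> \<open>Young's inequality carries the exponent p - 1 on its first argument, so it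
        is applied to the (1/(p-1))-th power of this factor, whose p-th power is the required p'-th
        power.\<close>
      have w: "(\<bar>grid_proj K A V i\<bar> powr (1 / (p - 1))) powr (p - 1) = \<bar>grid_proj K A V i\<bar>"
        using assms by (simp add: powr_powr)
      have w': "(\<bar>grid_proj K A V i\<bar> powr (1 / (p - 1))) powr (p - 1 + 1) = \<bar>grid_proj K A V i\<bar> powr p'"
        by (simp add: powr_powr p'_def)
      have "F i * grid_proj K A V i \<le> \<bar>grid_proj K A V i\<bar> * \<bar>F i\<bar>"
        by (metis abs_ge_self abs_mult mult.commute)
      also have "\<dots> \<le> 1 / (2 * C) * \<bar>grid_proj K A V i\<bar> powr p' + \<kappa> * \<bar>F i\<bar> powr p"
        using young[rule_format, of "\<bar>grid_proj K A V i\<bar> powr (1 / (p - 1))" "\<bar>F i\<bar>"]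
        unfolding w w' by (simp add: powr_one)
      finally show "F i * grid_proj K A V i \<le> 1 / (2 * C) * \<bar>grid_proj K A V i\<bar> powr p' + \<kappa> * \<bar>F i\<bar> powr p" .
    qed
    also have "\<dots> = 1 / (2 * C) * (\<Sum>i\<in>grid K. \<bar>grid_proj K A V i\<bar> powr p') + \<kappa> * (\<Sum>i\<in>grid K. \<bar>F i\<bar> powr p)"
      by (simp add: sum.distrib sum_distrib_left)
    also have "(\<Sum>i\<in>grid K. \<bar>grid_proj K A V i\<bar> powr p') \<le> C * (\<Sum>i\<in>grid K. \<bar>?G i\<bar> powr p)"
      using C A unfolding Vp[symmetric] by blast
    finally show ?thesis using C by (simp add: field_simps)
  qed
  moreover have "0 < 2 * \<kappa>" using \<kappa> by simp
  ultimately show ?thesis by blast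
qed (rule grid_proj_bounded_ge2)

text \<open>The kernel for a product set is the product of univariate kernels, so the sums of
  absolute values over one variable multiply. The rest is Schur's test in L_1.\<close>

theorem grid_proj_product_L1:
  fixes F :: "('n::finite => nat) => real"
  assumes "\<And>j u. u < 2 ^ K ==> (\<Sum>t<2 ^ K. \<bar>\<Sum>m\<in>B j. haar_weight m * hh K m t * hh K m u\<bar>) \<le> 2 ^ K"
    and "\<And>j. finite (B j)"
  shows "(\<Sum>i\<in>grid K. \<bar>grid_proj K (PiE UNIV B) F i\<bar>) \<le> (\<Sum>i\<in>grid K. \<bar>F i\<bar>)"
proof -
  define k where "k j t u = (\<Sum>m\<in>B j. haar_weight m * hh K m t * hh K m u)" for j t u
  have ker: "(\<Sum>m\<in>PiE UNIV B. tensor_weight m * th K m i * th K m i') = (\<Prod>j\<in>UNIV. k j (i j) (i' j))" for i i'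
    unfolding k_def th_def tensor_weight_def
    by (subst prod_sum_PiE) (auto simp: prod.distrib assms)
  let ?N = "2 ^ (K * CARD('n)) :: real"
  have "(\<Sum>i\<in>grid K. \<bar>grid_proj K (PiE UNIV B) F i\<bar>) \<le> (\<Sum>i\<in>grid K. \<Sum>i'\<in>grid K. (\<Prod>j\<in>UNIV. \<bar>k j (i j) (i' j)\<bar>) * \<bar>F i'\<bar> / ?N)"
  proof (rule sum_mono)
    fix i :: "'n => nat"
    have "\<bar>grid_proj K (PiE UNIV B) F i\<bar> \<le> (\<Sum>i'\<in>grid K. \<bar>(\<Prod>j\<in>UNIV. k j (i j) (i' j)) * F i'\<bar>) / ?N"
      unfolding grid_proj_kernel ker by (simp add: divide_right_mono sum_abs)
    then show "\<bar>grid_proj K (PiE UNIV B) F i\<bar> \<le> (\<Sum>i'\<in>grid K. (\<Prod>j\<in>UNIV. \<bar>k j (i j) (i' j)\<bar>) * \<bar>F i'\<bar> / ?N)"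
      by (simp add: abs_mult abs_prod sum_divide_distrib)
  qed
  also have "\<dots> = (\<Sum>i'\<in>grid K. (\<Sum>i\<in>grid K. \<Prod>j\<in>UNIV. \<bar>k j (i j) (i' j)\<bar>) * \<bar>F i'\<bar> / ?N)"
    by (subst sum.swap) (simp add: sum_distrib_right sum_divide_distrib)
  also have "\<dots> \<le> (\<Sum>i'\<in>grid K. ?N * \<bar>F i'\<bar> / ?N)"
  proof (intro sum_mono divide_right_mono mult_right_mono)
    fix i' :: "'n => nat"
    assume i': "i' \<in> grid K"
    have "(\<Sum>i\<in>grid K. \<Prod>j\<in>UNIV. \<bar>k j (i j) (i' j)\<bar>) = (\<Prod>j\<in>UNIV. \<Sum>t<2 ^ K. \<bar>k j t (i' j)\<bar>)"
      unfolding grid_def by (subst prod_sum_PiE) auto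
    also have "\<dots> \<le> (\<Prod>j\<in>(UNIV :: 'n set). 2 ^ K)"
      using i' assms(1) by (intro prod_mono conjI sum_nonneg) (auto simp: k_def mem_grid)
    also have "\<dots> = ?N" by (simp add: power_mult)
    finally show "(\<Sum>i\<in>grid K. \<Prod>j\<in>UNIV. \<bar>k j (i j) (i' j)\<bar>) \<le> ?N" .
  qed auto
  finally show ?thesis by simp
qed

section \<open>Moduli of smoothness and the discretized quasi-norm\<close>

text \<open>Keeping the p-th power allows one treatment of all p > 0: factors such as
  \<open>2 powr p\<close> take the place of the triangle inequality, and roots appear only in the
  comparison with the given definitions.\<close>

definition lp_int :: "real => (real ^ 'n::finite) set => (real ^ 'n => real) => real" where
  "lp_int p A f = (\<integral>x. \<bar>f x\<bar> powr p \<partial>lebesgue_on A)"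

lemma lp_int_nonneg [simp]: "0 \<le> lp_int p A f"
  unfolding lp_int_def by (intro integral_nonneg_AE) auto

lemma Lp_norm_powr: "0 < p ==> Lp_norm p A f powr p = lp_int p A f"
  by (simp add: Lp_norm_def lp_int_def[symmetric] powr_powr)

lemma Lp_norm_lp_int: "Lp_norm p A f = lp_int p A f powr (1 / p)"
  by (simp add: Lp_norm_def lp_int_def)

lemma Lp_norm_nonneg [simp]: "0 \<le> Lp_norm p A f"
  by (simp add: Lp_norm_lp_int)

lemma Lp_space_measurable: "f \<in> Lp_space p A ==> f \<in> borel_measurable (lebesgue_on A)"
  and Lp_space_integrable: "f \<in> Lp_space p A ==> integrable (lebesgue_on A) (\<lambda>x. \<bar>f x\<bar> powr p)"
  by (auto simp: Lp_space_def)

lemma Lp_space_dominated: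
  assumes g: "integrable (lebesgue_on A) g" and f: "f \<in> borel_measurable (lebesgue_on A)"
    and le: "AE x in lebesgue_on A. \<bar>f x\<bar> powr p \<le> g x"
  shows "f \<in> Lp_space p A" "lp_int p A f \<le> integral\<^sup>L (lebesgue_on A) g"
proof -
  have m: "(\<lambda>x. \<bar>f x\<bar> powr p) \<in> borel_measurable (lebesgue_on A)" using f by measurable
  have i: "integrable (lebesgue_on A) (\<lambda>x. \<bar>f x\<bar> powr p)"
    by (rule Bochner_Integration.integrable_bound[OF g m]) (use le in eventually_elim, auto)
  then show "f \<in> Lp_space p A" using f by (simp add: Lp_space_def)
  show "lp_int p A f \<le> integral\<^sup>L (lebesgue_on A) g"
    unfolding lp_int_def by (rule integral_mono_AE[OF i g le])
qed

lemma Lp_add: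
  assumes "0 < p" "f \<in> Lp_space p A" "g \<in> Lp_space p A"
  shows "(\<lambda>x. f x + g x) \<in> Lp_space p A"
    "lp_int p A (\<lambda>x. f x + g x) \<le> 2 powr p * (lp_int p A f + lp_int p A g)"
proof -
  have le: "\<bar>f x + g x\<bar> powr p \<le> 2 powr p * (\<bar>f x\<bar> powr p + \<bar>g x\<bar> powr p)" for x
  proof -
    have "\<bar>f x + g x\<bar> powr p \<le> (\<bar>f x\<bar> + \<bar>g x\<bar>) powr p"
      using assms by (intro powr_mono2) auto
    then show ?thesis using powr_add_le[of "\<bar>f x\<bar>" "\<bar>g x\<bar>" p] assms by simp
  qed
  have i: "integrable (lebesgue_on A) (\<lambda>x. 2 powr p * (\<bar>f x\<bar> powr p + \<bar>g x\<bar> powr p))"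
    using assms by (intro integrable_mult_right Bochner_Integration.integrable_add) (auto simp: Lp_space_def)
  have m: "(\<lambda>x. f x + g x) \<in> borel_measurable (lebesgue_on A)"
    using assms by (intro borel_measurable_add Lp_space_measurable) auto
  show "(\<lambda>x. f x + g x) \<in> Lp_space p A"
    using Lp_space_dominated(1)[OF i m] le by simp
  have "lp_int p A (\<lambda>x. f x + g x) \<le> (\<integral>x. 2 powr p * (\<bar>f x\<bar> powr p + \<bar>g x\<bar> powr p) \<partial>lebesgue_on A)"
    using Lp_space_dominated(2)[OF i m] le by simp
  also have "\<dots> = 2 powr p * (lp_int p A f + lp_int p A g)"
    unfolding lp_int_def using assms by (simp add: Lp_space_integrable)
  finally show "lp_int p A (\<lambda>x. f x + g x) \<le> 2 powr p * (lp_int p A f + lp_int p A g)" .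
qed

lemma Lp_cmult:
  assumes "f \<in> Lp_space p A"
  shows "(\<lambda>x. c * f x) \<in> Lp_space p A" "lp_int p A (\<lambda>x. c * f x) = \<bar>c\<bar> powr p * lp_int p A f"
  using assms by (auto simp: Lp_space_def lp_int_def abs_mult powr_mult)

lemma Lp_diff:
  assumes "0 < p" "f \<in> Lp_space p A" "g \<in> Lp_space p A"
  shows "(\<lambda>x. f x - g x) \<in> Lp_space p A"
    "lp_int p A (\<lambda>x. f x - g x) \<le> 2 powr p * (lp_int p A f + lp_int p A g)"
  using Lp_add[OF assms(1,2) Lp_cmult(1)[OF assms(3), of "- 1"]] Lp_cmult(2)[OF assms(3), of "- 1"]
  by simp_all

lemma Lp_zero: "0 < p ==> (\<lambda>x. 0) \<in> Lp_space p A" "lp_int p A (\<lambda>x. 0) = 0"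
  by (auto simp: Lp_space_def lp_int_def)

text \<open>Iterating \<open>Lp_add\<close> would cost a fixed factor for each further summand. Here
  the l-th summand costs only \<mu>^l with \<mu> arbitrarily close to 1, which the Hardy inequality
  for s < 1/p can afford.\<close>

lemma Lp_weighted_sum:
  assumes "0 < p" "1 < \<mu>"
  shows "\<exists>C>0. \<forall>(A :: (real ^ 'n::finite) set) f n. (\<forall>l<n. f l \<in> Lp_space p A) -->
     lp_int p A (\<lambda>x. \<Sum>l<n. f l x) \<le> C * (\<Sum>l<n. \<mu> ^ l * lp_int p A (f l))"
proof -
  obtain C where C: "C > 0" "\<forall>(a :: nat => real) n. (\<forall>l<n. 0 \<le> a l) -->
       (\<Sum>l<n. a l) powr p \<le> C * (\<Sum>l<n. \<mu> ^ l * a l powr p)"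
    using powr_sum_le_weighted[OF assms] by blast
  have "lp_int p A (\<lambda>x. \<Sum>l<n. f l x) \<le> C * (\<Sum>l<n. \<mu> ^ l * lp_int p A (f l))"
    if f: "\<forall>l<n. f l \<in> Lp_space p A" for A :: "(real ^ 'n) set" and f n
  proof -
    let ?g = "\<lambda>x. C * (\<Sum>l<n. \<mu> ^ l * \<bar>f l x\<bar> powr p)"
    have i: "integrable (lebesgue_on A) ?g"
      using f by (intro integrable_mult_right Bochner_Integration.integrable_sum) (auto simp: Lp_space_def)
    have m: "(\<lambda>x. \<Sum>l<n. f l x) \<in> borel_measurable (lebesgue_on A)"
      using f by (intro borel_measurable_sum Lp_space_measurable) auto
    have "\<bar>\<Sum>l<n. f l x\<bar> powr p \<le> ?g x" for x
    proof -
      have "\<bar>\<Sum>l<n. f l x\<bar> powr p \<le> (\<Sum>l<n. \<bar>f l x\<bar>) powr p"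
        using assms by (intro powr_mono2) auto
      also have "\<dots> \<le> ?g x" using C(2)[rule_format, of n "\<lambda>l. \<bar>f l x\<bar>"] by simp
      finally show ?thesis .
    qed
    then have "lp_int p A (\<lambda>x. \<Sum>l<n. f l x) \<le> integral\<^sup>L (lebesgue_on A) ?g"
      by (intro Lp_space_dominated(2)[OF i m]) simp
    also have "\<dots> = C * (\<Sum>l<n. \<mu> ^ l * lp_int p A (f l))"
      using f by (simp add: lp_int_def Lp_space_integrable)
    finally show ?thesis .
  qed
  then show ?thesis using C(1) by blast
qed

section \<open>Translations of functions on the cube\<close>

lemma translate_lebesgue:
  fixes y :: "'a::euclidean_space"
  shows "(\<lambda>x. x + y) \<in> lebesgue \<rightarrow>\<^sub>M lebesgue" "distr lebesgue lebesgue (\<lambda>x. x + y) = lebesgue"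
proof -
  have T: "(\<lambda>x. y + (\<Sum>j\<in>Basis. (1 * (x \<bullet> j)) *\<^sub>R j)) = (\<lambda>x. x + y)"
    by (simp add: euclidean_representation add.commute)
  show "(\<lambda>x. x + y) \<in> lebesgue \<rightarrow>\<^sub>M lebesgue"
    using lebesgue_affine_measurable[of "\<lambda>_. 1" y] unfolding T by simp
  show "distr lebesgue lebesgue (\<lambda>x. x + y) = lebesgue"
    using lebesgue_affine_euclidean[of "\<lambda>_. 1" y] unfolding T by (simp add: density_1)
qed

lemma integrable_translate:
  fixes f :: "'a::euclidean_space => real"
  assumes "integrable lebesgue f"
  shows "integrable lebesgue (\<lambda>x. f (x + y))" "(\<integral>x. f (x + y) \<partial>lebesgue) = integral\<^sup>L lebesgue f"
proof -
  have f: "f \<in> borel_measurable lebesgue" using assms by auto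
  show "integrable lebesgue (\<lambda>x. f (x + y))"
    using integrable_distr_eq[OF translate_lebesgue(1) f, of y] assms unfolding translate_lebesgue(2) by simp
  show "(\<integral>x. f (x + y) \<partial>lebesgue) = integral\<^sup>L lebesgue f"
    using integral_distr[OF translate_lebesgue(1) f, of y] unfolding translate_lebesgue(2) by simp
qed

lemma AE_translate:
  fixes y :: "'a::euclidean_space"
  assumes "AE x in lebesgue. P x"
  shows "AE x in lebesgue. P (x + y)"
proof -
  obtain N where "{x \<in> space lebesgue. \<not> P x} \<subseteq> N" "emeasure lebesgue N = 0" "N \<in> sets lebesgue"
    using assms by (rule AE_E)
  then have N: "N \<in> null_sets lebesgue" "{x \<in> space lebesgue. \<not> P x} \<subseteq> N" by auto
  have m: "(\<lambda>x. x + y) -` N \<inter> space lebesgue \<in> sets lebesgue"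
    using N by (intro measurable_sets[OF translate_lebesgue(1)]) auto
  have "emeasure lebesgue ((\<lambda>x. x + y) -` N \<inter> space lebesgue) = emeasure (distr lebesgue lebesgue (\<lambda>x. x + y)) N"
    using N by (intro emeasure_distr[OF translate_lebesgue(1), symmetric]) auto
  also have "\<dots> = 0" unfolding translate_lebesgue(2) using N by auto
  finally have "(\<lambda>x. x + y) -` N \<inter> space lebesgue \<in> null_sets lebesgue" using m by auto
  moreover have "{x \<in> space lebesgue. \<not> P (x + y)} \<subseteq> (\<lambda>x. x + y) -` N \<inter> space lebesgue"
    using N by auto
  ultimately show ?thesis by (rule AE_I')
qed

lemma sets_unit_cube [simp]: "unit_cube \<in> sets lebesgue"
  by (simp add: unit_cube_def)

lemma shifted_cube_eq: "shifted_cube y = cbox 0 1 \<inter> cbox (- y) (1 - y)"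
proof -
  have "z + y \<in> cbox 0 1 \<longleftrightarrow> z \<in> cbox (- y) (1 - y)" for z
    unfolding mem_box_cart by (rule iff_allI) auto
  then show ?thesis by (auto simp: shifted_cube_def unit_cube_def)
qed

lemma sets_shifted_cube [simp]: "shifted_cube y \<in> sets lebesgue"
  unfolding shifted_cube_eq by (intro sets.Int) auto

lemma shifted_cubeD: "x \<in> shifted_cube y ==> x \<in> unit_cube" "x \<in> shifted_cube y ==> x + y \<in> unit_cube"
  by (auto simp: shifted_cube_def)

lemma Lp_translate:
  assumes "f \<in> Lp_space p unit_cube"
  shows "(\<lambda>x. f (x + y)) \<in> Lp_space p (shifted_cube y)"
    "lp_int p (shifted_cube y) (\<lambda>x. f (x + y)) \<le> lp_int p unit_cube f"
proof -
  let ?F = "\<lambda>x. indicator unit_cube x *\<^sub>R \<bar>f x\<bar> powr p"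
  have F: "integrable lebesgue ?F" "integral\<^sup>L lebesgue ?F = lp_int p unit_cube f"
    using Lp_space_integrable[OF assms] unfolding lp_int_def
    by (auto simp: integrable_restrict_space integral_restrict_space)
  have "(\<lambda>x. indicator unit_cube x *\<^sub>R f x) \<in> borel_measurable lebesgue"
    using Lp_space_measurable[OF assms] by (simp add: borel_measurable_restrict_space_iff)
  then have "(\<lambda>x. indicator unit_cube (x + y) *\<^sub>R f (x + y)) \<in> borel_measurable lebesgue"
    by (rule measurable_compose[OF translate_lebesgue(1)])
  then have "(\<lambda>x. indicator unit_cube (x + y) *\<^sub>R f (x + y)) \<in> borel_measurable (lebesgue_on (shifted_cube y))"
    by (rule measurable_restrict_space1)
  then have m: "(\<lambda>x. f (x + y)) \<in> borel_measurable (lebesgue_on (shifted_cube y))"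
    by (rule subst[OF measurable_cong, rotated]) (auto simp: shifted_cubeD)
  have i: "integrable (lebesgue_on (shifted_cube y)) (\<lambda>x. ?F (x + y))"
    by (subst integrable_restrict_space)
       (simp, rule integrable_mult_indicator[OF sets_shifted_cube integrable_translate(1)[OF F(1)]])
  have le: "AE x in lebesgue_on (shifted_cube y). \<bar>f (x + y)\<bar> powr p \<le> ?F (x + y)"
    by (rule AE_I2) (auto simp: shifted_cubeD)
  show "(\<lambda>x. f (x + y)) \<in> Lp_space p (shifted_cube y)"
    by (rule Lp_space_dominated(1)[OF i m le])
  have "lp_int p (shifted_cube y) (\<lambda>x. f (x + y)) \<le> (\<integral>x. ?F (x + y) \<partial>lebesgue_on (shifted_cube y))"
    by (rule Lp_space_dominated(2)[OF i m le])
  also have "\<dots> \<le> (\<integral>x. ?F (x + y) \<partial>lebesgue)"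
  proof -
    have "(\<integral>x. indicator (shifted_cube y) x *\<^sub>R ?F (x + y) \<partial>lebesgue) \<le> (\<integral>x. ?F (x + y) \<partial>lebesgue)"
      using integrable_translate(1)[OF F(1), of y]
      by (intro integral_mono integrable_mult_indicator) (auto simp: indicator_def)
    then show ?thesis by (simp add: integral_restrict_space)
  qed
  also have "\<dots> = lp_int p unit_cube f" using integrable_translate(2)[OF F(1)] F(2) by simp
  finally show "lp_int p (shifted_cube y) (\<lambda>x. f (x + y)) \<le> lp_int p unit_cube f" .
qed

lemma Lp_subset:
  assumes f: "f \<in> Lp_space p A" and AB: "B \<subseteq> A" "A \<in> sets lebesgue" "B \<in> sets lebesgue"
  shows "f \<in> Lp_space p B" "lp_int p B f \<le> lp_int p A f"
proof -
  have iA: "integrable lebesgue (\<lambda>x. indicator A x *\<^sub>R \<bar>f x\<bar> powr p)"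
    using Lp_space_integrable[OF f] AB by (simp add: integrable_restrict_space)
  have BA: "indicator B x *\<^sub>R (indicator A x *\<^sub>R r) = (indicator B x *\<^sub>R r :: real)" for x and r :: real
    using AB by (auto simp: indicator_def)
  have iB: "integrable lebesgue (\<lambda>x. indicator B x *\<^sub>R \<bar>f x\<bar> powr p)"
    using integrable_mult_indicator[OF AB(3) iA] unfolding BA .
  have h: "(\<lambda>x. indicator A x *\<^sub>R f x) \<in> borel_measurable lebesgue"
    using Lp_space_measurable[OF f] AB by (simp add: borel_measurable_restrict_space_iff)
  have "(\<lambda>x. indicator B x *\<^sub>R (indicator A x *\<^sub>R f x)) \<in> borel_measurable lebesgue"
    by (rule borel_measurable_scaleR[OF borel_measurable_indicator[OF AB(3)] h])
  then have m: "f \<in> borel_measurable (lebesgue_on B)"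
    unfolding BA using AB by (simp add: borel_measurable_restrict_space_iff)
  then show "f \<in> Lp_space p B"
    using iB AB by (simp add: Lp_space_def integrable_restrict_space)
  have "(\<integral>x. indicator B x *\<^sub>R \<bar>f x\<bar> powr p \<partial>lebesgue) \<le> (\<integral>x. indicator A x *\<^sub>R \<bar>f x\<bar> powr p \<partial>lebesgue)"
    using iA iB AB by (intro integral_mono) (auto simp: indicator_def)
  then show "lp_int p B f \<le> lp_int p A f"
    using AB by (simp add: lp_int_def integral_restrict_space)
qed

lemma difference_Lp:
  assumes "0 < p" "f \<in> Lp_space p unit_cube"
  shows "difference y f \<in> Lp_space p (shifted_cube y)"
    "lp_int p (shifted_cube y) (difference y f) \<le> 2 powr p * (2 * lp_int p unit_cube f)"
proof -
  have B: "f \<in> Lp_space p (shifted_cube y)" "lp_int p (shifted_cube y) f \<le> lp_int p unit_cube f"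
    using Lp_subset[OF assms(2)] shifted_cubeD(1) by (metis sets_shifted_cube sets_unit_cube subsetI)+
  have d: "difference y f = (\<lambda>x. f (x + y) - f x)" by (simp add: fun_eq_iff difference_def)
  show "difference y f \<in> Lp_space p (shifted_cube y)"
    unfolding d by (rule Lp_diff(1)[OF assms(1) Lp_translate(1)[OF assms(2)] B(1)])
  have "lp_int p (shifted_cube y) (difference y f)
      \<le> 2 powr p * (lp_int p (shifted_cube y) (\<lambda>x. f (x + y)) + lp_int p (shifted_cube y) f)"
    unfolding d by (rule Lp_diff(2)[OF assms(1) Lp_translate(1)[OF assms(2)] B(1)])
  also have "\<dots> \<le> 2 powr p * (2 * lp_int p unit_cube f)"
    using Lp_translate(2)[OF assms(2), of y] B(2) by (intro mult_left_mono) auto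
  finally show "lp_int p (shifted_cube y) (difference y f) \<le> 2 powr p * (2 * lp_int p unit_cube f)" .
qed

section \<open>Moduli of smoothness as p-th powers\<close>

definition mod_pow :: "real => real => (real ^ 'n::finite => real) => real" where
  "mod_pow p t f = modulus p t f powr p"

lemma mod_pow_nonneg [simp]: "0 \<le> mod_pow p t f"
  by (simp add: mod_pow_def)

lemma shift_exists: "0 < t ==> \<exists>y :: real ^ 'n::finite. 0 < norm y \<and> norm y \<le> t"
proof -
  assume t: "0 < t"
  obtain y :: "real ^ 'n" where "norm y = t"
    using t by (rule vector_choose_size[OF less_imp_le])
  then show ?thesis using t by auto
qed

lemma modulus_bdd:
  fixes f :: "real ^ 'n::finite => real"
  assumes "0 < p" "f \<in> Lp_space p unit_cube"
  shows "bdd_above ((\<lambda>y. Lp_norm p (shifted_cube y) (difference y f)) ` {y. 0 < norm y \<and> norm y \<le> t})"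
  by (rule bdd_aboveI[where M = "(2 powr p * (2 * lp_int p unit_cube f)) powr (1 / p)"])
     (use assms difference_Lp(2)[OF assms] in \<open>auto simp: Lp_norm_lp_int intro!: powr_mono2\<close>)

lemma Lp_norm_le_modulus:
  fixes f :: "real ^ 'n::finite => real"
  assumes "0 < p" "f \<in> Lp_space p unit_cube" "0 < norm y" "norm y \<le> t"
  shows "Lp_norm p (shifted_cube y) (difference y f) \<le> modulus p t f"
  unfolding modulus_def by (rule cSUP_upper[OF _ modulus_bdd[OF assms(1,2)]]) (use assms in auto)

lemma modulus_nonneg:
  fixes f :: "real ^ 'n::finite => real"
  assumes "0 < p" "f \<in> Lp_space p unit_cube" "0 < t"
  shows "0 \<le> modulus p t f"
proof -
  obtain y :: "real ^ 'n" where "0 < norm y" "norm y \<le> t" using shift_exists[OF assms(3)] by blast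
  then show ?thesis
    using order_trans[OF Lp_norm_nonneg Lp_norm_le_modulus[OF assms(1,2)]] by blast
qed

text \<open>The supremum in the modulus excludes y = 0, but there the difference vanishes; so the
  bound covers all shifts and can be used under an integral over shifts.\<close>

lemma lp_int_le_mod_pow:
  fixes f :: "real ^ 'n::finite => real"
  assumes "0 < p" "f \<in> Lp_space p unit_cube" "norm y \<le> t"
  shows "lp_int p (shifted_cube y) (difference y f) \<le> mod_pow p t f"
proof (cases "y = 0")
  case True
  then show ?thesis using assms by (simp add: difference_def[abs_def] lp_int_def)
next
  case False
  then have "Lp_norm p (shifted_cube y) (difference y f) powr p \<le> modulus p t f powr p"
    using assms by (intro powr_mono2 Lp_norm_le_modulus) auto
  then show ?thesis using assms by (simp add: Lp_norm_powr mod_pow_def)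
qed

lemma mod_pow_leI:
  fixes f :: "real ^ 'n::finite => real"
  assumes "0 < p" "f \<in> Lp_space p unit_cube" "0 < t" "0 \<le> R"
    and "\<And>y. 0 < norm y ==> norm y \<le> t ==> lp_int p (shifted_cube y) (difference y f) \<le> R"
  shows "mod_pow p t f \<le> R"
proof -
  have "modulus p t f \<le> R powr (1 / p)"
    unfolding modulus_def
  proof (rule cSUP_least)
    show "{y :: real ^ 'n. 0 < norm y \<and> norm y \<le> t} \<noteq> {}" using shift_exists[OF assms(3)] by blast
  qed (use assms in \<open>auto simp: Lp_norm_lp_int intro!: powr_mono2\<close>)
  then have "mod_pow p t f \<le> (R powr (1 / p)) powr p"
    unfolding mod_pow_def using assms modulus_nonneg by (intro powr_mono2) auto
  then show ?thesis using assms by (simp add: powr_powr)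
qed

lemma mod_pow_le:
  fixes f :: "real ^ 'n::finite => real"
  assumes "0 < p" "f \<in> Lp_space p unit_cube" "0 < t"
  shows "mod_pow p t f \<le> 2 powr p * (2 * lp_int p unit_cube f)"
  by (rule mod_pow_leI[OF assms]) (use difference_Lp(2)[OF assms(1,2)] in auto)

lemma modulus_mono:
  fixes f :: "real ^ 'n::finite => real"
  assumes "0 < p" "f \<in> Lp_space p unit_cube" "0 < t" "t \<le> t'"
  shows "modulus p t f \<le> modulus p t' f"
  unfolding modulus_def
proof (rule cSUP_subset_mono[OF _ modulus_bdd[OF assms(1,2)]])
  show "{y :: real ^ 'n. 0 < norm y \<and> norm y \<le> t} \<noteq> {}" using shift_exists[OF assms(3)] by blast
qed (use assms in auto)

lemma mod_pow_add:
  fixes f g :: "real ^ 'n::finite => real"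
  assumes "0 < p" "f \<in> Lp_space p unit_cube" "g \<in> Lp_space p unit_cube" "0 < t"
  shows "mod_pow p t (\<lambda>x. f x + g x) \<le> 2 powr p * (mod_pow p t f + mod_pow p t g)"
proof (rule mod_pow_leI)
  fix y :: "real ^ 'n"
  assume y: "0 < norm y" "norm y \<le> t"
  have e: "difference y (\<lambda>x. f x + g x) = (\<lambda>x. difference y f x + difference y g x)"
    by (auto simp: difference_def)
  have "lp_int p (shifted_cube y) (difference y (\<lambda>x. f x + g x))
    \<le> 2 powr p * (lp_int p (shifted_cube y) (difference y f) + lp_int p (shifted_cube y) (difference y g))"
    unfolding e by (intro Lp_add difference_Lp assms)
  also have "\<dots> \<le> 2 powr p * (mod_pow p t f + mod_pow p t g)"
    using assms y by (intro mult_left_mono add_mono lp_int_le_mod_pow) auto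
  finally show "lp_int p (shifted_cube y) (difference y (\<lambda>x. f x + g x)) \<le> 2 powr p * (mod_pow p t f + mod_pow p t g)" .
qed (use assms(1,4) Lp_add(1)[OF assms(1-3)] in simp_all)

lemma mod_pow_cmult:
  fixes f :: "real ^ 'n::finite => real"
  assumes "0 < p" "f \<in> Lp_space p unit_cube" "0 < t"
  shows "mod_pow p t (\<lambda>x. c * f x) \<le> \<bar>c\<bar> powr p * mod_pow p t f"
proof (rule mod_pow_leI)
  fix y :: "real ^ 'n"
  assume y: "0 < norm y" "norm y \<le> t"
  have e: "difference y (\<lambda>x. c * f x) = (\<lambda>x. c * difference y f x)"
    by (auto simp: difference_def algebra_simps)
  show "lp_int p (shifted_cube y) (difference y (\<lambda>x. c * f x)) \<le> \<bar>c\<bar> powr p * mod_pow p t f"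
    unfolding e Lp_cmult(2)[OF difference_Lp(1)[OF assms(1,2)]]
    using assms y by (intro mult_left_mono lp_int_le_mod_pow) auto
qed (use assms(1,3) Lp_cmult(1)[OF assms(2)] in simp_all)

text \<open>
  With \<^term>\<open>\<sigma> = s * p\<close> and \<^term>\<open>\<theta> = q / p\<close>, the sum over dyadic \<^term>\<open>t\<close> equivalent to the
  integral of the Besov quasi-norm; all quantities are \<^term>\<open>p\<close>-th powers.
\<close>

definition wsum :: "real => real => (nat => real) => ennreal" where
  "wsum \<sigma> \<theta> a = (\<Sum>k. ennreal ((2 powr (real k * \<sigma>) * a k) powr \<theta>))"

definition gauge_of :: "real => real => real => (real ^ 'n::finite => real) => ennreal" where
  "gauge_of p \<sigma> \<theta> f = ennreal (lp_int p unit_cube f powr \<theta>) + wsum \<sigma> \<theta> (\<lambda>k. mod_pow p ((1 / 2) ^ k) f)"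

lemma ennreal_suminf_swap: "(\<Sum>i. \<Sum>j. F i j) = (\<Sum>j. \<Sum>i. F i j :: ennreal)"
proof -
  have "(\<Sum>i. \<Sum>j. F i j) = (\<integral>\<^sup>+i. (\<Sum>j. F i j) \<partial>count_space UNIV)"
    by (simp add: nn_integral_count_space_nat)
  also have "\<dots> = (\<Sum>j. \<integral>\<^sup>+i. F i j \<partial>count_space UNIV)"
    by (rule nn_integral_suminf) simp
  finally show ?thesis by (simp add: nn_integral_count_space_nat)
qed

lemma wsum_mono:
  assumes "0 < \<theta>" "\<And>k. 0 \<le> a k" "\<And>k. a k \<le> b k"
  shows "wsum \<sigma> \<theta> a \<le> wsum \<sigma> \<theta> b"
  unfolding wsum_def
proof (rule suminf_le)
  fix k
  have "2 powr (real k * \<sigma>) * a k \<le> 2 powr (real k * \<sigma>) * b k"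
    using assms(3) by (rule mult_left_mono) simp
  then show "ennreal ((2 powr (real k * \<sigma>) * a k) powr \<theta>) \<le> ennreal ((2 powr (real k * \<sigma>) * b k) powr \<theta>)"
    using assms(1,2) by (intro ennreal_leI powr_mono2) simp_all
qed simp_all

lemma wsum_cmult:
  assumes "0 \<le> c"
  shows "wsum \<sigma> \<theta> (\<lambda>k. c * a k) = ennreal (c powr \<theta>) * wsum \<sigma> \<theta> a"
proof -
  have "(2 powr (real k * \<sigma>) * (c * a k)) powr \<theta> = c powr \<theta> * (2 powr (real k * \<sigma>) * a k) powr \<theta>" for k
    by (simp add: powr_mult)
  then show ?thesis by (simp add: wsum_def ennreal_mult)
qed

lemma wsum_add:
  assumes "0 < \<theta>" "\<And>k. 0 \<le> a k" "\<And>k. 0 \<le> b k"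
  shows "wsum \<sigma> \<theta> (\<lambda>k. a k + b k) \<le> ennreal (2 powr \<theta>) * (wsum \<sigma> \<theta> a + wsum \<sigma> \<theta> b)"
proof -
  have "wsum \<sigma> \<theta> (\<lambda>k. a k + b k) \<le> (\<Sum>k. ennreal (2 powr \<theta>) *
     (ennreal ((2 powr (real k * \<sigma>) * a k) powr \<theta>) + ennreal ((2 powr (real k * \<sigma>) * b k) powr \<theta>)))"
    unfolding wsum_def
  proof (intro suminf_le)
    fix k
    let ?w = "2 powr (real k * \<sigma>)"
    have "(?w * (a k + b k)) powr \<theta> \<le> 2 powr \<theta> * ((?w * a k) powr \<theta> + (?w * b k) powr \<theta>)"
      using powr_add_le[of "?w * a k" "?w * b k" \<theta>] assms by (simp add: distrib_left)
    then have "ennreal ((?w * (a k + b k)) powr \<theta>) \<le> ennreal (2 powr \<theta> * ((?w * a k) powr \<theta> + (?w * b k) powr \<theta>))"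
      by (rule ennreal_leI)
    then show "ennreal ((?w * (a k + b k)) powr \<theta>)
       \<le> ennreal (2 powr \<theta>) * (ennreal ((?w * a k) powr \<theta>) + ennreal ((?w * b k) powr \<theta>))"
      by (simp add: ennreal_mult ennreal_plus)
  qed auto
  also have "\<dots> = ennreal (2 powr \<theta>) * (wsum \<sigma> \<theta> a + wsum \<sigma> \<theta> b)"
    by (simp add: wsum_def suminf_add[symmetric])
  finally show ?thesis .
qed

lemma gauge_of_add:
  fixes f g :: "real ^ 'n::finite => real"
  assumes "0 < p" "0 < \<theta>" "f \<in> Lp_space p unit_cube" "g \<in> Lp_space p unit_cube"
  shows "gauge_of p \<sigma> \<theta> (\<lambda>x. f x + g x) \<le> ennreal ((2 powr p) powr \<theta> * 2 powr \<theta>) * (gauge_of p \<sigma> \<theta> f + gauge_of p \<sigma> \<theta> g)"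
proof -
  let ?c = "(2 powr p) powr \<theta> * 2 powr \<theta>"
  have "lp_int p unit_cube (\<lambda>x. f x + g x) powr \<theta> \<le> (2 powr p * (lp_int p unit_cube f + lp_int p unit_cube g)) powr \<theta>"
    using assms by (intro powr_mono2 Lp_add) auto
  also have "\<dots> \<le> (2 powr p) powr \<theta> * (2 powr \<theta> * (lp_int p unit_cube f powr \<theta> + lp_int p unit_cube g powr \<theta>))"
    unfolding powr_mult[of "2 powr p"] using assms by (intro mult_left_mono powr_add_le) auto
  finally have "ennreal (lp_int p unit_cube (\<lambda>x. f x + g x) powr \<theta>)
      \<le> ennreal (?c * (lp_int p unit_cube f powr \<theta> + lp_int p unit_cube g powr \<theta>))"
    by (intro ennreal_leI) (simp add: mult.assoc)
  then have 1: "ennreal (lp_int p unit_cube (\<lambda>x. f x + g x) powr \<theta>)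
     \<le> ennreal ?c * (ennreal (lp_int p unit_cube f powr \<theta>) + ennreal (lp_int p unit_cube g powr \<theta>))"
    by (simp add: ennreal_mult ennreal_plus)
  have "wsum \<sigma> \<theta> (\<lambda>k. mod_pow p ((1 / 2) ^ k) (\<lambda>x. f x + g x))
      \<le> wsum \<sigma> \<theta> (\<lambda>k. 2 powr p * (mod_pow p ((1 / 2) ^ k) f + mod_pow p ((1 / 2) ^ k) g))"
    using assms by (intro wsum_mono mod_pow_add) auto
  also have "\<dots> \<le> ennreal ((2 powr p) powr \<theta>) * (ennreal (2 powr \<theta>) *
      (wsum \<sigma> \<theta> (\<lambda>k. mod_pow p ((1 / 2) ^ k) f) + wsum \<sigma> \<theta> (\<lambda>k. mod_pow p ((1 / 2) ^ k) g)))"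
    unfolding wsum_cmult[OF powr_ge_zero] using assms by (intro mult_left_mono wsum_add) auto
  also have "\<dots> = ennreal ?c * (wsum \<sigma> \<theta> (\<lambda>k. mod_pow p ((1 / 2) ^ k) f) + wsum \<sigma> \<theta> (\<lambda>k. mod_pow p ((1 / 2) ^ k) g))"
    by (simp add: ennreal_mult mult.assoc)
  finally have 2: "wsum \<sigma> \<theta> (\<lambda>k. mod_pow p ((1 / 2) ^ k) (\<lambda>x. f x + g x))
    \<le> ennreal ?c * (wsum \<sigma> \<theta> (\<lambda>k. mod_pow p ((1 / 2) ^ k) f) + wsum \<sigma> \<theta> (\<lambda>k. mod_pow p ((1 / 2) ^ k) g))" .
  have e: "c * (a + b) + c * (u + v) = c * (a + u + (b + v))" for a b c u v :: ennreal
    by (simp only: distrib_left add_ac)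
  show ?thesis
    unfolding gauge_of_def by (rule order_trans[OF add_mono[OF 1 2] eq_refl[OF e]])
qed

lemma gauge_of_cmult:
  fixes f :: "real ^ 'n::finite => real"
  assumes "0 < p" "0 < \<theta>" "f \<in> Lp_space p unit_cube"
  shows "gauge_of p \<sigma> \<theta> (\<lambda>x. c * f x) \<le> ennreal (\<bar>c\<bar> powr (p * \<theta>)) * gauge_of p \<sigma> \<theta> f"
proof -
  have 1: "(\<bar>c\<bar> powr p) powr \<theta> = \<bar>c\<bar> powr (p * \<theta>)" by (rule powr_powr)
  have "wsum \<sigma> \<theta> (\<lambda>k. mod_pow p ((1 / 2) ^ k) (\<lambda>x. c * f x)) \<le> wsum \<sigma> \<theta> (\<lambda>k. \<bar>c\<bar> powr p * mod_pow p ((1 / 2) ^ k) f)"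
  proof (rule wsum_mono)
    show "mod_pow p ((1 / 2) ^ k) (\<lambda>x. c * f x) \<le> \<bar>c\<bar> powr p * mod_pow p ((1 / 2) ^ k) f" for k
      by (rule mod_pow_cmult[OF assms(1,3)]) simp
  qed (use assms in simp_all)
  also have "\<dots> = ennreal (\<bar>c\<bar> powr (p * \<theta>)) * wsum \<sigma> \<theta> (\<lambda>k. mod_pow p ((1 / 2) ^ k) f)"
    unfolding wsum_cmult[OF powr_ge_zero[of "\<bar>c\<bar>" p]] 1 ..
  finally have 2: "wsum \<sigma> \<theta> (\<lambda>k. mod_pow p ((1 / 2) ^ k) (\<lambda>x. c * f x))
    \<le> ennreal (\<bar>c\<bar> powr (p * \<theta>)) * wsum \<sigma> \<theta> (\<lambda>k. mod_pow p ((1 / 2) ^ k) f)" .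
  have 3: "ennreal (lp_int p unit_cube (\<lambda>x. c * f x) powr \<theta>) = ennreal (\<bar>c\<bar> powr (p * \<theta>)) * ennreal (lp_int p unit_cube f powr \<theta>)"
    unfolding Lp_cmult(2)[OF assms(3)] powr_mult[of "\<bar>c\<bar> powr p"] 1 by (rule ennreal_mult) simp_all
  show ?thesis
    unfolding gauge_of_def distrib_left 3 by (rule add_left_mono[OF 2])
qed

text \<open>A discrete Hardy inequality. Moving the index by j changes the weight by the factor
  2^(\<sigma> j), and \<mu> 2^\<sigma> < 2 for some \<mu> > 1, so the convolution kernel remains
  geometrically summable after weighting. The condition \<sigma> < 1 is s < 1/p.\<close>

lemma wsum_hardy:
  assumes "\<sigma> < 1" "0 < \<theta>"
  shows "\<exists>\<mu>>1. \<exists>C>0. \<forall>a b. (\<forall>k. 0 \<le> a k) --> (\<forall>k. 0 \<le> b k) --> (\<forall>k. b k \<le> (\<Sum>j<Suc k. (\<mu> / 2) ^ j * a (k - j))) -->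
       wsum \<sigma> \<theta> b \<le> ennreal C * wsum \<sigma> \<theta> a"
proof -
  \<comment> \<open>Half of the available decay 2^(\<sigma>-1) = r^2 is spent on \<mu> = 1/r > 1 and
    the other half r remains; \<nu> and \<rho> divide r^\<theta> in the same way.\<close>
  define r where "r = 2 powr ((\<sigma> - 1) / 2)"
  have r: "0 < r" "r < 1"
    using powr_less_mono[of "(\<sigma> - 1) / 2" 0 2] assms by (simp_all add: r_def)
  define \<mu> where "\<mu> = 1 / r"
  have \<mu>: "1 < \<mu>" using r by (simp add: \<mu>_def)
  define \<nu> where "\<nu> = r powr (- \<theta> / 2)"
  have \<nu>: "1 < \<nu>"
  proof -
    have "\<nu> = (1 / r) powr (\<theta> / 2)" using r by (simp add: \<nu>_def powr_minus powr_divide field_simps)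
    then show ?thesis using r assms by (simp add: gr_one_powr)
  qed
  have rr: "\<mu> / 2 * 2 powr \<sigma> = r"
  proof -
    have "r * r = 2 powr (\<sigma> - 1)" by (simp add: r_def flip: powr_add)
    also have "\<dots> = 2 powr \<sigma> / 2" by (simp add: powr_diff)
    finally show ?thesis using r by (simp add: \<mu>_def field_simps)
  qed
  define \<rho> where "\<rho> = r powr (\<theta> / 2)"
  have \<rho>: "0 < \<rho>" "\<rho> < 1" using r assms powr01_less_one[of r "\<theta> / 2"] by (auto simp: \<rho>_def)
  have \<nu>\<rho>: "\<nu> * r powr \<theta> = \<rho>" by (simp add: \<nu>_def \<rho>_def flip: powr_add)
  obtain C0 where C0: "C0 > 0" "\<forall>(a :: nat => real) n. (\<forall>l<n. 0 \<le> a l) -->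
       (\<Sum>l<n. a l) powr \<theta> \<le> C0 * (\<Sum>l<n. \<nu> ^ l * a l powr \<theta>)"
    using powr_sum_le_weighted[OF assms(2) \<nu>] by blast
  define C where "C = C0 * (1 / (1 - \<rho>))"
  have "wsum \<sigma> \<theta> b \<le> ennreal C * wsum \<sigma> \<theta> a"
    if a: "\<forall>k. 0 \<le> a k" and b: "\<forall>k. 0 \<le> b k" and ba: "\<forall>k. b k \<le> (\<Sum>j<Suc k. (\<mu> / 2) ^ j * a (k - j))" for a b
  proof -
    define w where "w k = (2 powr (real k * \<sigma>) * a k) powr \<theta>" for k
    have w0: "0 \<le> w k" for k by (simp add: w_def)
    have le: "(2 powr (real k * \<sigma>) * b k) powr \<theta> \<le> C0 * (\<Sum>j<Suc k. \<rho> ^ j * w (k - j))" for k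
    proof -
      have s: "2 powr (real k * \<sigma>) * ((\<mu> / 2) ^ j * a (k - j)) = r ^ j * (2 powr (real (k - j) * \<sigma>) * a (k - j))"
        if "j < Suc k" for j
      proof -
        have "2 powr (real k * \<sigma>) = 2 powr (real j * \<sigma>) * 2 powr (real (k - j) * \<sigma>)"
          using that by (simp add: of_nat_diff algebra_simps flip: powr_add)
        moreover have "2 powr (real j * \<sigma>) = (2 powr \<sigma>) ^ j"
          by (simp add: powr_power mult.commute)
        moreover have "r ^ j = (\<mu> / 2) ^ j * (2 powr \<sigma>) ^ j"
          by (simp only: power_mult_distrib[symmetric] rr)
        ultimately show ?thesis by (simp only: mult_ac)
      qed
      have "(2 powr (real k * \<sigma>) * b k) powr \<theta> \<le> (2 powr (real k * \<sigma>) * (\<Sum>j<Suc k. (\<mu> / 2) ^ j * a (k - j))) powr \<theta>"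
        using assms b ba by (intro powr_mono2 mult_left_mono mult_nonneg_nonneg) auto
      also have "2 powr (real k * \<sigma>) * (\<Sum>j<Suc k. (\<mu> / 2) ^ j * a (k - j))
          = (\<Sum>j<Suc k. r ^ j * (2 powr (real (k - j) * \<sigma>) * a (k - j)))"
        unfolding sum_distrib_left by (intro sum.cong refl s) simp
      also have "\<dots> powr \<theta> \<le> C0 * (\<Sum>j<Suc k. \<nu> ^ j * (r ^ j * (2 powr (real (k - j) * \<sigma>) * a (k - j))) powr \<theta>)"
        by (rule C0(2)[rule_format]) (use r a in auto)
      also have "\<dots> = C0 * (\<Sum>j<Suc k. \<rho> ^ j * w (k - j))"
      proof -
        have "\<nu> ^ j * (r ^ j * (2 powr (real (k - j) * \<sigma>) * a (k - j))) powr \<theta> = \<rho> ^ j * w (k - j)" for j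
        proof -
          have "(r ^ j) powr \<theta> = (r powr \<theta>) ^ j"
            using r by (simp add: powr_power powr_powr mult.commute flip: powr_realpow)
          then show ?thesis by (simp only: powr_mult[of "r ^ j"] w_def \<nu>\<rho>[symmetric] power_mult_distrib mult.assoc)
        qed
        then show ?thesis by (simp only:)
      qed
      finally show ?thesis .
    qed
    have "wsum \<sigma> \<theta> b \<le> (\<Sum>k. ennreal (C0 * (\<Sum>j<Suc k. \<rho> ^ j * w (k - j))))"
      unfolding wsum_def by (intro suminf_le ennreal_leI le) auto
    also have "\<dots> = (\<Sum>k. ennreal C0 * (\<Sum>j. if j \<le> k then ennreal (\<rho> ^ j * w (k - j)) else 0))"
    proof (intro suminf_cong)
      fix k
      have "(\<Sum>j. if j \<le> k then ennreal (\<rho> ^ j * w (k - j)) else 0) = (\<Sum>j<Suc k. ennreal (\<rho> ^ j * w (k - j)))"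
        by (subst suminf_finite[of "{..<Suc k}"]) auto
      also have "\<dots> = ennreal (\<Sum>j<Suc k. \<rho> ^ j * w (k - j))"
        using \<rho> w0 by (intro sum_ennreal) auto
      finally show "ennreal (C0 * (\<Sum>j<Suc k. \<rho> ^ j * w (k - j))) = ennreal C0 * (\<Sum>j. if j \<le> k then ennreal (\<rho> ^ j * w (k - j)) else 0)"
        using C0 \<rho> w0 by (simp add: ennreal_mult sum_nonneg)
    qed
    \<comment> \<open>After exchanging the sums, each lag j contributes a shifted copy of the series
      for \<open>a\<close>, and the geometric factors separate.\<close>
    also have "\<dots> = ennreal C0 * (\<Sum>j. \<Sum>k. if j \<le> k then ennreal (\<rho> ^ j * w (k - j)) else 0)"
      by (simp add: ennreal_suminf_swap[of "\<lambda>k j. if j \<le> k then ennreal (\<rho> ^ j * w (k - j)) else 0"])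
    also have "(\<Sum>j. \<Sum>k. if j \<le> k then ennreal (\<rho> ^ j * w (k - j)) else 0) = (\<Sum>j. ennreal (\<rho> ^ j) * wsum \<sigma> \<theta> a)"
    proof (intro suminf_cong)
      fix j
      have "(\<Sum>k. if j \<le> k then ennreal (\<rho> ^ j * w (k - j)) else 0)
         = (\<Sum>k. if j \<le> k + j then ennreal (\<rho> ^ j * w (k + j - j)) else 0) + (\<Sum>k<j. if j \<le> k then ennreal (\<rho> ^ j * w (k - j)) else 0)"
        by (rule suminf_offset) simp
      also have "\<dots> = (\<Sum>k. ennreal (\<rho> ^ j * w k))" by simp
      also have "\<dots> = ennreal (\<rho> ^ j) * wsum \<sigma> \<theta> a"
        using \<rho> w0 by (simp add: wsum_def w_def[symmetric] ennreal_mult)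
      finally show "(\<Sum>k. if j \<le> k then ennreal (\<rho> ^ j * w (k - j)) else 0) = ennreal (\<rho> ^ j) * wsum \<sigma> \<theta> a" .
    qed
    also have "\<dots> = ennreal (1 / (1 - \<rho>)) * wsum \<sigma> \<theta> a"
      using \<rho> by (simp add: suminf_ennreal2 summable_geometric suminf_geometric)
    also have "ennreal C0 * (ennreal (1 / (1 - \<rho>)) * wsum \<sigma> \<theta> a) = ennreal C * wsum \<sigma> \<theta> a"
    proof -
      have "ennreal C = ennreal C0 * ennreal (1 / (1 - \<rho>))"
        unfolding C_def by (rule ennreal_mult) (use C0 \<rho> in simp_all)
      then show ?thesis by (simp only: mult.assoc)
    qed
    finally show ?thesis .
  qed
  moreover have "0 < C" using C0 \<rho> by (simp add: C_def)
  ultimately show ?thesis using \<mu> by blast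
qed

section \<open>Comparison of the integral over t with its dyadic sum\<close>

definition dyadic_shell :: "nat => real set" where
  "dyadic_shell k = {(1 / 2) ^ Suc k..<(1 / 2) ^ k}"

lemma dyadic_shell_exists:
  assumes "0 < t" "t < 1"
  shows "\<exists>k. t \<in> dyadic_shell k"
proof -
  obtain n where n: "(1 / 2 :: real) ^ n < t" using real_arch_pow_inv[of t "1 / 2"] assms by auto
  have "(1 / 2 :: real) ^ Suc n \<le> (1 / 2) ^ n" by simp
  then have ex: "\<exists>n. (1 / 2) ^ Suc n \<le> t" using n by (intro exI[of _ n]) linarith
  define k where "k = (LEAST n. (1 / 2) ^ Suc n \<le> t)"
  have "(1 / 2) ^ Suc k \<le> t" unfolding k_def using ex by (rule LeastI_ex)
  moreover have "t < (1 / 2) ^ k"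
  proof (cases k)
    case (Suc j)
    then have "\<not> (1 / 2) ^ Suc j \<le> t" using not_less_Least[of j "\<lambda>n. (1 / 2) ^ Suc n \<le> t"] by (simp add: k_def)
    then show ?thesis using Suc by simp
  qed (use assms in simp)
  ultimately show ?thesis by (auto simp: dyadic_shell_def)
qed

lemma dyadic_shell_disjoint:
  assumes "t \<in> dyadic_shell k" "t \<in> dyadic_shell j"
  shows "j = k"
proof -
  have le: "m \<le> n" if "t \<in> dyadic_shell m" "t \<in> dyadic_shell n" for m n
  proof (rule ccontr)
    assume "\<not> m \<le> n"
    then have "(1 / 2 :: real) ^ m \<le> (1 / 2) ^ Suc n" by (intro power_decreasing) auto
    then show False using that by (simp add: dyadic_shell_def)
  qed
  show ?thesis using le assms by (meson order_antisym)
qed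

lemma dyadic_shell_suminf:
  assumes "t \<in> dyadic_shell k"
  shows "(\<Sum>j. g j * indicator (dyadic_shell j) t) = (g k :: ennreal)"
proof -
  have "(\<Sum>j. g j * indicator (dyadic_shell j) t) = (\<Sum>j\<in>{k}. g j * indicator (dyadic_shell j) t)"
    using dyadic_shell_disjoint[OF assms] by (intro suminf_finite) (auto simp: indicator_def)
  then show ?thesis using assms by simp
qed

lemma nn_integral_dyadic_shells:
  assumes "\<And>k. 0 \<le> g k"
  shows "(\<integral>\<^sup>+t. (\<Sum>k. ennreal (g k) * indicator (dyadic_shell k) t) \<partial>lborel) = (\<Sum>k. ennreal (g k * (1 / 2) ^ Suc k))"
proof -
  have e: "emeasure lborel (dyadic_shell k) = ennreal ((1 / 2) ^ Suc k)" for k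
  proof -
    have le: "(1 / 2 :: real) ^ Suc k \<le> (1 / 2) ^ k" by (rule power_decreasing) simp_all
    have "emeasure lborel (dyadic_shell k) = ennreal ((1 / 2) ^ k - (1 / 2) ^ Suc k)"
      unfolding dyadic_shell_def by (rule emeasure_lborel_Ico[OF le])
    also have "(1 / 2 :: real) ^ k - (1 / 2) ^ Suc k = (1 / 2) ^ Suc k" by simp
    finally show ?thesis .
  qed
  have "(\<integral>\<^sup>+t. (\<Sum>k. ennreal (g k) * indicator (dyadic_shell k) t) \<partial>lborel)
     = (\<Sum>k. \<integral>\<^sup>+t. ennreal (g k) * indicator (dyadic_shell k) t \<partial>lborel)"
    by (rule nn_integral_suminf) (auto simp: dyadic_shell_def)
  also have "\<dots> = (\<Sum>k. ennreal (g k) * ennreal ((1 / 2) ^ Suc k))"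
  proof (intro suminf_cong)
    fix k
    have "(\<integral>\<^sup>+t. ennreal (g k) * indicator (dyadic_shell k) t \<partial>lborel) = ennreal (g k) * emeasure lborel (dyadic_shell k)"
      by (rule nn_integral_cmult_indicator) (simp add: dyadic_shell_def)
    then show "(\<integral>\<^sup>+t. ennreal (g k) * indicator (dyadic_shell k) t \<partial>lborel) = ennreal (g k) * ennreal ((1 / 2) ^ Suc k)"
      by (simp only: e)
  qed
  moreover have "ennreal (g k) * ennreal ((1 / 2) ^ Suc k) = ennreal (g k * (1 / 2) ^ Suc k)" for k
    by (rule ennreal_mult[symmetric]) (use assms in simp_all)
  ultimately show ?thesis by (simp only:)
qed

lemma half_power_powr: "((1 / 2 :: real) ^ k) powr a = 2 powr (- (real k * a))"
proof -
  have "(1 / 2 :: real) ^ k = 2 powr (- real k)"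
    by (simp add: powr_minus powr_realpow power_one_over inverse_eq_divide)
  then show ?thesis by (simp add: powr_powr)
qed

lemma wsum_term_modulus:
  fixes f :: "real ^ 'n::finite => real"
  assumes "0 < p"
  shows "(2 powr (real k * (s * p)) * mod_pow p t f) powr (q / p) = (2 powr (real k * s) * modulus p t f) powr q"
  using assms by (simp add: mod_pow_def powr_mult powr_powr mult_ac)

text \<open>On a shell the factors t^(-s), 1/t and the modulus are bounded by their values at the
  ends, and the factor 2^(k+1) replacing 1/t cancels the length of the shell.\<close>

lemma besov_integral_le_wsum:
  fixes f :: "real ^ 'n::finite => real"
  assumes "0 < p" "0 < q" "0 \<le> s" "f \<in> Lp_space p unit_cube"
  shows "besov_integral p q s f \<le> ennreal (2 powr (s * q)) * wsum (s * p) (q / p) (\<lambda>k. mod_pow p ((1 / 2) ^ k) f)"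
proof -
  define g where "g k = (2 powr (real (Suc k) * s) * modulus p ((1 / 2) ^ k) f) powr q * 2 ^ Suc k" for k
  have le: "ennreal ((t powr - s * modulus p t f) powr q / t) * indicator {0<..<1} t
      \<le> (\<Sum>k. ennreal (g k) * indicator (dyadic_shell k) t)" for t
  proof (cases "0 < t \<and> t < 1")
    case True
    then obtain k where k: "t \<in> dyadic_shell k" using dyadic_shell_exists by blast
    then have t: "0 < t" "(1 / 2) ^ Suc k \<le> t" "t \<le> (1 / 2) ^ k" using True by (auto simp: dyadic_shell_def)
    have "t powr - s \<le> ((1 / 2) ^ Suc k) powr - s" using t assms by (intro powr_mono2') auto
    also have "\<dots> = 2 powr (real (Suc k) * s)" unfolding half_power_powr by simp
    finally have 1: "t powr - s \<le> 2 powr (real (Suc k) * s)" .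
    have 2: "1 / t \<le> 2 ^ Suc k" using t by (simp add: field_simps)
    have "(t powr - s * modulus p t f) powr q \<le> (2 powr (real (Suc k) * s) * modulus p ((1 / 2) ^ k) f) powr q"
      using 1 t assms by (intro powr_mono2 mult_mono modulus_mono modulus_nonneg mult_nonneg_nonneg) auto
    then have "(t powr - s * modulus p t f) powr q * (1 / t) \<le> g k"
      unfolding g_def using 2 t by (intro mult_mono) auto
    then have "ennreal ((t powr - s * modulus p t f) powr q / t) \<le> ennreal (g k)"
      by (intro ennreal_leI) simp
    then show ?thesis using True dyadic_shell_suminf[OF k, of "\<lambda>k. ennreal (g k)"] by simp
  qed (auto simp: indicator_def)
  have "besov_integral p q s f \<le> (\<integral>\<^sup>+t. (\<Sum>k. ennreal (g k) * indicator (dyadic_shell k) t) \<partial>lborel)"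
    unfolding besov_integral_def by (intro nn_integral_mono le)
  also have "\<dots> = (\<Sum>k. ennreal (g k * (1 / 2) ^ Suc k))"
    by (rule nn_integral_dyadic_shells) (simp add: g_def)
  also have "\<dots> = (\<Sum>k. ennreal (2 powr (s * q)) * ennreal ((2 powr (real k * (s * p)) * mod_pow p ((1 / 2) ^ k) f) powr (q / p)))"
  proof (intro suminf_cong)
    fix k
    have p2: "(2 :: real) ^ Suc k * (1 / 2) ^ Suc k = 1" by (simp add: power_one_over)
    have "2 powr (real (Suc k) * s) = 2 powr s * 2 powr (real k * s)"
      by (simp add: algebra_simps flip: powr_add)
    then have "(2 powr (real (Suc k) * s) * modulus p ((1 / 2) ^ k) f) powr q
        = 2 powr (s * q) * (2 powr (real k * s) * modulus p ((1 / 2) ^ k) f) powr q"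
      by (simp add: powr_mult powr_powr)
    then have "g k * (1 / 2) ^ Suc k = 2 powr (s * q) * (2 powr (real k * s) * modulus p ((1 / 2) ^ k) f) powr q"
      unfolding g_def mult.assoc p2 by simp
    then show "ennreal (g k * (1 / 2) ^ Suc k) = ennreal (2 powr (s * q)) * ennreal ((2 powr (real k * (s * p)) * mod_pow p ((1 / 2) ^ k) f) powr (q / p))"
      unfolding wsum_term_modulus[OF assms(1)] by (simp add: ennreal_mult)
  qed
  finally show ?thesis by (simp add: wsum_def)
qed

text \<open>From below, the modulus on shell k can only be replaced by its value at the left end
  2^(-(k+1)). So the integral over t < 1 controls the terms from index 1 on, and the term for t = 1
  is estimated by the L_p norm.\<close>

lemma wsum_le_besov_integral:
  fixes f :: "real ^ 'n::finite => real"
  assumes "0 < p" "0 < q" "0 \<le> s" "f \<in> Lp_space p unit_cube"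
  shows "wsum (s * p) (q / p) (\<lambda>k. mod_pow p ((1 / 2) ^ k) f)
     \<le> ennreal ((2 powr p * 2) powr (q / p)) * ennreal (lp_int p unit_cube f powr (q / p))
       + ennreal (2 * 2 powr (s * q)) * besov_integral p q s f"
proof -
  define W where "W k = ennreal ((2 powr (real k * (s * p)) * mod_pow p ((1 / 2) ^ k) f) powr (q / p))" for k
  define g where "g k = (2 powr (real k * s) * modulus p ((1 / 2) ^ Suc k) f) powr q * 2 ^ k" for k
  have le: "(\<Sum>k. ennreal (g k) * indicator (dyadic_shell k) t)
    \<le> ennreal ((t powr - s * modulus p t f) powr q / t) * indicator {0<..<1} t" for t
  proof (cases "\<exists>k. t \<in> dyadic_shell k")
    case True
    then obtain k where k: "t \<in> dyadic_shell k" by blast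
    have pos: "(0 :: real) < (1 / 2) ^ Suc k" by simp
    have t: "(1 / 2) ^ Suc k \<le> t" "t < (1 / 2) ^ k" using k by (auto simp: dyadic_shell_def)
    then have t0: "0 < t" using pos by linarith
    have "(1 / 2 :: real) ^ k \<le> 1" by (simp add: power_le_one)
    then have t1: "t < 1" using t by linarith
    have "2 powr (real k * s) = ((1 / 2) ^ k) powr - s" unfolding half_power_powr by simp
    also have "\<dots> \<le> t powr - s" using t t0 assms by (intro powr_mono2') auto
    finally have 1: "2 powr (real k * s) \<le> t powr - s" .
    have 2: "2 ^ k \<le> 1 / t"
    proof -
      have "t * 2 ^ k \<le> (1 / 2) ^ k * 2 ^ k" using t by (intro mult_right_mono) auto
      also have "\<dots> = 1" by (simp add: power_one_over)
      finally show ?thesis using t0 by (simp add: field_simps)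
    qed
    have "(2 powr (real k * s) * modulus p ((1 / 2) ^ Suc k) f) powr q \<le> (t powr - s * modulus p t f) powr q"
      using 1 t t0 assms by (intro powr_mono2 mult_mono modulus_mono modulus_nonneg mult_nonneg_nonneg) auto
    then have "g k \<le> (t powr - s * modulus p t f) powr q * (1 / t)"
      unfolding g_def using 2 t0 by (intro mult_mono) auto
    then have "ennreal (g k) \<le> ennreal ((t powr - s * modulus p t f) powr q / t)"
      by (intro ennreal_leI) simp
    then show ?thesis using t0 t1 dyadic_shell_suminf[OF k, of "\<lambda>k. ennreal (g k)"] by simp
  next
    case False
    then have "(\<Sum>k. ennreal (g k) * indicator (dyadic_shell k) t) = 0" by (simp add: indicator_def)
    then show ?thesis by simp
  qed
  have Wg: "W (Suc k) = ennreal (2 * 2 powr (s * q)) * ennreal (g k * (1 / 2) ^ Suc k)" for k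
  proof -
    have p2: "(2 :: real) ^ k * (1 / 2) ^ Suc k = 1 / 2" by (simp add: power_one_over)
    have "2 powr (real (Suc k) * s) = 2 powr s * 2 powr (real k * s)"
      by (simp add: algebra_simps flip: powr_add)
    then have "(2 powr (real (Suc k) * s) * modulus p ((1 / 2) ^ Suc k) f) powr q
        = 2 powr (s * q) * (2 powr (real k * s) * modulus p ((1 / 2) ^ Suc k) f) powr q"
      by (simp only: powr_mult powr_powr mult.assoc)
    also have "\<dots> = 2 * 2 powr (s * q) * (g k * (1 / 2) ^ Suc k)"
      unfolding g_def mult.assoc p2 by simp
    finally have "W (Suc k) = ennreal (2 * 2 powr (s * q) * (g k * (1 / 2) ^ Suc k))"
      unfolding W_def wsum_term_modulus[OF assms(1)] by (simp only:)
    also have "\<dots> = ennreal (2 * 2 powr (s * q)) * ennreal (g k * (1 / 2) ^ Suc k)"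
      by (rule ennreal_mult) (simp_all add: g_def)
    finally show ?thesis .
  qed
  have "(\<Sum>k. ennreal (g k * (1 / 2) ^ Suc k)) = (\<integral>\<^sup>+t. (\<Sum>k. ennreal (g k) * indicator (dyadic_shell k) t) \<partial>lborel)"
    by (rule nn_integral_dyadic_shells[symmetric]) (simp add: g_def)
  also have "\<dots> \<le> besov_integral p q s f"
    unfolding besov_integral_def by (intro nn_integral_mono le)
  finally have 1: "(\<Sum>k. W (Suc k)) \<le> ennreal (2 * 2 powr (s * q)) * besov_integral p q s f"
    unfolding Wg ennreal_suminf_cmult by (rule mult_left_mono) simp
  have "(mod_pow p 1 f) powr (q / p) \<le> (2 powr p * (2 * lp_int p unit_cube f)) powr (q / p)"
    using assms mod_pow_le[OF assms(1,4), of 1] by (intro powr_mono2) auto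
  then have "W 0 \<le> ennreal ((2 powr p * 2) powr (q / p) * lp_int p unit_cube f powr (q / p))"
    unfolding W_def by (intro ennreal_leI) (simp add: powr_mult mult.assoc)
  then have 2: "W 0 \<le> ennreal ((2 powr p * 2) powr (q / p)) * ennreal (lp_int p unit_cube f powr (q / p))"
    by (simp add: ennreal_mult)
  have "(\<Sum>k. W k) = (\<Sum>k. W (k + 1)) + (\<Sum>k<1. W k)" by (rule suminf_offset) simp
  then have "wsum (s * p) (q / p) (\<lambda>k. mod_pow p ((1 / 2) ^ k) f) = W 0 + (\<Sum>k. W (Suc k))"
    by (simp add: wsum_def W_def[symmetric] add.commute)
  then show ?thesis using add_mono[OF 2 1] by simp
qed

section \<open>Dyadic cells and Haar expansions of integrable functions\<close>

definition cell :: "nat => ('n::finite => nat) => (real ^ 'n) set" where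
  "cell K i = dyadic_cube K (\<lambda>j. Suc (i j))"

definition cell_size :: "'n::finite itself => nat => real" where
  "cell_size _ K = 1 / 2 ^ (K * CARD('n))"

abbreviation cube_measure :: "(real ^ 'n::finite) measure" where
  "cube_measure \<equiv> lebesgue_on unit_cube"

lemma mem_cell: "x \<in> cell K i \<longleftrightarrow> (\<forall>j. real (i j) / 2 ^ K \<le> x $ j \<and> x $ j < (real (i j) + 1) / 2 ^ K)"
  by (simp add: cell_def dyadic_cube_def dyadic_interval_def add.commute)

lemma cell_borel [measurable]: "cell K i \<in> sets borel"
proof -
  have "cell K i = (\<Inter>j. {x. real (i j) / 2 ^ K \<le> x $ j \<and> x $ j < (real (i j) + 1) / 2 ^ K})"
    by (auto simp: mem_cell)
  also have "\<dots> \<in> sets borel"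
    by (intro sets.finite_INT) auto
  finally show ?thesis .
qed

lemma cell_lebesgue [simp]: "cell K i \<in> sets lebesgue"
  using cell_borel[of K i] by (metis sets_completionI_sets sets_lborel)

lemma measure_cbox_cart:
  fixes a b :: "real ^ 'n::finite"
  assumes "\<And>j. a $ j \<le> b $ j"
  shows "emeasure lebesgue (cbox a b) = ennreal (\<Prod>j\<in>UNIV. b $ j - a $ j)"
    "emeasure lebesgue (box a b) = ennreal (\<Prod>j\<in>UNIV. b $ j - a $ j)"
proof -
  have le: "a \<bullet> u \<le> b \<bullet> u" if "u \<in> Basis" for u
    using that assms by (auto simp: Basis_vec_def inner_axis)
  have ne: "cbox a b \<noteq> {}" using assms by (simp add: interval_ne_empty_cart)
  have "emeasure lborel (cbox a b) = ennreal (measure lborel (cbox a b))"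
    by (rule emeasure_eq_ennreal_measure) (metis emeasure_lborel_cbox_finite infinity_ennreal_def less_irrefl)
  also have "measure lborel (cbox a b) = (\<Prod>j\<in>UNIV. b $ j - a $ j)" by (rule content_cbox_cart[OF ne])
  finally have c: "emeasure lborel (cbox a b) = ennreal (\<Prod>j\<in>UNIV. b $ j - a $ j)" .
  then show "emeasure lebesgue (cbox a b) = ennreal (\<Prod>j\<in>UNIV. b $ j - a $ j)" by simp
  have "emeasure lborel (box a b) = emeasure lborel (cbox a b)"
    using le by (simp add: emeasure_lborel_box emeasure_lborel_cbox)
  then show "emeasure lebesgue (box a b) = ennreal (\<Prod>j\<in>UNIV. b $ j - a $ j)" using c by simp
qed

lemma emeasure_cell:
  fixes i :: "'n::finite => nat"
  shows "emeasure lebesgue (cell K i) = ennreal (cell_size TYPE('n) K)"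
proof -
  define a :: "real ^ 'n" where "a = (\<chi> j. real (i j) / 2 ^ K)"
  define b :: "real ^ 'n" where "b = (\<chi> j. (real (i j) + 1) / 2 ^ K)"
  have ab: "a $ j \<le> b $ j" for j by (simp add: a_def b_def divide_right_mono)
  have "(\<Prod>j\<in>UNIV. b $ j - a $ j) = (\<Prod>j\<in>(UNIV :: 'n set). 1 / 2 ^ K)"
    by (intro prod.cong) (auto simp: a_def b_def diff_divide_distrib[symmetric])
  also have "\<dots> = cell_size TYPE('n) K" by (simp add: cell_size_def power_one_over power_mult)
  finally have e: "(\<Prod>j\<in>UNIV. b $ j - a $ j) = cell_size TYPE('n) K" .
  have "cell K i \<subseteq> cbox a b" "box a b \<subseteq> cell K i"
    by (auto simp: mem_cell mem_box_cart a_def b_def less_imp_le)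
  then have "emeasure lebesgue (cell K i) \<le> emeasure lebesgue (cbox a b)"
    "emeasure lebesgue (box a b) \<le> emeasure lebesgue (cell K i)"
    by (auto intro!: emeasure_mono)
  then show ?thesis unfolding measure_cbox_cart[OF ab] e by (rule order_antisym)
qed

lemma cell_subset_cube:
  fixes i :: "'n::finite => nat"
  assumes i: "i \<in> grid K"
  shows "cell K i \<subseteq> unit_cube"
proof
  fix x :: "real ^ 'n"
  assume x: "x \<in> cell K i"
  have "0 \<le> x $ j \<and> x $ j \<le> 1" for j
  proof -
    have "real (Suc (i j)) \<le> real (2 ^ K)" using i by (subst of_nat_le_iff) (simp add: mem_grid Suc_le_eq)
    then have "(real (i j) + 1) / 2 ^ K \<le> 1" by (simp add: add.commute)
    moreover have "0 \<le> real (i j) / 2 ^ K" by simp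
    ultimately show ?thesis using x unfolding mem_cell by (metis less_imp_le order_trans)
  qed
  then show "x \<in> unit_cube" by (simp add: unit_cube_def mem_box_cart)
qed

lemma cell_unique:
  assumes "x \<in> cell K i" "x \<in> cell K i'"
  shows "i = i'"
proof
  fix j
  have "real (i j) / 2 ^ K < (real (i' j) + 1) / 2 ^ K" "real (i' j) / 2 ^ K < (real (i j) + 1) / 2 ^ K"
    using assms unfolding mem_cell by (metis le_less_trans)+
  then have "real (i j) < real (i' j) + 1" "real (i' j) < real (i j) + 1"
    by (simp_all add: divide_less_cancel)
  then show "i j = i' j" by linarith
qed

lemma cell_exists:
  assumes "x \<in> unit_cube" "\<forall>j. x $ j \<noteq> 1"
  shows "\<exists>i\<in>grid K. x \<in> cell K i"
proof -
  define i where "i j = nat \<lfloor>2 ^ K * x $ j\<rfloor>" for j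
  have x: "0 \<le> x $ j" "x $ j < 1" for j
    using assms by (auto simp: unit_cube_def mem_box_cart less_le)
  have ri: "real (i j) = of_int \<lfloor>2 ^ K * x $ j\<rfloor>" for j
    using x(1)[of j] by (simp add: i_def)
  have "real (i j) \<le> 2 ^ K * x $ j" "2 ^ K * x $ j < real (i j) + 1" for j
    unfolding ri by linarith+
  then have 1: "real (i j) / 2 ^ K \<le> x $ j" "x $ j < (real (i j) + 1) / 2 ^ K" for j
    by (simp_all add: field_simps)
  have "real (i j) < real (2 ^ K)" for j
  proof -
    have "2 ^ K * x $ j < 2 ^ K * 1" using x(2)[of j] by (intro mult_strict_left_mono) auto
    moreover have "real (i j) \<le> 2 ^ K * x $ j" unfolding ri by linarith
    ultimately have "real (i j) < 2 ^ K" by linarith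
    then show ?thesis by (simp only: of_nat_power of_nat_numeral)
  qed
  then have "i j < 2 ^ K" for j by (subst of_nat_less_iff[symmetric])
  then have "i \<in> grid K" by (simp add: mem_grid)
  moreover have "x \<in> cell K i" using 1 by (simp add: mem_cell)
  ultimately show ?thesis by blast
qed

lemma AE_cell:
  "AE x :: real ^ 'n::finite in lebesgue. x \<in> unit_cube --> (\<exists>i\<in>grid K. x \<in> cell K i)"
proof -
  have "negligible (\<Union>j. {x :: real ^ 'n. x $ j = 1})"
    using negligible_standard_hyperplane[of "axis j 1 :: real ^ 'n" 1 for j]
    by (intro negligible_Union) (auto simp: cart_eq_inner_axis)
  then have "(\<Union>j. {x :: real ^ 'n. x $ j = 1}) \<in> null_sets lebesgue"
    by (simp add: negligible_iff_null_sets)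
  then show ?thesis
    by (rule AE_I') (use cell_exists in blast)
qed

lemma AE_cube_cell: "AE x in cube_measure. \<exists>i\<in>grid K. x \<in> cell K i"
  using AE_cell[of K] by (simp add: AE_restrict_space_iff)

lemma cube_measure_finite: "emeasure cube_measure (space (cube_measure :: (real ^ 'n::finite) measure)) = 1"
proof -
  have "emeasure lebesgue (cbox 0 1 :: (real ^ 'n) set) = ennreal (\<Prod>j\<in>(UNIV :: 'n set). (1 :: real ^ 'n) $ j - (0 :: real ^ 'n) $ j)"
    by (rule measure_cbox_cart) simp
  then show ?thesis by (simp add: emeasure_restrict_space space_restrict_space unit_cube_def)
qed

lemma finite_measure_cube: "finite_measure (cube_measure :: (real ^ 'n::finite) measure)"
  by (rule finite_measureI, subst cube_measure_finite) simp

lemma cell_sets_cube: "i \<in> grid K ==> cell K i \<in> sets cube_measure"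
  using cell_subset_cube[of i K] by (simp add: sets_restrict_space_iff)

lemma measure_cell_cube:
  fixes i :: "'n::finite => nat"
  assumes "i \<in> grid K"
  shows "measure cube_measure (cell K i) = cell_size TYPE('n) K"
  using emeasure_cell[of K i] cell_subset_cube[OF assms]
  by (simp add: measure_def emeasure_restrict_space cell_size_def)

lemma integral_indicator_cell:
  fixes i :: "'n::finite => nat"
  assumes "i \<in> grid K"
  shows "(\<integral>x. indicator (cell K i) x * 1 \<partial>cube_measure) = cell_size TYPE('n) K"
proof -
  have "cell K i \<inter> unit_cube = cell K i" using cell_subset_cube[OF assms] by blast
  then show ?thesis using measure_cell_cube[OF assms] by simp
qed

lemma cell_size_pos: "0 < cell_size TYPE('n::finite) K"
  by (simp add: cell_size_def)

lemma sum_indicator_cells: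
  assumes "i \<in> grid K" "x \<in> cell K i"
  shows "(\<Sum>i'\<in>grid K. indicator (cell K i') x * v i') = (v i :: real)"
proof -
  have "(\<Sum>i'\<in>grid K. indicator (cell K i') x * v i') = (\<Sum>i'\<in>grid K. if i' = i then v i else 0)"
    using cell_unique assms by (intro sum.cong) (auto simp: indicator_def)
  then show ?thesis using assms by simp
qed

lemma integral_cells:
  fixes \<phi> :: "real ^ 'n::finite => real"
  assumes "integrable cube_measure \<phi>"
  shows "integral\<^sup>L cube_measure \<phi> = (\<Sum>i\<in>grid K. \<integral>x. indicator (cell K i) x * \<phi> x \<partial>cube_measure)"
proof -
  have i: "integrable cube_measure (\<lambda>x. indicator (cell K i) x * \<phi> x)" if "i \<in> grid K" for i
    using integrable_mult_indicator[OF cell_sets_cube[OF that] assms] by simp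
  have "integral\<^sup>L cube_measure \<phi> = (\<integral>x. (\<Sum>i\<in>grid K. indicator (cell K i) x * \<phi> x) \<partial>cube_measure)"
  proof (rule integral_cong_AE)
    show "AE x in cube_measure. \<phi> x = (\<Sum>i\<in>grid K. indicator (cell K i) x * \<phi> x)"
      using AE_cube_cell[of K]
    proof eventually_elim
      case (elim x)
      then obtain i where "i \<in> grid K" "x \<in> cell K i" by blast
      from sum_indicator_cells[OF this, of "\<lambda>_. \<phi> x"] show ?case by simp
    qed
    show "(\<lambda>x. \<Sum>i\<in>grid K. indicator (cell K i) x * \<phi> x) \<in> borel_measurable cube_measure"
      using i by (intro borel_measurable_sum) auto
  qed (use assms in auto)
  also have "\<dots> = (\<Sum>i\<in>grid K. \<integral>x. indicator (cell K i) x * \<phi> x \<partial>cube_measure)"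
    using i by (rule Bochner_Integration.integral_sum)
  finally show ?thesis .
qed

lemma integral_cell_const:
  fixes g \<phi> :: "real ^ 'n::finite => real"
  assumes "\<And>x. x \<in> cell K i ==> g x = c"
  shows "(\<integral>x. indicator (cell K i) x * (g x * \<phi> x) \<partial>cube_measure) = c * (\<integral>x. indicator (cell K i) x * \<phi> x \<partial>cube_measure)"
proof -
  have "indicator (cell K i) x * (g x * \<phi> x) = c * (indicator (cell K i) x * \<phi> x)" for x
    using assms by (auto simp: indicator_def)
  then show ?thesis by (simp only: integral_mult_right_zero)
qed

lemma haar_borel [measurable]: "haar m \<in> borel_measurable borel"
  by (cases "m \<le> 1") (simp_all add: haar_def Let_def dyadic_interval_def)

lemma tensor_haar_borel [measurable]:
  fixes m :: "'n::finite => nat"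
  shows "tensor_haar m \<in> borel_measurable borel"
proof -
  have "(\<lambda>x :: real ^ 'n. haar (m j) (x $ j)) \<in> borel_measurable borel" for j
    by (rule measurable_compose[OF _ haar_borel]) (simp add: borel_measurable_continuous_onI continuous_intros)
  then show ?thesis unfolding tensor_haar_def[abs_def] by (intro borel_measurable_prod) auto
qed

lemma borel_imp_cube_measurable: "f \<in> borel_measurable borel ==> f \<in> borel_measurable cube_measure"
  by (intro measurable_restrict_space1 measurable_completion) simp

lemma tensor_haar_cube: "tensor_haar m \<in> borel_measurable cube_measure"
  by (intro borel_imp_cube_measurable tensor_haar_borel)

lemma abs_tensor_haar_le_1: "\<bar>tensor_haar m x\<bar> \<le> 1"
proof -
  have "\<bar>haar (m j) (x $ j)\<bar> \<le> 1" for j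
    using haar_values[of "m j" "x $ j"] by auto
  then show ?thesis unfolding tensor_haar_def abs_prod by (intro prod_le_1) auto
qed

lemma tensor_haar_cell:
  assumes "m \<in> haar_box K" "i \<in> grid K" "x \<in> cell K i"
  shows "tensor_haar m x = th K m i"
  unfolding tensor_haar_def th_def using assms
  by (intro prod.cong refl haar_cell) (auto simp: mem_haar_box mem_grid mem_cell)

section \<open>Haar coefficients, partial sums and cell averages\<close>

definition hcoef :: "('n::finite => nat) => (real ^ 'n => real) => real" where
  "hcoef m f = tensor_weight m * (\<integral>x. tensor_haar m x * f x \<partial>cube_measure)"

definition haar_sum :: "('n::finite => nat) set => (real ^ 'n => real) => real ^ 'n => real" where
  "haar_sum A f x = (\<Sum>m\<in>A. hcoef m f * tensor_haar m x)"

definition cell_avg :: "nat => (real ^ 'n::finite => real) => ('n => nat) => real" where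
  "cell_avg K f i = (\<integral>x. indicator (cell K i) x * f x \<partial>cube_measure) / cell_size TYPE('n) K"

lemma integrable_haar_mult:
  fixes f :: "real ^ 'n::finite => real"
  assumes "integrable cube_measure f"
  shows "integrable cube_measure (\<lambda>x. tensor_haar m x * f x)"
proof (rule Bochner_Integration.integrable_bound[OF assms])
  show "(\<lambda>x. tensor_haar m x * f x) \<in> borel_measurable cube_measure"
    using assms tensor_haar_cube by (intro borel_measurable_times) auto
  show "AE x in cube_measure. norm (tensor_haar m x * f x) \<le> norm (f x)"
    using abs_tensor_haar_le_1[of m] by (intro AE_I2) (simp add: abs_mult mult_left_le_one_le)
qed

text \<open>A tensor Haar function with index in \<open>haar_box K\<close> is constant on the cells
  of level K, so it sees only the averages of f. This is the bridge from functions on the cube to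
  functions on the grid.\<close>

lemma hcoef_grid:
  fixes f :: "real ^ 'n::finite => real"
  assumes "integrable cube_measure f" "m \<in> haar_box K"
  shows "hcoef m f = tensor_weight m * ((\<Sum>i\<in>grid K. th K m i * cell_avg K f i) / 2 ^ (K * CARD('n)))"
proof -
  have "(\<integral>x. tensor_haar m x * f x \<partial>cube_measure)
      = (\<Sum>i\<in>grid K. \<integral>x. indicator (cell K i) x * (tensor_haar m x * f x) \<partial>cube_measure)"
    by (rule integral_cells[OF integrable_haar_mult[OF assms(1)]])
  also have "\<dots> = (\<Sum>i\<in>grid K. th K m i * (\<integral>x. indicator (cell K i) x * f x \<partial>cube_measure))"
    by (intro sum.cong refl integral_cell_const tensor_haar_cell[OF assms(2)])
  also have "\<dots> = (\<Sum>i\<in>grid K. th K m i * cell_avg K f i) / 2 ^ (K * CARD('n))"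
    by (simp add: cell_avg_def cell_size_def sum_divide_distrib)
  finally show ?thesis by (simp add: hcoef_def)
qed

lemma haar_sum_cell:
  fixes f :: "real ^ 'n::finite => real"
  assumes "integrable cube_measure f" "A \<subseteq> haar_box K" "i \<in> grid K" "x \<in> cell K i"
  shows "haar_sum A f x = grid_proj K A (cell_avg K f) i"
  unfolding haar_sum_def grid_proj_def
proof (rule sum.cong[OF refl])
  fix m assume "m \<in> A"
  then have m: "m \<in> haar_box K" using assms by auto
  show "hcoef m f * tensor_haar m x
    = tensor_weight m * ((\<Sum>i'\<in>grid K. th K m i' * cell_avg K f i') / 2 ^ (K * CARD('n))) * th K m i"
    unfolding hcoef_grid[OF assms(1) m] tensor_haar_cell[OF m assms(3,4)] ..
qed

text \<open>Box partial sums are thus the conditional expectations with respect to the cells of a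
  level.\<close>

lemma haar_sum_box_cell:
  fixes f :: "real ^ 'n::finite => real"
  assumes "integrable cube_measure f" "i \<in> grid K" "x \<in> cell K i"
  shows "haar_sum (haar_box K) f x = cell_avg K f i"
  using haar_sum_cell[OF assms(1) order_refl assms(2,3)] grid_proj_box[OF assms(2)] by simp

lemma haar_sum_measurable: "haar_sum A f \<in> borel_measurable borel"
  unfolding haar_sum_def[abs_def] by measurable

lemma step_Lp:
  fixes g :: "real ^ 'n::finite => real"
  assumes "0 < p" "g \<in> borel_measurable cube_measure" "\<And>i x. i \<in> grid K ==> x \<in> cell K i ==> g x = v i"
  shows "g \<in> Lp_space p unit_cube" "lp_int p unit_cube g = (\<Sum>i\<in>grid K. \<bar>v i\<bar> powr p) * cell_size TYPE('n) K"
proof -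
  interpret finite_measure "cube_measure :: (real ^ 'n) measure" by (rule finite_measure_cube)
  have m: "(\<lambda>x. \<bar>g x\<bar> powr p) \<in> borel_measurable cube_measure" using assms(2) by measurable
  have "AE x in cube_measure. norm (\<bar>g x\<bar> powr p) \<le> (\<Sum>i\<in>grid K. \<bar>v i\<bar> powr p)"
    using AE_cube_cell[of K]
  proof eventually_elim
    case (elim x)
    then obtain i where i: "i \<in> grid K" "x \<in> cell K i" by blast
    have "\<bar>v i\<bar> powr p \<le> (\<Sum>i\<in>grid K. \<bar>v i\<bar> powr p)"
      by (rule member_le_sum) (use i in auto)
    then show ?case using assms(3)[OF i] by simp
  qed
  then have int: "integrable cube_measure (\<lambda>x. \<bar>g x\<bar> powr p)"
    using m by (rule integrable_const_bound)
  then show "g \<in> Lp_space p unit_cube" using assms(2) by (simp add: Lp_space_def)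
  have "lp_int p unit_cube g = (\<Sum>i\<in>grid K. \<integral>x. indicator (cell K i) x * (\<bar>g x\<bar> powr p * 1) \<partial>cube_measure)"
    using integral_cells[OF int, of K] by (simp add: lp_int_def)
  also have "\<dots> = (\<Sum>i\<in>grid K. \<bar>v i\<bar> powr p * (\<integral>x. indicator (cell K i) x * 1 \<partial>cube_measure))"
    by (intro sum.cong refl integral_cell_const) (simp add: assms(3))
  also have "\<dots> = (\<Sum>i\<in>grid K. \<bar>v i\<bar> powr p) * cell_size TYPE('n) K"
    unfolding sum_distrib_right by (intro sum.cong refl) (simp only: integral_indicator_cell)
  finally show "lp_int p unit_cube g = (\<Sum>i\<in>grid K. \<bar>v i\<bar> powr p) * cell_size TYPE('n) K" .
qed

text \<open>Jensen's inequality with the additional constant \<open>2 powr p\<close>, together with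
  integrability of f. Both come from the elementary bound |f| \<le> a + a^(1-p) |f|^p for any a > 0,
  which separates the values of f below a from those above.\<close>

lemma powr_average_le:
  fixes f :: "'a => real"
  assumes "finite_measure M" "1 \<le> p" "f \<in> borel_measurable M" "integrable M (\<lambda>x. \<bar>f x\<bar> powr p)"
  shows "integrable M f"
    "A \<in> sets M ==> 0 < measure M A ==>
      \<bar>(\<integral>x. indicator A x * f x \<partial>M) / measure M A\<bar> powr p \<le> 2 powr p * ((\<integral>x. indicator A x * \<bar>f x\<bar> powr p \<partial>M) / measure M A)"
proof -
  interpret finite_measure M by fact
  have le: "\<bar>f x\<bar> \<le> a + a powr (1 - p) * \<bar>f x\<bar> powr p" if "0 < a" for a x
  proof (cases "\<bar>f x\<bar> \<le> a")
    case False
    then have "a powr (p - 1) \<le> \<bar>f x\<bar> powr (p - 1)" using that assms by (intro powr_mono2) auto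
    then have "a powr (1 - p) * (a powr (p - 1) * \<bar>f x\<bar>) \<le> a powr (1 - p) * (\<bar>f x\<bar> powr (p - 1) * \<bar>f x\<bar>)"
      by (intro mult_left_mono mult_right_mono) auto
    moreover have "a powr (1 - p) * a powr (p - 1) = 1" using that by (simp flip: powr_add)
    moreover have "\<bar>f x\<bar> powr (p - 1) * \<bar>f x\<bar> = \<bar>f x\<bar> powr p"
      using powr_mult_base[of "\<bar>f x\<bar>" "p - 1"] by (simp add: mult.commute)
    ultimately have "\<bar>f x\<bar> \<le> a powr (1 - p) * \<bar>f x\<bar> powr p" by (simp add: mult.assoc[symmetric])
    then show ?thesis using that by simp
  qed (simp add: add_increasing2)
  show int: "integrable M f"
  proof (rule Bochner_Integration.integrable_bound)
    show "integrable M (\<lambda>x. 1 + 1 powr (1 - p) * \<bar>f x\<bar> powr p)"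
      using assms by (intro Bochner_Integration.integrable_add integrable_mult_right) auto
    show "AE x in M. norm (f x) \<le> norm (1 + 1 powr (1 - p) * \<bar>f x\<bar> powr p)"
      using le[of 1] by (intro AE_I2) simp
  qed fact
  assume A: "A \<in> sets M" "0 < measure M A"
  define E where "E = (\<integral>x. indicator A x * \<bar>f x\<bar> powr p \<partial>M) / measure M A"
  have E0: "0 \<le> E" unfolding E_def using A by (intro divide_nonneg_pos integral_nonneg_AE) auto
  have iA: "integrable M (\<lambda>x. indicator A x * f x)" "integrable M (\<lambda>x. indicator A x * \<bar>f x\<bar> powr p)"
    using integrable_mult_indicator[OF A(1) int] integrable_mult_indicator[OF A(1) assms(4)] by simp_all
  have iA1: "integrable M (\<lambda>x. indicator A x :: real)"
    by (rule integrable_real_indicator) (use A in \<open>auto simp: less_top[symmetric]\<close>)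
  have avg: "\<bar>(\<integral>x. indicator A x * f x \<partial>M) / measure M A\<bar> \<le> a + a powr (1 - p) * E" if a: "0 < a" for a
  proof -
    have "\<bar>\<integral>x. indicator A x * f x \<partial>M\<bar> \<le> (\<integral>x. \<bar>indicator A x * f x\<bar> \<partial>M)" by (rule integral_abs_bound)
    also have "\<dots> \<le> (\<integral>x. a * indicator A x + a powr (1 - p) * (indicator A x * \<bar>f x\<bar> powr p) \<partial>M)"
    proof (rule integral_mono)
      show "integrable M (\<lambda>x. a * indicator A x + a powr (1 - p) * (indicator A x * \<bar>f x\<bar> powr p))"
        using iA iA1 by (intro Bochner_Integration.integrable_add integrable_mult_right) auto
      show "\<bar>indicator A x * f x\<bar> \<le> a * indicator A x + a powr (1 - p) * (indicator A x * \<bar>f x\<bar> powr p)" for x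
        using le[OF a, of x] by (auto simp: indicator_def)
    qed (use iA in auto)
    also have "\<dots> = a * measure M A + a powr (1 - p) * (\<integral>x. indicator A x * \<bar>f x\<bar> powr p \<partial>M)"
      using iA iA1 A by (subst Bochner_Integration.integral_add) auto
    finally show ?thesis using A by (simp add: E_def field_simps)
  qed
  show "\<bar>(\<integral>x. indicator A x * f x \<partial>M) / measure M A\<bar> powr p \<le> 2 powr p * ((\<integral>x. indicator A x * \<bar>f x\<bar> powr p \<partial>M) / measure M A)"
  proof (cases "E = 0")
    \<comment> \<open>For E = 0 the choice of a below degenerates; letting a tend to 0 shows that
      the average vanishes.\<close>
    case True
    then have "\<bar>(\<integral>x. indicator A x * f x \<partial>M) / measure M A\<bar> \<le> 0 + a" if "0 < a" for a
      using avg[OF that] by simp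
    then have "\<bar>(\<integral>x. indicator A x * f x \<partial>M) / measure M A\<bar> \<le> 0" by (rule field_le_epsilon)
    then have "\<bar>(\<integral>x. indicator A x * f x \<partial>M) / measure M A\<bar> powr p = 0" by (simp only: abs_le_zero_iff abs_zero powr_0)
    then show ?thesis using E0 by (simp only: E_def[symmetric]) simp
  next
    case False
    then have E: "0 < E" using E0 by simp
    \<comment> \<open>With a = E^(1/p) the two terms of the bound are equal, which explains the
      constant 2.\<close>
    have "(E powr (1 / p)) powr (1 - p) * E = E powr ((1 - p) / p) * E powr 1"
      using E by (simp add: powr_powr)
    also have "\<dots> = E powr (1 / p)"
    proof -
      have "(1 - p) / p + 1 = 1 / p" using assms by (simp add: field_simps)
      then show ?thesis by (simp only: powr_add[symmetric])
    qed
    finally have "\<bar>(\<integral>x. indicator A x * f x \<partial>M) / measure M A\<bar> \<le> 2 * E powr (1 / p)"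
      using avg[of "E powr (1 / p)"] E by simp
    then have "\<bar>(\<integral>x. indicator A x * f x \<partial>M) / measure M A\<bar> powr p \<le> (2 * E powr (1 / p)) powr p"
      using assms by (intro powr_mono2) auto
    also have "\<dots> = 2 powr p * E" using E assms by (simp add: powr_mult powr_powr)
    finally show ?thesis by (simp add: E_def)
  qed
qed

lemma Lp_integrable:
  assumes "1 \<le> p" "f \<in> Lp_space p unit_cube"
  shows "integrable cube_measure f"
  by (rule powr_average_le(1)[OF finite_measure_cube assms(1)]) (use assms in \<open>auto simp: Lp_space_def\<close>)

lemma sum_cell_avg_powr:
  fixes f :: "real ^ 'n::finite => real"
  assumes "1 \<le> p" "f \<in> Lp_space p unit_cube"
  shows "(\<Sum>i\<in>grid K. \<bar>cell_avg K f i\<bar> powr p) * cell_size TYPE('n) K \<le> 2 powr p * lp_int p unit_cube f"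
proof -
  have f: "f \<in> borel_measurable cube_measure" "integrable cube_measure (\<lambda>x. \<bar>f x\<bar> powr p)"
    using assms by (auto simp: Lp_space_def)
  have "(\<Sum>i\<in>grid K. \<bar>cell_avg K f i\<bar> powr p) * cell_size TYPE('n) K
      \<le> (\<Sum>i\<in>grid K. 2 powr p * ((\<integral>x. indicator (cell K i) x * \<bar>f x\<bar> powr p \<partial>cube_measure) / cell_size TYPE('n) K)) * cell_size TYPE('n) K"
  proof (intro mult_right_mono sum_mono)
    fix i :: "'n => nat" assume i: "i \<in> grid K"
    show "\<bar>cell_avg K f i\<bar> powr p \<le> 2 powr p * ((\<integral>x. indicator (cell K i) x * \<bar>f x\<bar> powr p \<partial>cube_measure) / cell_size TYPE('n) K)"
      using powr_average_le(2)[OF finite_measure_cube assms(1) f cell_sets_cube[OF i]] cell_size_pos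
      unfolding cell_avg_def measure_cell_cube[OF i] by blast
  qed (use cell_size_pos[where 'n = 'n] in \<open>simp add: less_imp_le\<close>)
  also have "\<dots> = 2 powr p * (\<Sum>i\<in>grid K. \<integral>x. indicator (cell K i) x * \<bar>f x\<bar> powr p \<partial>cube_measure)"
    using cell_size_pos[where 'n = 'n and K = K] by (simp add: sum_distrib_left sum_distrib_right)
  also have "(\<Sum>i\<in>grid K. \<integral>x. indicator (cell K i) x * \<bar>f x\<bar> powr p \<partial>cube_measure) = lp_int p unit_cube f"
    unfolding lp_int_def by (rule integral_cells[OF f(2), symmetric])
  finally show ?thesis .
qed

text \<open>On each cell the partial sum takes the value of the grid projection of the averages of
  f, and the averages have a p-th power mean of at most \<open>2 powr p\<close> times that of f; so
  grid bounds transfer to L_p of the cube.\<close>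

lemma haar_sum_bounded:
  fixes f :: "real ^ 'n::finite => real"
  assumes "1 \<le> p" "f \<in> Lp_space p unit_cube" "A \<subseteq> haar_box K" "0 \<le> C"
    and "\<And>F :: ('n => nat) => real. (\<Sum>i\<in>grid K. \<bar>grid_proj K A F i\<bar> powr p) \<le> C * (\<Sum>i\<in>grid K. \<bar>F i\<bar> powr p)"
  shows "haar_sum A f \<in> Lp_space p unit_cube" "lp_int p unit_cube (haar_sum A f) \<le> C * 2 powr p * lp_int p unit_cube f"
proof -
  have p: "0 < p" using assms by simp
  note S = step_Lp[OF p borel_imp_cube_measurable[OF haar_sum_measurable] haar_sum_cell[OF Lp_integrable[OF assms(1,2)] assms(3)]]
  show "haar_sum A f \<in> Lp_space p unit_cube" by (rule S(1))
  have "lp_int p unit_cube (haar_sum A f) = (\<Sum>i\<in>grid K. \<bar>grid_proj K A (cell_avg K f) i\<bar> powr p) * cell_size TYPE('n) K"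
    by (rule S(2))
  also have "\<dots> \<le> C * (\<Sum>i\<in>grid K. \<bar>cell_avg K f i\<bar> powr p) * cell_size TYPE('n) K"
    using assms(5) cell_size_pos[where 'n = 'n and K = K] by (intro mult_right_mono) auto
  also have "\<dots> \<le> C * (2 powr p * lp_int p unit_cube f)"
    unfolding mult.assoc using assms by (intro mult_left_mono sum_cell_avg_powr) auto
  finally show "lp_int p unit_cube (haar_sum A f) \<le> C * 2 powr p * lp_int p unit_cube f" by (simp add: mult.assoc)
qed

lemma haar_sum_box_bounded:
  fixes f :: "real ^ 'n::finite => real"
  assumes "1 \<le> p" "f \<in> Lp_space p unit_cube"
  shows "haar_sum (haar_box K) f \<in> Lp_space p unit_cube"
    "lp_int p unit_cube (haar_sum (haar_box K) f) \<le> 2 powr p * lp_int p unit_cube f"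
proof -
  have "(\<Sum>i\<in>grid K. \<bar>grid_proj K (haar_box K) F i\<bar> powr p) \<le> 1 * (\<Sum>i\<in>grid K. \<bar>F i\<bar> powr p)" for F :: "('n => nat) => real"
    by (simp add: grid_proj_box cong: sum.cong)
  note H = haar_sum_bounded[OF assms order_refl zero_le_one this]
  show "haar_sum (haar_box K) f \<in> Lp_space p unit_cube" by (rule H(1))
  show "lp_int p unit_cube (haar_sum (haar_box K) f) \<le> 2 powr p * lp_int p unit_cube f" using H(2) by simp
qed

lemma haar_index_in_box:
  fixes B :: "('n::finite => nat) set"
  assumes "finite B" "\<And>m j. m \<in> B ==> 1 \<le> m j"
  shows "\<exists>K. \<forall>k\<ge>K. B \<subseteq> haar_box k"
proof -
  define N where "N = Max (insert 0 ((\<lambda>(m, j). m j) ` (B \<times> UNIV)))"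
  have N: "m j \<le> N" if "m \<in> B" for m j
    unfolding N_def using assms(1) that by (intro Max_ge) (auto intro!: image_eqI[of _ _ "(m, j)"])
  have "B \<subseteq> haar_box k" if "k \<ge> N" for k
  proof
    fix m assume m: "m \<in> B"
    have "m j \<le> 2 ^ k" for j
      using N[OF m, of j] that less_exp[of k] by linarith
    then show "m \<in> haar_box k" using assms(2)[OF m] by (simp add: mem_haar_box)
  qed
  then show ?thesis by blast
qed

lemma haar_box_mono: "K \<le> K' ==> haar_box K \<subseteq> haar_box K'"
proof
  fix m :: "'a => nat"
  assume "K \<le> K'" "m \<in> haar_box K"
  moreover have "(2::nat) ^ K \<le> 2 ^ K'" using \<open>K \<le> K'\<close> by (rule power_increasing) simp
  ultimately show "m \<in> haar_box K'" unfolding mem_haar_box by (meson order_trans)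
qed

lemma tensor_haar_integrable: "integrable cube_measure (tensor_haar m :: real ^ 'n::finite => real)"
proof -
  interpret finite_measure "cube_measure :: (real ^ 'n) measure" by (rule finite_measure_cube)
  show ?thesis
    by (rule integrable_const_bound[where B = 1]) (use abs_tensor_haar_le_1 tensor_haar_cube in auto)
qed

lemma cell_avg_tensor_haar:
  fixes m :: "'n::finite => nat"
  assumes "m \<in> haar_box K" "i \<in> grid K"
  shows "cell_avg K (tensor_haar m) i = th K m i"
proof -
  have "(\<integral>x. indicator (cell K i) x * (tensor_haar m x * 1) \<partial>cube_measure) = th K m i * (\<integral>x. indicator (cell K i) x * 1 \<partial>cube_measure)"
    by (rule integral_cell_const) (rule tensor_haar_cell[OF assms])
  then show ?thesis
    unfolding integral_indicator_cell[OF assms(2)] using cell_size_pos[where 'n = 'n and K = K]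
    by (simp add: cell_avg_def)
qed

lemma hcoef_tensor_haar:
  fixes m m' :: "'n::finite => nat"
  assumes "\<And>j. 1 \<le> m j" "\<And>j. 1 \<le> m' j"
  shows "hcoef m (tensor_haar m') = (if m = m' then 1 else 0)"
proof -
  obtain K where "{m, m'} \<subseteq> haar_box K" using haar_index_in_box[of "{m, m'}"] assms by auto
  then have K: "m \<in> haar_box K" "m' \<in> haar_box K" by auto
  have "(\<Sum>i\<in>grid K. th K m i * cell_avg K (tensor_haar m') i) = (\<Sum>i\<in>grid K. th K m i * th K m' i)"
    by (intro sum.cong refl) (simp add: cell_avg_tensor_haar[OF K(2)])
  then show ?thesis
    unfolding hcoef_grid[OF tensor_haar_integrable K(1)] th_orthogonal[OF K]
    using tensor_weight_pos[of m'] by simp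
qed

lemma hcoef_diff:
  assumes "integrable cube_measure f" "integrable cube_measure g"
  shows "hcoef m (\<lambda>x. f x - g x) = hcoef m f - hcoef m g"
  using integrable_haar_mult[OF assms(1)] integrable_haar_mult[OF assms(2)]
  by (simp add: hcoef_def right_diff_distrib)

lemma hcoef_lincomb:
  fixes c :: "('n::finite => nat) => real"
  assumes "finite B" "\<And>m j. m \<in> B ==> 1 \<le> m j" "\<And>j. 1 \<le> m' j"
  shows "hcoef m' (\<lambda>x. \<Sum>m\<in>B. c m * tensor_haar m x) = (if m' \<in> B then c m' else 0)"
proof -
  have "(\<integral>x. tensor_haar m' x * (\<Sum>m\<in>B. c m * tensor_haar m x) \<partial>cube_measure)
      = (\<integral>x. (\<Sum>m\<in>B. c m * (tensor_haar m' x * tensor_haar m x)) \<partial>cube_measure)"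
    by (simp add: sum_distrib_left mult_ac)
  also have "\<dots> = (\<Sum>m\<in>B. c m * (\<integral>x. tensor_haar m' x * tensor_haar m x \<partial>cube_measure))"
    by (subst Bochner_Integration.integral_sum)
       (auto intro!: integrable_mult_right integrable_haar_mult tensor_haar_integrable)
  finally have "hcoef m' (\<lambda>x. \<Sum>m\<in>B. c m * tensor_haar m x) = (\<Sum>m\<in>B. c m * hcoef m' (tensor_haar m))"
    by (simp add: hcoef_def sum_distrib_left mult_ac)
  also have "\<dots> = (\<Sum>m\<in>B. if m = m' then c m' else 0)"
    using assms by (intro sum.cong refl) (simp add: hcoef_tensor_haar)
  finally show ?thesis using assms by simp
qed

text \<open>By orthogonality the partial sum operators are commuting projections. This is what
  allows averages and partial sums to be interchanged later.\<close>

lemma haar_sum_haar_sum: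
  assumes "finite A" "finite B" "\<And>m j. m \<in> A \<union> B ==> 1 \<le> m j"
  shows "haar_sum A (haar_sum B f) = haar_sum (A \<inter> B) f"
proof
  fix x
  have "haar_sum A (haar_sum B f) x = (\<Sum>m\<in>A. if m \<in> B then hcoef m f * tensor_haar m x else 0)"
    unfolding haar_sum_def[of A] haar_sum_def[of B, abs_def]
    by (intro sum.cong refl, subst hcoef_lincomb) (use assms in auto)
  also have "\<dots> = haar_sum (A \<inter> B) f x"
    unfolding haar_sum_def using assms(1) by (simp add: sum.inter_restrict)
  finally show "haar_sum A (haar_sum B f) x = haar_sum (A \<inter> B) f x" .
qed

lemma haar_sum_diff:
  assumes "integrable cube_measure f" "integrable cube_measure g"
  shows "haar_sum A (\<lambda>x. f x - g x) = (\<lambda>x. haar_sum A f x - haar_sum A g x)"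
  by (simp add: haar_sum_def fun_eq_iff hcoef_diff[OF assms] left_diff_distrib sum_subtractf)

section \<open>Direct and inverse estimates\<close>

lemma lp_int_nn_integral:
  assumes "0 < p" "A \<in> sets lebesgue" "f \<in> Lp_space p A"
  shows "ennreal (lp_int p A f) = (\<integral>\<^sup>+x. ennreal (\<bar>f x\<bar> powr p) * indicator A x \<partial>lebesgue)"
proof -
  have "ennreal (lp_int p A f) = (\<integral>\<^sup>+x. ennreal (\<bar>f x\<bar> powr p) \<partial>lebesgue_on A)"
    unfolding lp_int_def using assms Lp_space_integrable
    by (intro nn_integral_eq_integral[symmetric]) auto
  also have "\<dots> = (\<integral>\<^sup>+x. ennreal (\<bar>f x\<bar> powr p) * indicator A x \<partial>lebesgue)"
    using assms by (intro nn_integral_restrict_space) auto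
  finally show ?thesis .
qed

lemma emeasure_slab:
  fixes a :: "real ^ 'n::finite"
  assumes "0 \<le> w" "0 < \<delta>"
  shows "emeasure lebesgue (cbox (\<chi> l. if l = j then u else a $ l) (\<chi> l. if l = j then u + w else a $ l + \<delta>))
     = ennreal (w / \<delta> * \<delta> ^ CARD('n))"
proof -
  have "emeasure lebesgue (cbox (\<chi> l. if l = j then u else a $ l) (\<chi> l. if l = j then u + w else a $ l + \<delta>))
     = ennreal (\<Prod>l\<in>UNIV. if l = j then w else \<delta>)"
    using assms by (subst measure_cbox_cart(1)) (auto intro!: arg_cong[of _ _ ennreal] prod.cong)
  also have "(\<Prod>l\<in>UNIV. if l = j then w else \<delta>) = w * (\<Prod>l\<in>UNIV - {j}. \<delta>)"
    by (subst prod.remove[of _ j]) (auto intro!: prod.cong)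
  also have "\<dots> = w / \<delta> * (\<delta> * (\<Prod>l\<in>UNIV - {j}. \<delta>))" using assms by simp
  also have "\<delta> * (\<Prod>l\<in>UNIV - {j}. \<delta>) = (\<Prod>l\<in>(UNIV :: 'n set). \<delta>)"
    by (subst (2) prod.remove[of _ j]) auto
  finally show ?thesis by simp
qed

text \<open>A point leaves the cell only if one of its coordinates crosses a face, so it lies in one
  of \<open>CARD('n)\<close> slabs, the j-th of thickness |y_j|. The bound holds for long shifts as
  well.\<close>

lemma emeasure_cell_leave:
  fixes y :: "real ^ 'n::finite"
  shows "emeasure lebesgue {x \<in> cell K i. x + y \<notin> cell K i}
    \<le> ennreal (real CARD('n) * 2 ^ K * norm y * cell_size TYPE('n) K)"
proof -
  define \<delta> :: real where "\<delta> = 1 / 2 ^ K"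
  have \<delta>: "0 < \<delta>" by (simp add: \<delta>_def)
  define a :: "real ^ 'n" where "a = (\<chi> j. real (i j) / 2 ^ K)"
  \<comment> \<open>The slab lies at the upper face if y_j is nonnegative and at the lower face
    otherwise; \<open>u\<close> is its lower end in direction j.\<close>
  define T where "T j = (let u = (if 0 \<le> y $ j then a $ j + \<delta> - y $ j else a $ j) in
    cbox (\<chi> l. if l = j then u else a $ l) (\<chi> l. if l = j then u + \<bar>y $ j\<bar> else a $ l + \<delta>))" for j
  have mem: "x \<in> cell K i \<longleftrightarrow> (\<forall>j. a $ j \<le> x $ j \<and> x $ j < a $ j + \<delta>)" for x
    by (simp add: mem_cell a_def \<delta>_def add_divide_distrib)
  have "{x \<in> cell K i. x + y \<notin> cell K i} \<subseteq> (\<Union>j. T j)"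
  proof
    fix x assume "x \<in> {x \<in> cell K i. x + y \<notin> cell K i}"
    then obtain j where x: "\<And>l. a $ l \<le> x $ l \<and> x $ l < a $ l + \<delta>"
      and j: "\<not> (a $ j \<le> x $ j + y $ j \<and> x $ j + y $ j < a $ j + \<delta>)" by (auto simp: mem)
    have "x \<in> T j"
      using x j by (auto simp: T_def Let_def mem_box_cart less_imp_le not_le not_less) (smt (verit) x)+
    then show "x \<in> (\<Union>j. T j)" by blast
  qed
  then have "emeasure lebesgue {x \<in> cell K i. x + y \<notin> cell K i} \<le> emeasure lebesgue (\<Union>j. T j)"
    by (intro emeasure_mono) (auto simp: T_def Let_def)
  also have "\<dots> \<le> (\<Sum>j\<in>UNIV. emeasure lebesgue (T j))"
    by (rule emeasure_subadditive_finite) (auto simp: T_def Let_def)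
  also have "\<dots> = (\<Sum>j\<in>UNIV. ennreal (\<bar>y $ j\<bar> / \<delta> * \<delta> ^ CARD('n)))"
    unfolding T_def Let_def using \<delta> by (intro sum.cong refl emeasure_slab) auto
  also have "\<dots> \<le> (\<Sum>j\<in>(UNIV :: 'n set). ennreal (norm y / \<delta> * \<delta> ^ CARD('n)))"
    using \<delta> by (intro sum_mono ennreal_leI mult_right_mono divide_right_mono component_le_norm_cart) auto
  also have "\<dots> = ennreal (real CARD('n) * (norm y / \<delta> * \<delta> ^ CARD('n)))"
    using \<delta> by (simp add: ennreal_of_nat_eq_real_of_nat flip: ennreal_mult)
  also have "real CARD('n) * (norm y / \<delta> * \<delta> ^ CARD('n)) = real CARD('n) * 2 ^ K * norm y * cell_size TYPE('n) K"
    by (simp add: \<delta>_def cell_size_def power_one_over power_mult[symmetric])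
  finally show ?thesis .
qed

text \<open>Points entering under the shift y are, after translation by y, the points that leave
  under the shift -y.\<close>

lemma emeasure_cell_enter:
  fixes y :: "real ^ 'n::finite"
  shows "emeasure lebesgue {x. x + y \<in> cell K i \<and> x \<notin> cell K i}
    \<le> ennreal (real CARD('n) * 2 ^ K * norm y * cell_size TYPE('n) K)"
proof -
  let ?B = "{x \<in> cell K i. x + (- y) \<notin> cell K i}"
  have B: "?B \<in> sets lebesgue"
  proof -
    have "?B = cell K i - (\<lambda>x. x + (- y)) -` cell K i \<inter> space lebesgue" by auto
    also have "\<dots> \<in> sets lebesgue"
      by (intro sets.Diff cell_lebesgue measurable_sets[OF translate_lebesgue(1)])
    finally show ?thesis .
  qed
  have "{x. x + y \<in> cell K i \<and> x \<notin> cell K i} = (\<lambda>x. x + y) -` ?B \<inter> space lebesgue" by auto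
  then have "emeasure lebesgue {x. x + y \<in> cell K i \<and> x \<notin> cell K i} = emeasure (distr lebesgue lebesgue (\<lambda>x. x + y)) ?B"
    using emeasure_distr[OF translate_lebesgue(1) B, of y] by simp
  also have "\<dots> = emeasure lebesgue ?B" by (simp only: translate_lebesgue(2))
  also have "\<dots> \<le> ennreal (real CARD('n) * 2 ^ K * norm y * cell_size TYPE('n) K)"
    using emeasure_cell_leave[of K i "- y"] by simp
  finally show ?thesis .
qed

text \<open>The difference vanishes unless x and x + y lie in different cells; such a point is
  charged to the cell it leaves and to the cell it enters, and the measure charged to a cell is of
  order 2^K |y| times its size. That |y| enters with the first power in an estimate of p-th powers
  is the reason for the range s < 1/p.\<close>

lemma step_inverse_estimate:
  fixes g :: "real ^ 'n::finite => real"
  assumes p: "0 < p" and g: "g \<in> borel_measurable cube_measure" "\<And>i x. i \<in> grid K ==> x \<in> cell K i ==> g x = v i"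
  shows "lp_int p (shifted_cube y) (difference y g)
    \<le> 2 powr p * (2 * real CARD('n)) * (2 ^ K * norm y) * lp_int p unit_cube g"
proof -
  define w where "w i = 2 powr p * \<bar>v i\<bar> powr p" for i
  have w: "0 \<le> w i" for i by (simp add: w_def)
  define A where "A i = {x \<in> cell K i. x + y \<notin> cell K i}" for i
  define B where "B i = {x. x + y \<in> cell K i \<and> x \<notin> cell K i}" for i
  have cy: "(\<lambda>x. x + y) -` cell K i \<inter> space lebesgue \<in> sets lebesgue" for i
    by (intro measurable_sets[OF translate_lebesgue(1)] cell_lebesgue)
  have AB: "A i \<in> sets lebesgue" "B i \<in> sets lebesgue" for i
  proof -
    have "A i = cell K i - (\<lambda>x. x + y) -` cell K i \<inter> space lebesgue" by (auto simp: A_def)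
    then show "A i \<in> sets lebesgue" using cy by (simp add: sets.Diff)
    have "B i = (\<lambda>x. x + y) -` cell K i \<inter> space lebesgue - cell K i" by (auto simp: B_def)
    then show "B i \<in> sets lebesgue" using cy by (simp add: sets.Diff)
  qed
  note gL = step_Lp[OF p g]
  have ae: "AE x in lebesgue. ennreal (\<bar>difference y g x\<bar> powr p) * indicator (shifted_cube y) x
      \<le> (\<Sum>i\<in>grid K. ennreal (w i) * (indicator (A i) x + indicator (B i) x))"
    using AE_cell[of K] AE_translate[OF AE_cell[of K], of y]
  proof eventually_elim
    case (elim x)
    show ?case
    proof (cases "x \<in> shifted_cube y")
      case True
      then obtain i i' where i: "i \<in> grid K" "x \<in> cell K i" and i': "i' \<in> grid K" "x + y \<in> cell K i'"
        using elim shifted_cubeD by blast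
      show ?thesis
      proof (cases "i = i'")
        case True
        then show ?thesis using g(2)[OF i] g(2)[OF i'] p by (simp add: difference_def)
      next
        case False
        then have x: "x \<in> A i" "x \<in> B i'"
          using i i' cell_unique by (auto simp: A_def B_def)
        have "\<bar>difference y g x\<bar> powr p \<le> (\<bar>v i'\<bar> + \<bar>v i\<bar>) powr p"
          using g(2)[OF i] g(2)[OF i'] p by (intro powr_mono2) (auto simp: difference_def)
        also have "\<dots> \<le> w i + w i'"
          using powr_add_le[of "\<bar>v i'\<bar>" "\<bar>v i\<bar>" p] p by (simp add: w_def algebra_simps)
        finally have "ennreal (\<bar>difference y g x\<bar> powr p) \<le> ennreal (w i) + ennreal (w i')"
          using w by (simp add: ennreal_leI flip: ennreal_plus)
        also have "\<dots> \<le> ennreal (w i) * (indicator (A i) x + indicator (B i) x) + ennreal (w i') * (indicator (A i') x + indicator (B i') x)"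
          using x by (intro add_mono) (auto simp: indicator_def distrib_left)
        also have "\<dots> = (\<Sum>i\<in>{i, i'}. ennreal (w i) * (indicator (A i) x + indicator (B i) x))"
          using False by simp
        also have "\<dots> \<le> (\<Sum>i\<in>grid K. ennreal (w i) * (indicator (A i) x + indicator (B i) x))"
          using i i' by (intro sum_mono2) auto
        finally show ?thesis using True by simp
      qed
    qed simp
  qed
  let ?c = "real CARD('n) * 2 ^ K * norm y * cell_size TYPE('n) K"
  have c0: "0 \<le> ?c" using cell_size_pos[where 'n = 'n and K = K] by simp
  have "ennreal (lp_int p (shifted_cube y) (difference y g))
     = (\<integral>\<^sup>+x. ennreal (\<bar>difference y g x\<bar> powr p) * indicator (shifted_cube y) x \<partial>lebesgue)"
    by (rule lp_int_nn_integral[OF p sets_shifted_cube difference_Lp(1)[OF p gL(1)]])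
  also have "\<dots> \<le> (\<integral>\<^sup>+x. (\<Sum>i\<in>grid K. ennreal (w i) * (indicator (A i) x + indicator (B i) x)) \<partial>lebesgue)"
    by (rule nn_integral_mono_AE[OF ae])
  also have "\<dots> = (\<Sum>i\<in>grid K. ennreal (w i) * (emeasure lebesgue (A i) + emeasure lebesgue (B i)))"
    using AB by (simp add: nn_integral_sum nn_integral_cmult nn_integral_add)
  also have "\<dots> \<le> (\<Sum>i\<in>grid K. ennreal (w i) * (ennreal ?c + ennreal ?c))"
    unfolding A_def B_def by (intro sum_mono mult_left_mono add_mono emeasure_cell_leave emeasure_cell_enter) simp
  also have "\<dots> = (\<Sum>i\<in>grid K. ennreal (w i * (2 * ?c)))"
  proof (intro sum.cong refl)
    fix i
    have "ennreal ?c + ennreal ?c = ennreal (2 * ?c)" by (simp only: ennreal_plus[OF c0 c0, symmetric] mult_2)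
    then show "ennreal (w i) * (ennreal ?c + ennreal ?c) = ennreal (w i * (2 * ?c))"
      using ennreal_mult[OF w] c0 by (simp only: mult_nonneg_nonneg zero_le_numeral)
  qed
  also have "\<dots> = ennreal (\<Sum>i\<in>grid K. w i * (2 * ?c))"
    using c0 w by (intro sum_ennreal) simp
  finally have "lp_int p (shifted_cube y) (difference y g) \<le> (\<Sum>i\<in>grid K. w i * (2 * ?c))"
    using c0 w by (simp add: sum_nonneg)
  also have "\<dots> = 2 powr p * (2 * ?c) * (\<Sum>i\<in>grid K. \<bar>v i\<bar> powr p)"
    unfolding sum_distrib_left by (intro sum.cong refl) (simp add: w_def)
  also have "\<dots> = 2 powr p * (2 * real CARD('n)) * (2 ^ K * norm y) * ((\<Sum>i\<in>grid K. \<bar>v i\<bar> powr p) * cell_size TYPE('n) K)"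
    by simp
  also have "(\<Sum>i\<in>grid K. \<bar>v i\<bar> powr p) * cell_size TYPE('n) K = lp_int p unit_cube g"
    by (rule gL(2)[symmetric])
  finally show ?thesis .
qed

lemma nn_integral_translate_lborel:
  fixes x :: "'a::euclidean_space"
  assumes [measurable]: "\<psi> \<in> borel_measurable borel"
  shows "(\<integral>\<^sup>+y. \<psi> y \<partial>lborel) = (\<integral>\<^sup>+z. \<psi> (x + z) \<partial>lborel)"
proof -
  have "(\<integral>\<^sup>+y. \<psi> y \<partial>lborel) = (\<integral>\<^sup>+y. \<psi> y \<partial>distr lborel borel ((+) x))" by (simp add: lborel_distr_plus)
  also have "\<dots> = (\<integral>\<^sup>+z. \<psi> (x + z) \<partial>lborel)" by (rule nn_integral_distr) auto
  finally show ?thesis .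
qed

text \<open>By Jensen the p-th power of the error at x is at most a multiple of the average of |f(x)
  - f(y)|^p over y in the cell of x. Substituting y = x + z and exchanging the integrals gives an
  integral over shifts z of norms of differences. The factor \<open>2 ^ CARD('n)\<close> is the
  volume of the cube of admissible shifts divided by that of a cell.\<close>

theorem haar_box_direct_estimate:
  fixes f :: "real ^ 'n::finite => real"
  assumes "1 \<le> p" "f \<in> Lp_space p unit_cube" "real CARD('n) / 2 ^ K \<le> t"
  shows "lp_int p unit_cube (\<lambda>x. f x - haar_sum (haar_box K) f x) \<le> 2 powr p * 2 ^ CARD('n) * mod_pow p t f"
proof -
  have p: "0 < p" using assms by simp
  have fi: "integrable cube_measure f" by (rule Lp_integrable[OF assms(1,2)])
  define F where "F x = f x - haar_sum (haar_box K) f x" for x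
  have FL: "F \<in> Lp_space p unit_cube"
    unfolding F_def[abs_def] by (rule Lp_diff(1)[OF p assms(2) haar_sum_box_bounded(1)[OF assms(1,2)]])
  define N :: real where "N = cell_size TYPE('n) K"
  have N: "0 < N" using cell_size_pos by (simp add: N_def)
  define h where "h a b = ennreal (\<bar>a - b\<bar> powr p)" for a b :: real
  define S :: "((real ^ 'n) \<times> (real ^ 'n)) set" where "S = (\<Union>i\<in>grid K. cell K i \<times> cell K i)"
  have S [measurable]: "S \<in> sets (borel \<Otimes>\<^sub>M borel)" unfolding S_def by (intro sets.finite_UN) auto
  \<comment> \<open>Exchanging the integrals requires joint measurability in x and z, which a Borel
    representative of f provides; on the cube it agrees with f almost everywhere.\<close>
  obtain g where g [measurable]: "g \<in> borel_measurable lborel"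
    and fg: "AE x in lborel. indicator unit_cube x *\<^sub>R f x = g x"
  proof -
    have "(\<lambda>x. indicator unit_cube x *\<^sub>R f x) \<in> borel_measurable (completion lborel)"
      using Lp_space_measurable[OF assms(2)] by (simp add: borel_measurable_restrict_space_iff)
    then show ?thesis using completion_ex_borel_measurable_real that by blast
  qed
  have fgL: "AE x in lebesgue. x \<in> unit_cube --> f x = g x"
    using AE_completion[OF fg] by eventually_elim (auto simp: indicator_def)
  have gb [measurable]: "g \<in> borel_measurable borel" using g by simp
  have pt: "ennreal (\<bar>F x\<bar> powr p) \<le> ennreal (2 powr p / N) * (\<integral>\<^sup>+y. indicator S (x, y) * h (f x) (f y) \<partial>cube_measure)"
    if i: "i \<in> grid K" "x \<in> cell K i" for i x
  proof -
    have cL: "(\<lambda>_. f x) \<in> Lp_space p unit_cube"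
      using finite_measure.integrable_const[OF finite_measure_cube] by (simp add: Lp_space_def)
    have dL: "(\<lambda>y. f x - f y) \<in> Lp_space p unit_cube" by (rule Lp_diff(1)[OF p cL assms(2)])
    have iind: "integrable cube_measure (\<lambda>y. indicator (cell K i) y * f y)"
      using integrable_mult_indicator[OF cell_sets_cube[OF i(1)] fi] by simp
    have iind1: "integrable cube_measure (\<lambda>y. indicator (cell K i) y * f x)"
      using integrable_mult_indicator[OF cell_sets_cube[OF i(1)] Lp_integrable[OF assms(1) cL]] by simp
    have e: "(\<integral>y. indicator (cell K i) y * (f x - f y) \<partial>cube_measure) / N = F x"
    proof -
      have "(\<integral>y. indicator (cell K i) y * (f x - f y) \<partial>cube_measure)
         = (\<integral>y. indicator (cell K i) y * f x \<partial>cube_measure) - (\<integral>y. indicator (cell K i) y * f y \<partial>cube_measure)"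
        unfolding right_diff_distrib using iind1 iind by (rule Bochner_Integration.integral_diff)
      also have "(\<integral>y. indicator (cell K i) y * f x \<partial>cube_measure) = N * f x"
        using integral_indicator_cell[OF i(1)] by (simp add: N_def)
      finally show ?thesis
        using haar_sum_box_cell[OF fi i] N by (simp add: F_def cell_avg_def N_def[symmetric] diff_divide_distrib)
    qed
    have iii: "integrable cube_measure (\<lambda>y. indicator (cell K i) y * \<bar>f x - f y\<bar> powr p)"
      using integrable_mult_indicator[OF cell_sets_cube[OF i(1)] Lp_space_integrable[OF dL]] by simp
    have "\<bar>F x\<bar> powr p \<le> 2 powr p * ((\<integral>y. indicator (cell K i) y * \<bar>f x - f y\<bar> powr p \<partial>cube_measure) / N)"
      using powr_average_le(2)[OF finite_measure_cube assms(1) Lp_space_measurable[OF dL] Lp_space_integrable[OF dL] cell_sets_cube[OF i(1)]]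
      unfolding measure_cell_cube[OF i(1)] N_def[symmetric] e using N by blast
    also have "\<dots> = 2 powr p / N * (\<integral>y. indicator (cell K i) y * \<bar>f x - f y\<bar> powr p \<partial>cube_measure)" by simp
    finally have "ennreal (\<bar>F x\<bar> powr p) \<le> ennreal (2 powr p / N) * ennreal (\<integral>y. indicator (cell K i) y * \<bar>f x - f y\<bar> powr p \<partial>cube_measure)"
      using N by (subst ennreal_mult[symmetric]) (auto intro!: ennreal_leI integral_nonneg_AE)
    also have "ennreal (\<integral>y. indicator (cell K i) y * \<bar>f x - f y\<bar> powr p \<partial>cube_measure)
        = (\<integral>\<^sup>+y. ennreal (indicator (cell K i) y * \<bar>f x - f y\<bar> powr p) \<partial>cube_measure)"
      by (rule nn_integral_eq_integral[OF iii, symmetric]) simp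
    also have "\<dots> \<le> (\<integral>\<^sup>+y. indicator S (x, y) * h (f x) (f y) \<partial>cube_measure)"
      using i by (intro nn_integral_mono) (auto simp: S_def h_def indicator_def)
    finally show ?thesis by (simp add: mult_left_mono)
  qed
  have inner: "(\<integral>\<^sup>+y. indicator S (x, y) * h a (f y) \<partial>cube_measure) \<le> (\<integral>\<^sup>+y. indicator S (x, y) * h a (g y) \<partial>lborel)" for x a
  proof -
    have "(\<integral>\<^sup>+y. indicator S (x, y) * h a (f y) \<partial>cube_measure) = (\<integral>\<^sup>+y. indicator S (x, y) * h a (f y) * indicator unit_cube y \<partial>lebesgue)"
      by (intro nn_integral_restrict_space) simp
    also have "\<dots> \<le> (\<integral>\<^sup>+y. indicator S (x, y) * h a (g y) \<partial>lebesgue)"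
      by (intro nn_integral_mono_AE, use fgL in eventually_elim) (auto simp: indicator_def)
    finally show ?thesis by (simp add: nn_integral_completion)
  qed
  \<comment> \<open>Two points of one cell differ in each coordinate by at most 2^(-K), so only
    shifts in this cube contribute; their norm is at most \<open>real CARD('n) / 2 ^ K\<close>,
    hence at most t.\<close>
  define B :: "(real ^ 'n) set" where "B = cbox (- (\<chi> j. 1 / 2 ^ K)) (\<chi> j. 1 / 2 ^ K)"
  define t' where "t' z = (\<integral>\<^sup>+x. indicator S (x, x + z) * h (g x) (g (x + z)) \<partial>lborel)" for z
  have "ennreal (lp_int p unit_cube F) = (\<integral>\<^sup>+x. ennreal (\<bar>F x\<bar> powr p) * indicator unit_cube x \<partial>lebesgue)"
    by (rule lp_int_nn_integral[OF p sets_unit_cube FL])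
  also have "\<dots> \<le> (\<integral>\<^sup>+x. ennreal (2 powr p / N) * (\<integral>\<^sup>+y. indicator S (x, y) * h (g x) (g y) \<partial>lborel) \<partial>lebesgue)"
  proof (intro nn_integral_mono_AE, use fgL AE_cell[of K] in eventually_elim)
    fix x assume 1: "x \<in> unit_cube --> f x = g x" "x \<in> unit_cube --> (\<exists>i\<in>grid K. x \<in> cell K i)"
    show "ennreal (\<bar>F x\<bar> powr p) * indicator unit_cube x \<le> ennreal (2 powr p / N) * (\<integral>\<^sup>+y. indicator S (x, y) * h (g x) (g y) \<partial>lborel)"
    proof (cases "x \<in> unit_cube")
      case True
      then obtain i where i: "i \<in> grid K" "x \<in> cell K i" using 1 by blast
      have "ennreal (\<bar>F x\<bar> powr p) \<le> ennreal (2 powr p / N) * (\<integral>\<^sup>+y. indicator S (x, y) * h (f x) (g y) \<partial>lborel)"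
        using pt[OF i] mult_left_mono[OF inner[of x "f x"], of "ennreal (2 powr p / N)"] by (auto intro: order_trans)
      then show ?thesis using True 1 by simp
    qed simp
  qed
  also have "\<dots> = ennreal (2 powr p / N) * (\<integral>\<^sup>+x. (\<integral>\<^sup>+y. indicator S (x, y) * h (g x) (g y) \<partial>lborel) \<partial>lborel)"
    unfolding nn_integral_completion by (rule nn_integral_cmult) (simp add: h_def)
  also have "(\<integral>\<^sup>+x. (\<integral>\<^sup>+y. indicator S (x, y) * h (g x) (g y) \<partial>lborel) \<partial>lborel)
      = (\<integral>\<^sup>+x. (\<integral>\<^sup>+z. indicator S (x, x + z) * h (g x) (g (x + z)) \<partial>lborel) \<partial>lborel)"
    by (intro nn_integral_cong nn_integral_translate_lborel) (simp add: h_def)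
  also have "\<dots> = (\<integral>\<^sup>+z. t' z \<partial>lborel)"
    unfolding t'_def
    by (rule lborel_pair.Fubini'[symmetric, of "\<lambda>x z. indicator S (x, x + z) * h (g x) (g (x + z))"])
       (simp add: h_def)
  also have "\<dots> \<le> (\<integral>\<^sup>+z. ennreal (mod_pow p t f) * indicator B z \<partial>lborel)"
  proof (rule nn_integral_mono)
    fix z :: "real ^ 'n"
    have zB: "z \<in> B" if xz: "(x, x + z) \<in> S" for x
    proof -
      obtain i where i: "x \<in> cell K i" "x + z \<in> cell K i" using xz by (auto simp: S_def)
      have "- (1 / 2 ^ K) \<le> z $ j \<and> z $ j \<le> 1 / 2 ^ K" for j
      proof -
        have "real (i j) / 2 ^ K \<le> x $ j" "x $ j < real (i j) / 2 ^ K + 1 / 2 ^ K"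
          "real (i j) / 2 ^ K \<le> x $ j + z $ j" "x $ j + z $ j < real (i j) / 2 ^ K + 1 / 2 ^ K"
          using i unfolding mem_cell add_divide_distrib by auto
        then show ?thesis by linarith
      qed
      then show ?thesis by (simp add: B_def mem_box_cart)
    qed
    show "t' z \<le> ennreal (mod_pow p t f) * indicator B z"
    proof (cases "z \<in> B")
      case True
      have "norm z \<le> (\<Sum>j\<in>UNIV. \<bar>z $ j\<bar>)" by (rule norm_le_l1_cart)
      also have "\<dots> \<le> (\<Sum>j\<in>(UNIV :: 'n set). 1 / 2 ^ K)"
      proof (rule sum_mono)
        fix j
        have "- (1 / 2 ^ K) \<le> z $ j" "z $ j \<le> 1 / 2 ^ K" using True by (auto simp: B_def mem_box_cart)
        then show "\<bar>z $ j\<bar> \<le> 1 / 2 ^ K" by linarith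
      qed
      also have "\<dots> = real CARD('n) / 2 ^ K" by simp
      finally have zt: "norm z \<le> t" using assms(3) by linarith
      have "t' z = (\<integral>\<^sup>+x. indicator S (x, x + z) * h (g x) (g (x + z)) \<partial>lebesgue)"
        by (simp add: t'_def nn_integral_completion)
      also have "\<dots> \<le> (\<integral>\<^sup>+x. ennreal (\<bar>difference z f x\<bar> powr p) * indicator (shifted_cube z) x \<partial>lebesgue)"
      proof (intro nn_integral_mono_AE, use fgL AE_translate[OF fgL, of z] in eventually_elim)
        fix x assume 1: "x \<in> unit_cube --> f x = g x" "x + z \<in> unit_cube --> f (x + z) = g (x + z)"
        show "indicator S (x, x + z) * h (g x) (g (x + z)) \<le> ennreal (\<bar>difference z f x\<bar> powr p) * indicator (shifted_cube z) x"
        proof (cases "(x, x + z) \<in> S")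
          case True
          then have "x \<in> unit_cube" "x + z \<in> unit_cube" using cell_subset_cube by (auto simp: S_def)
          then show ?thesis using True 1 by (simp add: shifted_cube_def h_def difference_def abs_minus_commute)
        qed simp
      qed
      also have "\<dots> = ennreal (lp_int p (shifted_cube z) (difference z f))"
        by (rule lp_int_nn_integral[OF p sets_shifted_cube difference_Lp(1)[OF p assms(2)], symmetric])
      also have "\<dots> \<le> ennreal (mod_pow p t f)"
        by (intro ennreal_leI lp_int_le_mod_pow p assms(2) zt)
      finally show ?thesis using True by simp
    next
      case False
      then have "(x, x + z) \<notin> S" for x using zB by blast
      then show ?thesis by (simp add: t'_def)
    qed
  qed
  also have "\<dots> = ennreal (mod_pow p t f) * emeasure lebesgue B"
    by (subst nn_integral_cmult_indicator) (auto simp: B_def)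
  also have "emeasure lebesgue B = ennreal (2 ^ CARD('n) * N)"
    unfolding B_def by (subst measure_cbox_cart(1)) (simp_all add: N_def cell_size_def power_mult power_divide)
  finally have "ennreal (lp_int p unit_cube F) \<le> ennreal (2 powr p / N) * (ennreal (mod_pow p t f) * ennreal (2 ^ CARD('n) * N))"
    by (simp add: mult_left_mono)
  also have "\<dots> = ennreal (2 powr p / N * (mod_pow p t f * (2 ^ CARD('n) * N)))"
    using N by (simp flip: ennreal_mult)
  also have "2 powr p / N * (mod_pow p t f * (2 ^ CARD('n) * N)) = 2 powr p * 2 ^ CARD('n) * mod_pow p t f"
    using N by simp
  finally show ?thesis unfolding F_def by simp
qed

section \<open>The Besov quasi-norm and Haar expansions\<close>

text \<open>Comparable on the Besov space to the q-th power of \<open>besov_norm\<close>; without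
  the outer root it obeys simple inequalities for sums and multiples.\<close>

definition besov_gauge :: "real => real => real => (real ^ 'n::finite => real) => real" where
  "besov_gauge p q s f = enn2real (gauge_of p (s * p) (q / p) f)"

lemma besov_gauge_nonneg [simp]: "0 \<le> besov_gauge p q s f"
  by (simp add: besov_gauge_def)

lemma besov_space_iff:
  fixes f :: "real ^ 'n::finite => real"
  assumes "0 < p" "0 < q" "0 \<le> s"
  shows "f \<in> besov_space p q s \<longleftrightarrow> f \<in> Lp_space p unit_cube \<and> gauge_of p (s * p) (q / p) f < \<infinity>"
proof (cases "f \<in> Lp_space p unit_cube")
  case True
  have "besov_integral p q s f < \<infinity>" if "gauge_of p (s * p) (q / p) f < \<infinity>"
  proof -
    have "wsum (s * p) (q / p) (\<lambda>k. mod_pow p ((1 / 2) ^ k) f) < \<infinity>"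
      using that by (simp add: gauge_of_def)
    then have "ennreal (2 powr (s * q)) * wsum (s * p) (q / p) (\<lambda>k. mod_pow p ((1 / 2) ^ k) f) < \<infinity>"
      by (simp add: ennreal_mult_less_top)
    then show ?thesis using besov_integral_le_wsum[OF assms True] by (rule le_less_trans[rotated])
  qed
  moreover have "gauge_of p (s * p) (q / p) f < \<infinity>" if "besov_integral p q s f < \<infinity>"
  proof -
    have "ennreal ((2 powr p * 2) powr (q / p)) * ennreal (lp_int p unit_cube f powr (q / p))
       + ennreal (2 * 2 powr (s * q)) * besov_integral p q s f < \<infinity>"
      using that by (simp add: ennreal_mult_less_top)
    then have "wsum (s * p) (q / p) (\<lambda>k. mod_pow p ((1 / 2) ^ k) f) < \<infinity>"
      using wsum_le_besov_integral[OF assms True] by (rule le_less_trans[rotated])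
    then show ?thesis by (simp add: gauge_of_def)
  qed
  ultimately show ?thesis using True by (auto simp: besov_space_def)
qed (simp add: besov_space_def)

lemma besov_norm_nonneg [simp]: "0 \<le> besov_norm p q s f"
  by (simp add: besov_norm_def)

lemma besov_norm_gauge:
  assumes "0 < p" "0 < q" "0 \<le> s"
  shows "\<exists>C>0. \<forall>f :: real ^ 'n::finite => real. f \<in> besov_space p q s -->
    besov_norm p q s f powr q \<le> C * besov_gauge p q s f \<and> besov_gauge p q s f \<le> C * besov_norm p q s f powr q"
proof -
  define c1 where "c1 = 2 powr (s * q)"
  define c2 where "c2 = (2 powr p * 2) powr (q / p)"
  have c: "0 < c1" "0 < c2" by (simp_all add: c1_def c2_def)
  define C where "C = 1 + c2 + 2 * c1"
  have C: "0 < C" "1 \<le> C" "c1 \<le> C" "1 + c2 \<le> C" "2 * c1 \<le> C" using c by (auto simp: C_def)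
  have "besov_norm p q s f powr q \<le> C * besov_gauge p q s f \<and> besov_gauge p q s f \<le> C * besov_norm p q s f powr q"
    if f: "f \<in> besov_space p q s" for f :: "real ^ 'n => real"
  proof -
    have fL: "f \<in> Lp_space p unit_cube" and fin: "gauge_of p (s * p) (q / p) f < \<infinity>"
      using f besov_space_iff[OF assms] by auto
    define L where "L = lp_int p unit_cube f powr (q / p)"
    define W where "W = enn2real (wsum (s * p) (q / p) (\<lambda>k. mod_pow p ((1 / 2) ^ k) f))"
    define B where "B = enn2real (besov_integral p q s f)"
    have w: "wsum (s * p) (q / p) (\<lambda>k. mod_pow p ((1 / 2) ^ k) f) = ennreal W"
      using fin by (simp add: W_def gauge_of_def)
    have b: "besov_integral p q s f = ennreal B" using f by (simp add: B_def besov_space_def)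
    have pos: "0 \<le> L" "0 \<le> W" "0 \<le> B" by (simp_all add: L_def W_def B_def)
    have g: "besov_gauge p q s f = L + W"
      unfolding besov_gauge_def gauge_of_def w L_def[symmetric] using pos by (simp flip: ennreal_plus)
    have "Lp_norm p unit_cube f powr q = L" by (simp add: Lp_norm_lp_int powr_powr L_def)
    then have N: "besov_norm p q s f powr q = L + B"
      using pos assms by (simp add: besov_norm_def B_def[symmetric] powr_powr)
    have "ennreal B \<le> ennreal (c1 * W)"
      using besov_integral_le_wsum[OF assms fL] unfolding w b c1_def[symmetric]
      using c pos by (simp add: ennreal_mult)
    then have 1: "B \<le> c1 * W" using c pos by simp
    have "ennreal W \<le> ennreal (c2 * L + 2 * c1 * B)"
      using wsum_le_besov_integral[OF assms fL] unfolding w b c1_def[symmetric] c2_def[symmetric] L_def[symmetric]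
      using c pos by (simp add: ennreal_mult ennreal_plus)
    moreover have "0 \<le> c2 * L + 2 * c1 * B" using c pos by simp
    ultimately have 2: "W \<le> c2 * L + 2 * c1 * B" by (simp only: ennreal_le_iff)
    have "L + B \<le> C * L + C * W"
      using 1 mult_right_mono[OF C(2) pos(1)] mult_right_mono[OF C(3) pos(2)] by simp
    moreover have "L + W \<le> C * L + C * B"
      using 2 mult_right_mono[OF C(4) pos(1)] mult_right_mono[OF C(5) pos(3)] by (simp add: distrib_right)
    ultimately show ?thesis unfolding g N by (simp add: distrib_left)
  qed
  then show ?thesis using C(1) by blast
qed

lemma besov_gauge_ennreal:
  assumes "0 < p" "0 < q" "0 \<le> s" "f \<in> besov_space p q s"
  shows "ennreal (besov_gauge p q s f) = gauge_of p (s * p) (q / p) f"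
  using assms besov_space_iff[OF assms(1-3), of f] by (simp add: besov_gauge_def)

lemma besov_add:
  assumes "0 < p" "0 < q" "0 \<le> s"
  shows "\<exists>K>0. \<forall>f g :: real ^ 'n::finite => real. f \<in> besov_space p q s --> g \<in> besov_space p q s -->
    (\<lambda>x. f x + g x) \<in> besov_space p q s \<and>
    besov_gauge p q s (\<lambda>x. f x + g x) \<le> K * (besov_gauge p q s f + besov_gauge p q s g)"
proof -
  define K where "K = (2 powr p) powr (q / p) * 2 powr (q / p)"
  have K: "0 < K" by (simp add: K_def)
  have "(\<lambda>x. f x + g x) \<in> besov_space p q s \<and>
    besov_gauge p q s (\<lambda>x. f x + g x) \<le> K * (besov_gauge p q s f + besov_gauge p q s g)"
    if f: "f \<in> besov_space p q s" and g: "g \<in> besov_space p q s" for f g :: "real ^ 'n => real"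
  proof -
    have L: "f \<in> Lp_space p unit_cube" "g \<in> Lp_space p unit_cube"
      using f g by (auto simp: besov_space_def)
    have "gauge_of p (s * p) (q / p) (\<lambda>x. f x + g x) \<le> ennreal K * (ennreal (besov_gauge p q s f) + ennreal (besov_gauge p q s g))"
      using gauge_of_add[OF assms(1) _ L, of "q / p" "s * p"] assms
      unfolding K_def besov_gauge_ennreal[OF assms f] besov_gauge_ennreal[OF assms g] by simp
    also have "\<dots> = ennreal (K * (besov_gauge p q s f + besov_gauge p q s g))"
      using K by (simp add: ennreal_mult ennreal_plus)
    finally have le: "gauge_of p (s * p) (q / p) (\<lambda>x. f x + g x) \<le> ennreal (K * (besov_gauge p q s f + besov_gauge p q s g))" .
    have "gauge_of p (s * p) (q / p) (\<lambda>x. f x + g x) < \<infinity>" by (rule le_less_trans[OF le]) simp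
    then have B: "(\<lambda>x. f x + g x) \<in> besov_space p q s"
      using besov_space_iff[OF assms] Lp_add(1)[OF assms(1) L] by blast
    have "besov_gauge p q s (\<lambda>x. f x + g x) \<le> K * (besov_gauge p q s f + besov_gauge p q s g)"
      using le K unfolding besov_gauge_ennreal[OF assms B, symmetric] by simp
    then show ?thesis using B by blast
  qed
  then show ?thesis using K by blast
qed

lemma besov_cmult:
  assumes "0 < p" "0 < q" "0 \<le> s" "f \<in> besov_space p q s"
  shows "(\<lambda>x. c * f x) \<in> besov_space p q s"
    "besov_gauge p q s (\<lambda>x. c * f x) \<le> \<bar>c\<bar> powr q * besov_gauge p q s f"
proof -
  have L: "f \<in> Lp_space p unit_cube" using assms by (auto simp: besov_space_def)
  have "gauge_of p (s * p) (q / p) (\<lambda>x. c * f x) \<le> ennreal (\<bar>c\<bar> powr q) * ennreal (besov_gauge p q s f)"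
    using gauge_of_cmult[OF assms(1) _ L, of "q / p" "s * p" c] assms(1,2)
    unfolding besov_gauge_ennreal[OF assms] by simp
  then have le: "gauge_of p (s * p) (q / p) (\<lambda>x. c * f x) \<le> ennreal (\<bar>c\<bar> powr q * besov_gauge p q s f)"
    by (simp add: ennreal_mult)
  have "gauge_of p (s * p) (q / p) (\<lambda>x. c * f x) < \<infinity>" by (rule le_less_trans[OF le]) simp
  then show B: "(\<lambda>x. c * f x) \<in> besov_space p q s"
    using besov_space_iff[OF assms(1-3)] Lp_cmult(1)[OF L] by blast
  show "besov_gauge p q s (\<lambda>x. c * f x) \<le> \<bar>c\<bar> powr q * besov_gauge p q s f"
    using le unfolding besov_gauge_ennreal[OF assms(1-3) B, symmetric] by simp
qed

lemma besov_zero: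
  assumes "0 < p" "0 < q" "0 \<le> s"
  shows "(\<lambda>x :: real ^ 'n::finite. 0) \<in> besov_space p q s" "besov_gauge p q s (\<lambda>x :: real ^ 'n. 0) = 0"
proof -
  have L: "(\<lambda>x :: real ^ 'n. 0) \<in> Lp_space p unit_cube" by (rule Lp_zero(1)[OF assms(1)])
  have "mod_pow p t (\<lambda>x :: real ^ 'n. 0) \<le> 0" if "0 < t" for t
    using mod_pow_le[OF assms(1) L that] by (simp add: Lp_zero(2))
  then have "mod_pow p ((1 / 2) ^ k) (\<lambda>x :: real ^ 'n. 0) = 0" for k
    using mod_pow_nonneg[of p "(1 / 2) ^ k"] by (intro order_antisym) auto
  then have g: "gauge_of p (s * p) (q / p) (\<lambda>x :: real ^ 'n. 0) = 0"
    by (simp add: gauge_of_def wsum_def Lp_zero(2))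
  then show "(\<lambda>x :: real ^ 'n. 0) \<in> besov_space p q s"
    by (intro besov_space_iff[OF assms, THEN iffD2] conjI L) simp
  show "besov_gauge p q s (\<lambda>x :: real ^ 'n. 0) = 0" using g by (simp add: besov_gauge_def)
qed

lemma besov_diff:
  fixes f g :: "real ^ 'n::finite => real"
  assumes "0 < p" "0 < q" "0 \<le> s" "f \<in> besov_space p q s" "g \<in> besov_space p q s"
  shows "(\<lambda>x. f x - g x) \<in> besov_space p q s"
proof -
  obtain K where K: "\<forall>f g :: real ^ 'n => real. f \<in> besov_space p q s --> g \<in> besov_space p q s -->
    (\<lambda>x. f x + g x) \<in> besov_space p q s \<and>
    besov_gauge p q s (\<lambda>x. f x + g x) \<le> K * (besov_gauge p q s f + besov_gauge p q s g)"
    using besov_add[OF assms(1-3)] by blast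
  have "(\<lambda>x. f x + (- 1) * g x) \<in> besov_space p q s"
    using K assms(4) besov_cmult(1)[OF assms(1-3,5), of "- 1"] by blast
  then show ?thesis by simp
qed

lemma besov_sum:
  fixes f :: "'l => real ^ 'n::finite => real"
  assumes "0 < p" "0 < q" "0 \<le> s" "\<And>l. l \<in> L ==> f l \<in> besov_space p q s"
  shows "(\<lambda>x. \<Sum>l\<in>L. f l x) \<in> besov_space p q s"
  using assms(4)
proof (induction L rule: infinite_finite_induct)
  case (insert l L)
  obtain K where K: "\<forall>f g :: real ^ 'n => real. f \<in> besov_space p q s --> g \<in> besov_space p q s -->
    (\<lambda>x. f x + g x) \<in> besov_space p q s \<and>
    besov_gauge p q s (\<lambda>x. f x + g x) \<le> K * (besov_gauge p q s f + besov_gauge p q s g)"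
    using besov_add[OF assms(1-3)] by blast
  have "(\<lambda>x. f l x + (\<Sum>l\<in>L. f l x)) \<in> besov_space p q s" using K insert by blast
  then show ?case using insert by simp
qed (use besov_zero(1)[OF assms(1-3)] in auto)

text \<open>Up to constants, the largest contribution of the moduli to the gauge of a step function
  of level K with unit L_p mass: shifts longer than a cell give no decay, shorter ones give the
  factor 2^(K-k).\<close>

definition level_weight :: "real => real => nat => ennreal" where
  "level_weight \<sigma> \<theta> K = wsum \<sigma> \<theta> (\<lambda>k. min 1 (2 ^ K / 2 ^ k))"

text \<open>The condition \<sigma> < 1, that is s < 1/p, makes the terms decay geometrically with
  ratio 2^((\<sigma>-1)\<theta>).\<close>

lemma level_weight_finite:
  assumes "0 \<le> \<sigma>" "\<sigma> < 1" "0 < \<theta>"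
  shows "level_weight \<sigma> \<theta> K < \<infinity>"
proof -
  define \<rho> where "\<rho> = (2 powr (\<sigma> - 1)) powr \<theta>"
  have \<rho>: "0 < \<rho>" "\<rho> < 1"
    using assms powr_less_mono[of "(\<sigma> - 1) * \<theta>" 0 2] by (auto simp: \<rho>_def powr_powr mult_neg_pos)
  have "(2 powr (real k * \<sigma>) * min 1 (2 ^ K / 2 ^ k)) powr \<theta> \<le> (2 ^ K) powr \<theta> * \<rho> ^ k" for k
  proof -
    have "(2 powr (real k * \<sigma>) * min 1 (2 ^ K / 2 ^ k)) powr \<theta> \<le> (2 powr (real k * \<sigma>) * (2 ^ K / 2 ^ k)) powr \<theta>"
      using assms by (intro powr_mono2 mult_left_mono) auto
    also have "2 powr (real k * \<sigma>) * (2 ^ K / 2 ^ k) = 2 ^ K * 2 powr ((\<sigma> - 1) * real k)"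
    proof -
      have "(\<sigma> - 1) * real k = real k * \<sigma> - real k" by (simp add: algebra_simps)
      then show ?thesis by (simp add: powr_diff powr_realpow)
    qed
    also have "(2 ^ K * 2 powr ((\<sigma> - 1) * real k)) powr \<theta> = (2 ^ K) powr \<theta> * \<rho> ^ k"
      using \<rho> by (simp add: powr_mult \<rho>_def powr_powr mult_ac flip: powr_realpow)
    finally show ?thesis .
  qed
  then have "level_weight \<sigma> \<theta> K \<le> (\<Sum>k. ennreal ((2 ^ K) powr \<theta> * \<rho> ^ k))"
    unfolding level_weight_def wsum_def by (intro suminf_le ennreal_leI) auto
  also have "\<dots> < \<infinity>"
  proof -
    have "summable (\<lambda>k. (2 ^ K) powr \<theta> * \<rho> ^ k)" using \<rho> by (intro summable_mult summable_geometric) simp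
    then have "(\<Sum>k. ennreal ((2 ^ K) powr \<theta> * \<rho> ^ k)) \<noteq> top"
      by (rule ennreal_suminf_neq_top) (use \<rho> in simp)
    then show ?thesis by (simp add: less_top)
  qed
  finally show ?thesis .
qed

text \<open>The factor with \<open>level_weight\<close> is kept unevaluated on purpose: the Haar
  functions in the counterexample for p < 1 satisfy a lower bound with the same factor, so it
  cancels there.\<close>

lemma step_gauge_le:
  assumes "0 < p" "0 < q"
  shows "\<exists>C>0. \<forall>K v. \<forall>g :: real ^ 'n::finite => real. g \<in> borel_measurable cube_measure -->
     (\<forall>i x. i \<in> grid K --> x \<in> cell K i --> g x = v i) -->
     gauge_of p \<sigma> (q / p) g \<le> ennreal C * ennreal (lp_int p unit_cube g powr (q / p)) * (1 + level_weight \<sigma> (q / p) K)"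
proof -
  define c where "c = 2 powr p * (2 * real CARD('n))"
  define \<theta> where "\<theta> = q / p"
  have \<theta>: "0 < \<theta>" using assms by (simp add: \<theta>_def)
  have "1 \<le> CARD('n)" by (simp add: Suc_le_eq card_gt_0_iff)
  then have c: "2 powr p * 2 \<le> c" "0 < c" by (auto simp: c_def)
  define C where "C = 1 + c powr \<theta>"
  have C: "0 < C" "1 \<le> C" "c powr \<theta> \<le> C" by (auto simp: C_def add_pos_nonneg)
  have "gauge_of p \<sigma> \<theta> g \<le> ennreal C * ennreal (lp_int p unit_cube g powr \<theta>) * (1 + level_weight \<sigma> \<theta> K)"
    if g: "g \<in> borel_measurable cube_measure" "\<forall>i x. i \<in> grid K --> x \<in> cell K i --> g x = v i"
    for K v and g :: "real ^ 'n => real"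
  proof -
    have gv: "\<And>i x. i \<in> grid K ==> x \<in> cell K i ==> g x = v i" using g(2) by blast
    have gL: "g \<in> Lp_space p unit_cube" by (rule step_Lp(1)[OF assms(1) g(1) gv])
    define L where "L = lp_int p unit_cube g"
    have L: "0 \<le> L" by (simp add: L_def)
    have mod: "mod_pow p ((1 / 2) ^ k) g \<le> c * L * min 1 (2 ^ K / 2 ^ k)" for k
    proof -
      have "mod_pow p ((1 / 2) ^ k) g \<le> 2 powr p * 2 * L"
        using mod_pow_le[OF assms(1) gL, of "(1 / 2) ^ k"] by (simp add: L_def)
      also have "\<dots> \<le> c * L" using c L by (intro mult_right_mono) auto
      finally have 1: "mod_pow p ((1 / 2) ^ k) g \<le> c * L" .
      have 2: "mod_pow p ((1 / 2) ^ k) g \<le> c * L * (2 ^ K / 2 ^ k)"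
      proof (rule mod_pow_leI[OF assms(1) gL])
        fix y :: "real ^ 'n"
        assume y: "norm y \<le> (1 / 2) ^ k"
        have "lp_int p (shifted_cube y) (difference y g) \<le> c * (2 ^ K * norm y) * L"
          using step_inverse_estimate[OF assms(1) g(1) gv] by (simp add: c_def L_def)
        also have "\<dots> \<le> c * (2 ^ K * (1 / 2) ^ k) * L"
          using y c L by (intro mult_right_mono mult_left_mono) auto
        also have "\<dots> = c * L * (2 ^ K / 2 ^ k)" by (simp add: power_one_over)
        finally show "lp_int p (shifted_cube y) (difference y g) \<le> c * L * (2 ^ K / 2 ^ k)" .
      qed (use c L in auto)
      show ?thesis using 1 2 by (simp add: min_def)
    qed
    have "wsum \<sigma> \<theta> (\<lambda>k. mod_pow p ((1 / 2) ^ k) g) \<le> wsum \<sigma> \<theta> (\<lambda>k. c * L * min 1 (2 ^ K / 2 ^ k))"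
      using \<theta> mod by (intro wsum_mono) auto
    also have "\<dots> = ennreal ((c * L) powr \<theta>) * level_weight \<sigma> \<theta> K"
      unfolding level_weight_def using c L by (intro wsum_cmult) auto
    also have "ennreal ((c * L) powr \<theta>) \<le> ennreal (C * L powr \<theta>)"
      unfolding powr_mult using C by (intro ennreal_leI mult_right_mono) auto
    also have "ennreal (C * L powr \<theta>) = ennreal C * ennreal (L powr \<theta>)"
      by (rule ennreal_mult) (use C in auto)
    finally have 1: "wsum \<sigma> \<theta> (\<lambda>k. mod_pow p ((1 / 2) ^ k) g) \<le> ennreal C * ennreal (L powr \<theta>) * level_weight \<sigma> \<theta> K"
      by (simp add: mult_right_mono)
    have "1 * ennreal (L powr \<theta>) \<le> ennreal C * ennreal (L powr \<theta>)"
      using C by (intro mult_right_mono) (auto simp: ennreal_leI[of 1 C, simplified])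
    then have 2: "ennreal (L powr \<theta>) \<le> ennreal C * ennreal (L powr \<theta>) * 1" by simp
    show ?thesis
      unfolding gauge_of_def L_def[symmetric] distrib_left by (rule add_mono[OF 2 1])
  qed
  then show ?thesis using C(1) unfolding \<theta>_def by blast
qed

lemma step_besov:
  fixes g :: "real ^ 'n::finite => real"
  assumes "0 < p" "0 < q" "0 \<le> s" "s < 1 / p"
    and g: "g \<in> borel_measurable cube_measure" "\<And>i x. i \<in> grid K ==> x \<in> cell K i ==> g x = v i"
  shows "g \<in> besov_space p q s"
proof -
  have \<sigma>: "0 \<le> s * p" "s * p < 1" "0 < q / p" using assms by (auto simp: field_simps)
  obtain C where C: "\<forall>K v. \<forall>g :: real ^ 'n => real. g \<in> borel_measurable cube_measure -->
     (\<forall>i x. i \<in> grid K --> x \<in> cell K i --> g x = v i) -->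
     gauge_of p (s * p) (q / p) g \<le> ennreal C * ennreal (lp_int p unit_cube g powr (q / p)) * (1 + level_weight (s * p) (q / p) K)"
    using step_gauge_le[OF assms(1,2)] by blast
  have "gauge_of p (s * p) (q / p) g \<le> ennreal C * ennreal (lp_int p unit_cube g powr (q / p)) * (1 + level_weight (s * p) (q / p) K)"
    using C g by blast
  also have "\<dots> < \<infinity>" using level_weight_finite[OF \<sigma>] by (simp add: ennreal_mult_less_top)
  finally show ?thesis
    by (intro besov_space_iff[OF assms(1-3), THEN iffD2] conjI step_Lp(1)[OF assms(1) g])
qed

lemma tensor_haar_besov:
  fixes m :: "'n::finite => nat"
  assumes "0 < p" "0 < q" "0 \<le> s" "s < 1 / p" "\<And>j. 1 \<le> m j"
  shows "tensor_haar m \<in> besov_space p q s"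
proof -
  obtain K where "{m} \<subseteq> haar_box K" using haar_index_in_box[of "{m}"] assms by auto
  then show ?thesis
    by (intro step_besov[OF assms(1-4) tensor_haar_cube, where K = K and v = "th K m"] tensor_haar_cell) auto
qed

section \<open>Equivalence with the Haar projection errors for \<open>p \<ge> 1\<close>\<close>

definition proj_error :: "real => (real ^ 'n::finite => real) => nat => real" where
  "proj_error p f k = lp_int p unit_cube (\<lambda>x. f x - haar_sum (haar_box k) f x)"

text \<open>The gauge with moduli replaced by errors of averages. Unlike moduli, these errors
  interact exactly with Haar partial sums.\<close>

definition proj_gauge :: "real => real => real => (real ^ 'n::finite => real) => ennreal" where
  "proj_gauge p \<sigma> \<theta> f = ennreal (lp_int p unit_cube f powr \<theta>) + wsum \<sigma> \<theta> (proj_error p f)"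

lemma proj_error_nonneg [simp]: "0 \<le> proj_error p f k"
  by (simp add: proj_error_def)

lemma haar_box_finite_index: "m \<in> haar_box k ==> 1 \<le> m j"
  by (simp add: mem_haar_box)

lemma proj_error_le:
  fixes f :: "real ^ 'n::finite => real"
  assumes "1 \<le> p" "f \<in> Lp_space p unit_cube"
  shows "proj_error p f k \<le> 2 powr p * (1 + 2 powr p) * lp_int p unit_cube f"
proof -
  have p: "0 < p" using assms by simp
  have "proj_error p f k \<le> 2 powr p * (lp_int p unit_cube f + lp_int p unit_cube (haar_sum (haar_box k) f))"
    unfolding proj_error_def by (rule Lp_diff(2)[OF p assms(2) haar_sum_box_bounded(1)[OF assms]])
  also have "\<dots> \<le> 2 powr p * (lp_int p unit_cube f + 2 powr p * lp_int p unit_cube f)"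
    using haar_sum_box_bounded(2)[OF assms, of k] by (intro mult_left_mono add_left_mono) auto
  finally show ?thesis by (simp add: algebra_simps)
qed

lemma haar_residual:
  fixes f :: "real ^ 'n::finite => real"
  assumes "integrable cube_measure f" "finite A" "\<And>m j. m \<in> A ==> 1 \<le> m j" "finite B" "\<And>m j. m \<in> B ==> 1 \<le> m j"
  shows "haar_sum A (\<lambda>x. f x - haar_sum B f x) = (\<lambda>x. haar_sum A f x - haar_sum (A \<inter> B) f x)"
proof -
  have "integrable cube_measure (haar_sum B f)"
    unfolding haar_sum_def[abs_def] by (intro Bochner_Integration.integrable_sum integrable_mult_right tensor_haar_integrable)
  then have "haar_sum A (\<lambda>x. f x - haar_sum B f x) = (\<lambda>x. haar_sum A f x - haar_sum A (haar_sum B f) x)"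
    by (rule haar_sum_diff[OF assms(1)])
  also have "haar_sum A (haar_sum B f) = haar_sum (A \<inter> B) f"
    using assms by (intro haar_sum_haar_sum) auto
  finally show ?thesis .
qed

text \<open>The coarsest average is constant on the closed cube, since \<open>haar 1\<close>
  includes the right endpoint. It drops out of all differences and so ends the telescoping sum in
  the next proof.\<close>

lemma difference_haar_box_0:
  fixes f :: "real ^ 'n::finite => real"
  assumes "x \<in> shifted_cube y"
  shows "haar_sum (haar_box 0) f (x + y) = haar_sum (haar_box 0) f x"
proof -
  have one: "tensor_haar m z = 1" if m: "m \<in> haar_box 0" and z: "z \<in> unit_cube" for m :: "'n => nat" and z
  proof -
    have m1: "m j = 1" for j using m[unfolded mem_haar_box] by (metis le_antisym power_0)
    have "haar (m j) (z $ j) = 1" for j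
      using z unfolding m1 by (simp add: haar_def unit_cube_def mem_box_cart indicator_def)
    then show ?thesis by (simp add: tensor_haar_def)
  qed
  show ?thesis
    unfolding haar_sum_def using shifted_cubeD[OF assms] by (intro sum.cong refl) (simp add: one)
qed

text \<open>Let P_l be the box partial sum of level l. Up to a constant, f is f - P_k f plus the
  increments P_l f - P_(l-1) f for l \<le> k. For a shift of length at most 2^(-k) the inverse
  estimate gives an increment of level l the factor 2^(l-k), and its norm is bounded by the error at
  level l - 1.\<close>

lemma mod_pow_le_proj_errors:
  assumes "1 \<le> p" "1 < \<mu>"
  shows "\<exists>C>0. \<forall>(f :: real ^ 'n::finite => real) k. f \<in> Lp_space p unit_cube -->
     mod_pow p ((1 / 2) ^ k) f \<le> C * (\<Sum>j<Suc k. (\<mu> / 2) ^ j * proj_error p f (k - j))"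
proof -
  have p: "0 < p" using assms by simp
  obtain C1 where C1: "C1 > 0" "\<forall>(A :: (real ^ 'n) set) f n. (\<forall>l<n. f l \<in> Lp_space p A) -->
     lp_int p A (\<lambda>x. \<Sum>l<n. f l x) \<le> C1 * (\<Sum>l<n. \<mu> ^ l * lp_int p A (f l))"
    using Lp_weighted_sum[OF p assms(2), where 'n = 'n] by blast
  define c2 where "c2 = 2 powr p * (2 * real CARD('n))"
  define C2 where "C2 = 2 powr p * 2 + c2 * 2 * 2 powr p"
  have C2: "0 < C2" "2 powr p * 2 \<le> C2" "c2 * 2 * 2 powr p \<le> C2" "0 \<le> c2"
    by (auto simp: C2_def c2_def add_pos_nonneg)
  have "mod_pow p ((1 / 2) ^ k) f \<le> (C1 * C2) * (\<Sum>j<Suc k. (\<mu> / 2) ^ j * proj_error p f (k - j))"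
    if f: "f \<in> Lp_space p unit_cube" for f :: "real ^ 'n => real" and k
  proof (rule mod_pow_leI[OF p f])
    show "0 \<le> C1 * C2 * (\<Sum>j<Suc k. (\<mu> / 2) ^ j * proj_error p f (k - j))"
      using C1 C2 assms by (intro mult_nonneg_nonneg sum_nonneg) auto
    fix y :: "real ^ 'n"
    assume y: "norm y \<le> (1 / 2) ^ k"
    let ?P = "\<lambda>k. haar_sum (haar_box k) f"
    \<comment> \<open>Numbered downwards from level k: for j \<ge> 1 this is the increment from
      level k - j to level k - j + 1, so a larger j means a coarser piece with a smaller factor
      2^(-j).\<close>
    define u where "u j = (case j of 0 => (\<lambda>x. f x - ?P k x) | Suc i => (\<lambda>x. ?P (k - i) x - ?P (k - Suc i) x))" for j
    have PL: "?P l \<in> Lp_space p unit_cube" for l by (rule haar_sum_box_bounded(1)[OF assms(1) f])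
    have uL: "u j \<in> Lp_space p unit_cube" for j
      by (cases j) (auto simp: u_def intro!: Lp_diff(1)[OF p] f PL)
    have tele: "(\<Sum>j<Suc n. u j x) = f x - ?P (k - n) x" if "n \<le> k" for n x
      using that by (induction n) (auto simp: u_def)
    have dsum: "difference y f x = (\<Sum>j<Suc k. difference y (u j) x)" if "x \<in> shifted_cube y" for x
    proof -
      have "(\<Sum>j<Suc k. difference y (u j) x) = (f (x + y) - ?P 0 (x + y)) - (f x - ?P 0 x)"
        unfolding difference_def sum_subtractf tele[OF order_refl] by simp
      then show ?thesis using difference_haar_box_0[OF that, of f] by (simp add: difference_def)
    qed
    have summand: "lp_int p (shifted_cube y) (difference y (u j)) \<le> C2 * ((1 / 2) ^ j * proj_error p f (k - j))"
      if "j < Suc k" for j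
    proof (cases j)
      case 0
      have "lp_int p (shifted_cube y) (difference y (u j)) \<le> 2 powr p * (2 * proj_error p f k)"
        using difference_Lp(2)[OF p uL[of 0], of y] 0 by (simp add: u_def proj_error_def)
      also have "\<dots> \<le> C2 * proj_error p f k"
        unfolding mult.assoc[symmetric] using C2 by (intro mult_right_mono) auto
      finally show ?thesis using 0 by simp
    next
      case (Suc i)
      define l where "l = k - i"
      have l: "l - 1 = k - j" "l + i = k" "1 \<le> l" using that Suc by (auto simp: l_def)
      have uj: "u j = (\<lambda>x. ?P l x - ?P (l - 1) x)" using Suc l by (simp add: u_def l_def)
      have cellv: "u j x = cell_avg l (u j) i'" if "i' \<in> grid l" "x \<in> cell l i'" for i' x
      proof -
        have "haar_sum (haar_box l) (u j) x = u j x"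
        proof -
          have fi: "integrable cube_measure f" by (rule Lp_integrable[OF assms(1) f])
          have "haar_sum (haar_box l) (u j) = (\<lambda>x. haar_sum (haar_box l) (?P l) x - haar_sum (haar_box l) (?P (l - 1)) x)"
            unfolding uj by (intro haar_sum_diff Lp_integrable[OF assms(1)] PL)
          also have "haar_sum (haar_box l) (?P l) = ?P l"
            by (subst haar_sum_haar_sum) (auto simp: mem_haar_box)
          also have "haar_sum (haar_box l) (?P (l - 1)) = ?P (l - 1)"
          proof -
            have "haar_box l \<inter> haar_box (l - 1) = (haar_box (l - 1) :: ('n => nat) set)"
              by (intro Int_absorb1 haar_box_mono) simp
            then show ?thesis by (subst haar_sum_haar_sum) (auto simp: mem_haar_box)
          qed
          finally show ?thesis by (simp add: uj)
        qed
        then show ?thesis using haar_sum_box_cell[OF Lp_integrable[OF assms(1) uL] that] by simp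
      qed
      have "lp_int p (shifted_cube y) (difference y (u j)) \<le> c2 * (2 ^ l * norm y) * lp_int p unit_cube (u j)"
        unfolding c2_def by (rule step_inverse_estimate[OF p Lp_space_measurable[OF uL] cellv])
      also have "\<dots> \<le> c2 * (2 * (1 / 2) ^ j) * lp_int p unit_cube (u j)"
      proof (intro mult_right_mono mult_left_mono)
        have "2 ^ l * norm y \<le> 2 ^ l * (1 / 2) ^ k" using y by (intro mult_left_mono) auto
        also have "\<dots> = 2 * (1 / 2) ^ j"
          unfolding l(2)[symmetric] Suc by (simp add: power_add power_one_over)
        finally show "2 ^ l * norm y \<le> 2 * (1 / 2) ^ j" .
      qed (use C2 in auto)
      \<comment> \<open>The increment is P_l applied to f - P_(l-1) f, and P_l is bounded in
        L_p.\<close>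
      also have "lp_int p unit_cube (u j) \<le> 2 powr p * proj_error p f (k - j)"
      proof -
        have "haar_sum (haar_box l) (\<lambda>x. f x - ?P (l - 1) x) = (\<lambda>x. ?P l x - haar_sum (haar_box l \<inter> haar_box (l - 1)) f x)"
          by (rule haar_residual[OF Lp_integrable[OF assms(1) f]]) (auto simp: mem_haar_box)
        also have "haar_box l \<inter> haar_box (l - 1) = (haar_box (l - 1) :: ('n => nat) set)"
          by (intro Int_absorb1 haar_box_mono) simp
        finally have "u j = haar_sum (haar_box l) (\<lambda>x. f x - ?P (l - 1) x)" by (simp add: uj)
        then show ?thesis
          using haar_sum_box_bounded(2)[OF assms(1) Lp_diff(1)[OF p f PL], of l "l - 1"] by (simp add: proj_error_def l(1)[symmetric])
      qed
      finally have "lp_int p (shifted_cube y) (difference y (u j)) \<le> c2 * (2 * (1 / 2) ^ j) * (2 powr p * proj_error p f (k - j))"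
        using C2 by (simp add: mult_left_mono)
      also have "\<dots> = (c2 * 2 * 2 powr p) * ((1 / 2) ^ j * proj_error p f (k - j))" by simp
      also have "\<dots> \<le> C2 * ((1 / 2) ^ j * proj_error p f (k - j))"
        using C2 by (intro mult_right_mono) auto
      finally show ?thesis .
    qed
    have "lp_int p (shifted_cube y) (difference y f) = lp_int p (shifted_cube y) (\<lambda>x. \<Sum>j<Suc k. difference y (u j) x)"
      unfolding lp_int_def by (intro Bochner_Integration.integral_cong refl) (simp add: dsum del: sum.lessThan_Suc)
    also have "\<dots> \<le> C1 * (\<Sum>j<Suc k. \<mu> ^ j * lp_int p (shifted_cube y) (difference y (u j)))"
      by (rule C1(2)[rule_format]) (rule difference_Lp(1)[OF p uL])
    also have "\<dots> \<le> C1 * (\<Sum>j<Suc k. \<mu> ^ j * (C2 * ((1 / 2) ^ j * proj_error p f (k - j))))"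
      using C1 assms by (intro mult_left_mono sum_mono summand) auto
    also have "\<dots> = (C1 * C2) * (\<Sum>j<Suc k. (\<mu> / 2) ^ j * proj_error p f (k - j))"
      unfolding sum_distrib_left by (intro sum.cong refl) (simp add: power_divide power_one_over)
    finally show "lp_int p (shifted_cube y) (difference y f) \<le> C1 * C2 * (\<Sum>j<Suc k. (\<mu> / 2) ^ j * proj_error p f (k - j))" .
  qed simp
  moreover have "0 < C1 * C2" using C1 C2 by simp
  ultimately show ?thesis by blast
qed

text \<open>The Hardy inequality converts the pointwise estimate of moduli by weighted errors into
  one between the two gauges; the ratio \<mu> in that estimate is the one the Hardy inequality
  allows.\<close>

lemma gauge_le_proj_gauge:
  assumes "1 \<le> p" "0 < \<theta>" "\<sigma> < 1"
  shows "\<exists>C>0. \<forall>f :: real ^ 'n::finite => real. f \<in> Lp_space p unit_cube -->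
    gauge_of p \<sigma> \<theta> f \<le> ennreal C * proj_gauge p \<sigma> \<theta> f"
proof -
  obtain \<mu> C1 where \<mu>: "1 < \<mu>" and C1: "0 < C1"
    "\<forall>a b. (\<forall>k. 0 \<le> a k) --> (\<forall>k. 0 \<le> b k) --> (\<forall>k. b k \<le> (\<Sum>j<Suc k. (\<mu> / 2) ^ j * a (k - j))) -->
       wsum \<sigma> \<theta> b \<le> ennreal C1 * wsum \<sigma> \<theta> a"
    using wsum_hardy[OF assms(3,2)] by blast
  obtain C2 where C2: "C2 > 0" "\<forall>(f :: real ^ 'n => real) k. f \<in> Lp_space p unit_cube -->
     mod_pow p ((1 / 2) ^ k) f \<le> C2 * (\<Sum>j<Suc k. (\<mu> / 2) ^ j * proj_error p f (k - j))"
    using mod_pow_le_proj_errors[OF assms(1) \<mu>, where 'n = 'n] by blast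
  define C where "C = 1 + C1 * C2 powr \<theta>"
  have C: "0 < C" "1 \<le> C" "C1 * C2 powr \<theta> \<le> C" using C1 C2 by (auto simp: C_def add_pos_nonneg)
  have "gauge_of p \<sigma> \<theta> f \<le> ennreal C * proj_gauge p \<sigma> \<theta> f"
    if f: "f \<in> Lp_space p unit_cube" for f :: "real ^ 'n => real"
  proof -
    have "mod_pow p ((1 / 2) ^ k) f \<le> (\<Sum>j<Suc k. (\<mu> / 2) ^ j * (C2 * proj_error p f (k - j)))" for k
    proof -
      have "mod_pow p ((1 / 2) ^ k) f \<le> C2 * (\<Sum>j<Suc k. (\<mu> / 2) ^ j * proj_error p f (k - j))"
        using C2 f by blast
      also have "\<dots> = (\<Sum>j<Suc k. (\<mu> / 2) ^ j * (C2 * proj_error p f (k - j)))"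
        unfolding sum_distrib_left by (intro sum.cong refl) simp
      finally show ?thesis .
    qed
    then have "wsum \<sigma> \<theta> (\<lambda>k. mod_pow p ((1 / 2) ^ k) f) \<le> ennreal C1 * wsum \<sigma> \<theta> (\<lambda>k. C2 * proj_error p f k)"
      by (intro C1(2)[rule_format]) (use C2 in auto)
    also have "\<dots> = ennreal (C1 * C2 powr \<theta>) * wsum \<sigma> \<theta> (proj_error p f)"
    proof -
      have "wsum \<sigma> \<theta> (\<lambda>k. C2 * proj_error p f k) = ennreal (C2 powr \<theta>) * wsum \<sigma> \<theta> (proj_error p f)"
        by (rule wsum_cmult) (use C2 in simp)
      moreover have "ennreal (C1 * C2 powr \<theta>) = ennreal C1 * ennreal (C2 powr \<theta>)"
        by (rule ennreal_mult) (use C1 in simp_all)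
      ultimately show ?thesis by (simp only: mult.assoc)
    qed
    also have "\<dots> \<le> ennreal C * wsum \<sigma> \<theta> (proj_error p f)"
      using C by (intro mult_right_mono ennreal_leI) auto
    finally have 1: "wsum \<sigma> \<theta> (\<lambda>k. mod_pow p ((1 / 2) ^ k) f) \<le> ennreal C * wsum \<sigma> \<theta> (proj_error p f)" .
    have "1 * ennreal (lp_int p unit_cube f powr \<theta>) \<le> ennreal C * ennreal (lp_int p unit_cube f powr \<theta>)"
      using C by (intro mult_right_mono) (auto simp: ennreal_leI[of 1 C, simplified])
    then have 2: "ennreal (lp_int p unit_cube f powr \<theta>) \<le> ennreal C * ennreal (lp_int p unit_cube f powr \<theta>)" by simp
    show ?thesis unfolding gauge_of_def proj_gauge_def distrib_left by (rule add_mono[OF 2 1])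
  qed
  then show ?thesis using C(1) by blast
qed

text \<open>The direct estimate at scale 2^(-k) requires cells smaller by the factor d =
  \<open>CARD('n)\<close>; since d \<le> 2^d, going d levels deeper suffices. The first d errors
  have no matching modulus and are estimated by the L_p norm.\<close>

lemma proj_gauge_le_gauge:
  assumes "1 \<le> p" "0 < \<theta>" "0 \<le> \<sigma>"
  shows "\<exists>C>0. \<forall>f :: real ^ 'n::finite => real. f \<in> Lp_space p unit_cube -->
    proj_gauge p \<sigma> \<theta> f \<le> ennreal C * gauge_of p \<sigma> \<theta> f"
proof -
  have p: "0 < p" using assms by simp
  define d where "d = CARD('n)"
  define A where "A = 2 powr p * (1 + 2 powr p)"
  define B :: real where "B = 2 powr p * 2 ^ d"
  define w where "w k = 2 powr (real k * \<sigma>)" for k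
  have w: "0 < w k" for k by (simp add: w_def)
  define c1 where "c1 = (\<Sum>k<d. (w k * A) powr \<theta>)"
  define c2 where "c2 = (w d * B) powr \<theta>"
  define C where "C = 1 + c1 + c2"
  have c: "0 \<le> c1" "0 \<le> c2" by (auto simp: c1_def c2_def intro: sum_nonneg)
  have C: "0 < C" "1 + c1 \<le> C" "c2 \<le> C" using c by (auto simp: C_def)
  have "proj_gauge p \<sigma> \<theta> f \<le> ennreal C * gauge_of p \<sigma> \<theta> f"
    if f: "f \<in> Lp_space p unit_cube" for f :: "real ^ 'n => real"
  proof -
    define L where "L = lp_int p unit_cube f"
    have L: "0 \<le> L" by (simp add: L_def)
    define t where "t k = ennreal ((w k * proj_error p f k) powr \<theta>)" for k
    have head: "(\<Sum>k<d. t k) \<le> ennreal (c1 * L powr \<theta>)"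
    proof -
      have "(\<Sum>k<d. t k) \<le> (\<Sum>k<d. ennreal ((w k * A) powr \<theta> * L powr \<theta>))"
      proof (rule sum_mono)
        fix k
        have "w k * proj_error p f k \<le> w k * (A * L)"
          using proj_error_le[OF assms(1) f, of k] w[of k] by (intro mult_left_mono) (auto simp: A_def L_def)
        then have "(w k * proj_error p f k) powr \<theta> \<le> (w k * A * L) powr \<theta>"
          using assms w[of k] by (intro powr_mono2) (auto simp: mult.assoc intro!: mult_nonneg_nonneg less_imp_le)
        also have "\<dots> = (w k * A) powr \<theta> * L powr \<theta>" by (rule powr_mult)
        finally show "t k \<le> ennreal ((w k * A) powr \<theta> * L powr \<theta>)" unfolding t_def by (rule ennreal_leI)
      qed
      also have "\<dots> = ennreal (c1 * L powr \<theta>)" unfolding c1_def sum_distrib_right by (rule sum_ennreal) simp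
      finally show ?thesis .
    qed
    have tail: "t (k + d) \<le> ennreal c2 * ennreal ((w k * mod_pow p ((1 / 2) ^ k) f) powr \<theta>)" for k
    proof -
      have "real CARD('n) / 2 ^ (k + d) \<le> (1 / 2) ^ k"
      proof -
        have "real d \<le> 2 ^ d" using less_imp_le[OF less_exp[of d]] by (metis of_nat_le_iff of_nat_numeral of_nat_power)
        then show ?thesis by (simp add: power_add power_one_over d_def[symmetric] field_simps)
      qed
      from haar_box_direct_estimate[OF assms(1) f this]
      have "proj_error p f (k + d) \<le> B * mod_pow p ((1 / 2) ^ k) f" by (simp add: proj_error_def B_def d_def)
      then have "w (k + d) * proj_error p f (k + d) \<le> w (k + d) * (B * mod_pow p ((1 / 2) ^ k) f)"
        using w[of "k + d"] by (intro mult_left_mono) auto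
      also have "w (k + d) * (B * mod_pow p ((1 / 2) ^ k) f) = (w d * B) * (w k * mod_pow p ((1 / 2) ^ k) f)"
        by (simp add: w_def distrib_right powr_add)
      finally have "(w (k + d) * proj_error p f (k + d)) powr \<theta> \<le> ((w d * B) * (w k * mod_pow p ((1 / 2) ^ k) f)) powr \<theta>"
        by (rule powr_mono2[rotated 2]) (use assms less_imp_le[OF w] in simp_all)
      also have "\<dots> = c2 * (w k * mod_pow p ((1 / 2) ^ k) f) powr \<theta>" unfolding c2_def by (rule powr_mult)
      finally show ?thesis
        unfolding t_def using c by (subst ennreal_mult[symmetric]) (auto intro: ennreal_leI)
    qed
    let ?W = "wsum \<sigma> \<theta> (\<lambda>k. mod_pow p ((1 / 2) ^ k) f)"
    have "wsum \<sigma> \<theta> (proj_error p f) = (\<Sum>k. t (k + d)) + (\<Sum>k<d. t k)"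
      unfolding wsum_def t_def w_def by (rule suminf_offset) simp
    also have "\<dots> \<le> ennreal c2 * ?W + ennreal (c1 * L powr \<theta>)"
    proof (rule add_mono[OF _ head])
      have "(\<Sum>k. t (k + d)) \<le> (\<Sum>k. ennreal c2 * ennreal ((w k * mod_pow p ((1 / 2) ^ k) f) powr \<theta>))"
        by (intro suminf_le tail) auto
      then show "(\<Sum>k. t (k + d)) \<le> ennreal c2 * ?W" by (simp add: wsum_def w_def)
    qed
    also have "ennreal c2 * ?W \<le> ennreal C * ?W" using C by (intro mult_right_mono ennreal_leI) auto
    finally have "proj_gauge p \<sigma> \<theta> f \<le> ennreal (L powr \<theta>) + (ennreal C * ?W + ennreal (c1 * L powr \<theta>))"
      unfolding proj_gauge_def L_def[symmetric] by (simp add: add_left_mono)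
    also have "\<dots> = ennreal ((1 + c1) * L powr \<theta>) + ennreal C * ?W"
      using c by (simp add: distrib_right ennreal_plus add_ac)
    also have "ennreal ((1 + c1) * L powr \<theta>) \<le> ennreal C * ennreal (L powr \<theta>)"
      using C by (subst ennreal_mult[symmetric]) (auto intro!: ennreal_leI mult_right_mono)
    finally show ?thesis unfolding gauge_of_def L_def[symmetric] distrib_left by (simp add: add_right_mono)
  qed
  then show ?thesis using C(1) by blast
qed

section \<open>A criterion for Schauder bases\<close>

lemma besov_norm_tendsto_iff:
  fixes u :: "nat => real ^ 'n::finite => real"
  assumes "0 < p" "0 < q" "0 \<le> s" and u: "\<And>n. u n \<in> besov_space p q s"
  shows "(\<lambda>n. besov_norm p q s (u n)) \<longlonglongrightarrow> 0 \<longleftrightarrow> (\<lambda>n. besov_gauge p q s (u n)) \<longlonglongrightarrow> 0"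
proof -
  obtain C where C: "C > 0" "\<forall>f :: real ^ 'n => real. f \<in> besov_space p q s -->
    besov_norm p q s f powr q \<le> C * besov_gauge p q s f \<and> besov_gauge p q s f \<le> C * besov_norm p q s f powr q"
    using besov_norm_gauge[OF assms(1-3), where 'n = 'n] by blast
  show ?thesis
  proof
    assume "(\<lambda>n. besov_norm p q s (u n)) \<longlonglongrightarrow> 0"
    then have "(\<lambda>n. besov_norm p q s (u n) powr q) \<longlonglongrightarrow> 0"
      using assms by (intro tendsto_zero_powrI[where b = q]) auto
    then have "(\<lambda>n. C * besov_norm p q s (u n) powr q) \<longlonglongrightarrow> C * 0" by (rule tendsto_mult_left)
    then have 0: "(\<lambda>n. C * besov_norm p q s (u n) powr q) \<longlonglongrightarrow> 0" by simp
    show "(\<lambda>n. besov_gauge p q s (u n)) \<longlonglongrightarrow> 0"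
      by (rule tendsto_sandwich[OF _ _ tendsto_const 0]) (use C u in \<open>auto intro!: always_eventually\<close>)
  next
    assume "(\<lambda>n. besov_gauge p q s (u n)) \<longlonglongrightarrow> 0"
    then have "(\<lambda>n. C * besov_gauge p q s (u n)) \<longlonglongrightarrow> C * 0" by (rule tendsto_mult_left)
    then have "(\<lambda>n. C * besov_gauge p q s (u n)) \<longlonglongrightarrow> 0" by simp
    then have 0: "(\<lambda>n. (C * besov_gauge p q s (u n)) powr (1 / q)) \<longlonglongrightarrow> 0"
      using assms C by (intro tendsto_zero_powrI[where b = "1 / q"]) auto
    have le: "besov_norm p q s (u n) \<le> (C * besov_gauge p q s (u n)) powr (1 / q)" for n
    proof -
      have "(besov_norm p q s (u n) powr q) powr (1 / q) \<le> (C * besov_gauge p q s (u n)) powr (1 / q)"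
        using C u assms by (intro powr_mono2) auto
      then show ?thesis using assms by (simp add: powr_powr)
    qed
    show "(\<lambda>n. besov_norm p q s (u n)) \<longlonglongrightarrow> 0"
      by (rule tendsto_sandwich[OF _ _ tendsto_const 0]) (use le in \<open>auto intro!: always_eventually\<close>)
  qed
qed

lemma lp_int_le_besov_gauge:
  fixes f :: "real ^ 'n::finite => real"
  assumes "0 < p" "0 < q" "0 \<le> s" "f \<in> besov_space p q s"
  shows "lp_int p unit_cube f powr (q / p) \<le> besov_gauge p q s f"
proof -
  have "ennreal (lp_int p unit_cube f powr (q / p)) \<le> ennreal (besov_gauge p q s f)"
    unfolding besov_gauge_ennreal[OF assms] gauge_of_def by simp
  then show ?thesis by simp
qed

text \<open>For p \<ge> 1 the coefficients are continuous on L_p, as L_p of the cube embeds into L_1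
  and Haar functions are bounded. This gives the uniqueness of expansions.\<close>

lemma hcoef_tendsto_0:
  fixes u :: "nat => real ^ 'n::finite => real"
  assumes "1 \<le> p" and u: "\<And>n. u n \<in> Lp_space p unit_cube" and lim: "(\<lambda>n. lp_int p unit_cube (u n)) \<longlonglongrightarrow> 0"
  shows "(\<lambda>n. hcoef m (u n)) \<longlonglongrightarrow> 0"
proof -
  let ?I = "\<lambda>n. (\<integral>x. \<bar>u n x\<bar> \<partial>cube_measure)"
  have one: "measure (cube_measure :: (real ^ 'n) measure) unit_cube = 1"
    using cube_measure_finite[where 'n = 'n] by (simp add: measure_def)
  have le: "?I n \<le> 2 * lp_int p unit_cube (u n) powr (1 / p)" for n
  proof -
    have a: "(\<lambda>x. \<bar>u n x\<bar>) \<in> borel_measurable cube_measure" "integrable cube_measure (\<lambda>x. \<bar>\<bar>u n x\<bar>\<bar> powr p)"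
      using u[of n] by (auto simp: Lp_space_def)
    have ind: "(\<integral>x. indicator unit_cube x * \<phi> x \<partial>cube_measure) = (\<integral>x. \<phi> x \<partial>cube_measure)" for \<phi> :: "real ^ 'n => real"
      by (intro Bochner_Integration.integral_cong refl) simp
    let ?M = "cube_measure :: (real ^ 'n) measure"
    have "\<bar>(\<integral>x. indicator unit_cube x * \<bar>u n x\<bar> \<partial>?M) / measure ?M unit_cube\<bar> powr p
        \<le> 2 powr p * ((\<integral>x. indicator unit_cube x * \<bar>\<bar>u n x\<bar>\<bar> powr p \<partial>?M) / measure ?M unit_cube)"
    proof -
      have "unit_cube \<in> sets (cube_measure :: (real ^ 'n) measure)" by simp
      moreover have "0 < measure (cube_measure :: (real ^ 'n) measure) unit_cube" by (simp only: one zero_less_one)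
      ultimately show ?thesis by (rule powr_average_le(2)[OF finite_measure_cube assms(1) a])
    qed
    then have "?I n powr p \<le> 2 powr p * lp_int p unit_cube (u n)"
      unfolding ind one by (simp add: lp_int_def integral_nonneg_AE)
    then have "(?I n powr p) powr (1 / p) \<le> (2 powr p * lp_int p unit_cube (u n)) powr (1 / p)"
      using assms by (intro powr_mono2) auto
    then show ?thesis using assms by (simp add: powr_powr powr_mult integral_nonneg_AE)
  qed
  have bound: "\<bar>hcoef m (u n)\<bar> \<le> tensor_weight m * (2 * lp_int p unit_cube (u n) powr (1 / p))" for n
  proof -
    have ui: "integrable cube_measure (u n)" by (rule Lp_integrable[OF assms(1) u])
    have "\<bar>\<integral>x. tensor_haar m x * u n x \<partial>cube_measure\<bar> \<le> (\<integral>x. \<bar>tensor_haar m x * u n x\<bar> \<partial>cube_measure)"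
      by (rule integral_abs_bound)
    also have "\<dots> \<le> ?I n"
    proof (rule integral_mono)
      show "integrable cube_measure (\<lambda>x. \<bar>tensor_haar m x * u n x\<bar>)"
        by (rule integrable_abs[OF integrable_haar_mult[OF ui]])
      show "integrable cube_measure (\<lambda>x. \<bar>u n x\<bar>)" by (rule integrable_abs[OF ui])
      show "\<bar>tensor_haar m x * u n x\<bar> \<le> \<bar>u n x\<bar>" for x
        using abs_tensor_haar_le_1[of m x] by (simp add: abs_mult mult_left_le_one_le)
    qed
    also note le[of n]
    finally show ?thesis
      using tensor_weight_pos[of m] by (simp add: hcoef_def abs_mult mult_left_mono)
  qed
  have "(\<lambda>n. lp_int p unit_cube (u n) powr (1 / p)) \<longlonglongrightarrow> 0"
    using assms by (intro tendsto_zero_powrI[where b = "1 / p"] lim) auto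
  then have "(\<lambda>n. tensor_weight m * (2 * lp_int p unit_cube (u n) powr (1 / p))) \<longlonglongrightarrow> tensor_weight m * (2 * 0)"
    by (intro tendsto_intros)
  then have lim0: "(\<lambda>n. tensor_weight m * (2 * lp_int p unit_cube (u n) powr (1 / p))) \<longlonglongrightarrow> 0" by simp
  show ?thesis
    by (rule Lim_null_comparison[OF _ lim0]) (use bound in \<open>auto intro!: always_eventually\<close>)
qed

text \<open>The product of two box sums is the box sum of the smaller level, so passing to f - P_k f
  freezes all errors below level k at their value for k.\<close>

lemma proj_error_residual:
  fixes f :: "real ^ 'n::finite => real"
  assumes "integrable cube_measure f"
  shows "proj_error p (\<lambda>x. f x - haar_sum (haar_box k) f x) l = proj_error p f (max l k)"
proof -
  have "haar_sum (haar_box l) (\<lambda>x. f x - haar_sum (haar_box k) f x)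
      = (\<lambda>x. haar_sum (haar_box l) f x - haar_sum (haar_box l \<inter> haar_box k) f x)"
    by (rule haar_residual[OF assms]) (auto simp: mem_haar_box)
  moreover have "haar_box l \<inter> haar_box k = (haar_box (min l k) :: ('n => nat) set)"
    by (cases "l \<le> k") (simp_all add: haar_box_mono Int_absorb1 Int_absorb2)
  ultimately have "(\<lambda>x. f x - haar_sum (haar_box k) f x - haar_sum (haar_box l) (\<lambda>x. f x - haar_sum (haar_box k) f x) x)
      = (\<lambda>x. f x - haar_sum (haar_box (max l k)) f x)"
    by (auto simp: fun_eq_iff min_def max_def)
  then show ?thesis by (simp add: proj_error_def)
qed

text \<open>Dominated convergence for series: each term tends to 0 with k because the errors of f
  do, and a convergent majorant exists because the error at level max l k is at most a constant
  times the error at level l.\<close>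

lemma proj_gauge_residual_tendsto:
  fixes f :: "real ^ 'n::finite => real"
  assumes "1 \<le> p" "0 < \<theta>" "0 \<le> \<sigma>" "f \<in> Lp_space p unit_cube" "proj_gauge p \<sigma> \<theta> f < \<infinity>"
  shows "(\<lambda>k. proj_gauge p \<sigma> \<theta> (\<lambda>x. f x - haar_sum (haar_box k) f x)) \<longlonglongrightarrow> 0"
proof -
  have p: "0 < p" using assms by simp
  have fi: "integrable cube_measure f" by (rule Lp_integrable[OF assms(1,4)])
  let ?E = "proj_error p f"
  define D where "D = 2 powr p * (1 + 2 powr p)"
  have D: "0 < D" by (simp add: D_def add_pos_nonneg)
  define t where "t l = (2 powr (real l * \<sigma>) * ?E l) powr \<theta>" for l
  have "(\<Sum>l. ennreal (t l)) < \<infinity>" using assms(5) by (simp add: proj_gauge_def wsum_def t_def)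
  then have sum_t: "summable t" by (intro summable_suminf_not_top) (auto simp: t_def)
  have Et: "?E k powr \<theta> \<le> t k" for k
  proof -
    have "1 * ?E k \<le> 2 powr (real k * \<sigma>) * ?E k"
      using assms by (intro mult_right_mono ge_one_powr_ge_zero) auto
    then show ?thesis unfolding t_def using assms by (intro powr_mono2) auto
  qed
  have E\<theta>: "(\<lambda>k. ?E k powr \<theta>) \<longlonglongrightarrow> 0"
    by (rule tendsto_sandwich[OF _ _ tendsto_const summable_LIMSEQ_zero[OF sum_t]])
       (use Et in \<open>auto intro!: always_eventually\<close>)
  then have "(\<lambda>k. (?E k powr \<theta>) powr (1 / \<theta>)) \<longlonglongrightarrow> 0"
    by (rule tendsto_zero_powrI[OF _ tendsto_const]) (use assms in auto)
  then have E0: "?E \<longlonglongrightarrow> 0" using assms by (simp add: powr_powr)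
  have Emax: "?E (max l k) \<le> D * ?E l" for l k
  proof -
    have "proj_error p (\<lambda>x. f x - haar_sum (haar_box l) f x) k \<le> D * lp_int p unit_cube (\<lambda>x. f x - haar_sum (haar_box l) f x)"
      unfolding D_def
      by (intro proj_error_le[OF assms(1)] Lp_diff(1)[OF p assms(4)] haar_sum_box_bounded(1)[OF assms(1,4)])
    then show ?thesis unfolding proj_error_residual[OF fi] by (simp add: proj_error_def max.commute)
  qed
  define u where "u k l = ennreal ((2 powr (real l * \<sigma>) * ?E (max l k)) powr \<theta>)" for k l
  have "(\<lambda>k. \<integral>\<^sup>+l. u k l \<partial>count_space UNIV) \<longlonglongrightarrow> (\<integral>\<^sup>+l. 0 \<partial>count_space (UNIV :: nat set))"
  proof (rule nn_integral_dominated_convergence[where w = "\<lambda>l. ennreal (D powr \<theta>) * ennreal (t l)"])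
    show "AE l in count_space UNIV. u k l \<le> ennreal (D powr \<theta>) * ennreal (t l)" for k
    proof (rule AE_I2)
      fix l :: nat
      have "(2 powr (real l * \<sigma>) * ?E (max l k)) powr \<theta> \<le> (2 powr (real l * \<sigma>) * (D * ?E l)) powr \<theta>"
        using assms Emax by (intro powr_mono2 mult_left_mono) auto
      also have "\<dots> = D powr \<theta> * t l" by (simp add: t_def powr_mult)
      finally show "u k l \<le> ennreal (D powr \<theta>) * ennreal (t l)"
        unfolding u_def by (subst ennreal_mult[symmetric]) (auto simp: t_def intro: ennreal_leI)
    qed
    have "(\<integral>\<^sup>+l. ennreal (D powr \<theta>) * ennreal (t l) \<partial>count_space UNIV) = ennreal (D powr \<theta>) * (\<Sum>l. ennreal (t l))"
      by (simp add: nn_integral_count_space_nat)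
    then show "(\<integral>\<^sup>+l. ennreal (D powr \<theta>) * ennreal (t l) \<partial>count_space UNIV) < \<infinity>"
      using \<open>(\<Sum>l. ennreal (t l)) < \<infinity>\<close> by (simp add: ennreal_mult_less_top)
    show "AE l in count_space UNIV. (\<lambda>k. u k l) \<longlonglongrightarrow> 0"
    proof (rule AE_I2)
      fix l :: nat
      have "(\<lambda>k. ?E (max l k)) \<longlonglongrightarrow> 0"
      proof (rule Lim_transform_eventually[OF E0])
        show "\<forall>\<^sub>F k in sequentially. ?E k = ?E (max l k)"
          using eventually_ge_at_top[of l] by eventually_elim (simp add: max_def)
      qed
      then have "(\<lambda>k. 2 powr (real l * \<sigma>) * ?E (max l k)) \<longlonglongrightarrow> 2 powr (real l * \<sigma>) * 0" by (rule tendsto_mult_left)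
      then have "(\<lambda>k. (2 powr (real l * \<sigma>) * ?E (max l k)) powr \<theta>) \<longlonglongrightarrow> 0"
        using assms by (intro tendsto_zero_powrI[where b = \<theta>]) auto
      then show "(\<lambda>k. u k l) \<longlonglongrightarrow> 0" unfolding u_def using tendsto_ennrealI by fastforce
    qed
  qed auto
  then have W: "(\<lambda>k. wsum \<sigma> \<theta> (\<lambda>l. ?E (max l k))) \<longlonglongrightarrow> 0"
    by (simp add: nn_integral_count_space_nat u_def wsum_def)
  have "(\<lambda>k. ennreal (?E k powr \<theta>)) \<longlonglongrightarrow> 0" using tendsto_ennrealI[OF E\<theta>] by simp
  from tendsto_add[OF this W] show ?thesis
    unfolding proj_gauge_def proj_error_residual[OF fi] by (simp add: proj_error_def)
qed

text \<open>Let S_M be the M-th partial sum and P_k the box sum. As they commute, the residual of f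
  - S_M f at level k equals I - S_M applied to f - P_k f, so an L_p bound passes to
  \<open>proj_gauge\<close>. Convergence follows because f - S_M f = (I - S_M)(f - P_k f) once the
  first M indices cover the box of level k, and the gauge of f - P_k f tends to 0.\<close>

theorem haar_schauder_basis:
  fixes \<nu> :: "nat => 'n::finite => nat"
  assumes p: "1 \<le> p" and q: "0 < q" and s: "0 \<le> s" "s < 1 / p"
    and \<nu>: "bij_betw \<nu> UNIV {m. \<forall>j. 1 \<le> m j}"
    and bound: "\<And>M f. f \<in> Lp_space p unit_cube ==>
       haar_sum (\<nu> ` {..<M}) f \<in> Lp_space p unit_cube \<and>
       lp_int p unit_cube (haar_sum (\<nu> ` {..<M}) f) \<le> B * lp_int p unit_cube f"
  shows "schauder_basis (besov_space p q s) (besov_norm p q s) (\<lambda>i. tensor_haar (\<nu> i))"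
proof -
  have p0: "0 < p" using p by simp
  note pqs = p0 q s(1)
  have \<sigma>: "0 \<le> s * p" "s * p < 1" and \<theta>: "0 < q / p" using p q s by (auto simp: field_simps)
  have inj: "inj \<nu>" using \<nu> by (simp add: bij_betw_def)
  have idx: "1 \<le> \<nu> i j" for i j using \<nu> by (auto simp: bij_betw_def)
  have eb: "tensor_haar (\<nu> i) \<in> besov_space p q s" for i
    by (rule tensor_haar_besov[OF pqs s(2) idx])
  let ?S = "\<lambda>M. haar_sum (\<nu> ` {..<M})"
  have S_sum: "?S M f x = (\<Sum>i<M. hcoef (\<nu> i) f * tensor_haar (\<nu> i) x)" for M f x
    unfolding haar_sum_def by (subst sum.reindex) (use inj in \<open>auto intro: inj_on_subset\<close>)
  have comb: "(\<lambda>x. g x - (\<Sum>i<M. c i * tensor_haar (\<nu> i) x)) \<in> besov_space p q s"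
    if "g \<in> besov_space p q s" for g c M
    by (intro besov_diff[OF pqs] besov_sum[OF pqs] besov_cmult(1)[OF pqs] eb that)
  define A where "A = 2 powr p * (1 + B)"
  have resid: "proj_gauge p (s * p) (q / p) (\<lambda>x. f x - ?S M f x) \<le> ennreal (A powr (q / p)) * proj_gauge p (s * p) (q / p) f"
    if f: "f \<in> Lp_space p unit_cube" for f M
  proof -
    have le: "lp_int p unit_cube (\<lambda>x. g x - ?S M g x) \<le> A * lp_int p unit_cube g" if g: "g \<in> Lp_space p unit_cube" for g
    proof -
      have "lp_int p unit_cube (\<lambda>x. g x - ?S M g x) \<le> 2 powr p * (lp_int p unit_cube g + lp_int p unit_cube (?S M g))"
        using bound[OF g, of M] by (intro Lp_diff(2)[OF p0 g]) auto
      also have "\<dots> \<le> 2 powr p * (lp_int p unit_cube g + B * lp_int p unit_cube g)"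
        using bound[OF g, of M] by (intro mult_left_mono add_left_mono) auto
      finally show ?thesis by (simp add: A_def algebra_simps)
    qed
    show ?thesis
    \<comment> \<open>Nothing forces B to be nonnegative. If A < 0, the bound makes every L_p
      quantity vanish and the left-hand side is 0.\<close>
    proof (cases "0 \<le> A")
      case False
      then have A: "A < 0" by simp
      have z: "lp_int p unit_cube g = 0" if g: "g \<in> Lp_space p unit_cube" for g :: "real ^ 'n => real"
      proof (rule ccontr)
        assume "lp_int p unit_cube g \<noteq> 0"
        then have "0 < lp_int p unit_cube g" using lp_int_nonneg[of p unit_cube g] by linarith
        then have "A * lp_int p unit_cube g < 0" using A by (simp add: mult_neg_pos)
        then show False using le[OF g] lp_int_nonneg[of p unit_cube "\<lambda>x. g x - ?S M g x"] by linarith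
      qed
      have d: "(\<lambda>x. f x - ?S M f x) \<in> Lp_space p unit_cube" using bound[OF f] by (intro Lp_diff(1)[OF p0 f]) auto
      have "proj_error p (\<lambda>x. f x - ?S M f x) k = 0" for k
        unfolding proj_error_def by (intro z Lp_diff(1)[OF p0 d] haar_sum_box_bounded(1)[OF p d])
      then have "proj_gauge p (s * p) (q / p) (\<lambda>x. f x - ?S M f x) = 0"
        using z[OF d] by (simp add: proj_gauge_def wsum_def)
      then show ?thesis by simp
    next
      case A: True
      have fi: "integrable cube_measure f" by (rule Lp_integrable[OF p f])
      have err: "proj_error p (\<lambda>x. f x - ?S M f x) k \<le> A * proj_error p f k" for k
      proof -
        let ?r = "\<lambda>x. f x - haar_sum (haar_box k) f x"
        have 1: "haar_sum (haar_box k) (\<lambda>x. f x - ?S M f x) = (\<lambda>x. haar_sum (haar_box k) f x - haar_sum (haar_box k \<inter> \<nu> ` {..<M}) f x)"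
          by (rule haar_residual[OF fi]) (use idx in \<open>auto simp: mem_haar_box\<close>)
        have 2: "?S M ?r = (\<lambda>x. ?S M f x - haar_sum (\<nu> ` {..<M} \<inter> haar_box k) f x)"
          by (rule haar_residual[OF fi]) (use idx in \<open>auto simp: mem_haar_box\<close>)
        have "(\<lambda>x. f x - ?S M f x - haar_sum (haar_box k) (\<lambda>x. f x - ?S M f x) x) = (\<lambda>x. ?r x - ?S M ?r x)"
          unfolding 1 2 by (auto simp: Int_commute)
        then show ?thesis
          unfolding proj_error_def using le[OF Lp_diff(1)[OF p0 f haar_sum_box_bounded(1)[OF p f]], of k] by simp
      qed
      have "wsum (s * p) (q / p) (proj_error p (\<lambda>x. f x - ?S M f x)) \<le> wsum (s * p) (q / p) (\<lambda>k. A * proj_error p f k)"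
        using \<theta> err by (intro wsum_mono) auto
      also have "\<dots> = ennreal (A powr (q / p)) * wsum (s * p) (q / p) (proj_error p f)"
        by (rule wsum_cmult[OF A])
      finally have w: "wsum (s * p) (q / p) (proj_error p (\<lambda>x. f x - ?S M f x)) \<le> ennreal (A powr (q / p)) * wsum (s * p) (q / p) (proj_error p f)" .
      have "lp_int p unit_cube (\<lambda>x. f x - ?S M f x) powr (q / p) \<le> (A * lp_int p unit_cube f) powr (q / p)"
        using \<theta> le[OF f] by (intro powr_mono2) auto
      then have l: "ennreal (lp_int p unit_cube (\<lambda>x. f x - ?S M f x) powr (q / p)) \<le> ennreal (A powr (q / p)) * ennreal (lp_int p unit_cube f powr (q / p))"
        unfolding powr_mult by (subst ennreal_mult[symmetric]) (auto intro: ennreal_leI)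
      show ?thesis unfolding proj_gauge_def distrib_left by (rule add_mono[OF l w])
    qed
  qed
  obtain C where C: "C > 0" "\<forall>f :: real ^ 'n => real. f \<in> Lp_space p unit_cube -->
    gauge_of p (s * p) (q / p) f \<le> ennreal C * proj_gauge p (s * p) (q / p) f"
    using gauge_le_proj_gauge[OF p \<theta> \<sigma>(2), where 'n = 'n] by blast
  obtain C' where C': "C' > 0" "\<forall>f :: real ^ 'n => real. f \<in> Lp_space p unit_cube -->
    proj_gauge p (s * p) (q / p) f \<le> ennreal C' * gauge_of p (s * p) (q / p) f"
    using proj_gauge_le_gauge[OF p \<theta> \<sigma>(1), where 'n = 'n] by blast
  have conv: "(\<lambda>M. besov_norm p q s (\<lambda>x. f x - (\<Sum>i<M. hcoef (\<nu> i) f * tensor_haar (\<nu> i) x))) \<longlonglongrightarrow> 0"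
    if f: "f \<in> besov_space p q s" for f
  proof -
    have fL: "f \<in> Lp_space p unit_cube" and fg: "gauge_of p (s * p) (q / p) f < \<infinity>"
      using f besov_space_iff[OF pqs] by auto
    have fi: "integrable cube_measure f" by (rule Lp_integrable[OF p fL])
    let ?r = "\<lambda>k x. f x - haar_sum (haar_box k) f x"
    have "ennreal C' * gauge_of p (s * p) (q / p) f < \<infinity>" using fg by (simp add: ennreal_mult_less_top)
    then have fin: "proj_gauge p (s * p) (q / p) f < \<infinity>" using C' fL by (meson le_less_trans)
    define K where "K = C * A powr (q / p)"
    have K: "0 \<le> K" using C by (simp add: K_def)
    have "(\<lambda>k. ennreal K * proj_gauge p (s * p) (q / p) (?r k)) \<longlonglongrightarrow> ennreal K * 0"
      using proj_gauge_residual_tendsto[OF p \<theta> \<sigma>(1) fL fin] by (intro ennreal_tendsto_cmult) auto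
    then have lim: "(\<lambda>k. ennreal K * proj_gauge p (s * p) (q / p) (?r k)) \<longlonglongrightarrow> 0" by simp
    have "(\<lambda>M. besov_gauge p q s (\<lambda>x. f x - (\<Sum>i<M. hcoef (\<nu> i) f * tensor_haar (\<nu> i) x))) \<longlonglongrightarrow> 0"
    proof (rule LIMSEQ_I)
      fix \<epsilon> :: real assume \<epsilon>: "0 < \<epsilon>"
      then have "\<forall>\<^sub>F k in sequentially. ennreal K * proj_gauge p (s * p) (q / p) (?r k) < ennreal \<epsilon>"
        using lim by (auto simp: order_tendsto_iff)
      then obtain k where k: "ennreal K * proj_gauge p (s * p) (q / p) (?r k) < ennreal \<epsilon>"
        by (auto simp: eventually_sequentially)
      have "haar_box k \<subseteq> range \<nu>" using \<nu> by (auto simp: bij_betw_def mem_haar_box)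
      from finite_subset_image[OF finite_haar_box this]
      obtain T where T: "finite T" "haar_box k = \<nu> ` T" by blast
      obtain M0 where M0: "T \<subseteq> {..<M0}" using finite_nat_bounded[OF T(1)] by blast
      have "norm (besov_gauge p q s (\<lambda>x. f x - (\<Sum>i<M. hcoef (\<nu> i) f * tensor_haar (\<nu> i) x)) - 0) < \<epsilon>" if M: "M \<ge> M0" for M
      proof -
        have sub: "haar_box k \<subseteq> \<nu> ` {..<M}" using T M0 M by auto
        have rL: "?r k \<in> Lp_space p unit_cube" by (rule Lp_diff(1)[OF p0 fL haar_sum_box_bounded(1)[OF p fL]])
        have "?S M (?r k) = (\<lambda>x. ?S M f x - haar_sum (\<nu> ` {..<M} \<inter> haar_box k) f x)"
          by (rule haar_residual[OF fi]) (use idx in \<open>auto simp: mem_haar_box\<close>)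
        also have "\<nu> ` {..<M} \<inter> haar_box k = haar_box k" using sub by blast
        finally have SM: "?S M (?r k) = (\<lambda>x. ?S M f x - haar_sum (haar_box k) f x)" .
        have eq: "(\<lambda>x. f x - (\<Sum>i<M. hcoef (\<nu> i) f * tensor_haar (\<nu> i) x)) = (\<lambda>x. ?r k x - ?S M (?r k) x)"
          unfolding SM S_sum[symmetric] by (simp add: fun_eq_iff)
        have dL: "(\<lambda>x. ?r k x - ?S M (?r k) x) \<in> Lp_space p unit_cube"
          using bound[OF rL] by (intro Lp_diff(1)[OF p0 rL]) auto
        have "gauge_of p (s * p) (q / p) (\<lambda>x. ?r k x - ?S M (?r k) x)
            \<le> ennreal C * proj_gauge p (s * p) (q / p) (\<lambda>x. ?r k x - ?S M (?r k) x)"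
          using C(2) dL by blast
        also have "\<dots> \<le> ennreal C * (ennreal (A powr (q / p)) * proj_gauge p (s * p) (q / p) (?r k))"
          by (intro mult_left_mono resid[OF rL]) simp
        also have "\<dots> = ennreal K * proj_gauge p (s * p) (q / p) (?r k)"
        proof -
          have "ennreal K = ennreal C * ennreal (A powr (q / p))"
            unfolding K_def by (rule ennreal_mult) (use C in simp_all)
          then show ?thesis by (simp only: mult.assoc)
        qed
        also note k
        finally have "gauge_of p (s * p) (q / p) (\<lambda>x. ?r k x - ?S M (?r k) x) < ennreal \<epsilon>" .
        then have "gauge_of p (s * p) (q / p) (\<lambda>x. f x - (\<Sum>i<M. hcoef (\<nu> i) f * tensor_haar (\<nu> i) x)) < ennreal \<epsilon>"
          by (simp only: eq)
        then have "ennreal (besov_gauge p q s (\<lambda>x. f x - (\<Sum>i<M. hcoef (\<nu> i) f * tensor_haar (\<nu> i) x))) < ennreal \<epsilon>"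
          by (simp only: besov_gauge_ennreal[OF pqs comb[OF f]])
        then show ?thesis by (simp add: ennreal_less_iff)
      qed
      then show "\<exists>no. \<forall>n\<ge>no. norm (besov_gauge p q s (\<lambda>x. f x - (\<Sum>i<n. hcoef (\<nu> i) f * tensor_haar (\<nu> i) x)) - 0) < \<epsilon>"
        by blast
    qed
    moreover have "(\<lambda>x. f x - (\<Sum>i<M. hcoef (\<nu> i) f * tensor_haar (\<nu> i) x)) \<in> besov_space p q s" for M
      by (rule comb[OF f])
    ultimately show ?thesis by (simp only: besov_norm_tendsto_iff[OF pqs])
  qed
  have uniq: "c = (\<lambda>i. hcoef (\<nu> i) g)"
    if g: "g \<in> besov_space p q s" and lim: "(\<lambda>M. besov_norm p q s (\<lambda>x. g x - (\<Sum>i<M. c i * tensor_haar (\<nu> i) x))) \<longlonglongrightarrow> 0" for g c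
  proof
    fix a
    let ?u = "\<lambda>M x. g x - (\<Sum>i<M. c i * tensor_haar (\<nu> i) x)"
    have ub: "?u M \<in> besov_space p q s" for M by (rule comb[OF g])
    then have uL: "?u M \<in> Lp_space p unit_cube" for M by (simp add: besov_space_def)
    have gi: "integrable cube_measure g" using g by (intro Lp_integrable[OF p]) (simp add: besov_space_def)
    have lim': "(\<lambda>M. besov_gauge p q s (?u M)) \<longlonglongrightarrow> 0"
      by (rule besov_norm_tendsto_iff[OF pqs, of ?u, OF ub, THEN iffD1, OF lim])
    have "(\<lambda>M. lp_int p unit_cube (?u M) powr (q / p)) \<longlonglongrightarrow> 0"
      by (rule tendsto_sandwich[OF _ _ tendsto_const lim'])
         (use lp_int_le_besov_gauge[OF pqs ub] in \<open>auto intro!: always_eventually\<close>)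
    then have "(\<lambda>M. (lp_int p unit_cube (?u M) powr (q / p)) powr (p / q)) \<longlonglongrightarrow> 0"
      by (rule tendsto_zero_powrI[OF _ tendsto_const]) (use p0 q in auto)
    then have "(\<lambda>M. lp_int p unit_cube (?u M)) \<longlonglongrightarrow> 0" using p0 q by (simp add: powr_powr)
    then have lim0: "(\<lambda>M. hcoef (\<nu> a) (?u M)) \<longlonglongrightarrow> 0" by (rule hcoef_tendsto_0[OF p uL])
    \<comment> \<open>By orthogonality the coefficient of the difference is constant as soon as the
      partial sum contains the a-th term; since it tends to 0, it identifies
      \<open>c a\<close>.\<close>
    have late: "hcoef (\<nu> a) (?u M) = hcoef (\<nu> a) g - c a" if "M > a" for M
    proof -
      have e: "(\<lambda>x. \<Sum>i<M. c i * tensor_haar (\<nu> i) x) = (\<lambda>x. \<Sum>m\<in>\<nu> ` {..<M}. c (inv \<nu> m) * tensor_haar m x)"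
        by (subst sum.reindex) (use inj in \<open>auto intro: inj_on_subset simp: inv_f_f\<close>)
      have "hcoef (\<nu> a) (\<lambda>x. \<Sum>i<M. c i * tensor_haar (\<nu> i) x) = c a"
        unfolding e by (subst hcoef_lincomb) (use idx that inj in \<open>auto simp: inv_f_f\<close>)
      moreover have "integrable cube_measure (\<lambda>x. \<Sum>i<M. c i * tensor_haar (\<nu> i) x)"
        by (intro Bochner_Integration.integrable_sum integrable_mult_right tensor_haar_integrable)
      ultimately show ?thesis using hcoef_diff[OF gi] by simp
    qed
    have "\<forall>\<^sub>F M in sequentially. hcoef (\<nu> a) (?u M) = hcoef (\<nu> a) g - c a"
      by (rule eventually_mono[OF eventually_gt_at_top[of a] late])
    then have "(\<lambda>M. hcoef (\<nu> a) g - c a) \<longlonglongrightarrow> 0" using lim0 by (rule Lim_transform_eventually[rotated])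
    then have "hcoef (\<nu> a) g - c a = 0" by (simp add: LIMSEQ_const_iff)
    then show "c a = hcoef (\<nu> a) g" by simp
  qed
  show ?thesis
    unfolding schauder_basis_def
  proof (intro conjI ballI)
    show "range (\<lambda>i. tensor_haar (\<nu> i)) \<subseteq> besov_space p q s" using eb by blast
    fix g :: "real ^ 'n => real" assume g: "g \<in> besov_space p q s"
    show "\<exists>!c. (\<lambda>M. besov_norm p q s (\<lambda>x. g x - (\<Sum>m<M. c m * tensor_haar (\<nu> m) x))) \<longlonglongrightarrow> 0"
      by (rule ex1I[where a = "\<lambda>i. hcoef (\<nu> i) g"], rule conv[OF g], rule uniq[OF g])
  qed
qed

section \<open>Boundedness of coefficient functionals in complete quasi-normed spaces\<close>

text \<open>
  The functional \<^term>\<open>N\<close> is the \<^term>\<open>q\<close>-th power of a quasi-norm.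
\<close>

locale complete_quasi_norm =
  fixes X :: "('a => real) set" and N :: "('a => real) => real" and K q \<rho> :: real
  assumes K: "1 \<le> K" and q: "0 < q" and \<rho>: "0 < \<rho>" "K * \<rho> \<le> 1 / 2" "\<rho> \<le> 1 / 2"
    and N_nonneg [simp]: "0 \<le> N f"
    and X_nonempty: "(\<lambda>x. 0) \<in> X"
    and add: "f \<in> X ==> g \<in> X ==> (\<lambda>x. f x + g x) \<in> X \<and> N (\<lambda>x. f x + g x) \<le> K * (N f + N g)"
    and cmult: "f \<in> X ==> (\<lambda>x. c * f x) \<in> X \<and> N (\<lambda>x. c * f x) \<le> \<bar>c\<bar> powr q * N f"
    and complete: "(\<And>j. h j \<in> X \<and> N (h j) \<le> r * \<rho> ^ j) ==> \<exists>g\<in>X. (\<lambda>n. N (\<lambda>x. g x - (\<Sum>j<n. h j x))) \<longlonglongrightarrow> 0"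
begin

lemma N_zero: "N (\<lambda>x. 0) = 0"
  using cmult[OF X_nonempty, of 0] q N_nonneg[of "\<lambda>x. 0"] by simp

lemma diff: "f \<in> X ==> g \<in> X ==> (\<lambda>x. f x - g x) \<in> X \<and> N (\<lambda>x. f x - g x) \<le> K * (N f + N g)"
proof -
  assume fg: "f \<in> X" "g \<in> X"
  have m: "(\<lambda>x. - 1 * g x) \<in> X" "N (\<lambda>x. - 1 * g x) \<le> N g" using cmult[OF fg(2), of "- 1"] by auto
  have "K * (N f + N (\<lambda>x. - 1 * g x)) \<le> K * (N f + N g)" using m K by (intro mult_left_mono) auto
  then show ?thesis using add[OF fg(1) m(1)] by auto
qed

lemma N_commute: "f \<in> X ==> g \<in> X ==> N (\<lambda>x. f x - g x) \<le> N (\<lambda>x. g x - f x)"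
  using cmult[of "\<lambda>x. g x - f x" "- 1"] diff by auto

lemma sum_closed: "(\<And>i. i < n ==> f i \<in> X) ==> (\<lambda>x. \<Sum>i<(n::nat). f i x) \<in> X"
proof (induction n)
  case (Suc n)
  then show ?case using add[of "\<lambda>x. \<Sum>i<n. f i x" "f n"] by auto
qed (simp add: X_nonempty)

text \<open>Splitting off the first term repeatedly, the quasi-triangle constant K is paid once more
  for every later term; early terms stay cheap.\<close>

lemma N_sum: "(\<And>i. i < n ==> f i \<in> X) ==> N (\<lambda>x. \<Sum>i<(n::nat). f i x) \<le> (\<Sum>i<n. K ^ Suc i * N (f i))"
proof (induction n arbitrary: f)
  case (Suc n)
  have 1: "(\<lambda>x. \<Sum>i<n. f (Suc i) x) \<in> X" using Suc.prems by (intro sum_closed) auto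
  have "N (\<lambda>x. \<Sum>i<Suc n. f i x) = N (\<lambda>x. f 0 x + (\<Sum>i<n. f (Suc i) x))"
    by (simp only: sum.lessThan_Suc_shift)
  also have "\<dots> \<le> K * (N (f 0) + N (\<lambda>x. \<Sum>i<n. f (Suc i) x))" using add 1 Suc.prems by simp
  also have "\<dots> \<le> K * (N (f 0) + (\<Sum>i<n. K ^ Suc i * N (f (Suc i))))"
    using Suc.prems K by (intro mult_left_mono add_left_mono Suc.IH) auto
  also have "\<dots> = (\<Sum>i<Suc n. K ^ Suc i * N (f i))"
    by (simp only: sum.lessThan_Suc_shift) (simp add: distrib_left sum_distrib_left mult.assoc)
  finally show ?case .
qed (simp add: N_zero)

text \<open>The requirement K \<rho> \<le> 1/2 lets geometric decay of the terms beat the factors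
  K^(i+1).\<close>

lemma N_geometric_sum:
  assumes "\<And>i. h i \<in> X" "\<And>i. N (h i) \<le> a * \<rho> ^ i" "0 \<le> a"
  shows "N (\<lambda>x. \<Sum>i<n. h i x) \<le> 2 * K * a"
proof -
  have "N (\<lambda>x. \<Sum>i<n. h i x) \<le> (\<Sum>i<n. K ^ Suc i * N (h i))" by (rule N_sum) (rule assms(1))
  also have "\<dots> \<le> (\<Sum>i<n. K * a * (1 / 2) ^ i)"
  proof (rule sum_mono)
    fix i
    have "K ^ Suc i * N (h i) \<le> K ^ Suc i * (a * \<rho> ^ i)" using assms K by (intro mult_left_mono) auto
    also have "\<dots> = K * a * (K * \<rho>) ^ i" by (simp add: power_mult_distrib)
    also have "\<dots> \<le> K * a * (1 / 2) ^ i" using K \<rho> assms by (intro mult_left_mono power_mono) auto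
    finally show "K ^ Suc i * N (h i) \<le> K * a * (1 / 2) ^ i" .
  qed
  also have "\<dots> = K * a * (\<Sum>i<n. (1 / 2) ^ i)" by (simp add: sum_distrib_left)
  also have "\<dots> \<le> K * a * 2"
  proof (intro mult_left_mono)
    have "(\<Sum>i<n. (1 / 2 :: real) ^ i) \<le> (\<Sum>i. (1 / 2) ^ i)"
      by (intro sum_le_suminf) (auto intro: summable_geometric)
    then show "(\<Sum>i<n. (1 / 2 :: real) ^ i) \<le> 2" by (simp add: suminf_geometric)
  qed (use K assms in auto)
  finally show ?thesis by simp
qed

section \<open>Expansions with respect to a fixed basis\<close>

context
  fixes e :: "nat => 'a => real"
  assumes e: "e m \<in> X" "0 < N (e m)"
    and basis: "g \<in> X ==> \<exists>!c :: nat => real. (\<lambda>M. N (\<lambda>x. g x - (\<Sum>m<M. c m * e m x))) \<longlonglongrightarrow> 0"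
begin

definition represents :: "('a => real) => (nat => real) => bool" where
  "represents g c \<longleftrightarrow> (\<lambda>M. N (\<lambda>x. g x - (\<Sum>m<M. c m * e m x))) \<longlonglongrightarrow> 0"

definition coeff :: "('a => real) => nat => real" where
  "coeff g = (THE c. represents g c)"

definition part :: "('a => real) => nat => 'a => real" where
  "part g M x = (\<Sum>m<M. coeff g m * e m x)"

text \<open>These sets increase with a and exhaust X, because convergent expansions have bounded
  partial sums; Baire's argument is applied to them. They are not known to be closed, hence the
  statements about approximation up to arbitrary \<epsilon> below.\<close>

definition bounded_parts :: "real => ('a => real) set" where
  "bounded_parts a = {f \<in> X. \<forall>M. N (part f M) \<le> a}"

lemma represents_coeff: "g \<in> X ==> represents g (coeff g)"
proof -
  assume "g \<in> X"
  then have "\<exists>!c. represents g c" unfolding represents_def by (rule basis)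
  then show ?thesis unfolding coeff_def by (rule theI')
qed

lemma coeff_unique: "g \<in> X ==> represents g c ==> coeff g = c"
proof -
  assume "g \<in> X" and c: "represents g c"
  then have "\<exists>!c. represents g c" unfolding represents_def by (intro basis)
  then show ?thesis unfolding coeff_def by (metis c the1_equality)
qed

lemma lincomb_closed: "(\<lambda>x. \<Sum>m<M. c m * e m x) \<in> X"
  by (rule sum_closed) (use cmult e in blast)

lemma part_closed: "part g M \<in> X"
  unfolding part_def[abs_def] by (rule lincomb_closed)

lemma coeff_diff:
  assumes "f \<in> X" "g \<in> X"
  shows "coeff (\<lambda>x. f x - g x) = (\<lambda>m. coeff f m - coeff g m)"
proof (rule coeff_unique)
  show "(\<lambda>x. f x - g x) \<in> X" using diff assms by blast
  have "(\<lambda>M. K * (N (\<lambda>x. f x - part f M x) + N (\<lambda>x. g x - part g M x))) \<longlonglongrightarrow> K * (0 + 0)"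
    using represents_coeff[OF assms(1)] represents_coeff[OF assms(2)]
    unfolding represents_def part_def by (intro tendsto_intros)
  then have lim: "(\<lambda>M. K * (N (\<lambda>x. f x - part f M x) + N (\<lambda>x. g x - part g M x))) \<longlonglongrightarrow> 0" by simp
  have "N (\<lambda>x. f x - g x - (\<Sum>m<M. (coeff f m - coeff g m) * e m x)) \<le> K * (N (\<lambda>x. f x - part f M x) + N (\<lambda>x. g x - part g M x))" for M
  proof -
    have eq: "(\<lambda>x. f x - g x - (\<Sum>m<M. (coeff f m - coeff g m) * e m x)) = (\<lambda>x. (f x - part f M x) - (g x - part g M x))"
      by (simp add: part_def fun_eq_iff left_diff_distrib sum_subtractf)
    show ?thesis unfolding eq using diff assms part_closed by meson
  qed
  then show "represents (\<lambda>x. f x - g x) (\<lambda>m. coeff f m - coeff g m)"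
    unfolding represents_def by (intro tendsto_sandwich[OF _ _ tendsto_const lim]) auto
qed

lemma coeff_cmult:
  assumes "f \<in> X"
  shows "coeff (\<lambda>x. c * f x) = (\<lambda>m. c * coeff f m)"
proof (rule coeff_unique)
  show "(\<lambda>x. c * f x) \<in> X" using cmult assms by blast
  have "(\<lambda>M. \<bar>c\<bar> powr q * N (\<lambda>x. f x - part f M x)) \<longlonglongrightarrow> \<bar>c\<bar> powr q * 0"
    using represents_coeff[OF assms(1)] unfolding represents_def part_def by (intro tendsto_intros)
  then have lim: "(\<lambda>M. \<bar>c\<bar> powr q * N (\<lambda>x. f x - part f M x)) \<longlonglongrightarrow> 0" by simp
  have "N (\<lambda>x. c * f x - (\<Sum>m<M. c * coeff f m * e m x)) \<le> \<bar>c\<bar> powr q * N (\<lambda>x. f x - part f M x)" for M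
  proof -
    have eq: "(\<lambda>x. c * f x - (\<Sum>m<M. c * coeff f m * e m x)) = (\<lambda>x. c * (f x - part f M x))"
      by (simp add: part_def fun_eq_iff right_diff_distrib sum_distrib_left mult.assoc)
    show ?thesis unfolding eq using cmult diff assms part_closed by meson
  qed
  then show "represents (\<lambda>x. c * f x) (\<lambda>m. c * coeff f m)"
    unfolding represents_def by (intro tendsto_sandwich[OF _ _ tendsto_const lim]) auto
qed

lemma bounded_parts_exhaust:
  assumes "f \<in> X"
  shows "\<exists>n::nat. \<forall>k\<ge>n. f \<in> bounded_parts (real k)"
proof -
  have "Bseq (\<lambda>M. N (\<lambda>x. f x - part f M x))"
    using represents_coeff[OF assms] unfolding represents_def part_def
    by (intro convergent_imp_Bseq) (auto simp: convergent_def)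
  then obtain b where b: "\<And>M. N (\<lambda>x. f x - part f M x) \<le> b" by (auto simp: Bseq_def)
  have "N (part f M) \<le> K * (N f + b)" for M
  proof -
    have "N (part f M) = N (\<lambda>x. f x - (f x - part f M x))" by simp
    also have "\<dots> \<le> K * (N f + N (\<lambda>x. f x - part f M x))"
      using diff[OF assms] diff[OF assms part_closed] by blast
    also have "\<dots> \<le> K * (N f + b)" using K b by (intro mult_left_mono) auto
    finally show ?thesis .
  qed
  moreover obtain n :: nat where "K * (N f + b) \<le> real n" using real_arch_simple by blast
  ultimately have "N (part f M) \<le> real k" if "k \<ge> n" for k M
    using that by (smt (verit) of_nat_le_iff)
  then have "\<forall>k\<ge>n. f \<in> bounded_parts (real k)" using assms by (simp add: bounded_parts_def)
  then show ?thesis by blast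
qed

text \<open>Otherwise one can choose g_(n+1) near g_n with distance at least 4 K^2 r_(n+1) from the
  n-th set. The limit G is within 2 K^2 r_(n+1) of g_(n+1) for every n and belongs to the n-th set
  for some n, a contradiction. The nested sequence is built by hand since N only satisfies a
  quasi-triangle inequality.\<close>

lemma baire_step:
  "\<exists>(a::nat) g0 r. g0 \<in> X \<and> 0 < r \<and>
    (\<forall>f\<in>X. N (\<lambda>x. f x - g0 x) < r --> (\<forall>\<epsilon>>0. \<exists>u\<in>bounded_parts (real a). N (\<lambda>x. f x - u x) < \<epsilon>))"
proof (rule ccontr)
  assume "\<not> ?thesis"
  then have no: "\<exists>f\<in>X. N (\<lambda>x. f x - g0 x) < r \<and> (\<exists>\<epsilon>>0. \<forall>u\<in>bounded_parts (real a). \<epsilon> \<le> N (\<lambda>x. f x - u x))"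
    if "g0 \<in> X" "0 < r" for a :: nat and g0 r
    using that by (meson not_less)
  define P where "P n z \<longleftrightarrow> fst z \<in> X \<and> 0 < snd z" for n :: nat and z :: "('a => real) \<times> real"
  define Q where "Q n z z' \<longleftrightarrow> N (\<lambda>x. fst z' x - fst z x) < snd z \<and> snd z' \<le> \<rho> * snd z \<and>
      (\<forall>u\<in>bounded_parts (real n). 4 * K ^ 2 * snd z' \<le> N (\<lambda>x. fst z' x - u x))"
    for n and z z' :: "('a => real) \<times> real"
  have "\<exists>z. P 0 z" unfolding P_def using X_nonempty by (intro exI[of _ "(\<lambda>x. 0, 1)"]) auto
  moreover have "\<exists>z'. P (Suc n) z' \<and> Q n z z'" if z: "P n z" for n z
  proof -
    obtain f \<epsilon> where f: "f \<in> X" "N (\<lambda>x. f x - fst z x) < snd z" and \<epsilon>: "0 < \<epsilon>"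
      "\<forall>u\<in>bounded_parts (real n). \<epsilon> \<le> N (\<lambda>x. f x - u x)"
      using no[of "fst z" "snd z" n] z unfolding P_def by blast
    \<comment> \<open>The first bound makes successive distances decay like \<rho>^n, so that
      completeness applies; the second puts the set at least twice as far away as the limit will
      turn out to be.\<close>
    define r where "r = min (\<rho> * snd z) (\<epsilon> / (4 * K ^ 2))"
    have r: "0 < r" "r \<le> \<rho> * snd z" "4 * K ^ 2 * r \<le> \<epsilon>"
    proof -
      have K2: "0 < 4 * K ^ 2" using K by simp
      show "0 < r" using \<rho> z \<epsilon> K2 by (simp add: r_def P_def)
      show "r \<le> \<rho> * snd z" by (simp add: r_def)
      have "r \<le> \<epsilon> / (4 * K ^ 2)" by (simp add: r_def)
      then show "4 * K ^ 2 * r \<le> \<epsilon>" using K2 by (simp add: field_simps)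
    qed
    have "P (Suc n) (f, r) \<and> Q n z (f, r)"
      using f r \<epsilon>(2) by (auto simp: P_def Q_def intro: order_trans)
    then show ?thesis by blast
  qed
  ultimately obtain z where z: "\<And>n. P n (z n)" "\<And>n. Q n (z n) (z (Suc n))"
    using dependent_nat_choice[of P Q] by blast
  define g where "g n = fst (z n)" for n
  define r where "r n = snd (z n)" for n
  have gX: "g n \<in> X" and r0: "0 < r n" for n using z(1)[of n] by (auto simp: P_def g_def r_def)
  have step: "N (\<lambda>x. g (Suc n) x - g n x) < r n" "r (Suc n) \<le> \<rho> * r n"
    and far: "\<forall>u\<in>bounded_parts (real n). 4 * K ^ 2 * r (Suc n) \<le> N (\<lambda>x. g (Suc n) x - u x)" for n
    using z(2)[of n] by (auto simp: Q_def g_def r_def)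
  have rn: "r (n + i) \<le> r n * \<rho> ^ i" for n i
  proof (induction i)
    case (Suc i)
    have "r (n + Suc i) \<le> \<rho> * r (n + i)" using step(2)[of "n + i"] by simp
    also have "\<dots> \<le> \<rho> * (r n * \<rho> ^ i)" using Suc \<rho> by (intro mult_left_mono) auto
    finally show ?case by (simp add: mult_ac)
  qed simp
  let ?h = "\<lambda>n i x. g (n + Suc i) x - g (n + i) x"
  have hX: "?h n i \<in> X" for n i using diff gX by blast
  have hN: "N (?h n i) \<le> r n * \<rho> ^ i" for n i
    using less_imp_le[OF step(1)[of "n + i"]] rn[of n i] by simp
  have tele: "(\<Sum>i<k. ?h n i x) = g (n + k) x - g n x" for n k x
    by (induction k) auto
  obtain g' where g': "g' \<in> X" "(\<lambda>n. N (\<lambda>x. g' x - (\<Sum>j<n. ?h 0 j x))) \<longlonglongrightarrow> 0"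
    using complete[of "?h 0" "r 0"] hX hN by blast
  define G where "G x = g' x + g 0 x" for x
  have GX: "G \<in> X" unfolding G_def[abs_def] using add g'(1) gX by blast
  have lim: "(\<lambda>n. N (\<lambda>x. G x - g n x)) \<longlonglongrightarrow> 0"
  proof -
    have "(\<lambda>x. g' x - (\<Sum>j<n. ?h 0 j x)) = (\<lambda>x. G x - g n x)" for n
      unfolding tele by (simp add: G_def fun_eq_iff)
    then show ?thesis using g'(2) by simp
  qed
  \<comment> \<open>N is not assumed continuous, so the estimate passes through an intermediate
    g_(n+k) and then lets k tend to infinity; this costs the additional factor K.\<close>
  have near: "N (\<lambda>x. G x - g n x) \<le> K * (2 * K * r n)" for n
  proof -
    have "N (\<lambda>x. G x - g n x) \<le> K * (N (\<lambda>x. G x - g (n + k) x) + 2 * K * r n)" for k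
    proof -
      have d: "(\<lambda>x. G x - g (n + k) x) \<in> X" "(\<lambda>x. g (n + k) x - g n x) \<in> X" using diff GX gX by blast+
      have "N (\<lambda>x. g (n + k) x - g n x) \<le> 2 * K * r n"
        using N_geometric_sum[of "?h n" "r n" k] hX hN r0[of n] unfolding tele by (simp add: less_imp_le)
      moreover have "N (\<lambda>x. G x - g n x) \<le> K * (N (\<lambda>x. G x - g (n + k) x) + N (\<lambda>x. g (n + k) x - g n x))"
        using add[OF d] by simp
      moreover have "K * (N (\<lambda>x. G x - g (n + k) x) + N (\<lambda>x. g (n + k) x - g n x)) \<le> K * (N (\<lambda>x. G x - g (n + k) x) + 2 * K * r n)"
        using calculation(1) K by (intro mult_left_mono) auto
      ultimately show ?thesis by linarith
    qed
    moreover have "(\<lambda>k. K * (N (\<lambda>x. G x - g (n + k) x) + 2 * K * r n)) \<longlonglongrightarrow> K * (0 + 2 * K * r n)"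
      using LIMSEQ_ignore_initial_segment[OF lim, of n] by (intro tendsto_intros) (simp add: add.commute)
    ultimately show ?thesis using LIMSEQ_le_const by (metis (no_types, lifting) add_0)
  qed
  obtain n where n: "G \<in> bounded_parts (real n)" using bounded_parts_exhaust[OF GX] by blast
  have "4 * K ^ 2 * r (Suc n) \<le> N (\<lambda>x. g (Suc n) x - G x)" using far n by blast
  also have "\<dots> \<le> N (\<lambda>x. G x - g (Suc n) x)" using N_commute gX GX by blast
  also have "\<dots> \<le> K * (2 * K * r (Suc n))" by (rule near)
  finally have "4 * K ^ 2 * r (Suc n) \<le> 2 * K ^ 2 * r (Suc n)" by (simp add: power2_eq_square)
  moreover have "0 < K ^ 2 * r (Suc n)" using r0[of "Suc n"] K by simp
  ultimately show False by (simp add: mult.commute)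
qed

text \<open>Density near g0 is moved to the origin: a small f is scaled into the ball around g0,
  both the shifted point and g0 are approximated, and the difference of the two approximants is
  scaled back. By homogeneity the resulting bound is proportional to \<eta>.\<close>

lemma dense_step:
  "\<exists>b\<ge>0. \<forall>\<eta>>0. \<forall>f\<in>X. N f < \<eta> --> (\<forall>\<epsilon>>0. \<exists>u\<in>bounded_parts (b * \<eta>). N (\<lambda>x. f x - u x) < \<epsilon>)"
proof -
  obtain a :: nat and g0 r where g0: "g0 \<in> X" and r: "0 < r" and
    A: "\<forall>f\<in>X. N (\<lambda>x. f x - g0 x) < r --> (\<forall>\<epsilon>>0. \<exists>u\<in>bounded_parts (real a). N (\<lambda>x. f x - u x) < \<epsilon>)"
    using baire_step by blast
  define b where "b = K * (real a + real a) / r"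
  have "\<exists>u\<in>bounded_parts (b * \<eta>). N (\<lambda>x. f x - u x) < \<epsilon>"
    if \<eta>: "0 < \<eta>" and f: "f \<in> X" "N f < \<eta>" and \<epsilon>: "0 < \<epsilon>" for \<eta> f \<epsilon>
  proof -
    \<comment> \<open>Multiplication by \<tau> maps the ball N < \<eta> into the ball N < r, as N
      scales with the power q.\<close>
    define \<tau> where "\<tau> = (r / \<eta>) powr (1 / q)"
    have \<tau>: "0 < \<tau>" "\<tau> powr q = r / \<eta>" using r \<eta> q by (auto simp: \<tau>_def powr_powr)
    have i\<tau>: "(1 / \<tau>) powr q = \<eta> / r" using \<tau> r \<eta> by (simp add: powr_divide)
    have f1: "(\<lambda>x. \<tau> * f x + g0 x) \<in> X" using add cmult f g0 by blast
    have "N (\<lambda>x. (\<tau> * f x + g0 x) - g0 x) \<le> \<tau> powr q * N f" using cmult[OF f(1), of \<tau>] \<tau> by simp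
    also have "\<dots> < \<tau> powr q * \<eta>" using f \<tau> r \<eta> by (intro mult_strict_left_mono) auto
    also have "\<dots> = r" using \<tau> \<eta> by simp
    finally have near: "N (\<lambda>x. (\<tau> * f x + g0 x) - g0 x) < r" .
    \<comment> \<open>Scaled back and added with the constant K, two errors \<epsilon>' amount to
      \<epsilon>/2.\<close>
    define \<epsilon>' where "\<epsilon>' = \<epsilon> * r / (4 * K * \<eta>)"
    have \<epsilon>': "0 < \<epsilon>'" using \<epsilon> r \<eta> K by (simp add: \<epsilon>'_def)
    from A[rule_format, OF f1 near \<epsilon>']
    obtain u1 where u1: "u1 \<in> bounded_parts (real a)" "N (\<lambda>x. \<tau> * f x + g0 x - u1 x) < \<epsilon>'" by blast
    have "N (\<lambda>x. g0 x - g0 x) < r" using r N_zero by simp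
    from A[rule_format, OF g0 this \<epsilon>']
    obtain u2 where u2: "u2 \<in> bounded_parts (real a)" "N (\<lambda>x. g0 x - u2 x) < \<epsilon>'" by blast
    have uX: "u1 \<in> X" "u2 \<in> X" using u1 u2 by (auto simp: bounded_parts_def)
    define u where "u x = (1 / \<tau>) * (u1 x - u2 x)" for x
    have u12: "(\<lambda>x. u1 x - u2 x) \<in> X" using diff uX by blast
    have uX': "u \<in> X" unfolding u_def[abs_def] using cmult u12 by blast
    have "N (part u M) \<le> b * \<eta>" for M
    proof -
      have "part u M = (\<lambda>x. (1 / \<tau>) * (part u1 M x - part u2 M x))"
        unfolding part_def[abs_def] u_def[abs_def] coeff_cmult[OF u12] coeff_diff[OF uX]
        by (simp add: fun_eq_iff sum_distrib_left right_diff_distrib left_diff_distrib sum_subtractf diff_divide_distrib sum_divide_distrib)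
      then have "N (part u M) \<le> \<bar>1 / \<tau>\<bar> powr q * N (\<lambda>x. part u1 M x - part u2 M x)"
        using cmult[of "\<lambda>x. part u1 M x - part u2 M x" "1 / \<tau>"] diff part_closed by metis
      also have "\<dots> \<le> (\<eta> / r) * (K * (N (part u1 M) + N (part u2 M)))"
        using diff[OF part_closed part_closed] \<tau> i\<tau> \<eta> r by (intro mult_mono) auto
      also have "\<dots> \<le> (\<eta> / r) * (K * (real a + real a))"
        using u1 u2 \<eta> r K by (intro mult_left_mono add_mono) (auto simp: bounded_parts_def)
      finally show ?thesis by (simp add: b_def mult_ac)
    qed
    then have "u \<in> bounded_parts (b * \<eta>)" using uX' by (simp add: bounded_parts_def)
    moreover have "N (\<lambda>x. f x - u x) < \<epsilon>"
    proof -
      have d: "(\<lambda>x. \<tau> * f x + g0 x - u1 x) \<in> X" "(\<lambda>x. g0 x - u2 x) \<in> X" using diff f1 g0 uX by blast+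
      have "(\<lambda>x. f x - u x) = (\<lambda>x. (1 / \<tau>) * ((\<tau> * f x + g0 x - u1 x) - (g0 x - u2 x)))"
        using \<tau> by (auto simp: u_def fun_eq_iff field_simps)
      then have "N (\<lambda>x. f x - u x) \<le> \<bar>1 / \<tau>\<bar> powr q * N (\<lambda>x. (\<tau> * f x + g0 x - u1 x) - (g0 x - u2 x))"
        using cmult diff[OF d] by metis
      also have "\<dots> \<le> (\<eta> / r) * (K * (N (\<lambda>x. \<tau> * f x + g0 x - u1 x) + N (\<lambda>x. g0 x - u2 x)))"
        using diff[OF d] \<tau> i\<tau> \<eta> r by (intro mult_mono) auto
      also have "\<dots> \<le> (\<eta> / r) * (K * (\<epsilon>' + \<epsilon>'))"
        using u1 u2 \<eta> r K by (intro mult_left_mono add_mono) auto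
      also have "\<dots> = \<epsilon> / 2" using \<eta> r K by (simp add: \<epsilon>'_def field_simps)
      also have "\<dots> < \<epsilon>" using \<epsilon> by simp
      finally show ?thesis .
    qed
    ultimately show ?thesis by blast
  qed
  moreover have "0 \<le> b" using K r by (simp add: b_def)
  ultimately show ?thesis by blast
qed

text \<open>The successive approximation of the open mapping theorem. Iterating
  \<open>dense_step\<close> splits f into u_j whose partial sums are bounded by b \<eta> \<rho>^j.
  Adding the coefficients of all u_j yields an expansion of f with partial sums bounded by C \<eta>;
  by uniqueness it is the given one. Finally \<eta> decreases to N f.\<close>

theorem basis_parts_bounded:
  "\<exists>C\<ge>0. \<forall>g\<in>X. \<forall>c. (\<lambda>M. N (\<lambda>x. g x - (\<Sum>m<M. c m * e m x))) \<longlonglongrightarrow> 0 -->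
    (\<forall>M. N (\<lambda>x. \<Sum>m<M. c m * e m x) \<le> C * N g)"
proof -
  obtain b where b: "0 \<le> b" and D: "\<forall>\<eta>>0. \<forall>f\<in>X. N f < \<eta> --> (\<forall>\<epsilon>>0. \<exists>u\<in>bounded_parts (b * \<eta>). N (\<lambda>x. f x - u x) < \<epsilon>)"
    using dense_step by blast
  define C where "C = K * (2 * K * b)"
  have main: "\<exists>c. represents f c \<and> (\<forall>M. N (\<lambda>x. \<Sum>m<M. c m * e m x) \<le> C * \<eta>)"
    if f: "f \<in> X" and \<eta>: "N f < \<eta>" for f \<eta>
  proof -
    have \<eta>0: "0 < \<eta>" using \<eta> N_nonneg[of f] by linarith
    \<comment> \<open>\<open>v\<close> is the remainder before the n-th splitting; \<open>Q\<close>
      says that the part split off there has partial sums bounded in proportion to the size of the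
      remainder.\<close>
    define P where "P n v \<longleftrightarrow> v \<in> X \<and> N v < \<eta> * \<rho> ^ n" for n v
    define Q where "Q n v v' \<longleftrightarrow> (\<lambda>x. v x - v' x) \<in> bounded_parts (b * (\<eta> * \<rho> ^ n))" for n :: nat and v v' :: "'a => real"
    have "\<exists>v'. P (Suc n) v' \<and> Q n v v'" if Pv: "P n v" for n v
    proof -
      have pos: "0 < \<eta> * \<rho> ^ n" "0 < \<eta> * \<rho> ^ Suc n" using \<eta>0 \<rho> by auto
      have vX: "v \<in> X" "N v < \<eta> * \<rho> ^ n" using Pv by (simp_all add: P_def)
      from D[rule_format, OF pos(1) vX pos(2)]
      obtain u where u: "u \<in> bounded_parts (b * (\<eta> * \<rho> ^ n))" "N (\<lambda>x. v x - u x) < \<eta> * \<rho> ^ Suc n" by blast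
      have "u \<in> X" using u by (simp add: bounded_parts_def)
      then have "P (Suc n) (\<lambda>x. v x - u x)" using diff[OF vX(1)] u by (simp add: P_def)
      moreover have "Q n v (\<lambda>x. v x - u x)" using u by (simp add: Q_def)
      ultimately show ?thesis by blast
    qed
    moreover have "P 0 f" using f \<eta> by (simp add: P_def)
    ultimately obtain v where v0: "v 0 = f" and v: "\<And>n. P n (v n)" "\<And>n. Q n (v n) (v (Suc n))"
    proof -
      assume that: "\<And>v. v 0 = f ==> (\<And>n. P n (v n)) ==> (\<And>n. Q n (v n) (v (Suc n))) ==> thesis"
        and st: "\<And>n v. P n v ==> \<exists>v'. P (Suc n) v' \<and> Q n v v'" and "P 0 f"
      have "\<exists>v. (\<forall>n. (P n (v n) \<and> (n = 0 --> v n = f)) \<and> Q n (v n) (v (Suc n)))"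
        by (rule dependent_nat_choice[of "\<lambda>n v. P n v \<and> (n = 0 --> v = f)" Q]) (use st \<open>P 0 f\<close> in auto)
      then show thesis using that by blast
    qed
    define u where "u j x = v j x - v (Suc j) x" for j x
    have uB: "u j \<in> bounded_parts (b * (\<eta> * \<rho> ^ j))" for j using v(2)[of j] by (simp add: Q_def u_def[abs_def])
    then have uX: "u j \<in> X" for j by (simp add: bounded_parts_def)
    have uN: "N (part (u j) M) \<le> b * \<eta> * \<rho> ^ j" for j M using uB[of j] by (simp add: bounded_parts_def mult.assoc)
    have tele: "(\<Sum>j<n. u j x) = f x - v n x" for n x by (induction n) (auto simp: u_def v0)
    \<comment> \<open>A single term is the difference of two consecutive partial sums, and N (e m) >
      0 recovers the size of the coefficient from it; hence the coefficients decay like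
      \<rho>^(j/q).\<close>
    have cu: "summable (\<lambda>j. coeff (u j) m)" for m
    proof -
      define A where "A = (K * (2 * (b * \<eta>)) / N (e m)) powr (1 / q)"
      have le: "norm (coeff (u j) m) \<le> A * (\<rho> powr (1 / q)) ^ j" for j
      proof -
        have eq: "(\<lambda>x. coeff (u j) m * e m x) = (\<lambda>x. part (u j) (Suc m) x - part (u j) m x)"
          by (simp add: part_def fun_eq_iff)
        have hom: "\<bar>c\<bar> powr q * N (e m) \<le> N (\<lambda>x. c * e m x)" for c
        proof (cases "c = 0")
          case False
          have cX: "(\<lambda>x. c * e m x) \<in> X" using cmult e by blast
          have "N (e m) = N (\<lambda>x. (1 / c) * (c * e m x))" using False by simp
          also have "\<dots> \<le> \<bar>1 / c\<bar> powr q * N (\<lambda>x. c * e m x)" using cmult[OF cX] by blast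
          finally show ?thesis using False by (simp add: powr_divide field_simps)
        qed (use q N_nonneg in simp)
        have "\<bar>coeff (u j) m\<bar> powr q * N (e m) \<le> K * (N (part (u j) (Suc m)) + N (part (u j) m))"
          using hom[of "coeff (u j) m"] diff[OF part_closed part_closed] unfolding eq by (meson order_trans)
        also have "\<dots> \<le> K * (b * \<eta> * \<rho> ^ j + b * \<eta> * \<rho> ^ j)" using K uN by (intro mult_left_mono add_mono) auto
        finally have "\<bar>coeff (u j) m\<bar> powr q \<le> K * (2 * (b * \<eta>)) / N (e m) * \<rho> ^ j"
          using e(2)[of m] by (simp add: field_simps)
        then have "(\<bar>coeff (u j) m\<bar> powr q) powr (1 / q) \<le> (K * (2 * (b * \<eta>)) / N (e m) * \<rho> ^ j) powr (1 / q)"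
          using q by (intro powr_mono2) auto
        also have "\<dots> = A * (\<rho> powr (1 / q)) ^ j"
        proof -
          have "(\<rho> ^ j) powr (1 / q) = (\<rho> powr (1 / q)) ^ j"
            using \<rho> by (simp add: powr_power powr_powr mult.commute flip: powr_realpow)
          then show ?thesis unfolding A_def by (simp only: powr_mult)
        qed
        finally show ?thesis using q by (simp add: powr_powr)
      qed
      have "\<rho> powr (1 / q) < 1" using powr01_less_one[of \<rho> "1 / q"] \<rho> q by simp
      then have "summable (\<lambda>j. A * (\<rho> powr (1 / q)) ^ j)" by (intro summable_mult summable_geometric) simp
      from summable_comparison_test'[OF this le] show ?thesis .
    qed
    define c where "c m = (\<Sum>j. coeff (u j) m)" for m
    define S where "S M x = (\<Sum>m<M. c m * e m x)" for M x
    have SX: "S M \<in> X" for M unfolding S_def[abs_def] by (rule lincomb_closed)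
    \<comment> \<open>The difference is split at a further index n + k: the finitely many
      coefficients with m < M have remainders that vanish as k grows, and the k intermediate parts
      form a geometric sum bounded uniformly in k.\<close>
    have tail: "N (\<lambda>x. S M x - (\<Sum>j<n. part (u j) M x)) \<le> C * \<eta> * \<rho> ^ n" for M n
    proof -
      let ?d = "\<lambda>k m. c m - (\<Sum>j<n + k. coeff (u j) m)"
      have sX: "(\<lambda>x. \<Sum>j<k. part (u (i + j)) M x) \<in> X" for k i by (intro sum_closed part_closed)
      have "N (\<lambda>x. S M x - (\<Sum>j<n. part (u j) M x)) \<le> K * (N (\<lambda>x. \<Sum>m<M. ?d k m * e m x) + 2 * K * (b * \<eta> * \<rho> ^ n))" for k
      proof -
        have 1: "(\<lambda>x. S M x - (\<Sum>j<n. part (u j) M x)) = (\<lambda>x. (\<Sum>m<M. ?d k m * e m x) + (\<Sum>j<k. part (u (n + j)) M x))"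
        proof
          fix x
          have "(\<Sum>j<n + k. part (u j) M x) = (\<Sum>m<M. (\<Sum>j<n + k. coeff (u j) m) * e m x)"
            unfolding part_def by (subst sum.swap) (simp add: sum_distrib_right)
          moreover have "(\<Sum>j<n + k. part (u j) M x) = (\<Sum>j<n. part (u j) M x) + (\<Sum>j<k. part (u (n + j)) M x)"
            by (induction k) auto
          ultimately show "S M x - (\<Sum>j<n. part (u j) M x) = (\<Sum>m<M. ?d k m * e m x) + (\<Sum>j<k. part (u (n + j)) M x)"
            by (simp add: S_def left_diff_distrib sum_subtractf)
        qed
        have "N (\<lambda>x. \<Sum>j<k. part (u (n + j)) M x) \<le> 2 * K * (b * \<eta> * \<rho> ^ n)"
        proof (rule N_geometric_sum)
          show "N (part (u (n + i)) M) \<le> b * \<eta> * \<rho> ^ n * \<rho> ^ i" for i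
            using uN[of "n + i" M] by (simp add: power_add mult.assoc)
        qed (use b \<eta>0 \<rho> part_closed in auto)
        then have "K * (N (\<lambda>x. \<Sum>m<M. ?d k m * e m x) + N (\<lambda>x. \<Sum>j<k. part (u (n + j)) M x))
            \<le> K * (N (\<lambda>x. \<Sum>m<M. ?d k m * e m x) + 2 * K * (b * \<eta> * \<rho> ^ n))"
          using K by (intro mult_left_mono) auto
        moreover have "N (\<lambda>x. (\<Sum>m<M. ?d k m * e m x) + (\<Sum>j<k. part (u (n + j)) M x))
            \<le> K * (N (\<lambda>x. \<Sum>m<M. ?d k m * e m x) + N (\<lambda>x. \<Sum>j<k. part (u (n + j)) M x))"
          by (rule add[OF lincomb_closed sX, THEN conjunct2])
        ultimately show ?thesis unfolding 1 by linarith
      qed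
      moreover have "(\<lambda>k. K * (N (\<lambda>x. \<Sum>m<M. ?d k m * e m x) + 2 * K * (b * \<eta> * \<rho> ^ n))) \<longlonglongrightarrow> K * (0 + 2 * K * (b * \<eta> * \<rho> ^ n))"
      proof (intro tendsto_intros)
        have d0: "(\<lambda>k. ?d k m) \<longlonglongrightarrow> 0" for m
        proof -
          have "(\<lambda>k. \<Sum>j<k. coeff (u j) m) \<longlonglongrightarrow> c m" unfolding c_def by (rule summable_LIMSEQ[OF cu])
          then have "(\<lambda>k. \<Sum>j<k + n. coeff (u j) m) \<longlonglongrightarrow> c m" by (rule LIMSEQ_ignore_initial_segment)
          then have "(\<lambda>k. c m - (\<Sum>j<k + n. coeff (u j) m)) \<longlonglongrightarrow> c m - c m" by (intro tendsto_intros)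
          then show ?thesis by (simp add: add.commute)
        qed
        have "(\<lambda>k. \<Sum>m<M. K ^ Suc m * (\<bar>?d k m\<bar> powr q * N (e m))) \<longlonglongrightarrow> (\<Sum>m<M. K ^ Suc m * (0 * N (e m)))"
        proof (intro tendsto_intros)
          show "(\<lambda>k. \<bar>?d k m\<bar> powr q) \<longlonglongrightarrow> 0" for m
            by (rule tendsto_zero_powrI[OF _ tendsto_const]) (use d0[of m] q in \<open>auto intro: tendsto_rabs_zero\<close>)
        qed
        then have lim: "(\<lambda>k. \<Sum>m<M. K ^ Suc m * (\<bar>?d k m\<bar> powr q * N (e m))) \<longlonglongrightarrow> 0" by simp
        have "N (\<lambda>x. \<Sum>m<M. ?d k m * e m x) \<le> (\<Sum>m<M. K ^ Suc m * (\<bar>?d k m\<bar> powr q * N (e m)))" for k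
        proof -
          have "N (\<lambda>x. \<Sum>m<M. ?d k m * e m x) \<le> (\<Sum>m<M. K ^ Suc m * N (\<lambda>x. ?d k m * e m x))"
            by (rule N_sum) (use cmult e in blast)
          also have "\<dots> \<le> (\<Sum>m<M. K ^ Suc m * (\<bar>?d k m\<bar> powr q * N (e m)))"
            using cmult e K by (intro sum_mono mult_left_mono) auto
          finally show ?thesis .
        qed
        then show "(\<lambda>k. N (\<lambda>x. \<Sum>m<M. ?d k m * e m x)) \<longlonglongrightarrow> 0"
          by (intro tendsto_sandwich[OF _ _ tendsto_const lim]) auto
      qed
      ultimately have "N (\<lambda>x. S M x - (\<Sum>j<n. part (u j) M x)) \<le> K * (0 + 2 * K * (b * \<eta> * \<rho> ^ n))"
        using LIMSEQ_le_const by blast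
      then show ?thesis by (simp add: C_def mult_ac)
    qed
    have "N (S M) \<le> C * \<eta>" for M using tail[of M 0] by simp
    moreover have "represents f c"
      unfolding represents_def
    proof (rule LIMSEQ_I)
      fix \<epsilon> :: real assume \<epsilon>: "0 < \<epsilon>"
      have C0: "0 \<le> C" using K b by (simp add: C_def)
      \<comment> \<open>First n is fixed so that the remainder \<open>v n\<close> and the tail of
        the expansions are small for all M. After that only n expansions have to converge, which
        happens for large M.\<close>
      have "(\<lambda>n. K * (\<eta> * \<rho> ^ n + K * (C * \<eta> * \<rho> ^ n))) \<longlonglongrightarrow> K * (\<eta> * 0 + K * (C * \<eta> * 0))"
        using \<rho> by (intro tendsto_intros LIMSEQ_power_zero) auto
      then have "\<forall>\<^sub>F n in sequentially. K * (\<eta> * \<rho> ^ n + K * (C * \<eta> * \<rho> ^ n)) < \<epsilon> / 2"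
        using \<epsilon> by (intro order_tendstoD) auto
      then obtain n where n: "K * (\<eta> * \<rho> ^ n + K * (C * \<eta> * \<rho> ^ n)) < \<epsilon> / 2" by (auto simp: eventually_sequentially)
      let ?F = "\<lambda>x. \<Sum>j<n. u j x"
      let ?R = "\<lambda>M x. \<Sum>j<n. (u j x - part (u j) M x)"
      have pX: "(\<lambda>x. \<Sum>j<n. part (u j) M x) \<in> X" for M by (intro sum_closed part_closed)
      have RX: "?R M \<in> X" for M using diff uX part_closed by (intro sum_closed) blast
      have "(\<lambda>M. \<Sum>j<n. K ^ Suc j * N (\<lambda>x. u j x - part (u j) M x)) \<longlonglongrightarrow> (\<Sum>j<n. K ^ Suc j * 0)"
        using represents_coeff[OF uX] unfolding represents_def part_def by (intro tendsto_intros)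
      then have "(\<lambda>M. K * (K * (\<Sum>j<n. K ^ Suc j * N (\<lambda>x. u j x - part (u j) M x)))) \<longlonglongrightarrow> K * (K * 0)"
        by (intro tendsto_intros) simp
      then have "\<forall>\<^sub>F M in sequentially. K * (K * (\<Sum>j<n. K ^ Suc j * N (\<lambda>x. u j x - part (u j) M x))) < \<epsilon> / 2"
        using \<epsilon> by (intro order_tendstoD) auto
      then obtain M0 where M0: "\<And>M. M \<ge> M0 ==> K * (K * (\<Sum>j<n. K ^ Suc j * N (\<lambda>x. u j x - part (u j) M x))) < \<epsilon> / 2"
        by (auto simp: eventually_sequentially)
      have "N (\<lambda>x. f x - S M x) < \<epsilon>" if M: "M \<ge> M0" for M
      proof -
        have e1: "(\<lambda>x. f x - S M x) = (\<lambda>x. v n x + (?R M x - (S M x - (\<Sum>j<n. part (u j) M x))))"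
          using tele[of _ n] by (auto simp: fun_eq_iff sum_subtractf)
        have tX: "(\<lambda>x. S M x - (\<Sum>j<n. part (u j) M x)) \<in> X" using diff SX pX by blast
        have dX: "(\<lambda>x. ?R M x - (S M x - (\<Sum>j<n. part (u j) M x))) \<in> X" using diff[OF RX tX] by blast
        have vX: "v n \<in> X" "N (v n) < \<eta> * \<rho> ^ n" using v(1)[of n] by (auto simp: P_def)
        have "N (\<lambda>x. f x - S M x) \<le> K * (N (v n) + N (\<lambda>x. ?R M x - (S M x - (\<Sum>j<n. part (u j) M x))))"
          unfolding e1 using add[OF vX(1) dX] by blast
        also have "\<dots> \<le> K * (\<eta> * \<rho> ^ n + K * (N (?R M) + C * \<eta> * \<rho> ^ n))"
        proof (intro mult_left_mono add_mono)
          have "N (\<lambda>x. ?R M x - (S M x - (\<Sum>j<n. part (u j) M x))) \<le> K * (N (?R M) + N (\<lambda>x. S M x - (\<Sum>j<n. part (u j) M x)))"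
            using diff[OF RX tX] by blast
          also have "\<dots> \<le> K * (N (?R M) + C * \<eta> * \<rho> ^ n)" using K tail by (intro mult_left_mono add_left_mono) auto
          finally show "N (\<lambda>x. ?R M x - (S M x - (\<Sum>j<n. part (u j) M x))) \<le> K * (N (?R M) + C * \<eta> * \<rho> ^ n)" .
        qed (use vX K in auto)
        also have "\<dots> = K * (\<eta> * \<rho> ^ n + K * (C * \<eta> * \<rho> ^ n)) + K * (K * N (?R M))" by (simp add: algebra_simps)
        also have "K * (K * N (?R M)) \<le> K * (K * (\<Sum>j<n. K ^ Suc j * N (\<lambda>x. u j x - part (u j) M x)))"
          using K diff uX part_closed by (intro mult_left_mono N_sum) auto
        finally show ?thesis using n M0[OF M] by linarith
      qed
      then show "\<exists>no. \<forall>M\<ge>no. norm (N (\<lambda>x. f x - (\<Sum>m<M. c m * e m x)) - 0) < \<epsilon>"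
        by (intro exI[of _ M0]) (simp add: S_def)
    qed
    ultimately show ?thesis unfolding S_def[abs_def] by blast
  qed
  have "N (\<lambda>x. \<Sum>m<M. c m * e m x) \<le> C * N g"
    if g: "g \<in> X" and c: "(\<lambda>M. N (\<lambda>x. g x - (\<Sum>m<M. c m * e m x))) \<longlonglongrightarrow> 0" for g c M
  proof -
    have C0: "0 \<le> C" using K b by (simp add: C_def)
    have rc: "represents g c" using c by (simp add: represents_def)
    \<comment> \<open>The construction starts from a strict inequality N g < \<eta>, hence \<eta> =
      N g + \<delta>.\<close>
    have le: "N (\<lambda>x. \<Sum>m<M. c m * e m x) \<le> C * (N g + \<delta>)" if "0 < \<delta>" for \<delta>
    proof -
      obtain d where d: "represents g d" "N (\<lambda>x. \<Sum>m<M. d m * e m x) \<le> C * (N g + \<delta>)"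
        using main[OF g, of "N g + \<delta>"] \<open>0 < \<delta>\<close> by auto
      have "d = c" using coeff_unique[OF g d(1)] coeff_unique[OF g rc] by simp
      then show ?thesis using d(2) by simp
    qed
    have "(\<lambda>k. C * (N g + 1 / real (Suc k))) \<longlonglongrightarrow> C * (N g + 0)"
      using LIMSEQ_inverse_real_of_nat by (intro tendsto_intros) (simp add: inverse_eq_divide)
    then have "N (\<lambda>x. \<Sum>m<M. c m * e m x) \<le> C * (N g + 0)"
      by (rule LIMSEQ_le_const) (use le in auto)
    then show ?thesis by simp
  qed
  moreover have "0 \<le> C" using K b by (simp add: C_def)
  ultimately show ?thesis by blast
qed

end

end

section \<open>Completeness of the Besov gauge\<close>

lemma AE_summable_Lp:
  assumes u: "\<And>l::nat. u l \<in> Lp_space p A" and sm: "summable (\<lambda>l. 2 ^ l * lp_int p A (u l))"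
  shows "AE x in lebesgue_on A. summable (\<lambda>l. 2 ^ l * \<bar>u l x\<bar> powr p)"
proof -
  let ?M = "lebesgue_on A"
  have [measurable]: "u l \<in> borel_measurable ?M" for l by (rule Lp_space_measurable[OF u])
  have "(\<integral>\<^sup>+x. (\<Sum>l. ennreal (2 ^ l * \<bar>u l x\<bar> powr p)) \<partial>?M) = (\<Sum>l. \<integral>\<^sup>+x. ennreal (2 ^ l * \<bar>u l x\<bar> powr p) \<partial>?M)"
    by (rule nn_integral_suminf) measurable
  also have "\<dots> = (\<Sum>l. ennreal (2 ^ l * lp_int p A (u l)))"
  proof (rule suminf_cong)
    fix l
    have "integrable ?M (\<lambda>x. 2 ^ l * \<bar>u l x\<bar> powr p)" by (rule integrable_mult_right[OF Lp_space_integrable[OF u]])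
    from nn_integral_eq_integral[OF this] show "(\<integral>\<^sup>+x. ennreal (2 ^ l * \<bar>u l x\<bar> powr p) \<partial>?M) = ennreal (2 ^ l * lp_int p A (u l))"
      by (simp add: lp_int_def)
  qed
  also have "\<dots> = ennreal (\<Sum>l. 2 ^ l * lp_int p A (u l))" by (rule suminf_ennreal2[OF _ sm]) simp
  finally have fin: "(\<integral>\<^sup>+x. (\<Sum>l. ennreal (2 ^ l * \<bar>u l x\<bar> powr p)) \<partial>?M) \<noteq> \<infinity>" by (simp only: infinity_ennreal_def ennreal_neq_top not_False_eq_True)
  have "AE x in ?M. (\<Sum>l. ennreal (2 ^ l * \<bar>u l x\<bar> powr p)) \<noteq> \<infinity>"
    by (rule nn_integral_PInf_AE[OF _ fin]) measurable
  then show ?thesis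
  proof eventually_elim
    case (elim x)
    show ?case by (rule summable_suminf_not_top[OF _ elim[unfolded infinity_ennreal_def]]) simp
  qed
qed

text \<open>The weighted inequality for series is applied at almost every point and then integrated
  term by term.\<close>

lemma Lp_series:
  assumes p: "0 < p"
  shows "\<exists>C>0. \<forall>(A :: (real ^ 'n::finite) set) u F. F \<in> borel_measurable (lebesgue_on A) --> (\<forall>l::nat. u l \<in> Lp_space p A) -->
     summable (\<lambda>l. 2 ^ l * lp_int p A (u l)) --> (AE x in lebesgue_on A. F x = (\<Sum>l. u l x)) -->
     F \<in> Lp_space p A \<and> lp_int p A F \<le> C * (\<Sum>l. 2 ^ l * lp_int p A (u l))"
proof -
  obtain C where C: "0 < C" "\<forall>a :: nat => real. (\<forall>l. 0 \<le> a l) --> summable (\<lambda>l. 2 ^ l * a l powr p) -->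
       summable a \<and> suminf a powr p \<le> C * (\<Sum>l. 2 ^ l * a l powr p)"
    using powr_suminf_le_weighted[OF p, of 2] by auto
  have "F \<in> Lp_space p A \<and> lp_int p A F \<le> C * (\<Sum>l. 2 ^ l * lp_int p A (u l))"
    if F: "F \<in> borel_measurable (lebesgue_on A)" and u: "\<forall>l. u l \<in> Lp_space p A"
      and sm: "summable (\<lambda>l. 2 ^ l * lp_int p A (u l))" and eq: "AE x in lebesgue_on A. F x = (\<Sum>l. u l x)"
    for A :: "(real ^ 'n) set" and u :: "nat => real ^ 'n => real" and F :: "real ^ 'n => real"
  proof -
    let ?M = "lebesgue_on A"
    note u' = u[rule_format]
    have AEs: "AE x in ?M. summable (\<lambda>l. 2 ^ l * \<bar>u l x\<bar> powr p)" by (rule AE_summable_Lp[OF u' sm])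
    then have AEn: "AE x in ?M. summable (\<lambda>l. norm (2 ^ l * \<bar>u l x\<bar> powr p))" by simp
    have int: "integrable ?M (\<lambda>x. 2 ^ l * \<bar>u l x\<bar> powr p)" for l by (rule integrable_mult_right[OF Lp_space_integrable[OF u']])
    have intn: "(\<integral>x. norm (2 ^ l * \<bar>u l x\<bar> powr p) \<partial>?M) = 2 ^ l * lp_int p A (u l)" for l
      by (simp add: lp_int_def)
    have smn: "summable (\<lambda>l. \<integral>x. norm (2 ^ l * \<bar>u l x\<bar> powr p) \<partial>?M)" unfolding intn by (rule sm)
    have g: "integrable ?M (\<lambda>x. \<Sum>l. 2 ^ l * \<bar>u l x\<bar> powr p)" by (rule integrable_suminf[OF int AEn smn])
    have "integral\<^sup>L ?M (\<lambda>x. \<Sum>l. 2 ^ l * \<bar>u l x\<bar> powr p) = (\<Sum>l. \<integral>x. 2 ^ l * \<bar>u l x\<bar> powr p \<partial>?M)"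
      by (rule integral_suminf[OF int AEn smn])
    then have I: "integral\<^sup>L ?M (\<lambda>x. \<Sum>l. 2 ^ l * \<bar>u l x\<bar> powr p) = (\<Sum>l. 2 ^ l * lp_int p A (u l))"
      by (simp add: lp_int_def)
    have le: "AE x in ?M. \<bar>F x\<bar> powr p \<le> C * (\<Sum>l. 2 ^ l * \<bar>u l x\<bar> powr p)"
      using AEs eq
    proof eventually_elim
      case (elim x)
      have 0: "\<forall>l. 0 \<le> \<bar>u l x\<bar>" by simp
      have s: "summable (\<lambda>l. \<bar>u l x\<bar>)" "(\<Sum>l. \<bar>u l x\<bar>) powr p \<le> C * (\<Sum>l. 2 ^ l * \<bar>u l x\<bar> powr p)"
        using C(2)[THEN spec, of "\<lambda>l. \<bar>u l x\<bar>", THEN mp, OF 0, THEN mp, OF elim(1)] by blast+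
      have "\<bar>F x\<bar> \<le> (\<Sum>l. \<bar>u l x\<bar>)" unfolding elim(2) by (rule summable_rabs[OF s(1)])
      then have "\<bar>F x\<bar> powr p \<le> (\<Sum>l. \<bar>u l x\<bar>) powr p" using p by (intro powr_mono2) auto
      then show ?case using s(2) by linarith
    qed
    have "F \<in> Lp_space p A" "lp_int p A F \<le> (\<integral>x. C * (\<Sum>l. 2 ^ l * \<bar>u l x\<bar> powr p) \<partial>?M)"
      by (rule Lp_space_dominated[OF integrable_mult_right[OF g] F le])+
    then show ?thesis by (simp add: I)
  qed
  then show ?thesis using C(1) by blast
qed

lemma AE_sums_Lp:
  assumes p: "0 < p" and u: "\<And>l::nat. u l \<in> Lp_space p A" and sm: "summable (\<lambda>l. 2 ^ l * lp_int p A (u l))"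
  shows "AE x in lebesgue_on A. summable (\<lambda>l. u l x)"
proof -
  obtain C where C: "\<forall>a :: nat => real. (\<forall>l. 0 \<le> a l) --> summable (\<lambda>l. 2 ^ l * a l powr p) -->
       summable a \<and> suminf a powr p \<le> C * (\<Sum>l. 2 ^ l * a l powr p)"
    using powr_suminf_le_weighted[OF p, of 2] by auto
  have "AE x in lebesgue_on A. summable (\<lambda>l. 2 ^ l * \<bar>u l x\<bar> powr p)" by (rule AE_summable_Lp[OF u sm])
  then show ?thesis
  proof eventually_elim
    case (elim x)
    have 0: "\<forall>l. 0 \<le> \<bar>u l x\<bar>" by simp
    have "summable (\<lambda>l. \<bar>u l x\<bar>)"
      using C[THEN spec, of "\<lambda>l. \<bar>u l x\<bar>", THEN mp, OF 0, THEN mp, OF elim] by blast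
    then show ?case by (rule summable_rabs_cancel)
  qed
qed

text \<open>The exceptional null set has to be avoided both at x and at x + y, so it is used
  together with its translate.\<close>

lemma AE_difference_series:
  fixes u :: "nat => real ^ 'n::finite => real"
  assumes p: "0 < p" and u: "\<And>l. u l \<in> Lp_space p unit_cube"
    and sm: "summable (\<lambda>l. 2 ^ l * lp_int p unit_cube (u l))"
    and eq: "AE x in cube_measure. F x = (\<Sum>l. u l x)"
  shows "AE x in lebesgue_on (shifted_cube y). difference y F x = (\<Sum>l. difference y (u l) x)"
proof -
  define Q where "Q x \<longleftrightarrow> F x = (\<Sum>l. u l x) \<and> summable (\<lambda>l. u l x)" for x
  have "AE x in cube_measure. Q x" using eq AE_sums_Lp[OF p u sm] by eventually_elim (simp add: Q_def)
  then have 1: "AE x in lebesgue. x \<in> unit_cube --> Q x" by (simp add: AE_restrict_space_iff)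
  then have "AE x in lebesgue. x + y \<in> unit_cube --> Q (x + y)" by (rule AE_translate)
  with 1 have "AE x in lebesgue. x \<in> shifted_cube y --> difference y F x = (\<Sum>l. difference y (u l) x)"
  proof eventually_elim
    case (elim x)
    show ?case
    proof
      assume "x \<in> shifted_cube y"
      then have "Q x" "Q (x + y)" using elim shifted_cubeD by blast+
      then show "difference y F x = (\<Sum>l. difference y (u l) x)"
        by (simp add: Q_def difference_def suminf_diff)
    qed
  qed
  then show ?thesis by (simp add: AE_restrict_space_iff)
qed

text \<open>The ratio 2 * 2^\<theta> collects two losses: 2^l from the L_p estimate of a series,
  which becomes 2^(\<theta> l) in the \<theta>-th power, and another 2^l for taking the \<theta>-th
  power of the sum. The numerical fact \<open>key\<close> serves both the L_p term and each
  modulus.\<close>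

lemma gauge_of_series:
  assumes p: "0 < p" and \<theta>: "0 < \<theta>"
  shows "\<exists>C>0. \<forall>u. \<forall>F :: real ^ 'n::finite => real. F \<in> borel_measurable cube_measure --> (\<forall>l::nat. u l \<in> Lp_space p unit_cube) -->
     summable (\<lambda>l. 2 ^ l * lp_int p unit_cube (u l)) --> (AE x in cube_measure. F x = (\<Sum>l. u l x)) -->
     F \<in> Lp_space p unit_cube \<and>
     gauge_of p \<sigma> \<theta> F \<le> ennreal C * (\<Sum>l. ennreal ((2 * 2 powr \<theta>) ^ l) * gauge_of p \<sigma> \<theta> (u l))"
proof -
  obtain C1 where C1: "0 < C1" "\<forall>(A :: (real ^ 'n) set) u F. F \<in> borel_measurable (lebesgue_on A) --> (\<forall>l::nat. u l \<in> Lp_space p A) -->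
     summable (\<lambda>l. 2 ^ l * lp_int p A (u l)) --> (AE x in lebesgue_on A. F x = (\<Sum>l. u l x)) -->
     F \<in> Lp_space p A \<and> lp_int p A F \<le> C1 * (\<Sum>l. 2 ^ l * lp_int p A (u l))"
    using Lp_series[OF p] by blast
  obtain C2 where C2: "0 < C2" "\<forall>a :: nat => real. (\<forall>l. 0 \<le> a l) --> summable (\<lambda>l. 2 ^ l * a l powr \<theta>) -->
       summable a \<and> suminf a powr \<theta> \<le> C2 * (\<Sum>l. 2 ^ l * a l powr \<theta>)"
    using powr_suminf_le_weighted[OF \<theta>, of 2] by auto
  define \<Gamma> :: real where "\<Gamma> = 2 * 2 powr \<theta>"
  define C where "C = C1 powr \<theta> * C2"
  have C: "0 < C" using C1(1) C2(1) by (simp add: C_def)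
  have key: "ennreal (b powr \<theta>) \<le> ennreal C * (\<Sum>l. ennreal (\<Gamma> ^ l * a l powr \<theta>))"
    if a: "\<And>l. 0 \<le> a l" and b: "0 \<le> b" "b \<le> C1 * (\<Sum>l. 2 ^ l * a l)" for a b
  proof (cases "(\<Sum>l. ennreal (\<Gamma> ^ l * a l powr \<theta>)) = top")
    case True
    then show ?thesis using C by (simp add: ennreal_mult_top)
  next
    case False
    have \<Gamma>: "\<Gamma> ^ l * a l powr \<theta> = 2 ^ l * (2 ^ l * a l) powr \<theta>" for l
    proof -
      have "(2 powr \<theta>) ^ l = (2 ^ l) powr \<theta>" by (simp add: powr_power powr_powr mult.commute flip: powr_realpow)
      then show ?thesis using a by (simp add: \<Gamma>_def power_mult_distrib powr_mult mult.assoc)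
    qed
    have s: "summable (\<lambda>l. \<Gamma> ^ l * a l powr \<theta>)"
      by (rule summable_suminf_not_top[OF _ False]) (simp add: \<Gamma>_def)
    have 0: "\<forall>l. 0 \<le> 2 ^ l * a l" using a by simp
    have s': "summable (\<lambda>l. 2 ^ l * (2 ^ l * a l) powr \<theta>)" using s unfolding \<Gamma> .
    have "b powr \<theta> \<le> (C1 * (\<Sum>l. 2 ^ l * a l)) powr \<theta>" using b \<theta> by (intro powr_mono2) auto
    also have "\<dots> = C1 powr \<theta> * (\<Sum>l. 2 ^ l * a l) powr \<theta>"
      by (rule powr_mult)
    also have "\<dots> \<le> C1 powr \<theta> * (C2 * (\<Sum>l. \<Gamma> ^ l * a l powr \<theta>))"
      using C2(2)[THEN spec, of "\<lambda>l. 2 ^ l * a l", THEN mp, OF 0, THEN mp, OF s'] unfolding \<Gamma> by (intro mult_left_mono) auto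
    finally have "b powr \<theta> \<le> C * (\<Sum>l. \<Gamma> ^ l * a l powr \<theta>)" by (simp add: C_def mult.assoc)
    moreover have "(\<Sum>l. ennreal (\<Gamma> ^ l * a l powr \<theta>)) = ennreal (\<Sum>l. \<Gamma> ^ l * a l powr \<theta>)"
      by (rule suminf_ennreal2[OF _ s]) (simp add: \<Gamma>_def)
    moreover have "0 \<le> (\<Sum>l. \<Gamma> ^ l * a l powr \<theta>)" by (rule suminf_nonneg[OF s]) (simp add: \<Gamma>_def)
    ultimately show ?thesis using C by (simp add: ennreal_mult[symmetric] ennreal_leI)
  qed
  have "F \<in> Lp_space p unit_cube \<and> gauge_of p \<sigma> \<theta> F \<le> ennreal C * (\<Sum>l. ennreal (\<Gamma> ^ l) * gauge_of p \<sigma> \<theta> (u l))"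
    if F: "F \<in> borel_measurable cube_measure" and u: "\<forall>l. u l \<in> Lp_space p unit_cube"
      and sm: "summable (\<lambda>l. 2 ^ l * lp_int p unit_cube (u l))" and eq: "AE x in cube_measure. F x = (\<Sum>l. u l x)"
    for u and F :: "real ^ 'n => real"
  proof -
    note u' = u[rule_format]
    have FL: "F \<in> Lp_space p unit_cube" "lp_int p unit_cube F \<le> C1 * (\<Sum>l. 2 ^ l * lp_int p unit_cube (u l))"
      using C1(2)[rule_format, OF F u' sm eq] by blast+
    have mod: "mod_pow p t F \<le> C1 * (\<Sum>l. 2 ^ l * mod_pow p t (u l))"
      and sm_mod: "summable (\<lambda>l. 2 ^ l * mod_pow p t (u l))" if t: "0 < t" for t
    proof -
      have "summable (\<lambda>l. 2 powr p * 2 * (2 ^ l * lp_int p unit_cube (u l)))" using sm by (rule summable_mult)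
      moreover have "norm (2 ^ l * mod_pow p t (u l)) \<le> 2 powr p * 2 * (2 ^ l * lp_int p unit_cube (u l))" for l
        using mod_pow_le[OF p u' t] by (simp add: mult_ac)
      ultimately show s: "summable (\<lambda>l. 2 ^ l * mod_pow p t (u l))" by (rule summable_comparison_test')
      show "mod_pow p t F \<le> C1 * (\<Sum>l. 2 ^ l * mod_pow p t (u l))"
      proof (rule mod_pow_leI[OF p FL(1) t])
        show "0 \<le> C1 * (\<Sum>l. 2 ^ l * mod_pow p t (u l))"
          using C1(1) suminf_nonneg[OF s] by simp
        fix y :: "real ^ 'n" assume y: "norm y \<le> t"
        have d: "difference y (u l) \<in> Lp_space p (shifted_cube y)" for l by (rule difference_Lp(1)[OF p u'])
        have le: "2 ^ l * lp_int p (shifted_cube y) (difference y (u l)) \<le> 2 ^ l * mod_pow p t (u l)" for l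
          using lp_int_le_mod_pow[OF p u' y] by simp
        have sd: "summable (\<lambda>l. 2 ^ l * lp_int p (shifted_cube y) (difference y (u l)))"
          by (rule summable_comparison_test'[OF s]) (use le in simp)
        have "lp_int p (shifted_cube y) (difference y F) \<le> C1 * (\<Sum>l. 2 ^ l * lp_int p (shifted_cube y) (difference y (u l)))"
          using C1(2)[rule_format, OF Lp_space_measurable[OF difference_Lp(1)[OF p FL(1)]] d sd AE_difference_series[OF p u' sm eq]] by blast
        also have "\<dots> \<le> C1 * (\<Sum>l. 2 ^ l * mod_pow p t (u l))"
          using C1(1) suminf_le[OF le sd s] by simp
        finally show "lp_int p (shifted_cube y) (difference y F) \<le> C1 * (\<Sum>l. 2 ^ l * mod_pow p t (u l))" .
      qed
    qed
    have G0: "0 \<le> \<Gamma>" by (simp add: \<Gamma>_def)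
    have "ennreal (lp_int p unit_cube F powr \<theta>) \<le> ennreal C * (\<Sum>l. ennreal (\<Gamma> ^ l * lp_int p unit_cube (u l) powr \<theta>))"
      by (rule key) (use FL in auto)
    also have "\<dots> = ennreal C * (\<Sum>l. ennreal (\<Gamma> ^ l) * ennreal (lp_int p unit_cube (u l) powr \<theta>))"
      using G0 by (simp add: ennreal_mult)
    finally have 1: "ennreal (lp_int p unit_cube F powr \<theta>) \<le> ennreal C * (\<Sum>l. ennreal (\<Gamma> ^ l) * ennreal (lp_int p unit_cube (u l) powr \<theta>))" .
    have term_le: "ennreal ((2 powr (real k * \<sigma>) * mod_pow p ((1 / 2) ^ k) F) powr \<theta>)
        \<le> ennreal C * (\<Sum>l. ennreal (\<Gamma> ^ l) * ennreal ((2 powr (real k * \<sigma>) * mod_pow p ((1 / 2) ^ k) (u l)) powr \<theta>))" for k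
    proof -
      have t: "0 < (1 / 2 :: real) ^ k" by simp
      have "2 powr (real k * \<sigma>) * mod_pow p ((1 / 2) ^ k) F \<le> 2 powr (real k * \<sigma>) * (C1 * (\<Sum>l. 2 ^ l * mod_pow p ((1 / 2) ^ k) (u l)))"
        using mod[OF t] by (intro mult_left_mono) auto
      also have "\<dots> = C1 * (\<Sum>l. 2 powr (real k * \<sigma>) * (2 ^ l * mod_pow p ((1 / 2) ^ k) (u l)))"
        using suminf_mult[OF sm_mod[OF t], of "2 powr (real k * \<sigma>)"] by simp
      also have "\<dots> = C1 * (\<Sum>l. 2 ^ l * (2 powr (real k * \<sigma>) * mod_pow p ((1 / 2) ^ k) (u l)))"
        by (simp add: mult.left_commute)
      finally have "ennreal ((2 powr (real k * \<sigma>) * mod_pow p ((1 / 2) ^ k) F) powr \<theta>)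
        \<le> ennreal C * (\<Sum>l. ennreal (\<Gamma> ^ l * (2 powr (real k * \<sigma>) * mod_pow p ((1 / 2) ^ k) (u l)) powr \<theta>))"
        by (intro key) auto
      then show ?thesis using G0 by (simp add: ennreal_mult)
    qed
    have "wsum \<sigma> \<theta> (\<lambda>k. mod_pow p ((1 / 2) ^ k) F)
        \<le> (\<Sum>k. ennreal C * (\<Sum>l. ennreal (\<Gamma> ^ l) * ennreal ((2 powr (real k * \<sigma>) * mod_pow p ((1 / 2) ^ k) (u l)) powr \<theta>)))"
      unfolding wsum_def by (intro suminf_le term_le summableI)
    also have "\<dots> = ennreal C * (\<Sum>l. \<Sum>k. ennreal (\<Gamma> ^ l) * ennreal ((2 powr (real k * \<sigma>) * mod_pow p ((1 / 2) ^ k) (u l)) powr \<theta>))"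
      by (subst ennreal_suminf_swap) (simp add: ennreal_suminf_cmult)
    also have "\<dots> = ennreal C * (\<Sum>l. ennreal (\<Gamma> ^ l) * wsum \<sigma> \<theta> (\<lambda>k. mod_pow p ((1 / 2) ^ k) (u l)))"
      by (simp add: wsum_def ennreal_suminf_cmult)
    finally have 2: "wsum \<sigma> \<theta> (\<lambda>k. mod_pow p ((1 / 2) ^ k) F)
        \<le> ennreal C * (\<Sum>l. ennreal (\<Gamma> ^ l) * wsum \<sigma> \<theta> (\<lambda>k. mod_pow p ((1 / 2) ^ k) (u l)))" .
    have "gauge_of p \<sigma> \<theta> F \<le> ennreal C * (\<Sum>l. ennreal (\<Gamma> ^ l) * ennreal (lp_int p unit_cube (u l) powr \<theta>))
        + ennreal C * (\<Sum>l. ennreal (\<Gamma> ^ l) * wsum \<sigma> \<theta> (\<lambda>k. mod_pow p ((1 / 2) ^ k) (u l)))"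
      unfolding gauge_of_def by (rule add_mono[OF 1 2])
    also have "\<dots> = ennreal C * (\<Sum>l. ennreal (\<Gamma> ^ l) * gauge_of p \<sigma> \<theta> (u l))"
      unfolding gauge_of_def by (simp add: distrib_left suminf_add[OF summableI summableI, symmetric])
    finally show ?thesis using FL(1) by blast
  qed
  then show ?thesis using C unfolding \<Gamma>_def by blast
qed

text \<open>The limit is the pointwise sum, and its n-th remainder is again a series of this kind;
  the estimate for series, applied to the shifted sequence, bounds the remainder by a multiple of
  \<rho>^n. The smallness of \<rho> beats the weights in \<open>gauge_of_series\<close>.\<close>

lemma besov_series_converges:
  fixes h :: "nat => real ^ 'n::finite => real"
  assumes p: "0 < p" and q: "0 < q" and s: "0 \<le> s" and \<rho>: "0 < \<rho>" "2 * 2 powr (q / p) * \<rho> \<le> 1 / 2"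
    and h: "\<And>j. h j \<in> besov_space p q s \<and> besov_gauge p q s (h j) \<le> r * \<rho> ^ j"
  shows "\<exists>g\<in>besov_space p q s. (\<lambda>n. besov_gauge p q s (\<lambda>x. g x - (\<Sum>j<n. h j x))) \<longlonglongrightarrow> 0"
proof -
  define \<theta> where "\<theta> = q / p"
  have \<theta>: "0 < \<theta>" using p q by (simp add: \<theta>_def)
  define \<Gamma> :: real where "\<Gamma> = 2 * 2 powr \<theta>"
  have \<Gamma>: "0 < \<Gamma>" "\<Gamma> * \<rho> \<le> 1 / 2" using \<rho> by (simp_all add: \<Gamma>_def \<theta>_def)
  obtain C where C: "0 < C" "\<forall>u. \<forall>F :: real ^ 'n => real. F \<in> borel_measurable cube_measure --> (\<forall>l::nat. u l \<in> Lp_space p unit_cube) -->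
     summable (\<lambda>l. 2 ^ l * lp_int p unit_cube (u l)) --> (AE x in cube_measure. F x = (\<Sum>l. u l x)) -->
     F \<in> Lp_space p unit_cube \<and> gauge_of p (s * p) \<theta> F \<le> ennreal C * (\<Sum>l. ennreal (\<Gamma> ^ l) * gauge_of p (s * p) \<theta> (u l))"
    using gauge_of_series[OF p \<theta>, of "s * p"] unfolding \<Gamma>_def by blast
  obtain C2 where C2: "\<forall>a :: nat => real. (\<forall>l. 0 \<le> a l) --> summable (\<lambda>l. 2 ^ l * a l powr \<theta>) -->
       summable a \<and> suminf a powr \<theta> \<le> C2 * (\<Sum>l. 2 ^ l * a l powr \<theta>)"
    using powr_suminf_le_weighted[OF \<theta>, of 2] by auto
  have hB: "h j \<in> besov_space p q s" and hN: "besov_gauge p q s (h j) \<le> r * \<rho> ^ j" for j using h[of j] by blast+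
  have hL: "h j \<in> Lp_space p unit_cube" for j using hB[of j] besov_space_iff[OF p q s] by blast
  have r: "0 \<le> r" using order_trans[OF besov_gauge_nonneg hN[of 0]] by simp
  have geo: "\<Gamma> ^ l * (r * \<rho> ^ (n + l)) \<le> r * \<rho> ^ n * (1 / 2) ^ l" for n l
  proof -
    have "\<Gamma> ^ l * (r * \<rho> ^ (n + l)) = r * \<rho> ^ n * (\<Gamma> * \<rho>) ^ l" by (simp add: power_add power_mult_distrib)
    also have "\<dots> \<le> r * \<rho> ^ n * (1 / 2) ^ l" using r \<rho> \<Gamma> by (intro mult_left_mono power_mono) auto
    finally show ?thesis .
  qed
  have geo_sums: "(\<lambda>l. r * \<rho> ^ n * (1 / 2) ^ l) sums (r * \<rho> ^ n * 2)" for n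
    using sums_mult[OF geometric_sums[of "1 / 2 :: real"], of "r * \<rho> ^ n"] by simp
  have sm: "summable (\<lambda>l. 2 ^ l * lp_int p unit_cube (h (n + l)))" for n
  proof -
    have 0: "\<forall>l. 0 \<le> 2 ^ l * lp_int p unit_cube (h (n + l))" by simp
    have "summable (\<lambda>l. 2 ^ l * (2 ^ l * lp_int p unit_cube (h (n + l))) powr \<theta>)"
    proof (rule summable_comparison_test'[OF sums_summable[OF geo_sums[of n]]])
      fix l
      have "(2 powr \<theta>) ^ l = (2 ^ l) powr \<theta>" by (simp add: powr_power powr_powr mult.commute flip: powr_realpow)
      then have "2 ^ l * (2 ^ l * lp_int p unit_cube (h (n + l))) powr \<theta> = \<Gamma> ^ l * lp_int p unit_cube (h (n + l)) powr \<theta>"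
        by (simp add: \<Gamma>_def power_mult_distrib powr_mult mult.assoc)
      also have "\<dots> \<le> \<Gamma> ^ l * (r * \<rho> ^ (n + l))"
        using lp_int_le_besov_gauge[OF p q s hB, of "n + l"] hN[of "n + l"] \<Gamma> unfolding \<theta>_def by (intro mult_left_mono) auto
      also have "\<dots> \<le> r * \<rho> ^ n * (1 / 2) ^ l" by (rule geo)
      finally show "norm (2 ^ l * (2 ^ l * lp_int p unit_cube (h (n + l))) powr \<theta>) \<le> r * \<rho> ^ n * (1 / 2) ^ l" by simp
    qed
    then show ?thesis using C2[THEN spec, of "\<lambda>l. 2 ^ l * lp_int p unit_cube (h (n + l))", THEN mp, OF 0] by blast
  qed
  \<comment> \<open>The series may diverge on a null set; the default value of \<open>suminf\<close>
    there affects neither measurability nor the quasi-norms.\<close>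
  define g where "g x = (\<Sum>l. h l x)" for x
  define R where "R n x = g x - (\<Sum>j<n. h j x)" for n x
  have hm: "h j \<in> borel_measurable cube_measure" for j by (rule Lp_space_measurable[OF hL])
  have Rm: "R n \<in> borel_measurable cube_measure" for n
    unfolding R_def[abs_def] g_def[abs_def] using hm by measurable
  have "AE x in cube_measure. summable (\<lambda>l. h l x)"
    using AE_sums_Lp[of p "\<lambda>l. h (0 + l)", OF p hL sm] by simp
  then have RA: "AE x in cube_measure. R n x = (\<Sum>l. h (n + l) x)" for n
  proof eventually_elim
    case (elim x)
    from suminf_minus_initial_segment[OF elim, of n] show ?case by (simp add: R_def g_def add.commute)
  qed
  have R: "R n \<in> besov_space p q s \<and> besov_gauge p q s (R n) \<le> C * (r * \<rho> ^ n * 2)" for n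
  proof -
    have hL': "h (n + l) \<in> Lp_space p unit_cube" for l by (rule hL)
    have 1: "R n \<in> Lp_space p unit_cube" "gauge_of p (s * p) \<theta> (R n) \<le> ennreal C * (\<Sum>l. ennreal (\<Gamma> ^ l) * gauge_of p (s * p) \<theta> (h (n + l)))"
      using C(2)[rule_format, OF Rm hL' sm RA] by blast+
    note 1(2)
    also have "ennreal C * (\<Sum>l. ennreal (\<Gamma> ^ l) * gauge_of p (s * p) \<theta> (h (n + l))) \<le> ennreal C * (\<Sum>l. ennreal (r * \<rho> ^ n * (1 / 2) ^ l))"
    proof (intro mult_left_mono suminf_le summableI)
      fix l
      have "gauge_of p (s * p) \<theta> (h (n + l)) \<le> ennreal (r * \<rho> ^ (n + l))"
        using besov_gauge_ennreal[OF p q s hB, of "n + l"] hN[of "n + l"] unfolding \<theta>_def by (metis ennreal_leI)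
      then have "ennreal (\<Gamma> ^ l) * gauge_of p (s * p) \<theta> (h (n + l)) \<le> ennreal (\<Gamma> ^ l) * ennreal (r * \<rho> ^ (n + l))"
        by (intro mult_left_mono) auto
      also have "\<dots> = ennreal (\<Gamma> ^ l * (r * \<rho> ^ (n + l)))" using \<Gamma> r \<rho> by (intro ennreal_mult[symmetric]) auto
      also have "\<dots> \<le> ennreal (r * \<rho> ^ n * (1 / 2) ^ l)" by (intro ennreal_leI geo)
      finally show "ennreal (\<Gamma> ^ l) * gauge_of p (s * p) \<theta> (h (n + l)) \<le> ennreal (r * \<rho> ^ n * (1 / 2) ^ l)" .
    qed simp
    also have "(\<Sum>l. ennreal (r * \<rho> ^ n * (1 / 2) ^ l)) = ennreal (r * \<rho> ^ n * 2)"
      unfolding sums_unique[OF geo_sums[of n]] using r \<rho> by (intro suminf_ennreal2[OF _ sums_summable[OF geo_sums[of n]]]) simp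
    also have "ennreal C * ennreal (r * \<rho> ^ n * 2) = ennreal (C * (r * \<rho> ^ n * 2))"
      using C(1) r \<rho> by (intro ennreal_mult[symmetric]) auto
    finally have 2: "gauge_of p (s * p) \<theta> (R n) \<le> ennreal (C * (r * \<rho> ^ n * 2))" .
    have "gauge_of p (s * p) (q / p) (R n) < \<infinity>" using 2 unfolding \<theta>_def by (simp add: le_less_trans)
    then have "R n \<in> besov_space p q s" using 1(1) besov_space_iff[OF p q s] by blast
    moreover have "besov_gauge p q s (R n) \<le> C * (r * \<rho> ^ n * 2)"
      unfolding besov_gauge_def using 2 C(1) r \<rho> unfolding \<theta>_def by (intro enn2real_leI) auto
    ultimately show ?thesis by blast
  qed
  have "R 0 = g" by (simp add: R_def fun_eq_iff)
  then have gB: "g \<in> besov_space p q s" using R[of 0] by simp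
  have "1 \<le> 2 powr \<theta>" using \<theta> by (intro ge_one_powr_ge_zero) auto
  then have "1 \<le> \<Gamma>" by (simp add: \<Gamma>_def)
  from mult_right_mono[OF this less_imp_le[OF \<rho>(1)]] have "\<rho> \<le> \<Gamma> * \<rho>" by simp
  then have "\<rho> < 1" using \<Gamma>(2) by linarith
  then have "(\<lambda>n. C * (r * \<rho> ^ n * 2)) \<longlonglongrightarrow> C * (r * 0 * 2)"
    using \<rho> by (intro tendsto_intros LIMSEQ_power_zero) auto
  then have lim: "(\<lambda>n. C * (r * \<rho> ^ n * 2)) \<longlonglongrightarrow> 0" by simp
  have "(\<lambda>n. besov_gauge p q s (R n)) \<longlonglongrightarrow> 0"
    by (rule tendsto_sandwich[OF _ _ tendsto_const lim]) (use R in auto)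
  then show ?thesis using gB unfolding R_def[abs_def] by blast
qed

lemma besov_complete_quasi_norm:
  assumes p: "0 < p" and q: "0 < q" and s: "0 \<le> s"
  shows "\<exists>K \<rho>. complete_quasi_norm (besov_space p q s :: (real ^ 'n::finite => real) set) (besov_gauge p q s) K q \<rho>"
proof -
  obtain K where K: "0 < K" "\<forall>f g :: real ^ 'n => real. f \<in> besov_space p q s --> g \<in> besov_space p q s -->
    (\<lambda>x. f x + g x) \<in> besov_space p q s \<and> besov_gauge p q s (\<lambda>x. f x + g x) \<le> K * (besov_gauge p q s f + besov_gauge p q s g)"
    using besov_add[OF p q s] by blast
  define K' where "K' = max 1 K"
  \<comment> \<open>The maximum of all constants that 1/(2\<rho>) has to dominate: the
    quasi-triangle constant, 1, and the growth of the weights for series.\<close>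
  define D where "D = max (2 * 2 powr (q / p)) K'"
  define \<rho> where "\<rho> = 1 / (2 * D)"
  have K': "1 \<le> K'" "K \<le> K'" by (auto simp: K'_def)
  have D: "1 \<le> D" "K' \<le> D" "2 * 2 powr (q / p) \<le> D" using K' by (auto simp: D_def)
  have \<rho>0: "0 < \<rho>" using D by (simp add: \<rho>_def)
  have D2: "D * \<rho> = 1 / 2" using D by (simp add: \<rho>_def)
  have le: "X * \<rho> \<le> 1 / 2" if "X \<le> D" for X using mult_right_mono[OF that less_imp_le[OF \<rho>0]] D2 by simp
  have "complete_quasi_norm (besov_space p q s :: (real ^ 'n => real) set) (besov_gauge p q s) K' q \<rho>"
  proof (unfold_locales)
    fix f g :: "real ^ 'n => real" and c :: real
    assume f: "f \<in> besov_space p q s"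
    show "(\<lambda>x. c * f x) \<in> besov_space p q s \<and> besov_gauge p q s (\<lambda>x. c * f x) \<le> \<bar>c\<bar> powr q * besov_gauge p q s f"
      using besov_cmult[OF p q s f] by blast
    assume g: "g \<in> besov_space p q s"
    have "K * (besov_gauge p q s f + besov_gauge p q s g) \<le> K' * (besov_gauge p q s f + besov_gauge p q s g)"
      using K' by (intro mult_right_mono) auto
    then show "(\<lambda>x. f x + g x) \<in> besov_space p q s \<and> besov_gauge p q s (\<lambda>x. f x + g x) \<le> K' * (besov_gauge p q s f + besov_gauge p q s g)"
      using K(2)[rule_format, OF f g] by auto
  next
    fix h :: "nat => real ^ 'n => real" and r
    assume h: "\<And>j. h j \<in> besov_space p q s \<and> besov_gauge p q s (h j) \<le> r * \<rho> ^ j"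
    show "\<exists>g\<in>besov_space p q s. (\<lambda>n. besov_gauge p q s (\<lambda>x. g x - (\<Sum>j<n. h j x))) \<longlonglongrightarrow> 0"
      by (rule besov_series_converges[OF p q s \<rho>0 le[OF D(3)] h])
  qed (use K' q \<rho>0 le[OF D(2)] le[OF D(1)] besov_zero[OF p q s] in auto)
  then show ?thesis by blast
qed

section \<open>Necessary conditions for Haar bases\<close>

lemma inj_tensor_haar: "inj_on (tensor_haar :: ('n::finite => nat) => _) {m. \<forall>j. 1 \<le> m j}"
proof (rule inj_onI)
  fix m m' :: "'n => nat" assume m: "m \<in> {m. \<forall>j. 1 \<le> m j}" "m' \<in> {m. \<forall>j. 1 \<le> m j}"
    and eq: "tensor_haar m = tensor_haar m'"
  have "hcoef m (tensor_haar m) = 1" "hcoef m (tensor_haar m') = (if m = m' then 1 else 0)"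
    using m hcoef_tensor_haar[of m m] hcoef_tensor_haar[of m m'] by auto
  then show "m = m'" using eq by (auto split: if_splits)
qed

lemma haar_enumeration:
  fixes e :: "nat => real ^ 'n::finite => real"
  assumes "enumeration_of haar_system e"
  shows "\<exists>\<nu>. bij_betw \<nu> UNIV {m. \<forall>j. 1 \<le> m j} \<and> e = (\<lambda>i. tensor_haar (\<nu> i))"
proof -
  let ?S = "{m :: 'n => nat. \<forall>j. 1 \<le> m j}"
  have b: "bij_betw tensor_haar ?S haar_system"
    unfolding haar_system_def bij_betw_def using inj_tensor_haar by blast
  have e: "bij_betw e UNIV haar_system" using assms by (simp add: enumeration_of_def)
  have "bij_betw (inv_into ?S tensor_haar \<circ> e) UNIV ?S"
    by (rule bij_betw_trans[OF e bij_betw_inv_into[OF b]])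
  moreover have "tensor_haar (inv_into ?S tensor_haar (e i)) = e i" for i
    using bij_betw_inv_into_right[OF b] bij_betwE[OF e] by blast
  ultimately show ?thesis by (intro exI[of _ "inv_into ?S tensor_haar \<circ> e"]) (auto simp: fun_eq_iff)
qed

lemma tensor_haar_gauge_pos:
  fixes m :: "'n::finite => nat"
  assumes p: "0 < p" and q: "0 < q" and s: "0 \<le> s" "s < 1 / p" and m: "\<And>j. 1 \<le> m j"
  shows "0 < besov_gauge p q s (tensor_haar m)"
proof (rule ccontr)
  assume neg: "\<not> ?thesis"
  have B: "tensor_haar m \<in> besov_space p q s" by (rule tensor_haar_besov[OF p q s m])
  then have L: "tensor_haar m \<in> Lp_space p unit_cube" using besov_space_iff[OF p q s(1)] by blast
  have "lp_int p unit_cube (tensor_haar m) powr (q / p) \<le> 0"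
    using lp_int_le_besov_gauge[OF p q s(1) B] neg by linarith
  then have "\<not> 0 < lp_int p unit_cube (tensor_haar m) powr (q / p)" by simp
  then have "lp_int p unit_cube (tensor_haar m) = 0" by (simp only: powr_gt_zero not_not)
  then have "AE x in cube_measure. \<bar>tensor_haar m x\<bar> powr p = 0"
    using integral_nonneg_eq_0_iff_AE[OF Lp_space_integrable[OF L]] by (simp add: lp_int_def)
  then have "AE x in cube_measure. tensor_haar m x * tensor_haar m x = 0" by eventually_elim simp
  then have "(\<integral>x. tensor_haar m x * tensor_haar m x \<partial>cube_measure) = 0" by (rule integral_eq_zero_AE)
  then have "hcoef m (tensor_haar m) = 0" by (simp add: hcoef_def)
  then show False using hcoef_tensor_haar[where m = m and m' = m, OF m m] by simp
qed

text \<open>A finite Haar combination is its own expansion, so the uniform bound for partial sums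
  becomes an inequality between finite sums in which no limit occurs.\<close>

lemma haar_parts_bounded:
  fixes \<nu> :: "nat => 'n::finite => nat"
  assumes p: "0 < p" and q: "0 < q" and s: "0 \<le> s" "s < 1 / p"
    and \<nu>: "bij_betw \<nu> UNIV {m. \<forall>j. 1 \<le> m j}"
    and basis: "schauder_basis (besov_space p q s) (besov_norm p q s) (\<lambda>i. tensor_haar (\<nu> i))"
  shows "\<exists>C\<ge>0. \<forall>(B :: ('n => nat) set) c M. finite B --> (\<forall>m\<in>B. \<forall>j. 1 \<le> m j) -->
    besov_gauge p q s (\<lambda>x. \<Sum>m\<in>B \<inter> \<nu> ` {..<M}. c m * tensor_haar m x)
    \<le> C * besov_gauge p q s (\<lambda>x. \<Sum>m\<in>B. c m * tensor_haar m x)"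
proof -
  obtain K \<rho> where Q: "complete_quasi_norm (besov_space p q s :: (real ^ 'n => real) set) (besov_gauge p q s) K q \<rho>"
    using besov_complete_quasi_norm[OF p q s(1)] by blast
  have \<nu>1: "1 \<le> \<nu> i j" for i j using bij_betwE[OF \<nu>] by auto
  have tB: "tensor_haar (\<nu> i) \<in> besov_space p q s" for i by (rule tensor_haar_besov[OF p q s \<nu>1])
  have pos: "0 < besov_gauge p q s (tensor_haar (\<nu> i))" for i by (rule tensor_haar_gauge_pos[OF p q s \<nu>1])
  have sumB: "(\<lambda>x. \<Sum>m<M. c m * tensor_haar (\<nu> m) x) \<in> besov_space p q s" for c M
    by (rule besov_sum[OF p q s(1)], rule besov_cmult(1)[OF p q s(1) tB])
  have uniq: "\<exists>!c :: nat => real. (\<lambda>M. besov_gauge p q s (\<lambda>x. g x - (\<Sum>m<M. c m * tensor_haar (\<nu> m) x))) \<longlonglongrightarrow> 0"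
    if g: "g \<in> besov_space p q s" for g
  proof -
    have "\<exists>!c :: nat => real. (\<lambda>M. besov_norm p q s (\<lambda>x. g x - (\<Sum>m<M. c m * tensor_haar (\<nu> m) x))) \<longlonglongrightarrow> 0"
      using basis g unfolding schauder_basis_def by blast
    moreover have "(\<lambda>M. besov_norm p q s (\<lambda>x. g x - (\<Sum>m<M. c m * tensor_haar (\<nu> m) x))) \<longlonglongrightarrow> 0 \<longleftrightarrow>
        (\<lambda>M. besov_gauge p q s (\<lambda>x. g x - (\<Sum>m<M. c m * tensor_haar (\<nu> m) x))) \<longlonglongrightarrow> 0" for c
      by (rule besov_norm_tendsto_iff[OF p q s(1)], rule besov_diff[OF p q s(1) g sumB])
    ultimately show ?thesis by simp
  qed
  obtain C where C: "0 \<le> C" "\<forall>g\<in>besov_space p q s. \<forall>c. (\<lambda>M. besov_gauge p q s (\<lambda>x. g x - (\<Sum>m<M. c m * tensor_haar (\<nu> m) x))) \<longlonglongrightarrow> 0 -->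
    (\<forall>M. besov_gauge p q s (\<lambda>x. \<Sum>m<M. c m * tensor_haar (\<nu> m) x) \<le> C * besov_gauge p q s g)"
    using complete_quasi_norm.basis_parts_bounded[OF Q tB pos uniq] by blast
  have "besov_gauge p q s (\<lambda>x. \<Sum>m\<in>B \<inter> \<nu> ` {..<M}. c m * tensor_haar m x)
    \<le> C * besov_gauge p q s (\<lambda>x. \<Sum>m\<in>B. c m * tensor_haar m x)"
    if B: "finite B" "\<forall>m\<in>B. \<forall>j. 1 \<le> m j" for B :: "('n => nat) set" and c M
  proof -
    let ?g = "\<lambda>x. \<Sum>m\<in>B. c m * tensor_haar m x"
    define a where "a i = (if \<nu> i \<in> B then c (\<nu> i) else 0)" for i
    have inj: "inj \<nu>" using \<nu> by (rule bij_betw_imp_inj_on)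
    have S: "(\<Sum>i<M. a i * tensor_haar (\<nu> i) x) = (\<Sum>m\<in>B \<inter> \<nu> ` {..<M}. c m * tensor_haar m x)" for M x
    proof -
      have "(\<Sum>m\<in>\<nu> ` {..<M} \<inter> B. c m * tensor_haar m x) = (\<Sum>m\<in>\<nu> ` {..<M}. if m \<in> B then c m * tensor_haar m x else 0)"
        by (rule sum.inter_restrict) simp
      also have "\<dots> = (\<Sum>i<M. if \<nu> i \<in> B then c (\<nu> i) * tensor_haar (\<nu> i) x else 0)"
        by (subst sum.reindex) (auto intro: inj_on_subset[OF inj])
      also have "\<dots> = (\<Sum>i<M. a i * tensor_haar (\<nu> i) x)"
        by (intro sum.cong) (auto simp: a_def)
      finally show ?thesis by (simp add: Int_commute)
    qed
    have gB: "?g \<in> besov_space p q s"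
      by (rule besov_sum[OF p q s(1)], rule besov_cmult(1)[OF p q s(1) tensor_haar_besov[OF p q s]]) (use B in blast)
    have "B \<subseteq> range \<nu>" using B(2) bij_betw_imp_surj_on[OF \<nu>] by auto
    from finite_subset_image[OF B(1) this] obtain I where I: "finite I" "B = \<nu> ` I" by blast
    from finite_nat_bounded[OF I(1)] obtain M0 where M0: "I \<subseteq> {..<M0}" by blast
    have "besov_gauge p q s (\<lambda>x. ?g x - (\<Sum>i<M. a i * tensor_haar (\<nu> i) x)) = 0" if "M \<ge> M0" for M
    proof -
      have "B \<inter> \<nu> ` {..<M} = B" using I(2) M0 that by fastforce
      then show ?thesis using besov_zero(2)[OF p q s(1)] by (simp add: S)
    qed
    then have lim: "(\<lambda>M. besov_gauge p q s (\<lambda>x. ?g x - (\<Sum>i<M. a i * tensor_haar (\<nu> i) x))) \<longlonglongrightarrow> 0"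
      by (intro tendsto_eventually eventually_sequentiallyI) blast
    show ?thesis using C(2)[rule_format, OF gB lim, of M] unfolding S .
  qed
  then show ?thesis using C(1) by blast
qed

text \<open>A single term is the difference of two consecutive partial sums.\<close>

lemma haar_terms_bounded:
  fixes \<nu> :: "nat => 'n::finite => nat"
  assumes p: "0 < p" and q: "0 < q" and s: "0 \<le> s" "s < 1 / p"
    and \<nu>: "bij_betw \<nu> UNIV {m. \<forall>j. 1 \<le> m j}"
    and basis: "schauder_basis (besov_space p q s) (besov_norm p q s) (\<lambda>i. tensor_haar (\<nu> i))"
  shows "\<exists>C. \<forall>(B :: ('n => nat) set) c. \<forall>m\<in>B. finite B --> (\<forall>m\<in>B. \<forall>j. 1 \<le> m j) -->
    besov_gauge p q s (\<lambda>x. c m * tensor_haar m x) \<le> C * besov_gauge p q s (\<lambda>x. \<Sum>m\<in>B. c m * tensor_haar m x)"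
proof -
  obtain C where C: "0 \<le> C" "\<forall>(B :: ('n => nat) set) c M. finite B --> (\<forall>m\<in>B. \<forall>j. 1 \<le> m j) -->
    besov_gauge p q s (\<lambda>x. \<Sum>m\<in>B \<inter> \<nu> ` {..<M}. c m * tensor_haar m x)
    \<le> C * besov_gauge p q s (\<lambda>x. \<Sum>m\<in>B. c m * tensor_haar m x)"
    using haar_parts_bounded[OF assms] by blast
  obtain K where K: "0 < K" "\<forall>f g :: real ^ 'n => real. f \<in> besov_space p q s --> g \<in> besov_space p q s -->
    (\<lambda>x. f x + g x) \<in> besov_space p q s \<and> besov_gauge p q s (\<lambda>x. f x + g x) \<le> K * (besov_gauge p q s f + besov_gauge p q s g)"
    using besov_add[OF p q s(1)] by blast
  have "besov_gauge p q s (\<lambda>x. c m * tensor_haar m x) \<le> K * (2 * C) * besov_gauge p q s (\<lambda>x. \<Sum>m\<in>B. c m * tensor_haar m x)"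
    if m: "m \<in> B" and B: "finite B" "\<forall>m\<in>B. \<forall>j. 1 \<le> m j" for B :: "('n => nat) set" and c m
  proof -
    let ?S = "\<lambda>M x. \<Sum>m\<in>B \<inter> \<nu> ` {..<M}. c m * tensor_haar m x"
    let ?N = "besov_gauge p q s (\<lambda>x. \<Sum>m\<in>B. c m * tensor_haar m x)"
    have SB: "?S M \<in> besov_space p q s" for M
      by (rule besov_sum[OF p q s(1)], rule besov_cmult(1)[OF p q s(1) tensor_haar_besov[OF p q s]]) (use B in blast)
    have "m \<in> range \<nu>" using bij_betw_imp_surj_on[OF \<nu>] m B(2) by auto
    then obtain i where i: "m = \<nu> i" by blast
    have inj: "inj \<nu>" using \<nu> by (rule bij_betw_imp_inj_on)
    have "B \<inter> \<nu> ` {..<Suc i} = insert m (B \<inter> \<nu> ` {..<i})" using m i by (auto simp: lessThan_Suc)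
    moreover have "m \<notin> B \<inter> \<nu> ` {..<i}" using i inj by (auto dest: injD)
    moreover have "finite (B \<inter> \<nu> ` {..<i})" using B by simp
    ultimately have eq: "(\<lambda>x. c m * tensor_haar m x) = (\<lambda>x. ?S (Suc i) x + - 1 * ?S i x)" by (simp add: fun_eq_iff)
    have m1: "(\<lambda>x. - 1 * ?S i x) \<in> besov_space p q s" "besov_gauge p q s (\<lambda>x. - 1 * ?S i x) \<le> besov_gauge p q s (?S i)"
      using besov_cmult[OF p q s(1) SB, of "- 1" i] by auto
    have "besov_gauge p q s (\<lambda>x. c m * tensor_haar m x) \<le> K * (besov_gauge p q s (?S (Suc i)) + besov_gauge p q s (\<lambda>x. - 1 * ?S i x))"
      unfolding eq using K(2)[THEN spec, of "?S (Suc i)", THEN spec, of "\<lambda>x. - 1 * ?S i x", THEN mp, OF SB, THEN mp, OF m1(1)] by blast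
    also have "\<dots> \<le> K * (C * ?N + C * ?N)"
      using m1(2) C(2)[THEN spec, THEN spec, THEN spec, THEN mp, OF B(1), THEN mp, OF B(2), of c i]
        C(2)[THEN spec, THEN spec, THEN spec, THEN mp, OF B(1), THEN mp, OF B(2), of c "Suc i"] K(1)
      by (intro mult_left_mono add_mono) auto
    finally show ?thesis by (simp add: mult_ac)
  qed
  then show ?thesis by blast
qed

subsection \<open>Large one-dimensional projections for \<^term>\<open>p < 1\<close>\<close>

text \<open>2^l + 1 is the first index of its level, with a univariate function supported in [0,
  2^(-l)); all other coordinates carry the constant function. The support in the cube is therefore a
  slab, much larger than a cell when there is more than one coordinate.\<close>

definition corner_index :: "'n => nat => 'n => nat" where
  "corner_index j0 l j = (if j = j0 then Suc (2 ^ l) else 1)"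

text \<open>Agrees on every cell with the indicator function of the corner cell. Writing it as a
  Haar sum makes it exactly a finite combination of Haar functions, also on those faces that the
  cells do not reach.\<close>

definition corner_step :: "nat => real ^ 'n::finite => real" where
  "corner_step l = haar_sum (haar_box (Suc l)) (indicator (cell (Suc l) (\<lambda>_. 0)))"

lemma corner_index_box: "corner_index j0 l \<in> haar_box (Suc l)"
  by (simp add: mem_haar_box corner_index_def)

lemma corner_index_ge_1: "1 \<le> corner_index j0 l j"
  by (simp add: corner_index_def)

lemma corner_grid: "(\<lambda>_. 0) \<in> grid (Suc l)"
  by (simp add: mem_grid)

lemma corner_indicator_integrable:
  "integrable cube_measure (indicator (cell (Suc l) (\<lambda>_. 0)) :: real ^ 'n::finite => real)"
proof -
  interpret finite_measure "cube_measure :: (real ^ 'n) measure" by (rule finite_measure_cube)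
  show ?thesis
    by (rule integrable_const_bound[of _ 1])
      (auto simp: indicator_def intro!: borel_imp_cube_measurable borel_measurable_indicator[OF cell_borel, unfolded indicator_def])
qed

lemma corner_step_cell:
  fixes i :: "'n::finite => nat"
  assumes "i \<in> grid (Suc l)" "x \<in> cell (Suc l) i"
  shows "corner_step l x = (if i = (\<lambda>_. 0) then 1 else 0)"
proof -
  have avg: "corner_step l x = cell_avg (Suc l) (indicator (cell (Suc l) (\<lambda>_. 0))) i"
    unfolding corner_step_def by (rule haar_sum_box_cell[OF corner_indicator_integrable assms])
  have *: "(\<lambda>x. indicator (cell (Suc l) i) x * indicator (cell (Suc l) (\<lambda>_. 0)) x :: real)
      = (if i = (\<lambda>_. 0) then (\<lambda>x. indicator (cell (Suc l) i) x * 1) else (\<lambda>x. 0))"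
  proof (cases "i = (\<lambda>_. 0)")
    case False
    then have "x \<notin> cell (Suc l) (\<lambda>_. 0)" if "x \<in> cell (Suc l) i" for x using cell_unique[OF that] by blast
    then have "indicator (cell (Suc l) i) x * indicator (cell (Suc l) (\<lambda>_. 0)) x = (0 :: real)" for x
      by (cases "x \<in> cell (Suc l) i") auto
    then show ?thesis by (simp only: False if_False)
  next
    case True
    then show ?thesis by (auto simp: indicator_def)
  qed
  have "cell_avg (Suc l) (indicator (cell (Suc l) (\<lambda>_. 0))) i = (if i = (\<lambda>_. 0) then 1 else 0)"
    unfolding cell_avg_def * if_distrib[of "integral\<^sup>L cube_measure"] integral_indicator_cell[OF assms(1)]
    using cell_size_pos[where 'n='n, of "Suc l"] by simp
  then show ?thesis by (simp only: avg)
qed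

lemma corner_step_measurable: "corner_step l \<in> borel_measurable cube_measure"
  unfolding corner_step_def by (intro borel_imp_cube_measurable haar_sum_measurable)

lemma corner_step_lp_int:
  assumes "0 < p"
  shows "lp_int p unit_cube (corner_step l :: real ^ 'n::finite => real) = cell_size TYPE('n) (Suc l)"
proof -
  have "lp_int p unit_cube (corner_step l :: real ^ 'n => real)
      = (\<Sum>i\<in>grid (Suc l). \<bar>if i = (\<lambda>_::'n. 0) then 1 else 0\<bar> powr p) * cell_size TYPE('n) (Suc l)"
    using assms corner_step_measurable corner_step_cell by (rule step_Lp(2))
  also have "(\<Sum>i\<in>grid (Suc l). \<bar>if i = (\<lambda>_::'n. 0) then 1 else (0::real)\<bar> powr p) = (\<Sum>i\<in>grid (Suc l). if i = (\<lambda>_::'n. 0) then 1 else 0)"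
    using assms by (intro sum.cong) auto
  also have "\<dots> = 1" using corner_grid[of l] by simp
  finally show ?thesis by simp
qed

lemma corner_haar_values:
  fixes x :: "real ^ 'n::finite"
  assumes "x \<in> unit_cube"
  shows "x $ j0 < 1 / 2 ^ Suc l ==> tensor_haar (corner_index j0 l) x = 1"
    "1 / 2 ^ Suc l \<le> x $ j0 ==> x $ j0 < 2 / 2 ^ Suc l ==> tensor_haar (corner_index j0 l) x = - 1"
proof -
  have x: "0 \<le> x $ j" "x $ j \<le> 1" for j
    using assms by (auto simp: unit_cube_def mem_box_cart)
  have "tensor_haar (corner_index j0 l) x = (\<Prod>j\<in>UNIV. if j = j0 then haar (Suc (2 ^ l)) (x $ j0) else 1)"
    unfolding tensor_haar_def corner_index_def using x haar_1 by (intro prod.cong) auto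
  then have eq: "tensor_haar (corner_index j0 l) x = haar (Suc (2 ^ l)) (x $ j0)" by simp
  have h: "haar (Suc (2 ^ l)) (x $ j0) = indicator (dyadic_interval (Suc l) 1) (x $ j0) - indicator (dyadic_interval (Suc l) 2) (x $ j0)"
    using haar_dyadic[of "Suc l" 1 "x $ j0"] by simp
  show "x $ j0 < 1 / 2 ^ Suc l ==> tensor_haar (corner_index j0 l) x = 1"
    "1 / 2 ^ Suc l \<le> x $ j0 ==> x $ j0 < 2 / 2 ^ Suc l ==> tensor_haar (corner_index j0 l) x = - 1"
    unfolding eq h using x[of j0] by (auto simp: dyadic_interval_def indicator_def)
qed

lemma corner_hcoef_indicator:
  "hcoef (corner_index j0 l) (corner_step l) = hcoef (corner_index j0 l) (indicator (cell (Suc l) (\<lambda>_. 0)))"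
proof -
  have 1: "\<And>m j. m \<in> haar_box (Suc l) ==> 1 \<le> m j" by (rule haar_box_finite_index)
  show ?thesis
    unfolding corner_step_def haar_sum_def[abs_def]
    by (subst hcoef_lincomb) (simp_all only: finite_haar_box 1 corner_index_ge_1 corner_index_box if_True)
qed

lemma corner_hcoef:
  fixes j0 :: "'n::finite"
  shows "hcoef (corner_index j0 l) (corner_step l) = 2 ^ l * cell_size TYPE('n) (Suc l)"
proof -
  have "hcoef (corner_index j0 l) (corner_step l) = hcoef (corner_index j0 l) (indicator (cell (Suc l) (\<lambda>_::'n. 0)))"
    by (rule corner_hcoef_indicator)
  also have "(\<lambda>x. tensor_haar (corner_index j0 l) x * indicator (cell (Suc l) (\<lambda>_. 0)) x) = (\<lambda>x. indicator (cell (Suc l) (\<lambda>_::'n. 0)) x * 1)"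
  proof
    fix x :: "real ^ 'n"
    have "tensor_haar (corner_index j0 l) x = 1" if "x \<in> cell (Suc l) (\<lambda>_. 0)"
    proof (rule corner_haar_values(1))
      show "x \<in> unit_cube" using that cell_subset_cube[OF corner_grid] by blast
      show "x $ j0 < 1 / 2 ^ Suc l" using that unfolding mem_cell by simp
    qed
    then show "tensor_haar (corner_index j0 l) x * indicator (cell (Suc l) (\<lambda>_. 0)) x = indicator (cell (Suc l) (\<lambda>_. 0)) x * 1"
      by (simp add: indicator_def)
  qed
  then have "hcoef (corner_index j0 l) (indicator (cell (Suc l) (\<lambda>_::'n. 0))) = tensor_weight (corner_index j0 l) * cell_size TYPE('n) (Suc l)"
    unfolding hcoef_def by (simp only: integral_indicator_cell[OF corner_grid])
  also have "tensor_weight (corner_index j0 l) = (\<Prod>j\<in>UNIV. if j = j0 then 2 ^ l else 1)"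
    unfolding tensor_weight_def corner_index_def using haar_weight_1 haar_weight_fine[of 0 l] by (intro prod.cong) auto
  finally show ?thesis by simp
qed

text \<open>The function jumps from 1 to -1 across the hyperplane where coordinate j0 is 2^(-(l+1)).
  A shift by \<tau> in this direction gives a difference of absolute value 2 on a slab of thickness
  \<tau>; \<tau> is limited by the admissible length and by the width of the strips on which the
  values are 1 and -1.\<close>

lemma corner_haar_mod_pow:
  fixes j0 :: "'n::finite"
  assumes p: "0 < p"
  shows "2 powr p * min ((1 / 2) ^ k) (1 / 2 ^ Suc l) \<le> mod_pow p ((1 / 2) ^ k) (tensor_haar (corner_index j0 l) :: real ^ 'n => real)"
proof -
  define \<tau> :: real where "\<tau> = min ((1 / 2) ^ k) (1 / 2 ^ Suc l)"
  define y :: "real ^ 'n" where "y = \<tau> *\<^sub>R axis j0 1"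
  define a :: "real ^ 'n" where "a = (\<chi> j. if j = j0 then 1 / 2 ^ Suc l - \<tau> else 0)"
  define b :: "real ^ 'n" where "b = (\<chi> j. if j = j0 then 1 / 2 ^ Suc l else 1)"
  let ?h = "tensor_haar (corner_index j0 l) :: real ^ 'n => real"
  have \<tau>: "0 < \<tau>" "\<tau> \<le> (1 / 2) ^ k" "\<tau> \<le> 1 / 2 ^ Suc l" by (auto simp: \<tau>_def)
  have half: "1 / 2 ^ Suc l \<le> (1 / 2 :: real)" by (rule divide_left_mono) auto
  have "norm y = \<tau>" using \<tau> by (simp add: y_def)
  then have ny: "norm y \<le> (1 / 2) ^ k" using \<tau> by simp
  have hL: "?h \<in> Lp_space p unit_cube"
    by (rule step_Lp(1)[OF p tensor_haar_cube tensor_haar_cell[OF corner_index_box]])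
  have ab: "a $ j \<le> b $ j" for j using \<tau> by (simp add: a_def b_def)
  have "ennreal (2 powr p * \<tau>) = ennreal (2 powr p) * emeasure lebesgue (box a b)"
  proof -
    have "(\<Prod>j\<in>UNIV. b $ j - a $ j) = (\<Prod>j\<in>UNIV. if j = j0 then \<tau> else 1)"
      by (intro prod.cong) (auto simp: a_def b_def)
    then have "emeasure lebesgue (box a b) = ennreal \<tau>" using measure_cbox_cart(2)[OF ab] by simp
    then show ?thesis using \<tau> by (simp add: ennreal_mult)
  qed
  also have "\<dots> = (\<integral>\<^sup>+x. ennreal (2 powr p) * indicator (box a b) x \<partial>lebesgue)"
    by (subst nn_integral_cmult_indicator) auto
  also have "\<dots> \<le> (\<integral>\<^sup>+x. ennreal (\<bar>difference y ?h x\<bar> powr p) * indicator (shifted_cube y) x \<partial>lebesgue)"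
  proof (rule nn_integral_mono)
    fix x
    show "ennreal (2 powr p) * indicator (box a b) x \<le> ennreal (\<bar>difference y ?h x\<bar> powr p) * indicator (shifted_cube y) x"
    proof (cases "x \<in> box a b")
      case True
      then have x0: "1 / 2 ^ Suc l - \<tau> < x $ j0" "x $ j0 < 1 / 2 ^ Suc l" and xj: "j \<noteq> j0 ==> 0 < x $ j \<and> x $ j < 1" for j
        unfolding mem_box_cart a_def b_def by (auto dest: spec[of _ j0] spec[of _ j])
      have xy: "(x + y) $ j = (if j = j0 then x $ j0 + \<tau> else x $ j)" for j
        by (simp add: y_def axis_def)
      have x1: "0 \<le> x $ j0" "x $ j0 + \<tau> \<le> 1" using x0 \<tau> half by linarith+
      have "0 \<le> x $ j \<and> x $ j \<le> 1" for j using x1 xj[of j] \<tau>(1) by (cases "j = j0") auto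
      then have xc: "x \<in> unit_cube" by (simp add: unit_cube_def mem_box_cart)
      have "0 \<le> (x + y) $ j \<and> (x + y) $ j \<le> 1" for j
        using x1 xj[of j] \<tau>(1) unfolding xy by (cases "j = j0") auto
      then have yc: "x + y \<in> unit_cube" by (simp add: unit_cube_def mem_box_cart del: vector_add_component)
      have "?h x = 1" by (rule corner_haar_values(1)[OF xc x0(2)])
      moreover have "?h (x + y) = - 1"
      proof (rule corner_haar_values(2)[OF yc])
        have y0: "(x + y) $ j0 = x $ j0 + \<tau>" using xy by simp
        show "1 / 2 ^ Suc l \<le> (x + y) $ j0" "(x + y) $ j0 < 2 / 2 ^ Suc l" unfolding y0 using x0 \<tau> by linarith+
      qed
      ultimately have "\<bar>difference y ?h x\<bar> = 2" by (simp add: difference_def)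
      moreover have "x \<in> shifted_cube y" using xc yc by (simp add: shifted_cube_def)
      ultimately show ?thesis using True by simp
    qed simp
  qed
  also have "\<dots> = ennreal (lp_int p (shifted_cube y) (difference y ?h))"
    by (rule lp_int_nn_integral[symmetric, OF p sets_shifted_cube difference_Lp(1)[OF p hL]])
  also have "\<dots> \<le> ennreal (mod_pow p ((1 / 2) ^ k) ?h)"
    by (rule ennreal_leI[OF lp_int_le_mod_pow[OF p hL ny]])
  finally show ?thesis unfolding \<tau>_def by (simp add: ennreal_le_iff)
qed

text \<open>Matches the upper bound of \<open>step_gauge_le\<close> up to constants, with L_p mass
  of order 2^(-l) and the same level weight. The extra division by 2 comes from estimating the L_p
  mass from below by a modulus.\<close>

lemma corner_haar_gauge:
  fixes j0 :: "'n::finite"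
  assumes p: "0 < p" and \<theta>: "0 < \<theta>"
  shows "ennreal ((1 / 2 ^ Suc l / 2) powr \<theta>) * (1 + level_weight \<sigma> \<theta> (Suc l))
    \<le> gauge_of p \<sigma> \<theta> (tensor_haar (corner_index j0 l) :: real ^ 'n => real)"
proof -
  let ?h = "tensor_haar (corner_index j0 l) :: real ^ 'n => real"
  let ?c = "1 / 2 ^ Suc l / 2 :: real"
  have hL: "?h \<in> Lp_space p unit_cube"
    by (rule step_Lp(1)[OF p tensor_haar_cube tensor_haar_cell[OF corner_index_box]])
  have "2 powr p * min ((1 / 2) ^ Suc l) (1 / 2 ^ Suc l) \<le> 2 powr p * (2 * lp_int p unit_cube ?h)"
    by (rule order_trans[OF corner_haar_mod_pow[OF p] mod_pow_le[OF p hL]]) simp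
  then have "min ((1 / 2) ^ Suc l) (1 / 2 ^ Suc l) \<le> 2 * lp_int p unit_cube ?h" by (rule mult_left_le_imp_le) simp
  then have "?c \<le> lp_int p unit_cube ?h" by (simp add: power_divide)
  then have 1: "ennreal (?c powr \<theta>) \<le> ennreal (lp_int p unit_cube ?h powr \<theta>)"
    using \<theta> by (intro ennreal_leI powr_mono2) auto
  have "ennreal (?c powr \<theta>) * level_weight \<sigma> \<theta> (Suc l) = wsum \<sigma> \<theta> (\<lambda>k. ?c * min 1 (2 ^ Suc l / 2 ^ k))"
    unfolding level_weight_def by (rule wsum_cmult[symmetric]) simp
  also have "\<dots> \<le> wsum \<sigma> \<theta> (\<lambda>k. mod_pow p ((1 / 2) ^ k) ?h)"
  proof (rule wsum_mono[OF \<theta>])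
    fix k
    have "?c * min 1 (2 ^ Suc l / 2 ^ k) = (1 / 2) * min ((1 / 2) ^ k) (1 / 2 ^ Suc l)"
      by (auto simp: min_def field_simps power_divide)
    also have "\<dots> \<le> 2 powr p * min ((1 / 2) ^ k) (1 / 2 ^ Suc l)"
      using p ge_one_powr_ge_zero[of 2 p] by (intro mult_right_mono) auto
    also have "\<dots> \<le> mod_pow p ((1 / 2) ^ k) ?h" by (rule corner_haar_mod_pow[OF p])
    finally show "?c * min 1 (2 ^ Suc l / 2 ^ k) \<le> mod_pow p ((1 / 2) ^ k) ?h" .
  qed simp
  finally have 2: "ennreal (?c powr \<theta>) * level_weight \<sigma> \<theta> (Suc l) \<le> wsum \<sigma> \<theta> (\<lambda>k. mod_pow p ((1 / 2) ^ k) ?h)" .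
  show ?thesis unfolding gauge_of_def distrib_left using add_mono[OF 1 2] by simp
qed

text \<open>
  With \<^term>\<open>z = 2 ^ Suc l * cell_size TYPE('n::finite) (Suc l)\<close>, which tends to \<^term>\<open>0::real\<close> as
  the dimension exceeds one, the quotient of the two gauges is of order \<^term>\<open>z powr (q - q / p)\<close>.
\<close>

lemma corner_projection_unbounded:
  fixes j0 :: "'n::finite"
  assumes p: "0 < p" "p < 1" and q: "0 < q" and s: "0 \<le> s" "s < 1 / p" and d: "1 < CARD('n)"
  shows "\<exists>l. C * besov_gauge p q s (corner_step l :: real ^ 'n => real)
    < besov_gauge p q s (\<lambda>x. hcoef (corner_index j0 l) (corner_step l) * tensor_haar (corner_index j0 l) x)"
proof (rule ccontr)
  define \<theta> where "\<theta> = q / p"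
  have \<theta>: "0 < \<theta>" "q < \<theta>" using p q by (simp_all add: \<theta>_def field_simps)
  have sp: "0 \<le> s * p" "s * p < 1" using s p by (simp_all add: field_simps)
  assume "\<not> ?thesis"
  then have no: "besov_gauge p q s (\<lambda>x. hcoef (corner_index j0 l) (corner_step l) * tensor_haar (corner_index j0 l) x)
      \<le> C * besov_gauge p q s (corner_step l :: real ^ 'n => real)" for l by (meson not_less)
  obtain C1 where C1: "0 < C1" "\<forall>K v. \<forall>g :: real ^ 'n => real. g \<in> borel_measurable cube_measure -->
     (\<forall>i x. i \<in> grid K --> x \<in> cell K i --> g x = v i) -->
     gauge_of p (s * p) (q / p) g \<le> ennreal C1 * ennreal (lp_int p unit_cube g powr (q / p)) * (1 + level_weight (s * p) (q / p) K)"
    using step_gauge_le[OF p(1) q, of "s * p"] by blast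
  define D where "D = 2 powr (q + \<theta>) * (max 0 C * C1)"
  have main: "(2 powr (\<theta> - q)) ^ Suc l \<le> D" for l
  proof -
    let ?h = "tensor_haar (corner_index j0 l) :: real ^ 'n => real"
    define cs where "cs = cell_size TYPE('n) (Suc l)"
    define t :: real where "t = 2 ^ Suc l"
    define w where "w = enn2real (1 + level_weight (s * p) \<theta> (Suc l))"
    have cs: "0 < cs" by (simp add: cs_def cell_size_pos)
    have t: "0 < t" by (simp add: t_def)
    have fin: "1 + level_weight (s * p) \<theta> (Suc l) < \<infinity>" using level_weight_finite[OF sp \<theta>(1)] by simp
    have w': "ennreal w = 1 + level_weight (s * p) \<theta> (Suc l)" using fin by (simp add: w_def)
    have "ennreal 1 \<le> ennreal w" unfolding w' by simp
    then have w: "1 \<le> w" by (simp add: w_def ennreal_le_iff)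
    have hB: "?h \<in> besov_space p q s" by (rule tensor_haar_besov[OF p(1) q s corner_index_ge_1])
    have FB: "corner_step l \<in> besov_space p q s" by (rule step_besov[OF p(1) q s corner_step_measurable corner_step_cell])
    have "ennreal (besov_gauge p q s (corner_step l :: real ^ 'n => real)) \<le> ennreal C1 * ennreal (cs powr \<theta>) * ennreal w"
      using C1(2)[THEN spec, of "Suc l", THEN spec, of "\<lambda>i. if i = (\<lambda>_. 0) then 1 else 0", rule_format, OF corner_step_measurable corner_step_cell]
      unfolding besov_gauge_ennreal[OF p(1) q s(1) FB] corner_step_lp_int[OF p(1)] w' cs_def \<theta>_def by simp
    also have "\<dots> = ennreal (C1 * cs powr \<theta> * w)" using C1(1) w by (simp add: ennreal_mult)
    finally have up: "besov_gauge p q s (corner_step l :: real ^ 'n => real) \<le> C1 * cs powr \<theta> * w"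
      using C1(1) w by (simp add: ennreal_le_iff)
    have "ennreal ((1 / t / 2) powr \<theta> * w) \<le> ennreal (besov_gauge p q s ?h)"
      using corner_haar_gauge[OF p(1) \<theta>(1), of l "s * p" j0] w
      unfolding besov_gauge_ennreal[OF p(1) q s(1) hB] t_def w'[symmetric] \<theta>_def[symmetric] by (simp add: ennreal_mult)
    then have low: "(1 / t / 2) powr \<theta> * w \<le> besov_gauge p q s ?h" by (simp add: ennreal_le_iff)
    define a where "a = hcoef (corner_index j0 l) (corner_step l)"
    have a: "a = t * cs / 2" by (simp add: a_def corner_hcoef t_def cs_def)
    have a0: "0 < a" using t cs by (simp add: a)
    have ahB: "(\<lambda>x. a * ?h x) \<in> besov_space p q s" by (rule besov_cmult(1)[OF p(1) q s(1) hB])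
    \<comment> \<open>Homogeneity is an upper estimate; applied with the factor 1/a to the multiple
      by a it becomes the required lower one.\<close>
    have "besov_gauge p q s (\<lambda>x. (1 / a) * (a * ?h x)) \<le> \<bar>1 / a\<bar> powr q * besov_gauge p q s (\<lambda>x. a * ?h x)"
      by (rule besov_cmult(2)[OF p(1) q s(1) ahB])
    then have "besov_gauge p q s ?h \<le> (1 / a) powr q * besov_gauge p q s (\<lambda>x. a * ?h x)" using a0 by simp
    then have "a powr q * besov_gauge p q s ?h \<le> besov_gauge p q s (\<lambda>x. a * ?h x)"
      using a0 by (simp add: powr_divide field_simps)
    also have "\<dots> \<le> C * besov_gauge p q s (corner_step l :: real ^ 'n => real)" using no[of l] by (simp add: a_def)
    also have "\<dots> \<le> max 0 C * (C1 * cs powr \<theta> * w)" using up by (intro mult_mono) auto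
    finally have "a powr q * ((1 / t / 2) powr \<theta> * w) \<le> max 0 C * (C1 * cs powr \<theta> * w)"
      using mult_left_mono[OF low, of "a powr q"] by simp
    then have "a powr q * (1 / t / 2) powr \<theta> * w \<le> (max 0 C * C1 * cs powr \<theta>) * w" by (simp only: mult.assoc)
    then have "a powr q * (1 / t / 2) powr \<theta> \<le> max 0 C * C1 * cs powr \<theta>" using w by simp
    \<comment> \<open>Because a = t cs / 2, this multiplier turns the left-hand side into
      cs^\<theta> and leaves a power of t cs on the right.\<close>
    then have "2 powr (q + \<theta>) * (t * cs) powr (\<theta> - q) * (a powr q * (1 / t / 2) powr \<theta>)
        \<le> 2 powr (q + \<theta>) * (t * cs) powr (\<theta> - q) * (max 0 C * C1 * cs powr \<theta>)"
      by (intro mult_left_mono) auto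
    also have "2 powr (q + \<theta>) * (t * cs) powr (\<theta> - q) * (a powr q * (1 / t / 2) powr \<theta>) = cs powr \<theta>"
      using t cs by (simp add: a powr_mult powr_divide powr_diff powr_add)
    finally have "cs powr \<theta> * 1 \<le> cs powr \<theta> * (D * (t * cs) powr (\<theta> - q))" by (simp add: D_def mult_ac)
    then have le1: "1 \<le> D * (t * cs) powr (\<theta> - q)" using cs by simp
    have D0: "0 \<le> D" using C1(1) by (simp add: D_def)
    \<comment> \<open>With at least two coordinates a cell has measure at most t^(-2), so t cs \<le>
      1/t tends to 0; as \<theta> > q for p < 1, the inequality just obtained fails for large
      l.\<close>
    have "cs \<le> 1 / t ^ 2"
    proof -
      have "(2::real) ^ (Suc l * 2) \<le> 2 ^ (Suc l * CARD('n))" using d by (intro power_increasing mult_left_mono) auto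
      then have "1 / (2::real) ^ (Suc l * CARD('n)) \<le> 1 / 2 ^ (Suc l * 2)" by (intro divide_left_mono) auto
      then show ?thesis by (simp add: cs_def cell_size_def t_def power_mult[symmetric])
    qed
    then have "t * cs \<le> 1 / t" using t mult_left_mono[of cs "1 / t ^ 2" t] by (simp add: power2_eq_square)
    then have "(t * cs) powr (\<theta> - q) \<le> (1 / t) powr (\<theta> - q)" using t cs \<theta> by (intro powr_mono2) auto
    then have "1 \<le> D * (1 / t) powr (\<theta> - q)" using le1 D0 mult_left_mono[of "(t * cs) powr (\<theta> - q)" "(1 / t) powr (\<theta> - q)" D] by linarith
    then have "t powr (\<theta> - q) \<le> D" using t by (simp add: powr_divide field_simps)
    moreover have "t powr (\<theta> - q) = (2 powr (\<theta> - q)) ^ Suc l"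
      unfolding t_def by (simp only: powr_power powr_powr powr_realpow[symmetric] zero_less_numeral)
    ultimately show ?thesis by simp
  qed
  have "1 < 2 powr (\<theta> - q)" using \<theta> by simp
  from real_arch_pow[OF this] obtain n where "D < (2 powr (\<theta> - q)) ^ n" by blast
  also have "\<dots> \<le> (2 powr (\<theta> - q)) ^ Suc n" using \<open>1 < 2 powr (\<theta> - q)\<close> by (intro power_increasing) auto
  finally show False using main[of n] by simp
qed

lemma haar_not_schauder_basis:
  fixes e :: "nat => real ^ 'n::finite => real"
  assumes p: "0 < p" "p < 1" and q: "0 < q" and s: "0 \<le> s" "s < 1 / p" and d: "1 < CARD('n)"
    and e: "enumeration_of haar_system e"
  shows "\<not> schauder_basis (besov_space p q s) (besov_norm p q s) e"
proof
  assume basis: "schauder_basis (besov_space p q s) (besov_norm p q s) e"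
  obtain \<nu> where \<nu>: "bij_betw \<nu> UNIV {m. \<forall>j. 1 \<le> m j}" "e = (\<lambda>i. tensor_haar (\<nu> i))"
    using haar_enumeration[OF e] by blast
  obtain C where C: "\<forall>(B :: ('n => nat) set) c. \<forall>m\<in>B. finite B --> (\<forall>m\<in>B. \<forall>j. 1 \<le> m j) -->
    besov_gauge p q s (\<lambda>x. c m * tensor_haar m x) \<le> C * besov_gauge p q s (\<lambda>x. \<Sum>m\<in>B. c m * tensor_haar m x)"
    using haar_terms_bounded[OF p(1) q s \<nu>(1)] basis \<nu>(2) by blast
  obtain j0 :: 'n where True by blast
  have "besov_gauge p q s (\<lambda>x. hcoef (corner_index j0 l) (corner_step l) * tensor_haar (corner_index j0 l) x)
      \<le> C * besov_gauge p q s (corner_step l :: real ^ 'n => real)" for l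
  proof -
    define c where "c = (\<lambda>m. hcoef m (indicator (cell (Suc l) (\<lambda>_::'n. 0))))"
    have eq: "corner_step l = (\<lambda>x. \<Sum>m\<in>haar_box (Suc l). c m * tensor_haar m x)"
      by (simp add: corner_step_def haar_sum_def fun_eq_iff c_def)
    have "hcoef (corner_index j0 l) (corner_step l) = c (corner_index j0 l)"
      by (simp only: c_def corner_hcoef_indicator)
    moreover have "besov_gauge p q s (\<lambda>x. c (corner_index j0 l) * tensor_haar (corner_index j0 l) x)
        \<le> C * besov_gauge p q s (\<lambda>x. \<Sum>m\<in>haar_box (Suc l). c m * tensor_haar m x)"
      using C[THEN spec, THEN spec, THEN bspec, OF corner_index_box, THEN mp, OF finite_haar_box] haar_box_finite_index by blast
    ultimately show ?thesis unfolding eq by simp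
  qed
  then show False using corner_projection_unbounded[OF p q s d, of C j0] by (meson not_less)
qed

lemma haar_projector_hcoef:
  fixes m :: "'n::finite => nat"
  assumes m: "\<And>j. 1 \<le> m j"
  shows "haar_projector (tensor_haar m) f = (\<lambda>x. hcoef m f * tensor_haar m x)"
proof -
  have "1 = tensor_weight m * (\<integral>x. tensor_haar m x * tensor_haar m x \<partial>cube_measure)"
    using hcoef_tensor_haar[where m = m and m' = m, OF m m] by (simp add: hcoef_def)
  also have "(\<integral>x. tensor_haar m x * tensor_haar m x \<partial>cube_measure) = (Lp_norm 2 unit_cube (tensor_haar m))\<^sup>2"
  proof -
    have "(Lp_norm 2 unit_cube (tensor_haar m))\<^sup>2 = lp_int 2 unit_cube (tensor_haar m)"
      using Lp_norm_powr[of 2 unit_cube "tensor_haar m"] by simp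
    then show ?thesis by (simp add: lp_int_def power2_eq_square)
  qed
  finally have "inverse ((Lp_norm 2 unit_cube (tensor_haar m))\<^sup>2) = tensor_weight m"
    using tensor_weight_pos[of m] by (intro inverse_unique) (simp add: mult.commute)
  then show ?thesis by (simp add: haar_projector_def hcoef_def mult.commute fun_eq_iff)
qed

lemma dyadic_cube_cell:
  fixes i :: "'n::finite => nat"
  assumes "\<forall>j. i j \<in> {1..2 ^ k}"
  shows "dyadic_cube k i = cell k (\<lambda>j. i j - 1)" "(\<lambda>j. i j - 1) \<in> grid k"
proof -
  show "dyadic_cube k i = cell k (\<lambda>j. i j - 1)"
    unfolding cell_def using assms by (intro arg_cong[where f = "dyadic_cube k"]) (auto simp: fun_eq_iff Suc_le_eq)
  show "(\<lambda>j. i j - 1) \<in> grid k" unfolding mem_grid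
  proof
    fix j show "i j - 1 < 2 ^ k" using assms[rule_format, of j] by (simp only: atLeastAtMost_iff) linarith
  qed
qed

lemma step_functions_level_cells:
  fixes f :: "real ^ 'n::finite => real"
  shows "f \<in> step_functions_level k \<longleftrightarrow> (\<exists>v. \<forall>i\<in>grid k. \<forall>x\<in>cell k i. f x = v i)"
proof
  assume f: "f \<in> step_functions_level k"
  have "\<exists>c. \<forall>x\<in>cell k i. f x = c" if i: "i \<in> grid k" for i
  proof -
    have "\<forall>j. Suc (i j) \<in> {1..2 ^ k}" using i by (auto simp: mem_grid Suc_le_eq)
    moreover have "\<forall>i. (\<forall>j. i j \<in> {1..2 ^ k}) --> (\<exists>c. \<forall>x\<in>dyadic_cube k i. f x = c)"
      using f unfolding step_functions_level_def constant_on_def by blast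
    ultimately have "\<exists>c. \<forall>x\<in>dyadic_cube k (\<lambda>j. Suc (i j)). f x = c" by (elim allE[of _ "\<lambda>j. Suc (i j)"]) (rule mp)
    then show ?thesis unfolding cell_def .
  qed
  then show "\<exists>v. \<forall>i\<in>grid k. \<forall>x\<in>cell k i. f x = v i" by metis
next
  assume "\<exists>v. \<forall>i\<in>grid k. \<forall>x\<in>cell k i. f x = v i"
  then obtain v where v: "\<forall>i\<in>grid k. \<forall>x\<in>cell k i. f x = v i" by blast
  have "f constant_on dyadic_cube k i" if i: "\<forall>j. i j \<in> {1..2 ^ k}" for i
    unfolding dyadic_cube_cell(1)[OF i] constant_on_def using v dyadic_cube_cell(2)[OF i] by blast
  then show "f \<in> step_functions_level k" unfolding step_functions_level_def by blast
qed

lemma corner_step_step: "corner_step l \<in> (step_functions :: (real ^ 'n::finite => real) set)"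
proof -
  have "\<exists>v. \<forall>i\<in>grid (Suc l). \<forall>x\<in>cell (Suc l) i. (corner_step l :: real ^ 'n => real) x = v i"
    using corner_step_cell by (intro exI[of _ "\<lambda>i. if i = (\<lambda>_. 0) then 1 else 0"]) blast
  then show ?thesis unfolding step_functions_def using step_functions_level_cells by blast
qed

text \<open>The example is the one used against bases. Passing between \<open>besov_norm\<close> and
  the gauge costs the equivalence constant on both sides, hence the product with two factors
  c.\<close>

lemma haar_projectors_unbounded:
  assumes p: "0 < p" "p < 1" and q: "0 < q" and s: "0 \<le> s" "s < 1 / p" and d: "1 < CARD('n::finite)"
  shows "\<not> (\<exists>C :: real. \<forall>h \<in> (haar_system :: (real ^ 'n => real) set). \<forall>f \<in> step_functions.
              besov_norm p q s (haar_projector h f) \<le> C * besov_norm p q s f)"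
proof
  assume "\<exists>C :: real. \<forall>h \<in> (haar_system :: (real ^ 'n => real) set). \<forall>f \<in> step_functions.
              besov_norm p q s (haar_projector h f) \<le> C * besov_norm p q s f"
  then obtain C :: real where C: "\<And>h f. h \<in> (haar_system :: (real ^ 'n => real) set) ==> f \<in> step_functions ==>
              besov_norm p q s (haar_projector h f) \<le> C * besov_norm p q s f" by blast
  obtain c where c: "0 < c" "\<forall>f :: real ^ 'n => real. f \<in> besov_space p q s -->
    besov_norm p q s f powr q \<le> c * besov_gauge p q s f \<and> besov_gauge p q s f \<le> c * besov_norm p q s f powr q"
    using besov_norm_gauge[OF p(1) q s(1)] by blast
  obtain j0 :: 'n where True by blast
  have "besov_gauge p q s (\<lambda>x. hcoef (corner_index j0 l) (corner_step l) * tensor_haar (corner_index j0 l) x)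
      \<le> c * \<bar>C\<bar> powr q * c * besov_gauge p q s (corner_step l :: real ^ 'n => real)" for l
  proof -
    let ?f = "corner_step l :: real ^ 'n => real"
    let ?g = "haar_projector (tensor_haar (corner_index j0 l)) ?f"
    have g: "?g = (\<lambda>x. hcoef (corner_index j0 l) ?f * tensor_haar (corner_index j0 l) x)"
      by (rule haar_projector_hcoef[OF corner_index_ge_1])
    have gB: "?g \<in> besov_space p q s"
      unfolding g by (rule besov_cmult(1)[OF p(1) q s(1) tensor_haar_besov[OF p(1) q s corner_index_ge_1]])
    have FB: "?f \<in> besov_space p q s" by (rule step_besov[OF p(1) q s corner_step_measurable corner_step_cell])
    have "tensor_haar (corner_index j0 l) \<in> haar_system" unfolding haar_system_def by (intro imageI CollectI allI corner_index_ge_1)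
    then have "besov_norm p q s ?g \<le> C * besov_norm p q s ?f" by (rule C[OF _ corner_step_step])
    also have "\<dots> \<le> \<bar>C\<bar> * besov_norm p q s ?f" by (intro mult_right_mono) auto
    finally have "besov_norm p q s ?g powr q \<le> (\<bar>C\<bar> * besov_norm p q s ?f) powr q" using q by (intro powr_mono2) auto
    also have "\<dots> = \<bar>C\<bar> powr q * besov_norm p q s ?f powr q" by (rule powr_mult)
    also have "\<dots> \<le> \<bar>C\<bar> powr q * (c * besov_gauge p q s ?f)"
      using c(2)[rule_format, OF FB] by (intro mult_left_mono) auto
    finally have "c * besov_norm p q s ?g powr q \<le> c * (\<bar>C\<bar> powr q * (c * besov_gauge p q s ?f))"
      using c(1) by (intro mult_left_mono) auto
    moreover have "besov_gauge p q s ?g \<le> c * besov_norm p q s ?g powr q" using c(2) gB by blast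
    ultimately show ?thesis unfolding g by (simp add: mult.assoc)
  qed
  then show False using corner_projection_unbounded[OF p q s d, of "c * \<bar>C\<bar> powr q * c" j0] by (meson not_less)
qed

section \<open>A blockwise ordering for \<^term>\<open>p = 1\<close>\<close>

text \<open>Initial segments of the enumeration are exactly the sublevel sets of the key. That every
  segment has this form serves to bound all partial sums; that every sublevel set occurs serves to
  single out a bad partial sum.\<close>

lemma enumerate_by_key:
  fixes \<kappa> :: "'a => nat"
  assumes inj: "inj_on \<kappa> S" and inf: "infinite S"
  shows "\<exists>\<nu> :: nat => 'a. bij_betw \<nu> UNIV S \<and> strict_mono (\<lambda>i. \<kappa> (\<nu> i)) \<and>
    (\<forall>M. \<exists>c. \<nu> ` {..<M} = {m \<in> S. \<kappa> m < c}) \<and> (\<forall>c. \<exists>M. \<nu> ` {..<M} = {m \<in> S. \<kappa> m < c})"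
proof -
  define T where "T = \<kappa> ` S"
  have T: "infinite T" using inf inj by (simp add: T_def finite_image_iff)
  define \<nu> where "\<nu> = inv_into S \<kappa> \<circ> enumerate T"
  have b: "bij_betw \<nu> UNIV S"
    unfolding \<nu>_def using bij_enumerate[OF T] bij_betw_inv_into[of \<kappa> S T] inj
    by (intro bij_betw_trans[of "enumerate T" _ T]) (auto simp: bij_betw_def T_def)
  have k: "\<kappa> (\<nu> i) = enumerate T i" for i
    using enumerate_in_set[OF T, of i] by (auto simp: \<nu>_def T_def f_inv_into_f)
  have mono: "enumerate T i < enumerate T j \<longleftrightarrow> i < j" for i j by (rule enumerate_mono_iff[OF T])
  have seg: "\<nu> ` {..<M} = {m \<in> S. \<kappa> m < c}" if c: "\<And>i. enumerate T i < c \<longleftrightarrow> i < M" for M c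
  proof (intro equalityI subsetI)
    fix m assume "m \<in> {m \<in> S. \<kappa> m < c}"
    moreover then obtain i where "m = \<nu> i" using bij_betw_imp_surj_on[OF b] by blast
    ultimately show "m \<in> \<nu> ` {..<M}" using c[of i] by (simp add: k)
  next
    fix m assume "m \<in> \<nu> ` {..<M}"
    then show "m \<in> {m \<in> S. \<kappa> m < c}" using bij_betwE[OF b] c k by auto
  qed
  have 1: "\<exists>c. \<nu> ` {..<M} = {m \<in> S. \<kappa> m < c}" for M using seg[of "enumerate T M" M] mono by blast
  have 2: "\<exists>M. \<nu> ` {..<M} = {m \<in> S. \<kappa> m < c}" for c
  proof -
    define M where "M = (LEAST i. c \<le> enumerate T i)"
    have "c \<le> enumerate T M" unfolding M_def by (rule LeastI[of _ c]) (rule le_enumerate[OF T])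
    moreover have "enumerate T i < c" if "i < M" for i
      using not_less_Least[of i "\<lambda>i. c \<le> enumerate T i"] that by (simp add: M_def not_le)
    moreover have "c \<le> enumerate T i" if "M \<le> i" for i
      using calculation(1) mono[of i M] that by linarith
    ultimately have "enumerate T i < c \<longleftrightarrow> i < M" for i by (meson not_le)
    then show ?thesis using seg by blast
  qed
  have 3: "strict_mono (\<lambda>i. \<kappa> (\<nu> i))" unfolding k using mono by (simp add: strict_mono_def)
  show ?thesis by (rule exI[of _ \<nu>], intro conjI allI) (rule b 3 1 2)+
qed

text \<open>The number with base B digits m j - 1; the head of the list is the least significant
  digit.\<close>

fun digit_sum :: "nat => 'n list => ('n => nat) => nat" where
  "digit_sum B [] m = 0"
| "digit_sum B (j # js) m = (m j - 1) + B * digit_sum B js m"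

lemma digit_sum_less:
  assumes "\<forall>j\<in>set js. 1 \<le> m j \<and> m j \<le> B"
  shows "digit_sum B js m < B ^ length js"
  using assms
proof (induction js)
  case (Cons j js)
  then have "digit_sum B js m + 1 \<le> B ^ length js" "m j - 1 < B" by auto
  then have "B * (digit_sum B js m + 1) \<le> B * B ^ length js" by (intro mult_left_mono) auto
  then show ?case using \<open>m j - 1 < B\<close> by simp
qed simp

lemma digit_sum_inj:
  assumes "\<forall>j\<in>set js. 1 \<le> m j \<and> m j \<le> B" "\<forall>j\<in>set js. 1 \<le> m' j \<and> m' j \<le> B" "digit_sum B js m = digit_sum B js m'"
  shows "\<forall>j\<in>set js. m j = m' j"
  using assms
proof (induction js)
  case (Cons j js)
  have lt: "m j - 1 < B" "m' j - 1 < B" using Cons.prems by fastforce+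
  have eq: "(m j - 1) + B * digit_sum B js m = (m' j - 1) + B * digit_sum B js m'" using Cons.prems by simp
  from arg_cong[OF eq, of "\<lambda>x. x mod B"] lt have "m j - 1 = m' j - 1" by simp
  have "digit_sum B js m = digit_sum B js m'"
    using eq lt(1) unfolding \<open>m j - 1 = m' j - 1\<close> by simp
  then have "\<forall>l\<in>set js. m l = m' l" using Cons.prems by (intro Cons.IH) auto
  moreover have "m j = m' j"
  proof -
    have "1 \<le> m j" "1 \<le> m' j" using Cons.prems by auto
    then show ?thesis using \<open>m j - 1 = m' j - 1\<close> by linarith
  qed
  ultimately show ?case by simp
qed simp

section \<open>Boundedness in L_1 of projections onto index sets\<close>

definition L1_bounded :: "nat => ('n::finite => nat) set => real => bool" where
  "L1_bounded K A C \<longleftrightarrow> A \<subseteq> haar_box K \<and>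
    (\<forall>F. (\<Sum>i\<in>grid K. \<bar>grid_proj K A F i\<bar>) \<le> C * (\<Sum>i\<in>grid K. \<bar>F i\<bar>))"

lemma L1_bounded_finite: "L1_bounded K A C ==> finite A"
  unfolding L1_bounded_def using finite_subset[OF _ finite_haar_box] by blast

lemma grid_proj_Un:
  assumes "finite A" "finite B" "A \<inter> B = {}"
  shows "grid_proj K (A \<union> B) F i = grid_proj K A F i + grid_proj K B F i"
  unfolding grid_proj_def using assms by (rule sum.union_disjoint)

lemma L1_bounded_Un:
  assumes A: "L1_bounded K A C" and B: "L1_bounded K B D" and AB: "A \<inter> B = {}"
  shows "L1_bounded K (A \<union> B) (C + D)"
  unfolding L1_bounded_def
proof (intro conjI allI)
  show "A \<union> B \<subseteq> haar_box K" using A B by (simp add: L1_bounded_def)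
  fix F
  have "(\<Sum>i\<in>grid K. \<bar>grid_proj K (A \<union> B) F i\<bar>) \<le> (\<Sum>i\<in>grid K. \<bar>grid_proj K A F i\<bar> + \<bar>grid_proj K B F i\<bar>)"
    unfolding grid_proj_Un[OF L1_bounded_finite[OF A] L1_bounded_finite[OF B] AB] by (intro sum_mono abs_triangle_ineq)
  also have "\<dots> \<le> C * (\<Sum>i\<in>grid K. \<bar>F i\<bar>) + D * (\<Sum>i\<in>grid K. \<bar>F i\<bar>)"
    using A B unfolding sum.distrib L1_bounded_def by (intro add_mono) blast+
  finally show "(\<Sum>i\<in>grid K. \<bar>grid_proj K (A \<union> B) F i\<bar>) \<le> (C + D) * (\<Sum>i\<in>grid K. \<bar>F i\<bar>)" by (simp add: distrib_right)
qed

lemma L1_bounded_Diff: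
  assumes A: "L1_bounded K A C" and B: "L1_bounded K B D" and AB: "B \<subseteq> A"
  shows "L1_bounded K (A - B) (C + D)"
  unfolding L1_bounded_def
proof (intro conjI allI)
  show "A - B \<subseteq> haar_box K" using A by (auto simp: L1_bounded_def)
  fix F
  have "grid_proj K A F i = grid_proj K B F i + grid_proj K (A - B) F i" for i
    using grid_proj_Un[of B "A - B" K F i] L1_bounded_finite[OF A] L1_bounded_finite[OF B] AB
    by (simp add: Un_absorb1 Un_Diff_cancel)
  then have "(\<Sum>i\<in>grid K. \<bar>grid_proj K (A - B) F i\<bar>) = (\<Sum>i\<in>grid K. \<bar>grid_proj K A F i - grid_proj K B F i\<bar>)" by simp
  also have "\<dots> \<le> (\<Sum>i\<in>grid K. \<bar>grid_proj K A F i\<bar> + \<bar>grid_proj K B F i\<bar>)" by (intro sum_mono abs_triangle_ineq4)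
  also have "\<dots> \<le> C * (\<Sum>i\<in>grid K. \<bar>F i\<bar>) + D * (\<Sum>i\<in>grid K. \<bar>F i\<bar>)"
    using A B unfolding sum.distrib L1_bounded_def by (intro add_mono) blast+
  finally show "(\<Sum>i\<in>grid K. \<bar>grid_proj K (A - B) F i\<bar>) \<le> (C + D) * (\<Sum>i\<in>grid K. \<bar>F i\<bar>)" by (simp add: distrib_right)
qed

text \<open>Each factor is an initial segment or a single frequency; for both the univariate kernel
  satisfies the condition of Schur's test with constant 1.\<close>

lemma L1_bounded_product:
  fixes B :: "'n::finite => nat set"
  assumes "\<And>j. (\<exists>M\<le>2 ^ K. B j = {1..M}) \<or> (\<exists>v\<in>{1..2 ^ K}. B j = {v})"
  shows "L1_bounded K (PiE UNIV B) 1"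
  unfolding L1_bounded_def
proof (intro conjI allI)
  have sub: "B j \<subseteq> {1..2 ^ K}" for j using assms[of j] by auto
  then show "PiE UNIV B \<subseteq> haar_box K" unfolding haar_box_def by (intro PiE_mono) auto
  fix F
  have "(\<Sum>i\<in>grid K. \<bar>grid_proj K (PiE UNIV B) F i\<bar>) \<le> (\<Sum>i\<in>grid K. \<bar>F i\<bar>)"
  proof (rule grid_proj_product_L1)
    fix j and u :: nat assume "u < 2 ^ K"
    then show "(\<Sum>t<2 ^ K. \<bar>\<Sum>m\<in>B j. haar_weight m * hh K m t * hh K m u\<bar>) \<le> 2 ^ K"
      using assms[of j] haar_partial_kernel_L1[of u K] haar_single_kernel_L1[of _ K u] by auto
  next
    fix j show "finite (B j)" using sub finite_subset by blast
  qed
  then show "(\<Sum>i\<in>grid K. \<bar>grid_proj K (PiE UNIV B) F i\<bar>) \<le> 1 * (\<Sum>i\<in>grid K. \<bar>F i\<bar>)" by simp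
qed

lemma L1_bounded_empty: "L1_bounded K {} 1"
  by (simp add: L1_bounded_def grid_proj_def sum_nonneg)

text \<open>
  Fixing the most significant digit splits a lexicographic initial segment into a shorter such segment
  and a product set.
\<close>

lemma L1_bounded_digit_segment:
  fixes js :: "'n::finite list"
  assumes "b \<le> B" "b \<le> 2 ^ K" "0 < B" "distinct js"
  shows "L1_bounded K {m \<in> PiE UNIV (\<lambda>_. {1..b}). digit_sum B js m < c} (real (length js) + 1)"
  using assms(4)
proof (induction js arbitrary: c)
  case Nil
  have "L1_bounded K (PiE UNIV (\<lambda>_::'n. {1..b})) 1" by (rule L1_bounded_product) (use assms(2) in blast)
  then show ?case using L1_bounded_empty by (cases "c = 0") auto
next
  case (Cons j js)
  let ?box = "PiE UNIV (\<lambda>_::'n. {1..b})"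
  \<comment> \<open>As j is the least significant digit, c' consists of the remaining digits of the
    threshold and r is its last digit. Digits are m j - 1, so the strict condition on the last digit
    reads m j \<le> r.\<close>
  define c' r where "c' = c div B" and "r = c mod B"
  define E where "E = {m \<in> ?box. digit_sum B js m = c' \<and> m j \<le> r}"
  have c: "c = r + B * c'" "r < B" using assms(3) by (auto simp: c'_def r_def)
  have less_iff: "(m j - 1) + B * n < c \<longleftrightarrow> n < c' \<or> n = c' \<and> m j \<le> r" if "1 \<le> m j" "m j \<le> b" for m :: "'n => nat" and n
  proof -
    have "m j - 1 < B" using that assms(1) by linarith
    consider "n < c'" | "n = c'" | "c' < n" by linarith
    then show ?thesis
    proof cases
      case 1
      then have "B * (n + 1) \<le> B * c'" by (intro mult_left_mono) auto
      then show ?thesis using 1 c \<open>m j - 1 < B\<close> by simp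
    next
      case 2
      then show ?thesis using c that by auto
    next
      case 3
      then have "B * (c' + 1) \<le> B * n" by (intro mult_left_mono) auto
      then show ?thesis using 3 c by simp
    qed
  qed
  have split: "{m \<in> ?box. digit_sum B (j # js) m < c} = {m \<in> ?box. digit_sum B js m < c'} \<union> E"
    unfolding E_def using less_iff by (auto simp: PiE_iff)
  have "L1_bounded K E 1"
  proof (cases "\<exists>m0\<in>?box. digit_sum B js m0 = c'")
    case True
    then obtain m0 where m0: "m0 \<in> ?box" "digit_sum B js m0 = c'" by blast
    \<comment> \<open>Equal digit sums pin the coordinates in \<open>js\<close> to those of m0,
      while j runs through an initial segment and the remaining coordinates are free; so E is a
      product of initial segments and singletons.\<close>
    have "E = PiE UNIV (\<lambda>l. if l = j then {1..min b r} else if l \<in> set js then {m0 l} else {1..b})" (is "E = PiE UNIV ?P")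
    proof (intro equalityI subsetI)
      fix m assume m: "m \<in> E"
      have "\<forall>l\<in>set js. m l = m0 l"
        by (rule digit_sum_inj[of _ _ B]) (use m m0 assms(1) in \<open>auto simp: E_def PiE_iff intro: order_trans\<close>)
      then show "m \<in> PiE UNIV ?P" using m by (auto simp: E_def PiE_iff)
    next
      fix m assume m: "m \<in> PiE UNIV ?P"
      then have ml: "m l \<in> ?P l" for l by (simp add: PiE_iff)
      have m1: "1 \<le> m l \<and> m l \<le> b" for l using ml[of l] m0(1) by (auto simp: PiE_iff split: if_splits)
      have mj: "m j \<le> r" using ml[of j] by simp
      have eq: "\<forall>l\<in>set js. m l = m0 l" 
      proof
        fix l assume "l \<in> set js"
        then show "m l = m0 l" using ml[of l] Cons.prems by (simp split: if_splits)
      qed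
      have "digit_sum B js m = digit_sum B js m0" using eq by (induction js) auto
      then show "m \<in> E" using m0(2) m1 mj by (simp add: E_def PiE_iff)
    qed
    moreover have "L1_bounded K (PiE UNIV ?P) 1"
    proof (rule L1_bounded_product)
      fix l
      have "min b r \<le> 2 ^ K" using assms(2) by linarith
      moreover have "m0 l \<in> {1..2 ^ K}" using m0(1) assms(2) by (auto simp: PiE_iff intro: order_trans)
      ultimately show "(\<exists>M\<le>2 ^ K. ?P l = {1..M}) \<or> (\<exists>v\<in>{1..2 ^ K}. ?P l = {v})" using assms(2) by auto
    qed
    ultimately show ?thesis by simp
  next
    case False
    then have "E = {}" by (auto simp: E_def)
    then show ?thesis using L1_bounded_empty by simp
  qed
  moreover have "L1_bounded K {m \<in> ?box. digit_sum B js m < c'} (real (length js) + 1)"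
    using Cons by simp
  moreover have "{m \<in> ?box. digit_sum B js m < c'} \<inter> E = {}" by (auto simp: E_def)
  ultimately have "L1_bounded K ({m \<in> ?box. digit_sum B js m < c'} \<union> E) (real (length js) + 1 + 1)"
    by (intro L1_bounded_Un)
  then show ?case unfolding split by (simp add: add.commute)
qed

definition coordinates :: "'n::finite list" where
  "coordinates = (SOME js. set js = UNIV \<and> distinct js)"

lemma coordinates: "set (coordinates :: 'n::finite list) = UNIV" "distinct (coordinates :: 'n list)"
  "length (coordinates :: 'n list) = CARD('n)"
proof -
  have "\<exists>js :: 'n list. set js = UNIV \<and> distinct js" by (rule finite_distinct_list) simp
  then have "set (coordinates :: 'n list) = UNIV \<and> distinct (coordinates :: 'n list)"
    unfolding coordinates_def by (rule someI_ex)
  then show "set (coordinates :: 'n::finite list) = UNIV" "distinct (coordinates :: 'n list)"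
    "length (coordinates :: 'n list) = CARD('n)" using distinct_card by metis+
qed

definition haar_level :: "('n::finite => nat) => nat" where
  "haar_level m = (LEAST k. m \<in> haar_box k)"

lemma haar_level_le_iff:
  assumes "\<forall>j. 1 \<le> m j"
  shows "haar_level m \<le> k \<longleftrightarrow> m \<in> haar_box k"
proof
  obtain K where "m \<in> haar_box K" using haar_index_in_box[of "{m}"] assms by auto
  then have 1: "m \<in> haar_box (haar_level m)" unfolding haar_level_def by (rule LeastI)
  show "m \<in> haar_box k" if "haar_level m \<le> k" using 1 haar_box_mono[OF that] by blast
  show "haar_level m \<le> k" if "m \<in> haar_box k" using that unfolding haar_level_def by (rule Least_le)
qed

text \<open>
  Orders by levels; within a level the indices in \<^term>\<open>A\<close> come first, and ties are broken
  lexicographically.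
\<close>

definition level_key :: "('n::finite => nat) set => ('n => nat) => nat" where
  "level_key A m = 2 * 2 ^ (CARD('n) * haar_level m) + (if m \<in> A then 0 else 2 ^ (CARD('n) * haar_level m))
     + digit_sum (2 ^ haar_level m) coordinates m"

lemma level_digit_sum_less:
  fixes m :: "'n::finite => nat"
  assumes m: "\<forall>j. 1 \<le> m j"
  shows "digit_sum (2 ^ haar_level m) coordinates m < 2 ^ (CARD('n) * haar_level m)"
proof -
  have "m \<in> haar_box (haar_level m)" using haar_level_le_iff[OF m, of "haar_level m"] by simp
  then have "\<forall>j\<in>set coordinates. 1 \<le> m j \<and> m j \<le> 2 ^ haar_level m" unfolding mem_haar_box by blast
  then have "digit_sum (2 ^ haar_level m) coordinates m < (2 ^ haar_level m) ^ length (coordinates :: 'n list)" by (rule digit_sum_less)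
  also have "\<dots> = 2 ^ (CARD('n) * haar_level m)" by (simp only: coordinates(3) power_mult[symmetric] mult.commute)
  finally show ?thesis .
qed

text \<open>With d = \<open>CARD('n)\<close> and N_k = 2^(d k), the keys of level k lie in [2 N_k, 4
  N_k), those of A in the first half and the others in the second. Since d \<ge> 1, the range ends
  no later than 2 N_(k+1).\<close>

lemma level_key_less:
  fixes m :: "'n::finite => nat"
  assumes m: "\<forall>j. 1 \<le> m j" and k: "haar_level m < k"
  shows "level_key A m < 2 * 2 ^ (CARD('n) * k)"
proof -
  have "level_key A m < 2 * (2 * 2 ^ (CARD('n) * haar_level m))"
    using level_digit_sum_less[OF m] by (simp add: level_key_def)
  also have "2 * 2 ^ (CARD('n) * haar_level m) \<le> (2::nat) ^ (CARD('n) * k)"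
  proof -
    have "CARD('n) * haar_level m + 1 \<le> CARD('n) * haar_level m + CARD('n)" using zero_less_card_finite[where 'a='n] by linarith
    also have "\<dots> = CARD('n) * Suc (haar_level m)" by simp
    also have "\<dots> \<le> CARD('n) * k" using k by (intro mult_left_mono) auto
    finally have "(2::nat) ^ (CARD('n) * haar_level m + 1) \<le> 2 ^ (CARD('n) * k)" by (intro power_increasing) auto
    then show ?thesis by simp
  qed
  finally show ?thesis by simp
qed

lemma level_key_ge:
  fixes m :: "'n::finite => nat"
  assumes "k \<le> haar_level m"
  shows "2 * 2 ^ (CARD('n) * k) \<le> level_key A m"
proof -
  have "(2::nat) ^ (CARD('n) * k) \<le> 2 ^ (CARD('n) * haar_level m)"
    using assms by (intro power_increasing mult_left_mono) auto
  then show ?thesis unfolding level_key_def by linarith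
qed

lemma level_key_mono:
  assumes "\<forall>j. 1 \<le> m j" "haar_level m < haar_level m'"
  shows "level_key A m < level_key A m'"
  using level_key_less[OF assms] level_key_ge[OF le_refl] by (rule less_le_trans)

lemma level_key_inj: "inj_on (level_key A) {m :: 'n::finite => nat. \<forall>j. 1 \<le> m j}"
proof (rule inj_onI)
  fix m m' :: "'n => nat"
  assume m: "m \<in> {m. \<forall>j. 1 \<le> m j}" "m' \<in> {m. \<forall>j. 1 \<le> m j}" and eq: "level_key A m = level_key A m'"
  then have m': "\<forall>j. 1 \<le> m j" "\<forall>j. 1 \<le> m' j" by auto
  have l: "haar_level m' = haar_level m"
    using level_key_mono[OF m'(1), of m' A] level_key_mono[OF m'(2), of m A] eq by (metis less_irrefl linorder_neqE_nat)
  have d: "digit_sum (2 ^ haar_level m) coordinates m = digit_sum (2 ^ haar_level m) coordinates m'"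
    using eq level_digit_sum_less[OF m'(1)] level_digit_sum_less[OF m'(2)] unfolding level_key_def l by (auto split: if_splits)
  have "m \<in> haar_box (haar_level m)" "m' \<in> haar_box (haar_level m)"
    using haar_level_le_iff[OF m'(1), of "haar_level m"] haar_level_le_iff[OF m'(2), of "haar_level m"] l by auto
  then have "\<forall>j\<in>set coordinates. m j = m' j"
    by (intro digit_sum_inj[OF _ _ d]) (simp_all add: mem_haar_box)
  then show "m = m'" by (auto simp: coordinates(1))
qed

lemma infinite_haar_indices: "infinite {m :: 'n::finite => nat. \<forall>j. 1 \<le> m j}"
proof -
  have "inj (\<lambda>l (j::'n). Suc l)" by (auto simp: inj_def fun_eq_iff)
  then have "infinite (range (\<lambda>l (j::'n). Suc l))" by (rule range_inj_infinite)
  moreover have "range (\<lambda>l (j::'n). Suc l) \<subseteq> {m. \<forall>j. 1 \<le> m j}" by auto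
  ultimately show ?thesis using finite_subset by blast
qed

text \<open>A segment consists of all lower levels, which form a box, and of the indices of level k
  below a lexicographic threshold. The latter are a lexicographic segment of the whole box of level
  k minus one of the smaller box, both with base 2^k; this is why box and base are separate
  parameters in \<open>L1_bounded_digit_segment\<close>. The constant is 1 + 2 (d + 1).\<close>

lemma level_key_segment_L1:
  "\<exists>K. L1_bounded K {m :: 'n::finite => nat. (\<forall>j. 1 \<le> m j) \<and> level_key UNIV m < c} (2 * real CARD('n) + 3)"
proof (cases "c \<le> 2")
  case True
  have "{m :: 'n => nat. (\<forall>j. 1 \<le> m j) \<and> level_key UNIV m < c} = {}"
  proof (rule equals0I)
    fix m :: "'n => nat" assume "m \<in> {m. (\<forall>j. 1 \<le> m j) \<and> level_key UNIV m < c}"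
    then show False using level_key_ge[of 0 m UNIV] True by simp
  qed
  moreover have "L1_bounded 0 ({} :: ('n => nat) set) (2 * real CARD('n) + 3)"
    by (simp add: L1_bounded_def grid_proj_def sum_nonneg)
  ultimately show ?thesis by (intro exI[of _ 0]) (simp only:)
next
  case False
  define d where "d = CARD('n)"
  have d: "0 < d" by (simp add: d_def)
  \<comment> \<open>The level in which the threshold c falls, as keys of level k start at 2 * 2^(d
    k).\<close>
  define k where "k = (LEAST k. c \<le> 2 * 2 ^ (d * Suc k))"
  have k1: "c \<le> 2 * 2 ^ (d * Suc k)"
    unfolding k_def
  proof (rule LeastI[of _ c])
    have "c < 2 ^ c" by (rule less_exp)
    also have "\<dots> \<le> 2 ^ (d * Suc c)" using mult_le_mono1[of 1 d "Suc c"] d by (intro power_increasing) auto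
    finally show "c \<le> 2 * 2 ^ (d * Suc c)" by simp
  qed
  have k2: "2 * 2 ^ (d * k) < c"
  proof (cases k)
    case 0
    then show ?thesis using False by simp
  next
    case (Suc k')
    then have "\<not> c \<le> 2 * 2 ^ (d * Suc k')" using not_less_Least[of k' "\<lambda>k. c \<le> 2 * 2 ^ (d * Suc k)"] by (simp add: k_def)
    then show ?thesis using Suc by simp
  qed
  define c' where "c' = c - 2 * 2 ^ (d * k)"
  define D where "D b = {m :: 'n => nat. m \<in> PiE UNIV (\<lambda>_. {1..b}) \<and> digit_sum (2 ^ k) coordinates m < c'}" for b
  define L where "L = {m :: 'n => nat. (\<forall>j. 1 \<le> m j) \<and> haar_level m < k}"
  have DL: "D b \<subseteq> {m. \<forall>j. 1 \<le> m j}" for b by (auto simp: D_def PiE_iff)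
  have seg: "{m :: 'n => nat. (\<forall>j. 1 \<le> m j) \<and> level_key UNIV m < c} = L \<union> (D (2 ^ k) - L)"
  proof (intro set_eqI)
    fix m :: "'n => nat"
    show "m \<in> {m :: 'n => nat. (\<forall>j. 1 \<le> m j) \<and> level_key UNIV m < c} \<longleftrightarrow> m \<in> L \<union> (D (2 ^ k) - L)"
    proof (cases "\<forall>j. 1 \<le> m j")
      case m: True
      consider "haar_level m < k" | "haar_level m = k" | "k < haar_level m" by linarith
      then show ?thesis
      proof cases
        case 1
        then show ?thesis using level_key_less[OF m 1, of UNIV] k2 m unfolding L_def d_def by simp
      next
        case 2
        then have "m \<in> PiE UNIV (\<lambda>_. {1..2 ^ k})" using haar_level_le_iff[OF m, of k] by (simp add: haar_box_def)
        moreover have "level_key UNIV m < c \<longleftrightarrow> digit_sum (2 ^ k) coordinates m < c'"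
          unfolding level_key_def 2 c'_def d_def[symmetric] by simp linarith
        ultimately show ?thesis using m 2 by (simp add: L_def D_def)
      next
        case 3
        then have "m \<notin> D (2 ^ k)" using haar_level_le_iff[OF m, of k] by (simp add: D_def haar_box_def)
        moreover have "c \<le> level_key UNIV m" using level_key_ge[of "Suc k" m UNIV] 3 k1 unfolding d_def by simp
        ultimately show ?thesis using 3 by (simp add: L_def)
      qed
    next
      case False
      then show ?thesis using DL by (auto simp: L_def)
    qed
  qed
  have LD: "L1_bounded k (D b) (real d + 1)" if "b \<le> 2 ^ k" for b
    using L1_bounded_digit_segment[of b "2 ^ k" k "coordinates :: 'n list" c', OF that that _ coordinates(2)]
    unfolding D_def d_def by (simp add: coordinates(3))
  have LL: "\<exists>b\<le>2 ^ k. L1_bounded k L 1 \<and> D (2 ^ k) \<inter> L = D b"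
  \<comment> \<open>Below level 0 there is nothing; the empty set then plays the smaller box, with b
    = 0.\<close>
  proof (cases k)
    case 0
    then have "L = {}" "D 0 = {}" by (auto simp: L_def D_def PiE_iff)
    then show ?thesis using L1_bounded_empty by (intro exI[of _ 0]) auto
  next
    case (Suc k')
    have L: "L = PiE UNIV (\<lambda>_. {1..2 ^ k'})"
    proof (intro set_eqI)
      fix m :: "'n => nat"
      show "m \<in> L \<longleftrightarrow> m \<in> PiE UNIV (\<lambda>_. {1..2 ^ k'})"
        using haar_level_le_iff[of m k'] haar_box_finite_index[of m k'] Suc
        unfolding L_def haar_box_def by (auto simp: less_Suc_eq_le PiE_iff)
    qed
    have le: "(2::nat) ^ k' \<le> 2 ^ k" using Suc by simp
    have "L1_bounded k L 1" unfolding L by (rule L1_bounded_product) (use le in blast)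
    moreover have "D (2 ^ k) \<inter> L = D (2 ^ k')" unfolding L D_def using le by (auto simp: PiE_iff intro: order_trans)
    ultimately show ?thesis using le by blast
  qed
  then obtain b where b: "b \<le> 2 ^ k" "L1_bounded k L 1" "D (2 ^ k) \<inter> L = D b" by blast
  have "D (2 ^ k) - L = D (2 ^ k) - D b" using b(3) by blast
  moreover have "D b \<subseteq> D (2 ^ k)" using b(3) by blast
  ultimately have "L1_bounded k (D (2 ^ k) - L) (real d + 1 + (real d + 1))"
    using L1_bounded_Diff[OF LD[of "2 ^ k"] LD[OF b(1)]] by simp
  then have "L1_bounded k (L \<union> (D (2 ^ k) - L)) (1 + (real d + 1 + (real d + 1)))"
    by (intro L1_bounded_Un b(2)) auto
  then show ?thesis unfolding seg d_def by (intro exI[of _ k]) (simp add: algebra_simps)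
qed

text \<open>A Haar function that is constant on the cells of level k equals its averages almost
  everywhere, that is, its own box sum. If its index were outside the box, that sum would have
  coefficient 0 at m instead of 1.\<close>

lemma tensor_haar_level:
  fixes m :: "'n::finite => nat"
  assumes m: "\<forall>j. 1 \<le> m j"
  shows "tensor_haar m \<in> step_functions_level k \<longleftrightarrow> m \<in> haar_box k"
proof
  assume "m \<in> haar_box k"
  then show "tensor_haar m \<in> step_functions_level k"
    unfolding step_functions_level_cells using tensor_haar_cell by blast
next
  assume "tensor_haar m \<in> step_functions_level k"
  then obtain v where v: "\<And>i x. i \<in> grid k ==> x \<in> cell k i ==> tensor_haar m x = v i"
    unfolding step_functions_level_cells by blast
  show "m \<in> haar_box k"
  proof (rule ccontr)
    assume no: "m \<notin> haar_box k"
    let ?P = "haar_sum (haar_box k) (tensor_haar m)"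
    have avg: "cell_avg k (tensor_haar m) i = v i" if i: "i \<in> grid k" for i
    proof -
      have "(\<lambda>x. indicator (cell k i) x * tensor_haar m x) = (\<lambda>x. v i * (indicator (cell k i) x * 1))"
        using v[OF i] by (auto simp: fun_eq_iff indicator_def)
      then show ?thesis unfolding cell_avg_def
        using integral_indicator_cell[OF i] cell_size_pos[where 'n='n, of k] by simp
    qed
    have "AE x in cube_measure. tensor_haar m x * ?P x = tensor_haar m x * tensor_haar m x"
      using AE_cube_cell[of k]
    proof eventually_elim
      case (elim x)
      then obtain i where i: "i \<in> grid k" "x \<in> cell k i" by blast
      show ?case using haar_sum_box_cell[OF tensor_haar_integrable i] avg[OF i(1)] v[OF i] by simp
    qed
    then have "(\<integral>x. tensor_haar m x * ?P x \<partial>cube_measure) = (\<integral>x. tensor_haar m x * tensor_haar m x \<partial>cube_measure)"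
      by (intro integral_cong_AE borel_measurable_times tensor_haar_cube borel_imp_cube_measurable haar_sum_measurable)
    then have "hcoef m ?P = hcoef m (tensor_haar m)" by (simp add: hcoef_def)
    also have "\<dots> = 1" using hcoef_tensor_haar[where m = m and m' = m] m by simp
    finally have "hcoef m ?P = 1" .
    moreover have "hcoef m ?P = 0"
      unfolding haar_sum_def[abs_def] using m no haar_box_finite_index by (subst hcoef_lincomb) auto
    ultimately show False by simp
  qed
qed

lemma haar_block_level:
  fixes m :: "'n::finite => nat"
  assumes m: "\<forall>j. 1 \<le> m j" and h: "tensor_haar m \<in> haar_block k"
  shows "haar_level m = k"
proof (cases k)
  case 0
  have "(indicator unit_cube :: real ^ 'n => real) = tensor_haar (\<lambda>_. 1)"
  proof
    fix x :: "real ^ 'n"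
    have "tensor_haar (\<lambda>_. 1) x = (\<Prod>j\<in>UNIV. indicator {0..1} (x $ j))" by (simp only: tensor_haar_def haar_1)
    also have "\<dots> = (if \<forall>j. x $ j \<in> {0..1} then 1 else 0)"
      by (auto simp: indicator_def intro: prod.neutral prod_zero)
    finally show "indicator unit_cube x = tensor_haar (\<lambda>_. 1) x"
      by (simp add: unit_cube_def mem_box_cart indicator_def)
  qed
  then have "tensor_haar m = tensor_haar (\<lambda>_. 1)" using h 0 by (simp add: haar_block_def)
  then have "m = (\<lambda>_. 1)" using inj_onD[OF inj_tensor_haar] m by fastforce
  then have "m \<in> haar_box 0" by (simp add: mem_haar_box)
  then show ?thesis using haar_level_le_iff[OF m, of 0] 0 by simp
next
  case (Suc k')
  then have "m \<in> haar_box k" "m \<notin> haar_box k'"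
    using h tensor_haar_level[OF m] by (simp_all add: haar_block_def)
  then show ?thesis using haar_level_le_iff[OF m] Suc by (metis le_SucE)
qed

text \<open>For A = UNIV all indices belong to the first half of their level, so the key orders each
  level lexicographically.\<close>

lemma blockwise_haar_basis:
  assumes q: "0 < q" and s: "0 \<le> s" "s < 1"
  shows "\<exists>e :: nat => real ^ 'n::finite => real. blockwise_ordering e \<and> schauder_basis (besov_space 1 q s) (besov_norm 1 q s) e"
proof -
  let ?S = "{m :: 'n => nat. \<forall>j. 1 \<le> m j}"
  from enumerate_by_key[OF level_key_inj infinite_haar_indices, of UNIV]
  obtain \<nu> :: "nat => 'n => nat" where *: "bij_betw \<nu> UNIV ?S \<and> strict_mono (\<lambda>i. level_key UNIV (\<nu> i)) \<and>
    (\<forall>M. \<exists>c. \<nu> ` {..<M} = {m \<in> ?S. level_key UNIV m < c}) \<and> (\<forall>c. \<exists>M. \<nu> ` {..<M} = {m \<in> ?S. level_key UNIV m < c})"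
    by (rule exE)
  note \<nu> = *[THEN conjunct1] and mono = *[THEN conjunct2, THEN conjunct1]
    and seg = *[THEN conjunct2, THEN conjunct2, THEN conjunct1]
  have \<nu>1: "\<forall>j. 1 \<le> \<nu> i j" for i using bij_betwE[OF \<nu>] by auto
  define C where "C = 2 * real CARD('n) + 3"
  have "haar_sum (\<nu> ` {..<M}) f \<in> Lp_space 1 unit_cube \<and>
       lp_int 1 unit_cube (haar_sum (\<nu> ` {..<M}) f) \<le> C * 2 powr 1 * lp_int 1 unit_cube f"
    if f: "f \<in> Lp_space 1 unit_cube" for M and f :: "real ^ 'n => real"
  proof -
    obtain c where c: "\<nu> ` {..<M} = {m \<in> ?S. level_key UNIV m < c}" using seg by blast
    then obtain K where K: "L1_bounded K (\<nu> ` {..<M}) C"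
      using level_key_segment_L1[of c, where 'n='n] by (auto simp: C_def)
    have sub: "\<nu> ` {..<M} \<subseteq> haar_box K" and C0: "0 \<le> C" using K by (auto simp: L1_bounded_def C_def)
    have bd: "(\<Sum>i\<in>grid K. \<bar>grid_proj K (\<nu> ` {..<M}) F i\<bar> powr 1) \<le> C * (\<Sum>i\<in>grid K. \<bar>F i\<bar> powr 1)" for F
      using K by (simp add: L1_bounded_def)
    show ?thesis using haar_sum_bounded[OF _ f sub C0 bd] by simp
  qed
  then have "schauder_basis (besov_space 1 q s) (besov_norm 1 q s) (\<lambda>i. tensor_haar (\<nu> i))"
    using haar_schauder_basis[of 1 q s \<nu> "C * 2 powr 1"] \<nu> q s by simp
  moreover have "blockwise_ordering (\<lambda>i. tensor_haar (\<nu> i))"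
    unfolding blockwise_ordering_def
  proof (intro conjI allI impI)
    have "bij_betw tensor_haar ?S haar_system"
      unfolding haar_system_def bij_betw_def using inj_tensor_haar by blast
    from bij_betw_trans[OF \<nu> this] show "enumeration_of haar_system (\<lambda>i. tensor_haar (\<nu> i))"
      by (simp add: enumeration_of_def comp_def)
    fix k a b assume "tensor_haar (\<nu> a) \<in> haar_block k" "tensor_haar (\<nu> b) \<in> haar_block (Suc k)"
    then have "haar_level (\<nu> a) < haar_level (\<nu> b)" using haar_block_level[OF \<nu>1] by simp
    then have "level_key UNIV (\<nu> a) < level_key UNIV (\<nu> b)" by (rule level_key_mono[OF \<nu>1])
    then show "a < b" by (simp only: strict_mono_less[OF mono])
  qed
  ultimately show ?thesis by blast
qed

section \<open>Conditionality for \<^term>\<open>p = 1\<close>\<close>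

text \<open>
  The kernel of the projection onto every second block, evaluated at the corner. Its absolute sums
  grow by the factor \<^term>\<open>K\<close> compared with the full kernel, which is a point mass.
\<close>

definition even_kernel :: "nat => nat => real" where
  "even_kernel K t = (\<Sum>v\<in>{v \<in> {1..2 ^ K}. \<exists>a. even a \<and> v = Suc (2 ^ a)}. haar_weight v * hh K v 0 * hh K v t)"

lemma even_kernel_Suc:
  assumes t: "t < 2 ^ Suc K"
  shows "even_kernel (Suc K) t = even_kernel K (t div 2) +
    (if even K \<and> t div 2 = 0 then if even t then 2 ^ K else - (2 ^ K) else 0)"
proof -
  define E where "E v \<longleftrightarrow> (\<exists>a. even a \<and> v = Suc (2 ^ a))" for v :: nat
  define \<phi> where "\<phi> K t v = (if E v then haar_weight v * hh K v 0 * hh K v t else 0)" for K t v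
  have ker: "even_kernel K t = (\<Sum>v\<in>{1..2 ^ K}. \<phi> K t v)" for K t
    unfolding even_kernel_def \<phi>_def E_def by (rule sum.inter_filter) simp
  have EK: "E (Suc (2 ^ K)) \<longleftrightarrow> even K" by (auto simp: E_def)
  have "(\<Sum>v\<in>{1..2 ^ K}. \<phi> (Suc K) t v) = (\<Sum>v\<in>{1..2 ^ K}. \<phi> K (t div 2) v)"
    unfolding \<phi>_def using t by (intro sum.cong refl) (simp add: hh_Suc_coarse del: power_Suc)
  moreover have "(\<Sum>r<2 ^ K. \<phi> (Suc K) t (Suc (2 ^ K + r))) = (\<Sum>r<(2::nat) ^ K. if r = 0 then \<phi> (Suc K) t (Suc (2 ^ K)) else 0)"
    by (intro sum.cong) (auto simp: \<phi>_def hh_Suc_fine)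
  moreover have "\<phi> (Suc K) t (Suc (2 ^ K)) = (if even K \<and> t div 2 = 0 then if even t then 2 ^ K else - (2 ^ K) else 0)"
    using haar_weight_fine[of 0 K] hh_Suc_fine[of 0 K 0] hh_Suc_fine[of 0 K t] by (auto simp: \<phi>_def EK)
  ultimately show ?thesis unfolding ker sum_haar_index_Suc by simp
qed

text \<open>At even K the value at 0, about a third of 2^K, splits into its sum with 2^K and its
  difference from 2^K. Being smaller than 2^K, it makes the absolute sum gain more than (4/3) 2^K in
  addition to doubling; at odd K the sum merely doubles. Relative to 2^K this is a gain of 2/3 for
  every two levels, hence growth like K/3.\<close>

lemma even_kernel_growth:
  "(even K --> 2 ^ K * real K / 3 \<le> (\<Sum>t<2 ^ K. \<bar>even_kernel K t\<bar>) \<and> 3 * even_kernel K 0 = 2 ^ K - 1) \<and>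
   (odd K --> 2 ^ K * (real K + 1) / 3 \<le> (\<Sum>t<2 ^ K. \<bar>even_kernel K t\<bar>) \<and> 3 * even_kernel K 0 = 2 ^ Suc K - 1)"
proof (induction K)
  case 0
  have "even_kernel 0 t = 0" for t unfolding even_kernel_def by (rule sum.neutral) auto
  then show ?case by simp
next
  case (Suc K)
  define d :: "nat => real" where "d t = (if even K \<and> t = 0 then 2 ^ K else 0)" for t
  have eq: "even_kernel (Suc K) (2 * t) = even_kernel K t + d t" "even_kernel (Suc K) (Suc (2 * t)) = even_kernel K t - d t"
    if "t < 2 ^ K" for t
    using that even_kernel_Suc[of "2 * t" K] even_kernel_Suc[of "Suc (2 * t)" K] by (auto simp: d_def)
  have S: "(\<Sum>t<2 ^ Suc K. \<bar>even_kernel (Suc K) t\<bar>) = (\<Sum>t<2 ^ K. \<bar>even_kernel K t + d t\<bar> + \<bar>even_kernel K t - d t\<bar>)"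
    unfolding sum_grid_Suc by (intro sum.cong) (auto simp: eq)
  have z: "even_kernel (Suc K) 0 = even_kernel K 0 + d 0" using eq(1)[of 0] by simp
  show ?case
  proof (cases "even K")
    case True
    then have k0: "3 * even_kernel K 0 = 2 ^ K - 1" and IH: "2 ^ K * real K / 3 \<le> (\<Sum>t<2 ^ K. \<bar>even_kernel K t\<bar>)" using Suc by auto
    have one: "1 \<le> (2::real) ^ K" by simp
    have d0: "d 0 = 2 ^ K" using True by (simp add: d_def)
    have kb: "\<bar>even_kernel K 0\<bar> = even_kernel K 0" "\<bar>even_kernel K 0 + 2 ^ K\<bar> = even_kernel K 0 + 2 ^ K"
      "\<bar>even_kernel K 0 - 2 ^ K\<bar> = 2 ^ K - even_kernel K 0" using k0 one by linarith+
    have "2 * (\<Sum>t<2 ^ K. \<bar>even_kernel K t\<bar>) + 2 * (2 ^ K - even_kernel K 0)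
        = (\<Sum>t<2 ^ K. 2 * \<bar>even_kernel K t\<bar> + (if t = 0 then 2 * (2 ^ K - even_kernel K 0) else 0))"
      by (simp add: sum.distrib sum_distrib_left)
    also have "\<dots> \<le> (\<Sum>t<2 ^ K. \<bar>even_kernel K t + d t\<bar> + \<bar>even_kernel K t - d t\<bar>)"
    proof (rule sum_mono)
      fix t
      show "2 * \<bar>even_kernel K t\<bar> + (if t = 0 then 2 * (2 ^ K - even_kernel K 0) else 0) \<le> \<bar>even_kernel K t + d t\<bar> + \<bar>even_kernel K t - d t\<bar>"
        using kb d0 by (cases "t = 0") auto
    qed
    finally have "2 * (\<Sum>t<2 ^ K. \<bar>even_kernel K t\<bar>) + 2 * (2 ^ K - even_kernel K 0) \<le> (\<Sum>t<2 ^ Suc K. \<bar>even_kernel (Suc K) t\<bar>)"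
      unfolding S .
    then have "2 ^ Suc K * (real (Suc K) + 1) / 3 \<le> (\<Sum>t<2 ^ Suc K. \<bar>even_kernel (Suc K) t\<bar>)"
      using IH k0 one by (simp add: algebra_simps)
    then show ?thesis using True k0 by (simp add: z d0)
  next
    case False
    then have "d t = 0" for t by (simp add: d_def)
    then have "(\<Sum>t<2 ^ Suc K. \<bar>even_kernel (Suc K) t\<bar>) = 2 * (\<Sum>t<2 ^ K. \<bar>even_kernel K t\<bar>)" "even_kernel (Suc K) 0 = even_kernel K 0"
      unfolding S z by (simp_all add: sum_distrib_left)
    then show ?thesis using Suc False by (simp add: algebra_simps)
  qed
qed

section \<open>Functions oscillating in two coordinates\<close>

lemma prod_two:
  fixes a b :: "'n::finite => real"
  assumes "j0 \<noteq> j1"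
  shows "(\<Prod>j\<in>UNIV. if j = j0 then a j else if j = j1 then b j else 1) = a j0 * b j1"
proof -
  have "(\<Prod>j\<in>UNIV. if j = j0 then a j else if j = j1 then b j else 1) = (\<Prod>j\<in>UNIV. (if j = j0 then a j else 1) * (if j = j1 then b j else 1))"
    using assms by (intro prod.cong) auto
  then show ?thesis by (simp add: prod.distrib)
qed

lemma sum_grid_two:
  fixes a b :: "nat => real"
  assumes j: "j0 \<noteq> (j1 :: 'n::finite)"
  shows "(\<Sum>i\<in>grid K. a (i j0) * b (i j1)) = (\<Prod>j\<in>UNIV-{j1}. \<Sum>t<2 ^ K. if j = j0 then a t else 1) * (\<Sum>t<2 ^ K. b t)"
proof -
  have "(\<Sum>i\<in>grid K. a (i j0) * b (i j1)) = (\<Sum>i\<in>grid K. \<Prod>j\<in>UNIV. if j = j0 then a (i j) else if j = j1 then b (i j) else 1)"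
    by (simp only: prod_two[OF j])
  also have "\<dots> = (\<Prod>j\<in>UNIV. \<Sum>t<2 ^ K. if j = j0 then a t else if j = j1 then b t else 1)"
    unfolding grid_def by (subst prod_sum_PiE) auto
  also have "\<dots> = (\<Sum>t<2 ^ K. if j1 = j0 then a t else if j1 = j1 then b t else 1) *
      (\<Prod>j\<in>UNIV-{j1}. \<Sum>t<2 ^ K. if j = j0 then a t else if j = j1 then b t else 1)"
    by (rule prod.remove) auto
  also have "(\<Prod>j\<in>UNIV-{j1}. \<Sum>t<2 ^ K. if j = j0 then a t else if j = j1 then b t else 1) = (\<Prod>j\<in>UNIV-{j1}. \<Sum>t<2 ^ K. if j = j0 then a t else 1)"
    by (intro prod.cong sum.cong) auto
  finally show ?thesis using j by (simp add: mult.commute)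
qed

text \<open>Coordinate j0 carries a function of the highest frequency, so the index has level
  exactly l + 1 whatever 1 \<le> v \<le> 2^(l+1) is, and coordinate j1 is free to run through a
  complete univariate system.\<close>

definition hump_index :: "'n => 'n => nat => nat => 'n => nat" where
  "hump_index j0 j1 l v j = (if j = j0 then Suc (2 ^ l) else if j = j1 then v else 1)"

text \<open>In coordinate j1 these are the Haar coefficients of the discrete point mass at 0: the
  sum over all frequencies is 2^K on the first interval and 0 elsewhere.\<close>

definition hump_coef :: "'n => nat => ('n => nat) => real" where
  "hump_coef j1 K m = haar_weight (m j1) * hh K (m j1) 0"

lemma inj_hump_index: "j0 \<noteq> j1 ==> inj (hump_index j0 j1 l)"
  by (rule injI, drule fun_cong[of _ _ j1]) (simp add: hump_index_def)

lemma hump_index_level: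
  fixes j0 :: "'n::finite"
  assumes "j0 \<noteq> j1" "v \<in> {1..2 ^ Suc l}"
  shows "\<forall>j. 1 \<le> hump_index j0 j1 l v j" "hump_index j0 j1 l v \<in> haar_box (Suc l)" "haar_level (hump_index j0 j1 l v) = Suc l"
proof -
  show 1: "\<forall>j. 1 \<le> hump_index j0 j1 l v j" using assms by (simp add: hump_index_def)
  show 2: "hump_index j0 j1 l v \<in> haar_box (Suc l)"
    using assms unfolding mem_haar_box hump_index_def by auto
  have "\<not> hump_index j0 j1 l v j0 \<le> 2 ^ l" by (simp add: hump_index_def)
  then have "hump_index j0 j1 l v \<notin> haar_box l" unfolding mem_haar_box by blast
  then show "haar_level (hump_index j0 j1 l v) = Suc l"
    using 2 haar_level_le_iff[OF 1] by (metis le_SucE)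
qed

lemma th_hump:
  fixes j0 :: "'n::finite"
  assumes "j0 \<noteq> j1" "i \<in> grid K"
  shows "th K (hump_index j0 j1 l v) i = hh K (Suc (2 ^ l)) (i j0) * hh K v (i j1)"
proof -
  have "th K (hump_index j0 j1 l v) i = (\<Prod>j\<in>UNIV. if j = j0 then hh K (Suc (2 ^ l)) (i j) else if j = j1 then hh K v (i j) else 1)"
    unfolding th_def hump_index_def using assms(2) hh_1[of _ K] by (intro prod.cong) (auto simp: mem_grid)
  then show ?thesis by (simp only: prod_two[OF assms(1)])
qed

text \<open>The L_1 norm of a product factors; R collects the coordinates other than j1 and does not
  depend on the set V of frequencies.\<close>

lemma hump_lp_int:
  fixes j0 j1 :: "'n::finite"
  assumes j: "j0 \<noteq> j1"
  shows "\<exists>R>0. \<forall>V\<subseteq>{1..2 ^ Suc l}.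
    lp_int 1 unit_cube (\<lambda>x :: real ^ 'n. \<Sum>m\<in>hump_index j0 j1 l ` V. hump_coef j1 (Suc l) m * tensor_haar m x)
    = R * (\<Sum>t<2 ^ Suc l. \<bar>\<Sum>v\<in>V. haar_weight v * hh (Suc l) v 0 * hh (Suc l) v t\<bar>)"
proof -
  let ?K = "Suc l"
  define a where "a t = \<bar>hh ?K (Suc (2 ^ l)) t\<bar>" for t
  define R where "R = (\<Prod>j\<in>UNIV-{j1}. \<Sum>t<2 ^ ?K. if j = j0 then a t else 1) * cell_size TYPE('n) ?K"
  have "a 0 = 1" using hh_Suc_fine[of 0 l 0] by (simp add: a_def)
  then have "0 < (\<Sum>t<2 ^ ?K. if j = j0 then a t else 1)" for j
    by (intro sum_pos2[of _ 0]) (auto simp: a_def)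
  then have "0 < R" unfolding R_def by (intro mult_pos_pos prod_pos cell_size_pos)
  moreover have "lp_int 1 unit_cube (\<lambda>x :: real ^ 'n. \<Sum>m\<in>hump_index j0 j1 l ` V. hump_coef j1 ?K m * tensor_haar m x)
    = R * (\<Sum>t<2 ^ ?K. \<bar>\<Sum>v\<in>V. haar_weight v * hh ?K v 0 * hh ?K v t\<bar>)" if V: "V \<subseteq> {1..2 ^ ?K}" for V
  proof -
    let ?f = "\<lambda>x :: real ^ 'n. \<Sum>m\<in>hump_index j0 j1 l ` V. hump_coef j1 ?K m * tensor_haar m x"
    define b where "b t = (\<Sum>v\<in>V. haar_weight v * hh ?K v 0 * hh ?K v t)" for t
    have val: "?f x = hh ?K (Suc (2 ^ l)) (i j0) * b (i j1)" if i: "i \<in> grid ?K" "x \<in> cell ?K i" for i x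
    proof -
      have "?f x = (\<Sum>v\<in>V. hump_coef j1 ?K (hump_index j0 j1 l v) * tensor_haar (hump_index j0 j1 l v) x)"
        by (subst sum.reindex) (auto intro: inj_on_subset[OF inj_hump_index[OF j]])
      also have "\<dots> = (\<Sum>v\<in>V. haar_weight v * hh ?K v 0 * (hh ?K (Suc (2 ^ l)) (i j0) * hh ?K v (i j1)))"
      proof (rule sum.cong)
        fix v assume "v \<in> V"
        then have "v \<in> {1..2 ^ ?K}" using V by blast
        then show "hump_coef j1 ?K (hump_index j0 j1 l v) * tensor_haar (hump_index j0 j1 l v) x
            = haar_weight v * hh ?K v 0 * (hh ?K (Suc (2 ^ l)) (i j0) * hh ?K v (i j1))"
          using j tensor_haar_cell[OF hump_index_level(2)[OF j] i] th_hump[OF j i(1), of l v]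
          by (simp add: hump_coef_def hump_index_def)
      qed simp
      finally show ?thesis by (simp add: b_def sum_distrib_left mult_ac)
    qed
    have "?f \<in> borel_measurable cube_measure"
      using tensor_haar_cube by (intro borel_measurable_sum borel_measurable_times borel_measurable_const)
    then have "lp_int 1 unit_cube ?f = (\<Sum>i\<in>grid ?K. \<bar>hh ?K (Suc (2 ^ l)) (i j0) * b (i j1)\<bar> powr 1) * cell_size TYPE('n) ?K"
      using val by (intro step_Lp(2)) auto
    also have "(\<Sum>i\<in>grid ?K. \<bar>hh ?K (Suc (2 ^ l)) (i j0) * b (i j1)\<bar> powr 1) = (\<Sum>i\<in>grid ?K. a (i j0) * \<bar>b (i j1)\<bar>)"
      by (simp add: abs_mult a_def)
    also have "\<dots> = (\<Prod>j\<in>UNIV-{j1}. \<Sum>t<2 ^ ?K. if j = j0 then a t else 1) * (\<Sum>t<2 ^ ?K. \<bar>b t\<bar>)" by (rule sum_grid_two[OF j])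
    finally show ?thesis by (simp add: R_def b_def)
  qed
  ultimately show ?thesis by blast
qed

text \<open>For a function from one block the box sums vanish below level K and reproduce the
  function from level K on. The Besov weights thus form a common factor, which cancels in any
  comparison within the block.\<close>

lemma block_proj_gauge:
  fixes B :: "('n::finite => nat) set"
  assumes B: "finite B" "\<And>m. m \<in> B ==> \<forall>j. 1 \<le> m j" "\<And>m. m \<in> B ==> haar_level m = K"
  shows "proj_gauge p \<sigma> \<theta> (\<lambda>x. \<Sum>m\<in>B. c m * tensor_haar m x)
    = ennreal (lp_int p unit_cube (\<lambda>x. \<Sum>m\<in>B. c m * tensor_haar m x) powr \<theta>) * (1 + wsum \<sigma> \<theta> (\<lambda>k. if k < K then 1 else 0))"
proof -
  let ?f = "\<lambda>x. \<Sum>m\<in>B. c m * tensor_haar m x"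
  have box: "B \<subseteq> haar_box k" if "K \<le> k" for k
    using B(3) haar_level_le_iff[OF B(2)] that by auto
  have nbox: "B \<inter> haar_box k = {}" if "k < K" for k
  proof (rule equals0I)
    fix m assume m: "m \<in> B \<inter> haar_box k"
    then have "haar_level m \<le> k" using haar_level_le_iff[OF B(2), of m k] by blast
    then show False using B(3)[of m] m that by simp
  qed
  have coef: "hcoef m ?f = (if m \<in> B then c m else 0)" if "m \<in> haar_box k" for m k
    using B(1,2) haar_box_finite_index[OF that] by (subst hcoef_lincomb) auto
  have P: "haar_sum (haar_box k) ?f x = (\<Sum>m\<in>haar_box k \<inter> B. c m * tensor_haar m x)" for k x
    unfolding haar_sum_def by (subst sum.inter_restrict) (auto intro!: sum.cong simp: coef)
  have err: "proj_error p ?f k = lp_int p unit_cube ?f * (if k < K then 1 else 0)" for k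
  proof (cases "k < K")
    case True
    then have "haar_box k \<inter> B = {}" using nbox by blast
    then show ?thesis using True by (simp add: proj_error_def P)
  next
    case False
    then have "haar_box k \<inter> B = B" using box[of k] by auto
    then show ?thesis using False by (simp add: proj_error_def P lp_int_def)
  qed
  have "wsum \<sigma> \<theta> (proj_error p ?f) = ennreal (lp_int p unit_cube ?f powr \<theta>) * wsum \<sigma> \<theta> (\<lambda>k. if k < K then 1 else 0)"
    unfolding err[abs_def] by (rule wsum_cmult) simp
  then show ?thesis by (simp add: proj_gauge_def distrib_left)
qed

text \<open>In an order that puts the indices of A first within each level, some partial sum of the
  point mass example keeps exactly the frequencies of the even kernel. A uniform bound for partial
  sums would then bound the even kernel in L_1 by the full one, against its growth like K/3.\<close>

lemma haar_conditional:
  assumes q: "0 < q" and s: "0 \<le> s" "s < 1" and d: "1 < CARD('n::finite)"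
  shows "\<exists>\<nu>. bij_betw \<nu> UNIV {m :: 'n => nat. \<forall>j. 1 \<le> m j} \<and>
    \<not> schauder_basis (besov_space 1 q s) (besov_norm 1 q s) (\<lambda>i. tensor_haar (\<nu> i))"
proof -
  let ?S = "{m :: 'n => nat. \<forall>j. 1 \<le> m j}"
  have "\<not> is_singleton (UNIV :: 'n set)" using d by (auto simp: is_singleton_altdef)
  then obtain j0 j1 :: 'n where j: "j0 \<noteq> j1" by (metis UNIV_I UNIV_eq_I insertI1 is_singleton_def singletonD)
  define A where "A = {m :: 'n => nat. \<exists>a. even a \<and> m j1 = Suc (2 ^ a)}"
  from enumerate_by_key[OF level_key_inj infinite_haar_indices, of A]
  obtain \<nu> :: "nat => 'n => nat" where *: "bij_betw \<nu> UNIV ?S \<and> strict_mono (\<lambda>i. level_key A (\<nu> i)) \<and>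
    (\<forall>M. \<exists>c. \<nu> ` {..<M} = {m \<in> ?S. level_key A m < c}) \<and> (\<forall>c. \<exists>M. \<nu> ` {..<M} = {m \<in> ?S. level_key A m < c})"
    by (rule exE)
  note \<nu> = *[THEN conjunct1] and seg = *[THEN conjunct2, THEN conjunct2, THEN conjunct2]
  have "\<not> schauder_basis (besov_space 1 q s) (besov_norm 1 q s) (\<lambda>i. tensor_haar (\<nu> i))"
  proof
    assume basis: "schauder_basis (besov_space 1 q s) (besov_norm 1 q s) (\<lambda>i. tensor_haar (\<nu> i))"
    have p1: "(0::real) < 1" "(1::real) \<le> 1" and s1: "s < 1 / 1" using s by auto
    obtain C where C: "0 \<le> C" "\<forall>(B :: ('n => nat) set) c M. finite B --> (\<forall>m\<in>B. \<forall>j. 1 \<le> m j) -->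
      besov_gauge 1 q s (\<lambda>x. \<Sum>m\<in>B \<inter> \<nu> ` {..<M}. c m * tensor_haar m x)
      \<le> C * besov_gauge 1 q s (\<lambda>x. \<Sum>m\<in>B. c m * tensor_haar m x)"
      using haar_parts_bounded[OF p1(1) q s(1) s1 \<nu> basis] by blast
    have q1: "0 < q / 1" using q by simp
    obtain C1 where C1: "0 < C1" "\<forall>f :: real ^ 'n => real. f \<in> Lp_space 1 unit_cube -->
      gauge_of 1 (s * 1) (q / 1) f \<le> ennreal C1 * proj_gauge 1 (s * 1) (q / 1) f"
      using gauge_le_proj_gauge[OF p1(2) q1, of "s * 1"] s by auto
    obtain C2 where C2: "0 < C2" "\<forall>f :: real ^ 'n => real. f \<in> Lp_space 1 unit_cube -->
      proj_gauge 1 (s * 1) (q / 1) f \<le> ennreal C2 * gauge_of 1 (s * 1) (q / 1) f"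
      using proj_gauge_le_gauge[OF p1(2) q1, of "s * 1"] s by auto
    define D where "D = (C2 * (C * C1)) powr (1 / q)"
    have "real (Suc l) / 3 \<le> D" for l
    proof -
      let ?K = "Suc l"
      define c where "c = hump_coef j1 ?K"
      define V where "V = {v \<in> {1..2 ^ ?K}. \<exists>a. even a \<and> v = Suc (2 ^ a)}"
      define B where "B = hump_index j0 j1 l ` {1..2 ^ ?K}"
      define f where "f X x = (\<Sum>m\<in>X. c m * tensor_haar m x)" for X and x :: "real ^ 'n"
      have B1: "finite B" "\<And>m. m \<in> B ==> \<forall>j. 1 \<le> m j" "\<And>m. m \<in> B ==> haar_level m = ?K"
        using hump_index_level[OF j] by (auto simp: B_def)
      \<comment> \<open>The threshold separates, within level K = Suc l, the keys of the indices in
        A from those of all others.\<close>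
      obtain M where M: "\<nu> ` {..<M} = {m \<in> ?S. level_key A m < 3 * 2 ^ (CARD('n) * ?K)}" using seg by blast
      have BA: "m \<in> \<nu> ` {..<M} \<longleftrightarrow> m \<in> A" if m: "m \<in> B" for m
      proof -
        have "level_key A m < 3 * 2 ^ (CARD('n) * ?K) \<longleftrightarrow> m \<in> A"
          using level_digit_sum_less[OF B1(2)[OF m]] unfolding level_key_def B1(3)[OF m] by simp
        then show ?thesis using B1(2)[OF m] unfolding M by blast
      qed
      have "hump_index j0 j1 l v \<in> A \<longleftrightarrow> (\<exists>a. even a \<and> v = Suc (2 ^ a))" for v
        using j by (simp add: A_def hump_index_def)
      then have "B \<inter> A = hump_index j0 j1 l ` V" by (auto simp: B_def V_def)
      then have BM: "B \<inter> \<nu> ` {..<M} = hump_index j0 j1 l ` V" using BA by blast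
      define T where "T = hump_index j0 j1 l ` V"
      have T1: "finite T" "\<And>m. m \<in> T ==> \<forall>j. 1 \<le> m j" "\<And>m. m \<in> T ==> haar_level m = ?K"
        using hump_index_level[OF j] by (auto simp: T_def V_def)
      have fB: "f X \<in> besov_space 1 q s" if X: "\<And>m. m \<in> X ==> \<forall>j. 1 \<le> m j" for X
        unfolding f_def[abs_def]
        by (rule besov_sum[OF p1(1) q s(1)], rule besov_cmult(1)[OF p1(1) q s(1) tensor_haar_besov[OF p1(1) q s(1) s1]]) (use X in blast)
      have fL: "f X \<in> Lp_space 1 unit_cube" if X: "\<And>m. m \<in> X ==> \<forall>j. 1 \<le> m j" for X
        using fB[OF X] besov_space_iff[OF p1(1) q s(1)] by blast
      have gauge: "ennreal (besov_gauge 1 q s (f X)) = gauge_of 1 (s * 1) (q / 1) (f X)" if X: "\<And>m. m \<in> X ==> \<forall>j. 1 \<le> m j" for X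
        by (rule besov_gauge_ennreal[OF p1(1) q s(1) fB[OF X]])
      define W where "W = 1 + wsum (s * 1) (q / 1) (\<lambda>k. if k < ?K then 1 else 0)"
      have "W < \<infinity>"
      proof -
        have "wsum (s * 1) (q / 1) (\<lambda>k. if k < ?K then 1 else 0) = (\<Sum>k<?K. ennreal ((2 powr (real k * (s * 1)) * (if k < ?K then 1 else 0)) powr (q / 1)))"
          unfolding wsum_def by (rule suminf_finite) auto
        then show ?thesis unfolding W_def by simp
      qed
      then obtain w where w: "0 \<le> w" "W = ennreal w" by (metis enn2real_nonneg ennreal_enn2real infinity_ennreal_def)
      have "ennreal 1 \<le> ennreal w" unfolding w(2)[symmetric] W_def by simp
      then have w1: "1 \<le> w" using w(1) by (simp add: ennreal_le_iff)
      have pg: "proj_gauge 1 (s * 1) (q / 1) (f X) = ennreal (lp_int 1 unit_cube (f X) powr q * w)"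
        if X: "finite X" "\<And>m. m \<in> X ==> \<forall>j. 1 \<le> m j" "\<And>m. m \<in> X ==> haar_level m = ?K" for X
      proof -
        have "proj_gauge 1 (s * 1) (q / 1) (f X) = ennreal (lp_int 1 unit_cube (f X) powr (q / 1)) * W"
          unfolding f_def[abs_def] W_def by (rule block_proj_gauge[OF X])
        then show ?thesis unfolding w(2) using w(1) by (simp add: ennreal_mult)
      qed
      have pgT: "proj_gauge 1 (s * 1) (q / 1) (f T) = ennreal (lp_int 1 unit_cube (f T) powr q * w)"
        by (rule pg) (use T1 in blast)+
      have pgB: "proj_gauge 1 (s * 1) (q / 1) (f B) = ennreal (lp_int 1 unit_cube (f B) powr q * w)"
        by (rule pg) (use B1 in blast)+
      have gT: "ennreal (besov_gauge 1 q s (f T)) = gauge_of 1 (s * 1) (q / 1) (f T)"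
        by (rule gauge) (use T1 in blast)
      have gB: "ennreal (besov_gauge 1 q s (f B)) = gauge_of 1 (s * 1) (q / 1) (f B)"
        by (rule gauge) (use B1 in blast)
      have "ennreal (lp_int 1 unit_cube (f T) powr q * w) \<le> ennreal C2 * ennreal (besov_gauge 1 q s (f T))"
        unfolding pgT[symmetric] gT by (rule C2(2)[rule_format, OF fL[OF T1(2)]])
      also have "\<dots> \<le> ennreal C2 * ennreal (C * besov_gauge 1 q s (f B))"
      proof -
        have "besov_gauge 1 q s (\<lambda>x. \<Sum>m\<in>B \<inter> \<nu> ` {..<M}. c m * tensor_haar m x) \<le> C * besov_gauge 1 q s (\<lambda>x. \<Sum>m\<in>B. c m * tensor_haar m x)"
          by (rule C(2)[THEN spec, THEN spec, THEN spec, THEN mp, THEN mp, OF B1(1)]) (use B1(2) in blast)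
        then show ?thesis unfolding BM T_def[symmetric] f_def[abs_def] by (intro mult_left_mono ennreal_leI) auto
      qed
      also have "\<dots> = ennreal C2 * (ennreal C * gauge_of 1 (s * 1) (q / 1) (f B))"
        unfolding gB[symmetric] using C(1) by (simp add: ennreal_mult)
      also have "\<dots> \<le> ennreal C2 * (ennreal C * (ennreal C1 * proj_gauge 1 (s * 1) (q / 1) (f B)))"
        by (intro mult_left_mono C1(2)[rule_format, OF fL[OF B1(2)]]) auto
      also have "\<dots> = ennreal (C2 * (C * C1) * (lp_int 1 unit_cube (f B) powr q * w))"
        unfolding pgB using C(1) C1(1) C2(1) w(1) by (simp add: ennreal_mult mult.assoc)
      finally have "lp_int 1 unit_cube (f T) powr q * w \<le> C2 * (C * C1) * lp_int 1 unit_cube (f B) powr q * w"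
        using C(1) C1(1) C2(1) w(1) by (simp add: ennreal_le_iff mult.assoc)
      then have "lp_int 1 unit_cube (f T) powr q \<le> C2 * (C * C1) * lp_int 1 unit_cube (f B) powr q" using w1 by simp
      then have "(lp_int 1 unit_cube (f T) powr q) powr (1 / q) \<le> (C2 * (C * C1) * lp_int 1 unit_cube (f B) powr q) powr (1 / q)"
        using q by (intro powr_mono2) auto
      then have le: "lp_int 1 unit_cube (f T) \<le> D * lp_int 1 unit_cube (f B)"
        using q by (simp add: powr_mult powr_powr D_def)
      obtain R where R: "0 < R" "\<forall>V\<subseteq>{1..2 ^ ?K}.
        lp_int 1 unit_cube (\<lambda>x :: real ^ 'n. \<Sum>m\<in>hump_index j0 j1 l ` V. hump_coef j1 ?K m * tensor_haar m x)
        = R * (\<Sum>t<2 ^ ?K. \<bar>\<Sum>v\<in>V. haar_weight v * hh ?K v 0 * hh ?K v t\<bar>)"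
        using hump_lp_int[OF j] by blast
      have "lp_int 1 unit_cube (f T) = R * (\<Sum>t<2 ^ ?K. \<bar>even_kernel ?K t\<bar>)"
        unfolding f_def[abs_def] T_def c_def even_kernel_def V_def[symmetric]
        by (rule R(2)[rule_format]) (simp only: V_def Collect_mem_eq mem_Collect_eq subset_iff, blast)
      moreover have "lp_int 1 unit_cube (f B) = R * 2 ^ ?K"
      proof -
        have "lp_int 1 unit_cube (f B) = R * (\<Sum>t<2 ^ ?K. \<bar>\<Sum>v\<in>{1..2 ^ ?K}. haar_weight v * hh ?K v 0 * hh ?K v t\<bar>)"
          unfolding f_def[abs_def] B_def c_def by (rule R(2)[rule_format]) simp
        also have "(\<Sum>t<2 ^ ?K. \<bar>\<Sum>v\<in>{1..2 ^ ?K}. haar_weight v * hh ?K v 0 * hh ?K v t\<bar>) = (\<Sum>t<(2::nat) ^ ?K. if t = 0 then 2 ^ ?K else 0)"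
        proof (intro sum.cong refl)
          fix t :: nat assume "t \<in> {..<2 ^ ?K}"
          then show "\<bar>\<Sum>v\<in>{1..2 ^ ?K}. haar_weight v * hh ?K v 0 * hh ?K v t\<bar> = (if t = 0 then 2 ^ ?K else 0)"
            using haar_kernel[of 0 ?K t] by (auto simp del: power_Suc)
        qed
        finally show ?thesis by (simp del: power_Suc)
      qed
      ultimately have "R * (\<Sum>t<2 ^ ?K. \<bar>even_kernel ?K t\<bar>) \<le> R * (D * 2 ^ ?K)" using le by (simp add: mult_ac)
      then have "(\<Sum>t<2 ^ ?K. \<bar>even_kernel ?K t\<bar>) \<le> D * 2 ^ ?K" by (rule mult_left_le_imp_le) (rule R(1))
      moreover have "2 ^ ?K * real ?K / 3 \<le> (\<Sum>t<2 ^ ?K. \<bar>even_kernel ?K t\<bar>)"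
      proof -
        have "2 ^ ?K * real ?K / 3 \<le> 2 ^ ?K * (real ?K + 1) / 3" by (intro divide_right_mono mult_left_mono) auto
        then show ?thesis using even_kernel_growth[of ?K] by (cases "even ?K") (blast intro: order_trans)+
      qed
      ultimately have "2 ^ ?K * real ?K / 3 \<le> D * 2 ^ ?K" by linarith
      then have "2 ^ ?K * (real ?K / 3) \<le> 2 ^ ?K * D" by (simp only: mult.commute times_divide_eq_right)
      then show ?thesis by (rule mult_left_le_imp_le) simp
    qed
    then have le: "real (Suc l) / 3 \<le> D" for l .
    obtain l where "3 * D < real l" using reals_Archimedean2 by blast
    then show False using le[of l] by simp
  qed
  then show ?thesis using \<nu> by blast
qed

section \<open>The main theorem\<close>

text \<open>For p > 1 the projections onto all finite index sets share one bound, so the order in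
  which the sets grow is immaterial.\<close>

lemma haar_unconditional:
  fixes e :: "nat => real ^ 'n::finite => real"
  assumes p: "1 < p" and q: "0 < q" and s: "0 \<le> s" "s < 1 / p" and e: "enumeration_of haar_system e"
  shows "schauder_basis (besov_space p q s) (besov_norm p q s) e"
proof -
  obtain \<nu> where \<nu>: "bij_betw \<nu> UNIV {m. \<forall>j. 1 \<le> m j}" "e = (\<lambda>i. tensor_haar (\<nu> i))"
    using haar_enumeration[OF e] by blast
  obtain C where C: "0 < C" "\<forall>K (A :: ('n => nat) set) F. A \<subseteq> haar_box K -->
    (\<Sum>i\<in>grid K. \<bar>grid_proj K A F i\<bar> powr p) \<le> C * (\<Sum>i\<in>grid K. \<bar>F i\<bar> powr p)"
    using grid_proj_bounded[OF p] by blast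
  have p1: "1 \<le> p" using p by simp
  have "haar_sum (\<nu> ` {..<M}) f \<in> Lp_space p unit_cube \<and>
       lp_int p unit_cube (haar_sum (\<nu> ` {..<M}) f) \<le> C * 2 powr p * lp_int p unit_cube f"
    if f: "f \<in> Lp_space p unit_cube" for M and f :: "real ^ 'n => real"
  proof -
    have "\<exists>K. \<forall>k\<ge>K. \<nu> ` {..<M} \<subseteq> haar_box k"
      by (rule haar_index_in_box) (use bij_betwE[OF \<nu>(1)] in auto)
    then obtain K where K: "\<nu> ` {..<M} \<subseteq> haar_box K" by blast
    have bd: "(\<Sum>i\<in>grid K. \<bar>grid_proj K (\<nu> ` {..<M}) F i\<bar> powr p) \<le> C * (\<Sum>i\<in>grid K. \<bar>F i\<bar> powr p)" for F
      using C(2) K by blast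
    show ?thesis using haar_sum_bounded[OF p1 f K _ bd] C(1) by simp
  qed
  then show ?thesis unfolding \<nu>(2) by (rule haar_schauder_basis[OF p1 q s \<nu>(1)])
qed

lemma enumeration_rearrange:
  assumes "enumeration_of H e" "bij \<pi>"
  shows "enumeration_of H (e \<circ> \<pi>)"
  using bij_betw_trans[OF assms(2), of e H] assms(1) by (simp add: enumeration_of_def)

text \<open>Every enumeration is a rearrangement of the bad one, so none can be
  unconditional.\<close>

lemma haar_not_unconditional:
  fixes e :: "nat => real ^ 'n::finite => real"
  assumes q: "0 < q" and s: "0 \<le> s" "s < 1" and d: "1 < CARD('n)" and e: "enumeration_of haar_system e"
  shows "\<not> unconditional_schauder_basis (besov_space 1 q s) (besov_norm 1 q s) e"
proof
  assume u: "unconditional_schauder_basis (besov_space 1 q s) (besov_norm 1 q s) e"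
  obtain \<nu> where \<nu>: "bij_betw \<nu> UNIV {m. \<forall>j. 1 \<le> m j}" "e = (\<lambda>i. tensor_haar (\<nu> i))"
    using haar_enumeration[OF e] by blast
  obtain \<nu>' where \<nu>': "bij_betw \<nu>' UNIV {m :: 'n => nat. \<forall>j. 1 \<le> m j}"
    "\<not> schauder_basis (besov_space 1 q s) (besov_norm 1 q s) (\<lambda>i. tensor_haar (\<nu>' i))"
    using haar_conditional[OF q s d] by blast
  define \<pi> where "\<pi> = inv_into UNIV \<nu> \<circ> \<nu>'"
  have "bij \<pi>" unfolding \<pi>_def by (rule bij_betw_trans[OF \<nu>'(1) bij_betw_inv_into[OF \<nu>(1)]])
  moreover have "e \<circ> \<pi> = (\<lambda>i. tensor_haar (\<nu>' i))"
  proof -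
    have "\<nu> (inv_into UNIV \<nu> (\<nu>' i)) = \<nu>' i" for i
      by (rule bij_betw_inv_into_right[OF \<nu>(1)]) (use bij_betwE[OF \<nu>'(1)] in blast)
    then show ?thesis by (simp only: \<pi>_def \<nu>(2) comp_def)
  qed
  ultimately show False using u \<nu>'(2) unfolding unconditional_schauder_basis_def by metis
qed

theorem theorem4:
  fixes p q s :: real
  assumes "CARD('n::finite) > 1"
    and "0 < p" and "0 < q" and "0 \<le> s" and "s < 1 / p"
  shows
    "(\<forall>e. enumeration_of (haar_system :: (real ^ 'n \<Rightarrow> real) set) e \<longrightarrow>
        (unconditional_schauder_basis (besov_space p q s) (besov_norm p q s) e \<longleftrightarrow> 1 < p))
     \<and> (p = 1 \<longrightarrow>
        (\<exists>e :: nat \<Rightarrow> real ^ 'n \<Rightarrow> real. blockwise_ordering e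
           \<and> schauder_basis (besov_space p q s) (besov_norm p q s) e
           \<and> \<not> unconditional_schauder_basis (besov_space p q s) (besov_norm p q s) e))
     \<and> (p < 1 \<longrightarrow>
        \<not> (\<exists>C :: real. \<forall>h \<in> (haar_system :: (real ^ 'n \<Rightarrow> real) set). \<forall>f \<in> step_functions.
              besov_norm p q s (haar_projector h f) \<le> C * besov_norm p q s f)
        \<and> (\<forall>e. enumeration_of (haar_system :: (real ^ 'n \<Rightarrow> real) set) e \<longrightarrow>
              \<not> schauder_basis (besov_space p q s) (besov_norm p q s) e))"
proof (intro conjI allI impI)
  have d: "1 < CARD('n)" and p: "0 < p" and q: "0 < q" and s: "0 \<le> s" "s < 1 / p" using assms by auto
  fix e :: "nat => real ^ 'n => real"
  assume e: "enumeration_of haar_system e"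
  show "unconditional_schauder_basis (besov_space p q s) (besov_norm p q s) e \<longleftrightarrow> 1 < p"
  proof (cases p "1 :: real" rule: linorder_cases)
    case less
    then show ?thesis
      using haar_not_schauder_basis[OF p less q s d e] unfolding unconditional_schauder_basis_def by (metis bij_id comp_id less_asym)
  next
    case equal
    then show ?thesis using haar_not_unconditional[OF q s(1) _ d e] s by simp
  next
    case greater
    have "schauder_basis (besov_space p q s) (besov_norm p q s) (e \<circ> \<pi>)" if "bij \<pi>" for \<pi>
      by (rule haar_unconditional[OF greater q s enumeration_rearrange[OF e that]])
    then show ?thesis using greater unfolding unconditional_schauder_basis_def by blast
  qed
next
  assume p: "p = 1"
  have q: "0 < q" and s: "0 \<le> s" "s < 1" using assms p by auto
  obtain e :: "nat => real ^ 'n => real" where e: "blockwise_ordering e" "schauder_basis (besov_space 1 q s) (besov_norm 1 q s) e"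
    using blockwise_haar_basis[OF q s] by blast
  then have "enumeration_of haar_system e" by (simp add: blockwise_ordering_def)
  then show "\<exists>e :: nat => real ^ 'n => real. blockwise_ordering e
           \<and> schauder_basis (besov_space p q s) (besov_norm p q s) e
           \<and> \<not> unconditional_schauder_basis (besov_space p q s) (besov_norm p q s) e"
    using e haar_not_unconditional[OF q s assms(1)] unfolding p by blast
next
  assume "p < 1"
  then show "\<not> (\<exists>C :: real. \<forall>h \<in> (haar_system :: (real ^ 'n => real) set). \<forall>f \<in> step_functions.
              besov_norm p q s (haar_projector h f) \<le> C * besov_norm p q s f)"
    using assms by (intro haar_projectors_unbounded) auto
next
  fix e :: "nat => real ^ 'n => real"
  assume "p < 1" "enumeration_of haar_system e"
  then show "\<not> schauder_basis (besov_space p q s) (besov_norm p q s) e"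
    using assms by (intro haar_not_schauder_basis) auto
qed

end
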